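(* Let $G$ be a locally compact Abelian group, let $\mu\in M(G)$ and let $1\le p\le\infty$. Consider the following conditions on the convolution operator $\lambda_p(\mu)$: (a) $\lambda_p(\mu)$ is uniformly mean ergodic; (b) $\|\lambda_p(\mu)\|\le 1$ and $1$ is not an accumulation point of the spectrum of $\lambda_p(\mu)$. Conditions (a) and (b) are equivalent when any of the following holds: (1) $p=2$; (2) $\mu$ is positive and $1<p<\infty$; (3) $G$ is compact, $\mu$ is positive and $p=1$ or $p=\infty$. Moreover, in either case of (3) ($p=1$ or $p=\infty$), $\lambda_p(\mu)$ is uniformly mean ergodic if and only if $\lambda_\infty(\mu)$ is mean ergodic.
   Context: For a locally compact group $G$, $m_G$ is a left Haar measure, $L^p(G)=L^p(G,m_G)$, and $M(G)=C_0(G)^*$ is the Banach space of bounded regular (complex) measures on $G$ with total variation norm. For $\mu\in M(G)$ and $1\le p\le\infty$, the convolution operator $\lambda_p(\mu)\colon L^p(G)\to L^p(G)$ is $(\lambda_p(\mu)f)(s)=(\mu*f)(s)=\int f(x^{-1}s)\,d\mu(x)$. For a bounded linear operator $T$ on a Banach space $X$, its Cesàro means are $T_{[n]}=\frac1n\sum_{k=1}^n T^k$. $T$ is mean ergodic if $(T_{[n]})_n$ converges in the strong operator topology to some bounded operator $P$ on $X$, and uniformly mean ergodic if $(T_{[n]})_n$ converges in the operator norm. *)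

theory Defs
  imports "HOL-Probability.Essential_Supremum"
begin

text \<open>
  Groups are written additively, so the translate \<open>x\<^sup>-\<^sup>1 s\<close> reads \<open>s - x\<close>. A locally compact
  Abelian group is a type of class \<^class>\<open>topological_ab_group_add\<close> and \<^class>\<open>t2_space\<close>
  together with \<^term>\<open>locally_compact_space euclidean\<close>; no countability is assumed.
\<close>

definition haar_measure :: "'a::{topological_group_add, t2_space} measure \<Rightarrow> bool" where
  "haar_measure m \<longleftrightarrow>
     sets m = sets borel \<and>
     emeasure m (space m) \<noteq> 0 \<and>
     (\<forall>g. \<forall>A\<in>sets borel. emeasure m ((\<lambda>x. g + x) ` A) = emeasure m A) \<and>
     (\<forall>K. compact K \<longrightarrow> emeasure m K < \<infinity>) \<and>
     (\<forall>A\<in>sets borel. emeasure m A = (INF U\<in>{U. open U \<and> A \<subseteq> U}. emeasure m U)) \<and>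
     (\<forall>U. open U \<longrightarrow> emeasure m U = (SUP K\<in>{K. compact K \<and> K \<subseteq> U}. emeasure m K))"


subsection \<open>Complex Borel measures\<close>

text \<open>
  A complex measure is a set function of which only the values on Borel sets matter.
\<close>

definition total_variation :: "('a::topological_space set \<Rightarrow> complex) \<Rightarrow> 'a set \<Rightarrow> ennreal" where
  "total_variation \<mu> E =
     (SUP A\<in>{A :: nat \<Rightarrow> 'a set. range A \<subseteq> sets borel \<and> disjoint_family A \<and> (\<Union>n. A n) = E}.
        \<Sum>n. ennreal (norm (\<mu> (A n))))"

definition bounded_regular_measures :: "('a::t2_space set \<Rightarrow> complex) set" where
  "bounded_regular_measures = {\<mu>.
     (\<forall>A :: nat \<Rightarrow> 'a set. range A \<subseteq> sets borel \<and> disjoint_family A \<longrightarrow>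
        (\<lambda>n. \<mu> (A n)) sums \<mu> (\<Union>n. A n)) \<and>
     total_variation \<mu> UNIV < \<infinity> \<and>
     (\<forall>E\<in>sets borel.
        total_variation \<mu> E = (SUP K\<in>{K. compact K \<and> K \<subseteq> E}. total_variation \<mu> K) \<and>
        total_variation \<mu> E = (INF U\<in>{U. open U \<and> E \<subseteq> U}. total_variation \<mu> U))}"

definition positive_measure :: "('a::topological_space set \<Rightarrow> complex) \<Rightarrow> bool" where
  "positive_measure \<mu> \<longleftrightarrow> (\<forall>E\<in>sets borel. \<mu> E \<in> \<real>\<^sub>\<ge>\<^sub>0)"

text \<open>
  The positive part in the Jordan decomposition of a finite signed measure \<open>\<nu>\<close>; the negative
  part is the positive part of \<open>- \<nu>\<close>. Negative values \<open>\<nu> A\<close> are cut off to \<open>0 = \<nu> {}\<close> by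
  \<^const>\<open>ennreal\<close>, which does not change the supremum.
\<close>

definition jordan_pos :: "('a::topological_space set \<Rightarrow> real) \<Rightarrow> 'a measure" where
  "jordan_pos \<nu> =
     measure_of UNIV (sets borel) (\<lambda>E. SUP A\<in>{A \<in> sets borel. A \<subseteq> E}. ennreal (\<nu> A))"

definition complex_measure_integral ::
    "('a::topological_space set \<Rightarrow> complex) \<Rightarrow> ('a \<Rightarrow> complex) \<Rightarrow> complex" where
  "complex_measure_integral \<mu> f =
     (LINT x|jordan_pos (\<lambda>A. Re (\<mu> A)). f x) - (LINT x|jordan_pos (\<lambda>A. - Re (\<mu> A)). f x)
     + \<i> * ((LINT x|jordan_pos (\<lambda>A. Im (\<mu> A)). f x) - (LINT x|jordan_pos (\<lambda>A. - Im (\<mu> A)). f x))"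

text \<open>
  For \<open>f \<in> L\<^sup>p(G)\<close> the integral exists for almost every \<open>s\<close>; elsewhere the value is irrelevant.
  The same formula gives \<open>\<lambda>\<^sub>p(\<mu>)\<close> for every \<open>p\<close>.
\<close>

definition convolution ::
    "('a::topological_ab_group_add set \<Rightarrow> complex) \<Rightarrow> ('a \<Rightarrow> complex) \<Rightarrow> 'a \<Rightarrow> complex" where
  "convolution \<mu> f = (\<lambda>s. complex_measure_integral \<mu> (\<lambda>x. f (s - x)))"


subsection \<open>Operators on \<open>L\<^sup>p\<close>\<close>

text \<open>
  Elements of \<open>L\<^sup>p\<close> are represented by measurable functions, two of which are the same element
  iff they agree almost everywhere; all notions below are invariant under that identification.
  In particular a map on \<open>L\<^sup>p\<close> has to respect it and linearity is required up to null sets only.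
\<close>

definition Lp_space :: "ennreal \<Rightarrow> 'a measure \<Rightarrow> ('a \<Rightarrow> complex) set" where
  "Lp_space p m =
     (if p = \<infinity> then {f \<in> borel_measurable m. esssup m (\<lambda>x. ennreal (norm (f x))) < \<infinity>}
      else {f \<in> borel_measurable m. integrable m (\<lambda>x. norm (f x) powr enn2real p)})"

definition Lp_norm :: "ennreal \<Rightarrow> 'a measure \<Rightarrow> ('a \<Rightarrow> complex) \<Rightarrow> real" where
  "Lp_norm p m f =
     (if p = \<infinity> then enn2real (esssup m (\<lambda>x. ennreal (norm (f x))))
      else (LINT x|m. norm (f x) powr enn2real p) powr (1 / enn2real p))"

definition bounded_Lp_operator ::
    "ennreal \<Rightarrow> 'a measure \<Rightarrow> (('a \<Rightarrow> complex) \<Rightarrow> 'a \<Rightarrow> complex) \<Rightarrow> bool" where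
  "bounded_Lp_operator p m T \<longleftrightarrow>
     (\<forall>f\<in>Lp_space p m. T f \<in> Lp_space p m) \<and>
     (\<forall>f\<in>Lp_space p m. \<forall>g\<in>Lp_space p m.
        (AE x in m. f x = g x) \<longrightarrow> (AE x in m. T f x = T g x)) \<and>
     (\<forall>f\<in>Lp_space p m. \<forall>g\<in>Lp_space p m. AE x in m. T (\<lambda>y. f y + g y) x = T f x + T g x) \<and>
     (\<forall>c. \<forall>f\<in>Lp_space p m. AE x in m. T (\<lambda>y. c * f y) x = c * T f x) \<and>
     (\<exists>C. \<forall>f\<in>Lp_space p m. Lp_norm p m (T f) \<le> C * Lp_norm p m f)"

definition Lp_operator_norm ::
    "ennreal \<Rightarrow> 'a measure \<Rightarrow> (('a \<Rightarrow> complex) \<Rightarrow> 'a \<Rightarrow> complex) \<Rightarrow> real" where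
  "Lp_operator_norm p m T = (SUP f\<in>{f \<in> Lp_space p m. Lp_norm p m f \<le> 1}. Lp_norm p m (T f))"

definition Lp_spectrum ::
    "ennreal \<Rightarrow> 'a measure \<Rightarrow> (('a \<Rightarrow> complex) \<Rightarrow> 'a \<Rightarrow> complex) \<Rightarrow> complex set" where
  "Lp_spectrum p m T = {z. \<not> (\<exists>S. bounded_Lp_operator p m S \<and>
     (\<forall>f\<in>Lp_space p m.
        (AE x in m. S (\<lambda>y. z * f y - T f y) x = f x) \<and>
        (AE x in m. z * S f x - T (S f) x = f x)))}"

definition cesaro_mean ::
    "(('a \<Rightarrow> complex) \<Rightarrow> 'a \<Rightarrow> complex) \<Rightarrow> nat \<Rightarrow> ('a \<Rightarrow> complex) \<Rightarrow> 'a \<Rightarrow> complex" where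
  "cesaro_mean T n f = (\<lambda>x. (\<Sum>k=1..n. (T ^^ k) f x) / of_nat n)"

definition mean_ergodic ::
    "ennreal \<Rightarrow> 'a measure \<Rightarrow> (('a \<Rightarrow> complex) \<Rightarrow> 'a \<Rightarrow> complex) \<Rightarrow> bool" where
  "mean_ergodic p m T \<longleftrightarrow> (\<exists>P. bounded_Lp_operator p m P \<and>
     (\<forall>f\<in>Lp_space p m. (\<lambda>n. Lp_norm p m (\<lambda>x. cesaro_mean T n f x - P f x)) \<longlonglongrightarrow> 0))"

definition uniformly_mean_ergodic ::
    "ennreal \<Rightarrow> 'a measure \<Rightarrow> (('a \<Rightarrow> complex) \<Rightarrow> 'a \<Rightarrow> complex) \<Rightarrow> bool" where
  "uniformly_mean_ergodic p m T \<longleftrightarrow> (\<exists>P. bounded_Lp_operator p m P \<and>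
     (\<lambda>n. Lp_operator_norm p m (\<lambda>f x. cesaro_mean T n f x - P f x)) \<longlonglongrightarrow> 0)"

end

theory Submission
 imports Defs "HOL-Complex_Analysis.Complex_Analysis" "HOL-Library.Function_Algebras" "HOL-Real_Asymp.Real_Asymp"
begin

text \<open>
  A regular complex measure is a combination of positive finite Radon measures, so the operator is a
  combination of averages \<open>f \<mapsto> \<integral> f(s + y) d\<beta>(y)\<close>. These commute: on \<open>L\<^sup>2\<close> the operator \<open>T\<close> is normal.

  From (a) to (b): the limit of the means is a projection onto the fixed vectors along a space on
  which \<open>1 - T\<close> is invertible, so 1 is not an accumulation point of the spectrum; also \<open>T\<^sup>n\<close> has norm
  \<open>O(n)\<close>. For \<open>p = 2\<close>, normality turns this growth into \<open>\<parallel>T\<parallel> \<le> 1\<close>. For positive \<open>\<mu>\<close>, the \<open>n\<close>-fold sums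
  of a compact set grow polynomially in an Abelian group, so applying \<open>T\<^sup>n\<close> to their indicators bounds
  the mass of \<open>\<mu>\<close> by 1.

  From (b) to (a): for a normal operator, \<open>(z - 1) R(z)\<close> is bounded on \<open>L\<^sup>2\<close> near 1. Hence the
  functions \<open>(z - 1) \<langle>R(z) f, g\<rangle>\<close> extend to 1 for bounded integrable \<open>f\<close>, \<open>g\<close>, and the estimate of \<open>R\<close>
  in \<open>L\<^sup>p\<close> on a circle around 1 makes them Lipschitz. So \<open>(z - 1) R(z)\<close> converges in the norm of
  \<open>L\<^sup>p\<close>, and since \<open>T\<close> is a contraction, so do the means.

  For \<open>p = \<infinity>\<close>, Baire's theorem makes the means uniformly Cauchy on functions of small support. If all
  powers of \<open>\<mu>\<close> live on one null set, then near 0 the means almost only see the values on a small open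
  set around it, and translates of a neighbourhood of 0 cover the group. Otherwise some power is an
  \<open>L\<^sup>1\<close> function plus a measure of norm less than 1, and on the former the means converge uniformly.
  The case \<open>p = 1\<close> is dual.
\<close>

section \<open>Operators on a Banach space given by a carrier set\<close>

text \<open>Haar measure need not be sigma-finite and the topology need not be second countable, so
  the Borel sets of G x G can exceed the product sigma-algebra. This shapes the measure theory:
  iterated integrals are exchanged first for open sets, where inner regularity handles directed
  unions, and then for Borel functions that live on sigma-finite pieces. The pairing
  \<open>B\<close> reflects one argument because convolution by any measure is then its own
  transpose, \<open>B (T f) g = B f (T g)\<close>. The operator dual to T is again T, on L^q, and
  every estimate comes with its dual. The detour through L^2 excludes a pole of higher order at 1.
  Near an isolated point of the spectrum the resolvent on L^p may a priori grow at any rate, but a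
  normal operator on L^2 is bounded by its spectral radius, and Cauchy's inequality on L^p controls
  that radius, whatever the constants. The L^2 bound then only removes the singularity; all
  estimates in L^p come from a circle around 1.\<close>

locale banach_carrier = vector_space scale
 for scale :: "complex => 'v::ab_group_add => 'v" (infixr "\<odot>" 75) +
 fixes X :: "'v set" and N :: "'v => real"
 assumes X_subspace: "subspace X"
  and N_nonneg: "x : X ==> 0 <= N x"
  and N_scale: "x : X ==> N (c \<odot> x) = norm c * N x"
  and N_triangle: "x : X ==> y : X ==> N (x + y) <= N x + N y"
  and N_eq_0: "x : X ==> N x = 0 ==> x = 0"
  and N_complete: "(!!n. s n : X) ==> (!!e. e > 0 ==> EX M. ALL m>=M. ALL n>=M. N (s m - s n) < e)
    ==> EX l:X. (%n. N (s n - l)) \<longlonglongrightarrow> 0"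
begin

lemma X_closed [simp]:
 shows "0 : X" "x : X ==> y : X ==> x + y : X" "x : X ==> y : X ==> x - y : X"
  "x : X ==> c \<odot> x : X" "x : X ==> - x : X"
  "(!!i. i : I ==> f i : X) ==> sum f I : X"
 by (fact subspace_0[OF X_subspace], rule subspace_add[OF X_subspace], assumption+,
   rule subspace_diff[OF X_subspace], assumption+, rule subspace_scale[OF X_subspace], assumption,
   rule subspace_neg[OF X_subspace], assumption, rule subspace_sum[OF X_subspace])

lemma N_0 [simp]: "N 0 = 0"
 using N_scale[of 0 0] by simp

lemma N_minus: "x : X ==> N (- x) = N x"
 using N_scale[of x "-1"] by (simp add: scale_minus_left)

lemma N_diff_commute: "x : X ==> y : X ==> N (x - y) = N (y - x)"
 using N_minus[of "x - y"] by simp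

lemma N_diff_le: "x : X ==> y : X ==> N (x - y) <= N x + N y"
 using N_triangle[of x "- y"] by (simp add: N_minus)

lemma N_diff_triangle: "x : X ==> y : X ==> z : X ==> N (x - z) <= N (x - y) + N (y - z)"
 using N_triangle[of "x - y" "y - z"] by simp

lemma N_le_add: "x : X ==> y : X ==> N x <= N (x - y) + N y"
 using N_triangle[of "x - y" y] by simp

lemma N_sum: "(!!i. i : I ==> f i : X) ==> N (sum f I) <= (\<Sum>i\<in>I. N (f i))"
proof (induction I rule: infinite_finite_induct)
 case (insert i I)
 have "N (sum f (insert i I)) <= N (f i) + N (sum f I)"
  using insert by (simp add: N_triangle)
 moreover have "N (sum f I) <= (\<Sum>i\<in>I. N (f i))"
  using insert.IH insert.prems by simp
 ultimately show ?case using insert.hyps by simp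
qed simp_all

definition tends :: "(nat => 'v) => 'v => bool" where
 "tends s l \<longleftrightarrow> (ALL n. s n : X) & l : X & (%n. N (s n - l)) \<longlonglongrightarrow> 0"

lemma tends_X: "tends s l ==> s n : X" "tends s l ==> l : X"
 by (auto simp: tends_def)

lemma tends_le:
 assumes "!!n. s n : X" "l : X" "!!n. N (s n - l) <= f n" "f \<longlonglongrightarrow> 0"
 shows "tends s l"
 unfolding tends_def using assms
 by (auto intro!: tendsto_sandwich[of "%_. 0" "%n. N (s n - l)" sequentially f 0] always_eventually N_nonneg)

lemma tends_const: "x : X ==> tends (%_. x) x"
 by (auto simp: tends_def)

lemma tends_add:
 assumes "tends s l" "tends t k" shows "tends (%n. s n + t n) (l + k)"
proof (rule tends_le)
 show "(%n. N (s n - l) + N (t n - k)) \<longlonglongrightarrow> 0"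
  using tendsto_add[of "%n. N (s n - l)" 0 sequentially "%n. N (t n - k)" 0] assms by (auto simp: tends_def)
 show "N (s n + t n - (l + k)) <= N (s n - l) + N (t n - k)" for n
  using N_triangle[of "s n - l" "t n - k"] assms by (auto simp: tends_def algebra_simps)
qed (use assms in \<open>auto simp: tends_def\<close>)

lemma tends_scale_seq:
 assumes "tends s l" "c \<longlonglongrightarrow> c0" shows "tends (%n. c n \<odot> s n) (c0 \<odot> l)"
proof (rule tends_le)
 show "(%n. norm (c n) * N (s n - l) + norm (c n - c0) * N l) \<longlonglongrightarrow> 0"
  using assms
  by (auto intro!: tendsto_eq_intros simp: tends_def)
 show "N (c n \<odot> s n - c0 \<odot> l) <= norm (c n) * N (s n - l) + norm (c n - c0) * N l" for n
 proof -
  have "c n \<odot> s n - c0 \<odot> l = c n \<odot> (s n - l) + (c n - c0) \<odot> l"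
   by (simp add: scale_left_diff_distrib scale_right_diff_distrib)
  thus ?thesis
   using N_triangle[of "c n \<odot> (s n - l)" "(c n - c0) \<odot> l"] assms by (auto simp: tends_def N_scale)
 qed
qed (use assms in \<open>auto simp: tends_def\<close>)

lemma tends_diff:
 assumes "tends s l" "tends t k" shows "tends (%n. s n - t n) (l - k)"
 using tends_add[OF assms(1) tends_scale_seq[OF assms(2), of "%_. -1" "-1"]] by (simp add: scale_minus_left)

lemma tends_unique:
 assumes "tends s l" "tends s k" shows "l = k"
proof -
 have "(%n. N (s n - s n - (l - k))) \<longlonglongrightarrow> 0"
  using tends_diff[OF assms] by (auto simp: tends_def)
 hence "(%n::nat. N (k - l)) \<longlonglongrightarrow> 0" by simp
 hence "N (k - l) = 0" using LIMSEQ_const_iff by blast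
 thus ?thesis using N_eq_0[of "k - l"] assms by (auto simp: tends_def)
qed

lemma tends_Suc: "tends s l ==> tends (%n. s (Suc n)) l"
 unfolding tends_def by (auto intro: LIMSEQ_Suc[of "%n. N (s n - l)"])

section \<open>Linear and bounded operators on the carrier\<close>

definition lin :: "('v => 'v) => bool" where
 "lin T \<longleftrightarrow> (ALL x:X. T x : X) & (ALL x:X. ALL y:X. T (x + y) = T x + T y) &
   (ALL c. ALL x:X. T (c \<odot> x) = c \<odot> T x)"

definition bounded_by :: "('v => 'v) => real => bool" where
 "bounded_by T C \<longleftrightarrow> lin T & 0 <= C & (ALL x:X. N (T x) <= C * N x)"

definition bop :: "('v => 'v) => bool" where
 "bop T \<longleftrightarrow> (EX C. bounded_by T C)"

lemma linD:
 assumes "lin T"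
 shows "x : X ==> T x : X" "x : X ==> y : X ==> T (x + y) = T x + T y"
  "x : X ==> T (c \<odot> x) = c \<odot> T x"
 using assms by (auto simp: lin_def)

lemma lin_0: "lin T ==> T 0 = 0"
 using linD(3)[of T 0 0] by simp

lemma lin_minus: "lin T ==> x : X ==> T (- x) = - T x"
 using linD(3)[of T x "-1"] by (simp add: scale_minus_left)

lemma lin_diff: "lin T ==> x : X ==> y : X ==> T (x - y) = T x - T y"
 using linD(2)[of T x "- y"] by (simp add: lin_minus)

lemma lin_sum: "lin T ==> (!!i. i : I ==> f i : X) ==> T (sum f I) = (\<Sum>i\<in>I. T (f i))"
proof (induction I rule: infinite_finite_induct)
 case (insert i I)
 thus ?case by (simp add: linD(2))
qed (simp_all add: lin_0)

lemma bounded_byD: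
 assumes "bounded_by T C" shows "lin T" "0 <= C" "x : X ==> N (T x) <= C * N x"
 using assms by (auto simp: bounded_by_def)

lemma bopE:
 assumes "bop T" obtains C where "bounded_by T C"
 using assms by (auto simp: bop_def)

lemma bop_lin: "bop T ==> lin T" by (auto simp: bop_def bounded_by_def)

lemma bopX: "bop T ==> x : X ==> T x : X" by (auto simp: bop_def bounded_by_def lin_def)

lemma bounded_by_bop: "bounded_by T C ==> bop T" by (auto simp: bop_def)

lemma bounded_by_mono: "bounded_by T C ==> C <= C' ==> bounded_by T C'"
 unfolding bounded_by_def by (meson N_nonneg dual_order.trans mult_right_mono)

lemma bounded_by_compose: "bounded_by T C ==> bounded_by S C' ==> bounded_by (%x. T (S x)) (C * C')"
 unfolding bounded_by_def lin_def
 by (auto simp: mult.assoc) (meson N_nonneg mult_left_mono order_trans)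

lemma bounded_by_add:
 assumes "bounded_by T C" "bounded_by S C'" shows "bounded_by (%x. T x + S x) (C + C')"
proof -
 have "N (T x + S x) <= (C + C') * N x" if "x : X" for x
  using N_triangle[of "T x" "S x"] assms that by (fastforce simp: bounded_by_def lin_def algebra_simps)
 thus ?thesis using assms by (auto simp: bounded_by_def lin_def scale_right_distrib)
qed

lemma bounded_by_scale:
 assumes "bounded_by T C" shows "bounded_by (%x. c \<odot> T x) (norm c * C)"
 using assms by (auto simp: bounded_by_def lin_def scale_right_distrib N_scale mult.assoc mult_left_mono mult.commute[of c])

lemma bounded_by_diff:
 assumes "bounded_by T C" "bounded_by S C'" shows "bounded_by (%x. T x - S x) (C + C')"
 using bounded_by_add[OF assms(1) bounded_by_scale[OF assms(2), of "-1"]] by (simp add: scale_minus_left)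

lemma bounded_by_id: "bounded_by (%x. x) 1"
 by (auto simp: bounded_by_def lin_def)

lemma bounded_by_0: "bounded_by (%x. 0) 0"
 by (auto simp: bounded_by_def lin_def)

lemma bounded_by_sum:
 "(!!i. i : I ==> bounded_by (T i) (C i)) ==> bounded_by (%x. \<Sum>i\<in>I. T i x) (\<Sum>i\<in>I. C i)"
proof (induction I rule: infinite_finite_induct)
 case (insert i I)
 thus ?case using bounded_by_add[of "T i" "C i" "%x. \<Sum>i\<in>I. T i x"] by simp
qed (simp_all add: bounded_by_0)

lemma bounded_by_funpow: "bounded_by T C ==> bounded_by (T ^^ n) (C ^ n)"
proof (induction n)
 case 0 thus ?case using bounded_by_id by (simp add: id_def)
next
 case (Suc n)
 thus ?case using bounded_by_compose[of T C "T ^^ n"] by (simp add: comp_def)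
qed

lemma bop_compose: "bop T ==> bop S ==> bop (%x. T (S x))"
 by (elim bopE) (rule bounded_by_bop[OF bounded_by_compose])

lemma bop_add: "bop T ==> bop S ==> bop (%x. T x + S x)"
 by (elim bopE) (rule bounded_by_bop[OF bounded_by_add])

lemma bop_diff: "bop T ==> bop S ==> bop (%x. T x - S x)"
 by (elim bopE) (rule bounded_by_bop[OF bounded_by_diff])

lemma bop_scale: "bop T ==> bop (%x. c \<odot> T x)"
 by (elim bopE) (rule bounded_by_bop[OF bounded_by_scale])

lemma bop_id: "bop (%x. x)"
 by (rule bounded_by_bop[OF bounded_by_id])

lemma bop_funpow: "bop T ==> bop (T ^^ n)"
 by (elim bopE) (rule bounded_by_bop[OF bounded_by_funpow])

lemma bop_sum: "(!!i. i : I ==> bop (T i)) ==> bop (%x. \<Sum>i\<in>I. T i x)"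
proof -
 assume "!!i. i : I ==> bop (T i)"
 then obtain C where "!!i. i : I ==> bounded_by (T i) (C i)"
  unfolding bop_def by metis
 thus ?thesis using bounded_by_sum[of I T C] by (auto simp: bop_def)
qed

lemma tends_bop:
 assumes "bop T" "tends s l" shows "tends (%n. T (s n)) (T l)"
proof -
 obtain C where C: "bounded_by T C" using assms bopE by blast
 note l = bounded_byD[OF C]
 show ?thesis
 proof (rule tends_le)
  show "(%n. C * N (s n - l)) \<longlonglongrightarrow> 0"
   using assms by (auto intro!: tendsto_eq_intros simp: tends_def)
  show "N (T (s n) - T l) <= C * N (s n - l)" for n
   using l(3)[of "s n - l"] lin_diff[OF l(1), of "s n" l] assms by (auto simp: tends_def)
 qed (use assms linD(1)[OF l(1)] in \<open>auto simp: tends_def\<close>)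
qed

lemma tends_complete:
 assumes "!!n. s n : X" "!!e. e > 0 ==> EX M. ALL m>=M. ALL n>=M. N (s m - s n) < e"
 shows "EX l. tends s l"
 using N_complete[OF assms] assms(1) by (auto simp: tends_def)

lemma tends_N_le:
 assumes "tends s l" "!!n. n >= M ==> N (s n - y) <= c" "y : X" shows "N (l - y) <= c"
proof (rule field_le_epsilon)
 fix e :: real assume "e > 0"
 have "eventually (%n. N (s n - l) < e) sequentially"
  using assms(1) \<open>e > 0\<close> by (auto simp: tends_def intro: order_tendstoD(2))
 then obtain K where "!!n. n >= K ==> N (s n - l) < e"
  by (auto simp: eventually_sequentially)
 then obtain n where n: "N (s n - l) < e" "n >= M"
  using max.cobounded1 max.cobounded2 by blast
 have "N (l - y) <= N (l - s n) + N (s n - y)"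
  using N_diff_triangle assms by (auto simp: tends_def)
 thus "N (l - y) <= c + e"
  using n assms(2)[OF n(2)] N_diff_commute[of l "s n"] assms(1) by (auto simp: tends_def)
qed

text \<open>Norm convergence as a family of estimates on the carrier, so that statements about it
  are proved vector by vector.\<close>

definition converges_to :: "(nat => 'v => 'v) => ('v => 'v) => bool" where
 "converges_to U P \<longleftrightarrow> (ALL e>0. EX M. ALL n>=M. ALL x:X. N (U n x - P x) <= e * N x)"

text \<open>Completeness of the space of bounded operators: pointwise limits exist by completeness
  of the carrier, and the uniform Cauchy estimate survives the limit. Boundedness of the limit
  follows by comparing it with a single \<open>U M\<close> at distance 1.\<close>

lemma cauchy_operators_converge:
 assumes U: "!!n. bop (U n)"
  and cauchy: "!!e. e > 0 ==> EX M. ALL m>=M. ALL n>=M. ALL x:X. N (U m x - U n x) <= e * N x"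
 shows "EX P. bop P & converges_to U P"
proof -
 have UX: "U n x : X" if "x : X" for n x
  by (rule bopX[OF U that])
 have "EX l. tends (%n. U n x) l" if x: "x : X" for x
 proof (rule tends_complete)
  fix e :: real assume "e > 0"
  \<comment> \<open>The summand 1 covers \<open>N x = 0\<close>; the factor 2 makes the final
    inequality strict.\<close>
  define d where "d = e / (2 * (N x + 1))"
  have Nx: "N x >= 0" using N_nonneg x by auto
  hence "d > 0" using \<open>e > 0\<close> by (simp add: d_def)
  moreover have "d * N x < e"
  proof -
   have "d * N x <= d * (N x + 1)" using \<open>d > 0\<close> by simp
   also have "... = e / 2" using Nx by (simp add: d_def field_simps)
   finally show ?thesis using \<open>e > 0\<close> by simp
  qed
  ultimately show "EX M. ALL m>=M. ALL n>=M. N (U m x - U n x) < e"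
   using cauchy[of d] x by (meson order_le_less_trans)
 qed (use UX x in auto)
 then obtain P where P: "!!x. x : X ==> tends (%n. U n x) (P x)" by metis
 have close: "EX M. ALL n>=M. ALL x:X. N (U n x - P x) <= e * N x" if "e > 0" for e
 proof -
  obtain M where M: "ALL m>=M. ALL n>=M. ALL x:X. N (U m x - U n x) <= e * N x"
   using cauchy[OF \<open>e > 0\<close>] by blast
  have "N (U n x - P x) <= e * N x" if "n >= M" "x : X" for n x
   using tends_N_le[OF P[OF that(2)], of M "U n x" "e * N x"] M that UX P[OF that(2)]
   by (auto simp: N_diff_commute tends_def)
  thus ?thesis by blast
 qed
 have "lin P"
  unfolding lin_def
 proof (intro conjI ballI allI)
  fix x y assume "x : X" "y : X"
  thus "P (x + y) = P x + P y"
   using tends_unique[OF P[of "x + y"]] tends_add[OF P P, of x y] linD(2)[OF bop_lin[OF U]] by auto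
 next
  fix c x assume "x : X"
  thus "P (c \<odot> x) = c \<odot> P x"
   using tends_unique[OF P[of "c \<odot> x"]] tends_scale_seq[OF P, of x "%_. c"] linD(3)[OF bop_lin[OF U]] by auto
 qed (use P in \<open>auto simp: tends_def\<close>)
 moreover obtain M where M: "ALL n>=M. ALL x:X. N (U n x - P x) <= 1 * N x" using close[of 1] by auto
 moreover obtain C where C: "bounded_by (U M) C" using U bopE by blast
 ultimately have "bounded_by P (1 + C)"
  unfolding bounded_by_def
 proof (intro conjI ballI)
  fix x assume x: "x : X"
  have "N (P x) <= N (P x - U M x) + N (U M x)"
   by (intro N_le_add UX x linD(1)[OF \<open>lin P\<close>])
  also have "... <= 1 * N x + C * N x"
   using M x bounded_byD(3)[OF C x] N_diff_commute[of "P x" "U M x"] UX[OF x] linD(1)[OF \<open>lin P\<close>] by fastforce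
  finally show "N (P x) <= (1 + C) * N x" by (simp add: algebra_simps)
 qed (use bounded_byD[OF C] in auto)
 thus ?thesis using close by (auto simp: converges_to_def bop_def)
qed

lemma converges_to_tends:
 assumes "converges_to U P" "bop P" "!!n. bop (U n)" "x : X" shows "tends (%n. U n x) (P x)"
 unfolding tends_def
proof (intro conjI allI)
 show "(%n. N (U n x - P x)) \<longlonglongrightarrow> 0"
 proof (rule LIMSEQ_I)
  fix e :: real assume "e > 0"
  define d where "d = e / (2 * (N x + 1))"
  have Nx: "N x >= 0" using N_nonneg assms by auto
  hence "d > 0" using \<open>e > 0\<close> by (simp add: d_def)
  moreover have "d * N x < e"
  proof -
   have "d * N x <= d * (N x + 1)" using \<open>d > 0\<close> by simp
   also have "... = e / 2" using Nx by (simp add: d_def field_simps)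
   finally show ?thesis using \<open>e > 0\<close> by simp
  qed
  moreover obtain M where M: "!!n. n >= M ==> N (U n x - P x) <= d * N x"
   using assms(1)[unfolded converges_to_def, rule_format, OF \<open>d > 0\<close>] assms(4) by auto
  moreover have "0 <= N (U n x - P x)" for n
   using N_nonneg[OF X_closed(3)[OF bopX[OF assms(3,4)] bopX[OF assms(2,4)]]] .
  ultimately have "!!n. n >= M ==> norm (N (U n x - P x) - 0) < e"
   by fastforce
  thus "EX M. ALL n>=M. norm (N (U n x - P x) - 0) < e" by auto
 qed
qed (use bopX[OF assms(3,4)] bopX[OF assms(2,4)] in auto)

text \<open>W is the limit of the partial sums of the powers of M. Only the right-inverse relation
  for 1 - M is recorded; two-sided inverses are obtained later from injectivity.\<close>

lemma neumann_series:
 assumes M: "bounded_by M q" and "q < 1"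
 shows "EX W. bop W & (ALL x:X. W x - M (W x) = x)"
proof -
 have q: "0 <= q" using bounded_byD[OF M] by auto
 define U where "U n x = (\<Sum>k<n. (M ^^ k) x)" for n x
 have Mk: "bounded_by (M ^^ k) (q ^ k)" for k using bounded_by_funpow[OF M] .
 have MX: "(M ^^ k) x : X" if "x : X" for k x
  using bopX[OF bounded_by_bop[OF Mk] that] .
 have U: "bop (U n)" for n
  unfolding U_def by (intro bop_sum bounded_by_bop[OF Mk])
 have UX: "U n x : X" if "x : X" for n x by (rule bopX[OF U that])
 have diff: "N (U m x - U n x) <= q ^ n / (1 - q) * N x" if "n <= m" "x : X" for m n x
 proof -
  have "U m x - U n x = (\<Sum>k\<in>{n..<m}. (M ^^ k) x)"
   unfolding U_def using that
   by (metis atLeast0LessThan sum_diff_nat_ivl zero_le)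
  hence "N (U m x - U n x) <= (\<Sum>k\<in>{n..<m}. N ((M ^^ k) x))"
   using N_sum[of "{n..<m}" "%k. (M ^^ k) x"] MX that by simp
  also have "... <= (\<Sum>k\<in>{n..<m}. q ^ k * N x)"
   using bounded_byD(3)[OF Mk] that by (intro sum_mono) auto
  also have "... = (\<Sum>k\<in>{n..<m}. q ^ k) * N x" by (simp add: sum_distrib_right)
  also have "(\<Sum>k\<in>{n..<m}. q ^ k) = q ^ n * (\<Sum>k<m-n. q ^ k)"
   using sum.shift_bounds_nat_ivl[of "%k. q ^ k" 0 n "m - n"] that
   by (simp add: sum_distrib_left power_add atLeast0LessThan mult.commute)
  also have "(\<Sum>k<m-n. q ^ k) <= 1 / (1 - q)"
   using sum_le_suminf[of "%k. q ^ k" "{..<m-n}"] suminf_geometric[of q] summable_geometric[of q] q \<open>q < 1\<close>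
   by simp
  finally show ?thesis using q N_nonneg[OF that(2)] by (simp add: mult_left_mono mult_right_mono)
 qed
 have "EX P. bop P & converges_to U P"
 proof (rule cauchy_operators_converge[OF U])
  fix e :: real assume "e > 0"
  have "(%n. q ^ n / (1 - q)) \<longlonglongrightarrow> 0 / (1 - q)"
   using q \<open>q < 1\<close> by (intro tendsto_intros LIMSEQ_power_zero) auto
  hence "eventually (%n. q ^ n / (1 - q) < e) sequentially"
   using \<open>e > 0\<close> by (auto intro: order_tendstoD(2))
  then obtain K where K: "!!n. n >= K ==> q ^ n / (1 - q) < e" by (auto simp: eventually_sequentially)
  have "N (U m x - U n x) <= e * N x" if "m >= K" "n >= K" "x : X" for m n x
  proof -
   have *: "N (U m x - U n x) <= e * N x" if "n >= K" "n <= m" for m n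
    using diff[OF \<open>n <= m\<close> \<open>x : X\<close>] mult_right_mono[OF less_imp_le[OF K[OF \<open>n >= K\<close>]] N_nonneg[OF \<open>x : X\<close>]] by linarith
   show ?thesis using *[of n m] *[of m n] that N_diff_commute[OF UX UX, of x x m n] by (cases "n <= m") auto
  qed
  thus "EX M. ALL m>=M. ALL n>=M. ALL x:X. N (U m x - U n x) <= e * N x" by blast
 qed
 then obtain W where W: "bop W" "converges_to U W" by blast
 have "W x - M (W x) = x" if x: "x : X" for x
 proof -
  have 1: "tends (%n. U n x) (W x)" using converges_to_tends[OF W(2,1) U x] .
  have 2: "tends (%n. U n x - M (U n x)) (W x - M (W x))"
   using tends_diff[OF 1 tends_bop[OF bounded_by_bop[OF M] 1]] .
  have "U n x - M (U n x) = x - (M ^^ n) x" for n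
  proof -
   have "M (U n x) = (\<Sum>k<n. (M ^^ Suc k) x)"
    unfolding U_def using lin_sum[OF bounded_byD(1)[OF M], of "{..<n}" "%k. (M ^^ k) x"] MX x by simp
   thus ?thesis
    using sum_lessThan_telescope'[of "%k. (M ^^ k) x" n] by (simp add: U_def sum_subtractf[symmetric])
  qed
  moreover have "tends (%n. x - (M ^^ n) x) (x - 0)"
  proof (rule tends_diff[OF tends_const[OF x]], rule tends_le)
   show "N ((M ^^ n) x - 0) <= q ^ n * N x" for n using bounded_byD(3)[OF Mk x] by simp
   show "(%n. q ^ n * N x) \<longlonglongrightarrow> 0"
    using q \<open>q < 1\<close> by (auto intro!: tendsto_eq_intros LIMSEQ_power_zero)
  qed (use MX x in auto)
  ultimately show ?thesis using tends_unique[OF 2] by simp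
 qed
 thus ?thesis using W by blast
qed

section \<open>Cesaro means\<close>

definition ces :: "('v => 'v) => nat => 'v => 'v" where
 "ces T n x = (1 / of_nat n) \<odot> (\<Sum>k=1..n. (T ^^ k) x)"

lemma bop_ces: "bop T ==> bop (ces T n)"
 unfolding ces_def[abs_def] by (rule bop_scale, rule bop_sum, rule bop_funpow)

lemma ces_commute:
 assumes "lin T" "x : X" shows "T (ces T n x) = ces T n (T x)"
proof -
 have TX: "(T ^^ k) x : X" for k
  using assms by (induction k) (auto simp: lin_def)
 have "T (ces T n x) = (1 / of_nat n) \<odot> (\<Sum>k=1..n. T ((T ^^ k) x))"
  unfolding ces_def using assms TX by (simp add: linD(3) lin_sum)
 thus ?thesis by (simp add: ces_def funpow_swap1)
qed

lemma ces_diff: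
 "ces T n (T x) - ces T n x = (1 / of_nat n) \<odot> ((T ^^ Suc n) x - T x)"
proof -
 have "ces T n (T x) - ces T n x = (1 / of_nat n) \<odot> (\<Sum>k=1..n. (T ^^ Suc k) x - (T ^^ k) x)"
  unfolding ces_def by (simp add: scale_right_diff_distrib sum_subtractf funpow_swap1)
 also have "(\<Sum>k=1..n. (T ^^ Suc k) x - (T ^^ k) x) = (T ^^ Suc n) x - T x"
  using sum_Suc_diff[of 1 n "%k. (T ^^ k) x"] by simp
 finally show ?thesis .
qed

text \<open>Two consecutive partial sums differ by one power. This is how a bound on the means
  becomes one on the powers.\<close>

lemma power_from_ces: "n >= 1 ==> (T ^^ Suc n) x = of_nat (Suc n) \<odot> ces T (Suc n) x - of_nat n \<odot> ces T n x"
proof -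
 assume n: "n >= 1"
 have 1: "of_nat n \<odot> ces T n x = (\<Sum>k=1..n. (T ^^ k) x)" if "n >= 1" for n
  using that by (simp add: ces_def)
 show ?thesis using 1[of n] 1[of "Suc n"] n by simp
qed

lemma bounded_on_unit_ball:
 assumes S: "lin S" and c: "!!x. x : X ==> N x <= 1 ==> N (S x) <= c" and x: "x : X"
 shows "N (S x) <= c * N x"
proof (cases "x = 0")
 case False
 hence n: "N x > 0" using N_eq_0[OF x] N_nonneg[OF x] by fastforce
 have "N (S (of_real (1 / N x) \<odot> x)) <= c"
  using n x by (intro c) (auto simp: N_scale norm_divide)
 moreover have "N (S (of_real (1 / N x) \<odot> x)) = N (S x) / N x"
  unfolding linD(3)[OF S x] using n by (simp add: N_scale linD(1)[OF S x] norm_divide)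
 ultimately show ?thesis using n by (simp add: pos_divide_le_eq)
qed (simp add: lin_0[OF S])

text \<open>Baire's theorem for a closed part Y of the carrier. It is stated for subsets because it
  will be applied to the unit ball of L^\<infinity> with the metric of L^1: the ball is complete in
  that metric, while L^\<infinity> itself in general is not.\<close>

lemma Baire_ball:
 assumes Y: "Y \<subseteq> X" "Y ~= {}" "!!s l. (!!n. s n : Y) ==> tends s l ==> l : Y"
  and F: "!!n::nat. F n \<subseteq> Y" "!!n s l. (!!i. s i : F n) ==> tends s l ==> l : F n" "Y \<subseteq> (\<Union>n. F n)"
 shows "EX n f r. 0 < r & f : F n & (ALL g:Y. N (g - f) < r --> g : F n)"
proof -
 \<comment> \<open>Nonnegativity and symmetry of a metric are demanded for all arguments, while
   \<open>N\<close> is controlled only on X; hence the value 0 outside Y.\<close>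
 define d where "d x y = (if x : Y & y : Y then N (x - y) else 0)" for x y
 have YX: "x : Y ==> x : X" for x using Y(1) by blast
 interpret M: Metric_space Y d
 proof
  show "0 <= d x y" "d x y = d y x" for x y
   using N_nonneg[of "x - y"] N_diff_commute[of x y] YX by (auto simp: d_def)
  show "d x y = 0 \<longleftrightarrow> x = y" if "x : Y" "y : Y" for x y
   using N_eq_0[of "x - y"] that YX by (auto simp: d_def)
  show "d x z <= d x y + d y z" if "x : Y" "y : Y" "z : Y" for x y z
   using N_diff_triangle[of x y z] that YX by (auto simp: d_def)
 qed
 have lim: "limitin M.mtopology s l sequentially" if t: "tends s l" and s: "!!n. s n : Y" for s l
 proof -
  have "l : Y" using Y(3)[OF s t] .
  thus ?thesis using t s by (auto simp: M.limitin_metric_dist_null d_def tends_def)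
 qed
 have lim': "tends s l" if "limitin M.mtopology s l sequentially" and s: "!!n. s n : Y" for s l
  using that YX by (auto simp: M.limitin_metric_dist_null d_def tends_def)
 have "M.mcomplete"
  unfolding M.mcomplete_def
 proof (intro allI impI)
  fix s assume "M.MCauchy s"
  hence s: "s n : Y" for n by (auto simp: M.MCauchy_def)
  have c: "EX K. ALL m>=K. ALL n>=K. N (s m - s n) < e" if "e > 0" for e
   using \<open>M.MCauchy s\<close> that s by (simp add: M.MCauchy_def d_def)
  show "EX x. limitin M.mtopology s x sequentially"
   using tends_complete[of s, OF YX[OF s] c] lim[of s, OF _ s] by blast
 qed
 moreover have "closedin M.mtopology (F n)" for n
  unfolding M.metric_closedin_iff_sequentially_closed
 proof (intro conjI allI impI F(1))
  fix s l assume "range s \<subseteq> F n & limitin M.mtopology s l sequentially"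
  hence "!!i. s i : F n" "limitin M.mtopology s l sequentially" "!!i. s i : Y" using F(1)[of n] by auto
  thus "l : F n" using F(2)[of s n l] lim'[of s l] by blast
 qed
 ultimately have "M.mtopology interior_of (\<Union>(range F)) = {}" if "!!n. M.mtopology interior_of F n = {}"
  using that by (intro M.metric_Baire_category_alt) auto
 moreover have "\<Union>(range F) = Y" using F(1,3) by auto
 moreover have "M.mtopology interior_of Y ~= {}" using interior_of_topspace[of M.mtopology] Y(2) by simp
 ultimately have "\<not> (ALL n. M.mtopology interior_of F n = {})" by force
 then obtain n f where "f : M.mtopology interior_of F n" by auto
 then obtain r where r: "r > 0" "f : Y" "M.mball f r \<subseteq> F n"
  by (auto simp: M.in_interior_of_mball)
 have "g : F n" if "g : Y" "N (g - f) < r" for g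
  using r(2,3) that N_diff_commute[of f g] YX by (auto simp: M.mball_def d_def)
 moreover have "f : F n" using r by auto
 ultimately show ?thesis using r(1) by blast
qed

lemma ces_le:
 assumes T: "bounded_by T 1" and x: "x : X" shows "N (ces T n x) <= N x"
proof (cases "n = 0")
 case False
 note Tk = bounded_by_funpow[OF T, simplified]
 have TkX: "(T ^^ k) x : X" for k by (rule bopX[OF bounded_by_bop[OF Tk] x])
 have "N (ces T n x) = (1 / n) * N (\<Sum>k=1..n. (T ^^ k) x)"
  unfolding ces_def using TkX by (simp add: N_scale norm_divide)
 also have "... <= (1 / n) * (\<Sum>k=1..n. N x)"
  using bounded_byD(3)[OF Tk x] by (intro mult_left_mono order_trans[OF N_sum sum_mono] TkX) auto
 finally show ?thesis using False by simp
qed (use N_nonneg[OF x] in \<open>simp add: ces_def\<close>)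

text \<open>Each further application of T changes the mean by a telescoping difference of two powers
  divided by n, hence by at most 2/n times the norm.\<close>

lemma ces_shift_le:
 assumes T: "bounded_by T 1" and x: "x : X"
 shows "N (ces T n x - ces T n ((T ^^ k) x)) <= 2 * real k / real n * N x"
proof (induction k)
 case (Suc k)
 note Tk = bounded_by_funpow[OF T, simplified]
 have TkX: "(T ^^ k) x : X" for k by (rule bopX[OF bounded_by_bop[OF Tk] x])
 have cX: "ces T n ((T ^^ k) x) : X" for k by (rule bopX[OF bop_ces[OF bounded_by_bop[OF T]] TkX])
 have "N (ces T n ((T ^^ Suc k) x) - ces T n ((T ^^ k) x)) = (1 / n) * N ((T ^^ (Suc n + k)) x - (T ^^ Suc k) x)"
  using ces_diff[of T n "(T ^^ k) x"] TkX[of "Suc n + k"] TkX[of "Suc k"] by (simp add: N_scale norm_divide funpow_add)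
 also have "... <= (1 / n) * (N x + N x)"
 proof (rule mult_left_mono)
  show "N ((T ^^ (Suc n + k)) x - (T ^^ Suc k) x) <= N x + N x"
   using order_trans[OF N_diff_le[OF TkX TkX] add_mono[OF bounded_byD(3)[OF Tk x] bounded_byD(3)[OF Tk x]], of "Suc n + k" "Suc k"]
   by simp
 qed simp
 finally have "N (ces T n ((T ^^ k) x) - ces T n ((T ^^ Suc k) x)) <= 2 / n * N x"
  using N_diff_commute[OF cX cX, of k "Suc k"] by simp
 moreover have "N (ces T n x - ces T n ((T ^^ Suc k) x)) <= N (ces T n x - ces T n ((T ^^ k) x)) + N (ces T n ((T ^^ k) x) - ces T n ((T ^^ Suc k) x))"
  using N_diff_triangle[OF cX[of 0] cX[of k] cX[of "Suc k"]] by (simp del: funpow.simps(2))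
 ultimately have "N (ces T n x - ces T n ((T ^^ Suc k) x)) <= 2 * real k / n * N x + 2 / n * N x" using Suc by linarith
 also have "... = 2 * real (Suc k) / n * N x" by (simp add: add_divide_distrib distrib_right)
 finally show ?case .
qed simp

text \<open>A difference D of two late means is almost fixed by \<open>T ^^ k\<close>, because
  shifting the argument changes a mean little. So D is close to \<open>V D + W D\<close>; the first
  term is small by assumption and the second is absorbed since q < 1. Only V has to be understood,
  not T.\<close>

lemma ces_cauchy_of_split:
 assumes T: "bounded_by T 1" and W: "bounded_by W q" "q < 1"
  and split: "!!x. x : X ==> (T ^^ k) x = V x + W x" "!!x. x : X ==> V x : X"
  and V: "!!e. 0 < e ==> EX M. ALL i>=M. ALL j>=M. ALL x:X. N (V (ces T i x - ces T j x)) <= e * N x"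
  and e: "0 < e"
 shows "EX M. ALL i>=M. ALL j>=M. ALL x:X. N (ces T i x - ces T j x) <= e * N x"
proof -
 \<comment> \<open>Three errors of size d occur, two from shifting and one from V; dividing by 1 - q
   gives e.\<close>
 define d where "d = (1 - q) * e / 3"
 have d: "d > 0" using e W by (simp add: d_def)
 obtain M where M: "!!i j x. i >= M ==> j >= M ==> x : X ==> N (V (ces T i x - ces T j x)) <= d * N x"
  using V[OF d] by blast
 obtain L where L: "!!n. n >= L ==> 2 * real k / real n < d"
  using order_tendstoD(2)[OF lim_const_over_n[of "2 * real k"] d] by (auto simp: eventually_sequentially)
 have "N (ces T i x - ces T j x) <= e * N x" if ij: "i >= max M L" "j >= max M L" and x: "x : X" for i j x
 proof -
  note bT = bounded_by_bop[OF T]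
  have cX: "ces T n y : X" if "y : X" for n y by (rule bopX[OF bop_ces[OF bT] that])
  define D where "D = ces T i x - ces T j x"
  have DX: "D : X" using cX x by (simp add: D_def)
  have comm: "(T ^^ k) (ces T n x) = ces T n ((T ^^ k) x)" for n
   by (induction k) (simp_all add: ces_commute[OF bop_lin[OF bT]] bopX[OF bop_funpow[OF bT] x])
  have TkX: "(T ^^ k) x : X" by (rule bopX[OF bop_funpow[OF bT] x])
  have sh: "N (ces T n x - ces T n ((T ^^ k) x)) <= d * N x" if "n >= L" for n
   by (rule order_trans[OF ces_shift_le[OF T x] mult_right_mono[OF less_imp_le[OF L[OF that]] N_nonneg[OF x]]])
  have "(T ^^ k) D = ces T i ((T ^^ k) x) - ces T j ((T ^^ k) x)"
   unfolding D_def using lin_diff[OF bop_lin[OF bop_funpow[OF bT]] cX[OF x] cX[OF x]] comm by simp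
  hence "D - (T ^^ k) D = (ces T i x - ces T i ((T ^^ k) x)) - (ces T j x - ces T j ((T ^^ k) x))"
   by (simp add: D_def)
  hence "N (D - (T ^^ k) D) <= d * N x + d * N x"
   using N_diff_le[of "ces T i x - ces T i ((T ^^ k) x)" "ces T j x - ces T j ((T ^^ k) x)"] sh[of i] sh[of j] ij cX TkX x by simp
  moreover have "N D <= N (D - (T ^^ k) D) + N ((T ^^ k) D)" by (rule N_le_add[OF DX bopX[OF bop_funpow[OF bT] DX]])
  moreover have "N ((T ^^ k) D) <= N (V D) + q * N D"
   unfolding split(1)[OF DX] using N_triangle[OF split(2)[OF DX] bopX[OF bounded_by_bop[OF W(1)] DX]] bounded_byD(3)[OF W(1) DX] by simp
  moreover have "N (V D) <= d * N x" unfolding D_def using M ij x by simp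
  ultimately have "(1 - q) * N D <= 3 * d * N x" by (simp add: algebra_simps)
  hence "(1 - q) * N D <= (1 - q) * (e * N x)" by (simp add: d_def)
  thus ?thesis using W(2) by (simp add: D_def)
 qed
 thus ?thesis by blast
qed

lemma converges_to_Cauchy:
 assumes "converges_to U P" "!!n. bop (U n)" "bop P" and e: "0 < e"
 shows "EX M. ALL i>=M. ALL j>=M. ALL x:X. N (U i x - U j x) <= e * N x"
proof -
 obtain M where M: "!!n x. n >= M ==> x : X ==> N (U n x - P x) <= e / 2 * N x"
  using assms(1)[unfolded converges_to_def, rule_format, of "e / 2"] e by auto
 have "N (U i x - U j x) <= e * N x" if "i >= M" "j >= M" "x : X" for i j x
 proof -
  have "N (U i x - U j x) <= N (U i x - P x) + N (U j x - P x)"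
   using N_diff_triangle[of "U i x" "P x" "U j x"] N_diff_commute[of "P x" "U j x"] that(3) bopX[OF assms(2)] bopX[OF assms(3)] by simp
  also have "... <= e / 2 * N x + e / 2 * N x" by (intro add_mono M that)
  finally show ?thesis by simp
 qed
 thus ?thesis by blast
qed

text \<open>The Cauchy condition does not mention the limit operator, so it can be transferred by
  duality between L^1 and L^\<infinity>.\<close>

lemma converges_iff_Cauchy:
 assumes U: "!!n. bop (U n)"
 shows "(EX P. bop P & converges_to U P) \<longleftrightarrow> (ALL e>0. EX M. ALL i>=M. ALL j>=M. ALL x:X. N (U i x - U j x) <= e * N x)"
proof
 show "ALL e>0. EX M. ALL i>=M. ALL j>=M. ALL x:X. N (U i x - U j x) <= e * N x" if "EX P. bop P & converges_to U P"
  using converges_to_Cauchy[of U, OF _ U] that by blast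
qed (rule cauchy_operators_converge[of U, OF U], blast)

section \<open>Consequences of uniform mean ergodicity\<close>

text \<open>Norm convergent means are uniformly bounded, and a power is a difference of two
  consecutive means with weights of order n; this gives linear growth.\<close>

lemma ume_power_growth:
 assumes T: "bop T" and P: "bop P" "converges_to (ces T) P"
 shows "EX C. ALL n>=1. ALL x:X. N ((T ^^ n) x) <= C * n * N x"
proof -
 obtain CP where CP: "bounded_by P CP" using P bopE by blast
 obtain K where K: "ALL n>=K. ALL x:X. N (ces T n x - P x) <= 1 * N x"
  using P(2)[unfolded converges_to_def, rule_format, of 1] by auto
 have "EX C>=0. bounded_by (ces T n) C" for n
  using bop_ces[OF T, of n] bounded_byD(2) by (auto simp: bop_def)
 then obtain Cn where Cn: "!!n. 0 <= Cn n" "!!n. bounded_by (ces T n) (Cn n)" by metis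
 \<comment> \<open>\<open>1 + CP\<close> serves the means from K on, which are within 1 of P; the
   sum serves the finitely many earlier ones.\<close>
 define A where "A = 1 + CP + (\<Sum>k<K. Cn k)"
 have S0: "0 <= (\<Sum>k<K. Cn k)" using Cn by (simp add: sum_nonneg)
 have A: "N (ces T n x) <= A * N x" if x: "x : X" for n x
 proof (cases "n < K")
  case True
  have "Cn n <= (\<Sum>k<K. Cn k)" using True Cn member_le_sum[of n "{..<K}" Cn] by auto
  hence "Cn n <= A" using bounded_byD(2)[OF CP] by (simp add: A_def)
  thus ?thesis using bounded_byD(3)[OF Cn(2) x, of n] mult_right_mono[OF _ N_nonneg[OF x], of "Cn n" A] by linarith
 next
  case False
  have "N (ces T n x) <= N (ces T n x - P x) + N (P x)"
   by (rule N_le_add[OF bopX[OF bop_ces[OF T] x] bopX[OF P(1) x]])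
  also have "... <= 1 * N x + CP * N x"
   using K[rule_format, OF _ x, of n] False bounded_byD(3)[OF CP x] by linarith
  also have "... <= A * N x" using N_nonneg[OF x] S0 by (simp add: A_def algebra_simps)
  finally show ?thesis .
 qed
 have A0: "A >= 0" using S0 bounded_byD(2)[OF CP] by (simp add: A_def)
 have "N ((T ^^ n) x) <= (2 * A) * n * N x" if n: "n >= 1" and x: "x : X" for n x
 proof (cases "n = 1")
  case True
  have "T x = ces T 1 x" by (simp add: ces_def)
  thus ?thesis using A[OF x, of 1] True mult_nonneg_nonneg[OF A0 N_nonneg[OF x]] by simp
 next
  case False
  then obtain m where m: "n = Suc m" "m >= 1" using n by (cases n) auto
  have cX: "ces T k x : X" for k by (rule bopX[OF bop_ces[OF T] x])
  have "N ((T ^^ n) x) <= norm (of_nat (Suc m) :: complex) * N (ces T (Suc m) x) + norm (of_nat m :: complex) * N (ces T m x)"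
   unfolding m(1) power_from_ces[OF m(2)]
   by (intro order_trans[OF N_diff_le]) (auto simp: N_scale cX)
  also have "... <= real (Suc m) * (A * N x) + real m * (A * N x)"
   unfolding norm_of_nat using A[OF x] by (intro add_mono mult_left_mono) auto
  also have "... <= (2 * A) * n * N x"
   using m A0 N_nonneg[OF x] by (simp add: algebra_simps)
  finally show ?thesis .
 qed
 thus ?thesis by blast
qed

text \<open>The powers are not assumed bounded. That \<open>T ^^ Suc n\<close> divided by n tends to
  0 on each vector follows from the convergence itself, since it is (n + 1) / n times one mean minus
  the preceding mean, and both have the same limit.\<close>

lemma ume_limit_projection:
 assumes T: "bop T" and P: "bop P" "converges_to (ces T) P" and x: "x : X"
 shows "P (T x) = P x" "T (P x) = P x" "P (P x) = P x"
proof -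
 have c: "tends (%n. ces T n y) (P y)" if "y : X" for y
  using converges_to_tends[OF P(2,1) bop_ces[OF T] that] .
 have TX: "T x : X" "P x : X"
  by (fact bopX[OF T x], fact bopX[OF P(1) x])
 obtain C where C: "ALL n>=1. ALL x:X. N ((T ^^ n) x) <= C * n * N x"
  using ume_power_growth[OF T P] by blast
 have "tends (%n. ces T (Suc n) (T x) - ces T (Suc n) x) 0"
 proof -
  \<comment> \<open>The index is shifted by one so that no division by 0 occurs.\<close>
  have s: "ces T (Suc n) (T x) - ces T (Suc n) x =
    (of_nat (Suc (Suc n)) / of_nat (Suc n)) \<odot> ces T (Suc (Suc n)) x - ces T (Suc n) x - (1 / of_nat (Suc n)) \<odot> T x" for n
  proof -
   have "1 <= Suc n" by simp
   from power_from_ces[OF this, of T x] show ?thesis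
    unfolding ces_diff by (simp add: scale_right_diff_distrib del: of_nat_Suc funpow.simps)
  qed
  have l1: "(%n. of_nat (Suc (Suc n)) / of_nat (Suc n) :: complex) \<longlonglongrightarrow> 1"
   using LIMSEQ_Suc[OF LIMSEQ_Suc_n_over_n] by simp
  have l2: "(%n. 1 / of_nat (Suc n) :: complex) \<longlonglongrightarrow> 0"
   using LIMSEQ_Suc[OF lim_1_over_n] by simp
  show ?thesis unfolding s
   using tends_diff[OF tends_diff[OF tends_scale_seq[OF tends_Suc[OF tends_Suc[OF c[OF x]]] l1] tends_Suc[OF c[OF x]]]
     tends_scale_seq[OF tends_const[OF TX(1)] l2]] by simp
 qed
 moreover have "tends (%n. ces T (Suc n) (T x) - ces T (Suc n) x) (P (T x) - P x)"
  using tends_diff[OF tends_Suc[OF c[OF TX(1)]] tends_Suc[OF c[OF x]]] .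
 ultimately show PT: "P (T x) = P x" using tends_unique by fastforce
 have "tends (%n. T (ces T n x)) (T (P x))" using tends_bop[OF T c[OF x]] .
 thus TP: "T (P x) = P x"
  using tends_unique c[OF TX(1)] PT ces_commute[OF bop_lin[OF T] x] by simp
 have "(T ^^ k) (P x) = P x" for k by (induction k) (auto simp: TP)
 hence "ces T (Suc n) (P x) = P x" for n
 proof -
  have "ces T (Suc n) (P x) = (1 / of_nat (Suc n)) \<odot> (\<Sum>k=1..Suc n. P x)"
   unfolding ces_def using \<open>!!k. (T ^^ k) (P x) = P x\<close> by presburger
  also have "(\<Sum>k=1..Suc n. P x) = of_nat (Suc n) \<odot> P x"
   by (simp only: sum_constant_scale card_atLeastAtMost) simp
  finally show ?thesis by (simp only: scale_scale) (simp del: of_nat_Suc)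
 qed
 hence "tends (%n. ces T (Suc n) (P x)) (P x)" using tends_const TX by simp
 thus "P (P x) = P x" using tends_unique tends_Suc[OF c[OF TX(2)]] by metis
qed

definition resolvent_of :: "('v => 'v) => complex => ('v => 'v) => bool" where
 "resolvent_of T z S \<longleftrightarrow> bop S & (ALL x:X. S (z \<odot> x - T x) = x & z \<odot> S x - T (S x) = x)"

text \<open>Fix n such that the n-th mean is within 1/2 of P. An explicit polynomial Y in T
  satisfies \<open>(1 - T) Y = 1 - ces T n\<close>, hence \<open>(z - T) Y = 1 - M - P\<close> with
  M small for z near 1. On the kernel of P a Neumann series inverts 1 - M; on the range of P the
  operator z - T is multiplication by z - 1.\<close>

lemma ume_resolvent_near_1:
 assumes T: "bop T" and P: "bop P" "converges_to (ces T) P"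
 shows "EX d>0. ALL z. 0 < norm (z - 1) & norm (z - 1) < d --> (EX S. resolvent_of T z S)"
proof -
 note TX = bopX[OF T] and PX = bopX[OF P(1)] and linT = bop_lin[OF T] and linP = bop_lin[OF P(1)]
 note proj = ume_limit_projection[OF T P]
 have TkX: "(T ^^ k) x : X" if "x : X" for k x using bopX[OF bop_funpow[OF T] that] .
 obtain K where K: "!!n x. n >= K ==> x : X ==> N (ces T n x - P x) <= 1/2 * N x"
  using P(2)[unfolded converges_to_def, rule_format, of "1/2"] by auto
 define n where "n = Suc K"
 define E where "E x = ces T n x - P x" for x
 have E: "bounded_by E (1/2)"
  using bop_lin[OF bop_diff[OF bop_ces[OF T, of n] P(1)]] K[of n]
  by (auto simp: bounded_by_def E_def[abs_def] n_def)
 have EX: "E x : X" if "x : X" for x using bopX[OF bounded_by_bop[OF E] that] .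
 \<comment> \<open>Each inner sum is the quotient of the polynomials 1 - T^k and 1 - T; averaging
   over k gives \<open>1 - ces T n\<close> after multiplication by 1 - T.\<close>
 define Y where "Y x = (1 / of_nat n) \<odot> (\<Sum>k=1..n. \<Sum>j<k. (T ^^ j) x)" for x
 have Y: "bop Y"
  unfolding Y_def[abs_def] by (rule bop_scale, rule bop_sum, rule bop_sum, rule bop_funpow, rule T)
 note YX = bopX[OF Y] and linY = bop_lin[OF Y]
 have TY: "T (Y x) = Y (T x)" if "x : X" for x
  using that TkX unfolding Y_def by (simp add: linD(3)[OF linT] lin_sum[OF linT] funpow_swap1)
 have AY: "Y x - T (Y x) = x - ces T n x" if "x : X" for x
 proof -
  have "Y x - T (Y x) = (1 / of_nat n) \<odot> (\<Sum>k=1..n. \<Sum>j<k. (T ^^ j) x - (T ^^ Suc j) x)"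
   using that TkX unfolding Y_def
   by (simp add: linD(3)[OF linT] lin_sum[OF linT] scale_right_diff_distrib sum_subtractf)
  also have "(\<Sum>k=1..n. \<Sum>j<k. (T ^^ j) x - (T ^^ Suc j) x) = (\<Sum>k=1..n. x - (T ^^ k) x)"
  proof (rule sum.cong)
   show "(\<Sum>j<k. (T ^^ j) x - (T ^^ Suc j) x) = x - (T ^^ k) x" for k
    using sum_lessThan_telescope'[of "%j. (T ^^ j) x" k] by simp
  qed simp
  also have "(1 / of_nat n) \<odot> ... = x - ces T n x"
   by (simp add: ces_def sum_subtractf sum_constant_scale scale_right_diff_distrib n_def del: of_nat_Suc)
  finally show ?thesis .
 qed
 \<comment> \<open>P absorbs T, so on Y it acts through the average number c of summands.\<close>
 define c :: complex where "c = (1 / of_nat n) * (\<Sum>k=1..n. of_nat k)"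
 have PY: "P (Y x) = c \<odot> P x" if "x : X" for x
 proof -
  have PT: "P ((T ^^ k) x) = P x" for k
   by (induction k) (auto simp: proj(1)[OF TkX[OF that]])
  have "P (Y x) = (1 / of_nat n) \<odot> (\<Sum>k=1..n. \<Sum>j<k. P x)"
   using that TkX unfolding Y_def by (simp add: linD(3)[OF linP] lin_sum[OF linP] PT)
  thus ?thesis by (simp add: c_def sum_constant_scale flip: scale_sum_left)
 qed
 have PE: "P (E x) = 0" if x: "x : X" for x
 proof -
  have "P ((T ^^ k) x) = P x" for k
   by (induction k) (auto simp: proj(1)[OF TkX[OF that]])
  hence "P (ces T n x) = (1 / of_nat n) \<odot> (\<Sum>k=1..n. P x)"
   using that TkX unfolding ces_def by (simp add: linD(3)[OF linP] lin_sum[OF linP])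
  also have "... = P x" by (simp add: sum_constant_scale n_def del: of_nat_Suc)
  finally show ?thesis
   unfolding E_def using lin_diff[OF linP bopX[OF bop_ces[OF T] x] PX[OF x]] proj(3)[OF x] by simp
 qed
 obtain CY where CY: "bounded_by Y CY" using Y bopE by blast
 have CY0: "0 <= CY" using bounded_byD(2)[OF CY] .
 \<comment> \<open>The first bound keeps M below 3/4 in norm; the second makes
   \<open>1 + (z - 1) * c\<close> nonzero.\<close>
 define d where "d = min (1 / (4 * (CY + 1))) (1 / (norm c + 1))"
 have "d > 0" using CY0 by (auto simp: d_def add_nonneg_pos)
 moreover have "EX S. resolvent_of T z S" if z: "0 < norm (z - 1)" "norm (z - 1) < d" for z
 proof -
  define M where "M x = E x - (z - 1) \<odot> Y x" for x
  have zY: "norm (z - 1) * CY <= 1/4"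
  proof -
   have "norm (z - 1) * CY <= 1 / (4 * (CY + 1)) * CY"
    using z CY0 by (intro mult_right_mono) (auto simp: d_def)
   also have "... <= 1/4" using CY0 by (simp add: field_simps)
   finally show ?thesis .
  qed
  have zc: "norm ((z - 1) * c) < 1"
  proof -
   have "norm (z - 1) * norm c <= 1 / (norm c + 1) * norm c"
    using z by (intro mult_right_mono) (auto simp: d_def)
   also have "... < 1" by (simp add: field_simps add_pos_nonneg)
   finally show ?thesis by (simp add: norm_mult)
  qed
  have "bounded_by M (1/2 + norm (z - 1) * CY)"
   unfolding M_def[abs_def] by (rule bounded_by_diff[OF E bounded_by_scale[OF CY]])
  hence M: "bounded_by M (3/4)" by (rule bounded_by_mono) (use zY in simp)
  obtain W where W: "bop W" "!!x. x : X ==> W x - M (W x) = x"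
   using neumann_series[OF M] by auto
  note WX = bopX[OF W(1)]
  \<comment> \<open>On the fixed vectors division by z - 1; on the kernel of P the inverse of 1 - M
    followed by Y.\<close>
  define S where "S x = (1 / (z - 1)) \<odot> P x + Y (W (x - P x))" for x
  have bS: "bop S"
   unfolding S_def[abs_def]
   by (rule bop_add[OF bop_scale[OF P(1)] bop_compose[OF Y bop_compose[OF W(1) bop_diff[OF bop_id P(1)]]]])
  note SX = bopX[OF bS]
  have key: "z \<odot> Y w - T (Y w) = w - M w - P w" if "w : X" for w
  proof -
   have "z \<odot> Y w - T (Y w) = (z - 1) \<odot> Y w + (Y w - T (Y w))"
    by (simp add: scale_left_diff_distrib)
   thus ?thesis using AY[OF that] by (simp add: M_def E_def)
  qed
  have right: "z \<odot> S x - T (S x) = x" if x: "x : X" for x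
  proof -
   define v where "v = x - P x"
   define w where "w = W v"
   have v: "v : X" "P v = 0" using x PX lin_diff[OF linP x PX[OF x]] proj(3)[OF x] by (auto simp: v_def)
   have w: "w : X" "w - M w = v" using W(2)[OF v(1)] WX[OF v(1)] by (auto simp: w_def)
   \<comment> \<open>It is not obvious that W preserves the kernel of P. Applying P to
     \<open>w - M w = v\<close> leaves \<open>1 + (z - 1) * c\<close> times \<open>P w\<close>,
     which therefore vanishes.\<close>
   have "P w = 0"
   proof -
    have "P v = P w - (P (E w) - (z - 1) \<odot> P (Y w))"
     using w EX YX unfolding M_def
     by (simp flip: w(2) add: M_def lin_diff[OF linP] linD(3)[OF linP])
    hence "0 = P w + ((z - 1) * c) \<odot> P w" using v PE[OF w(1)] PY[OF w(1)] by simp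
    hence "(1 + (z - 1) * c) \<odot> P w = 0" by (simp add: scale_left_distrib)
    moreover have "1 + (z - 1) * c ~= 0"
     using zc by (metis add.inverse_inverse add_eq_0_iff less_irrefl norm_minus_cancel norm_one)
    ultimately show ?thesis using scale_eq_0_iff by blast
   qed
   hence zYw: "z \<odot> Y w - T (Y w) = v" using key[OF w(1)] w(2) by simp
   have "S x = (1 / (z - 1)) \<odot> P x + Y w" by (simp add: S_def w_def v_def)
   hence "z \<odot> S x - T (S x) = (z / (z - 1)) \<odot> P x - (1 / (z - 1)) \<odot> P x + (z \<odot> Y w - T (Y w))"
    using x PX YX w by (simp add: linD(2,3)[OF linT] proj(2)[OF x] scale_right_distrib)
   also have "(z / (z - 1)) \<odot> P x - (1 / (z - 1)) \<odot> P x = P x"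
    using z by (simp flip: scale_left_diff_distrib diff_divide_distrib)
   finally show ?thesis by (simp add: zYw v_def)
  qed
  \<comment> \<open>An eigenvector for z is annihilated by P because z differs from 1, and Y
    commutes with T; so \<open>key\<close> reduces the equation to \<open>y = M y\<close>, where M
    is a strict contraction.\<close>
  have inj: "y = 0" if y: "y : X" "z \<odot> y - T y = 0" for y
  proof -
   have Ty: "T y = z \<odot> y" using y by simp
   have "P y = z \<odot> P y" using proj(1)[OF y(1)] linD(3)[OF linP y(1), of z] Ty by simp
   hence "(z - 1) \<odot> P y = 0" by (simp add: scale_left_diff_distrib)
   hence Py: "P y = 0" using z by auto
   have "z \<odot> Y y - T (Y y) = 0"
    using TY[OF y(1)] Ty linD(3)[OF linY y(1), of z] by simp
   hence "y = M y" using key[OF y(1)] Py by simp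
   hence "N y <= 3/4 * N y" using bounded_byD(3)[OF M y(1)] by simp
   hence "N y = 0" using N_nonneg[OF y(1)] by simp
   thus ?thesis using N_eq_0 y by simp
  qed
  \<comment> \<open>The right inverse together with injectivity gives the left inverse.\<close>
  have left: "S (z \<odot> x - T x) = x" if x: "x : X" for x
  proof -
   define u where "u = S (z \<odot> x - T x)"
   have zx: "z \<odot> x - T x : X" using x TX by simp
   have u: "u : X" "z \<odot> u - T u = z \<odot> x - T x"
    using SX[OF zx] right[OF zx] by (auto simp: u_def)
   have "z \<odot> (u - x) - T (u - x) = 0"
    using u x by (simp add: lin_diff[OF linT] scale_right_diff_distrib algebra_simps)
   thus ?thesis using inj[of "u - x"] u x by (simp add: u_def)
  qed
  show ?thesis using bS left right by (auto simp: resolvent_of_def)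
 qed
 ultimately show ?thesis by auto
qed

end

section \<open>A removable singularity with estimates\<close>

text \<open>K serves to remove the singularity. The constants of the conclusion come from the circle
  of radius s, by the maximum principle for the extension and for its difference quotient at a. This
  matters because K will be an L^2 quantity, while M is expressed by the norms of L^p and
  L^q.\<close>

lemma bounded_isolated_singularity_lipschitz:
 fixes \<psi> :: "complex => complex"
 assumes hol: "\<psi> holomorphic_on ball a r - {a}" and s: "0 < s" "s < r"
  and bd: "!!z. 0 < norm (z - a) ==> norm (z - a) < r ==> norm (\<psi> z) <= K"
  and M: "!!z. norm (z - a) = s ==> norm (\<psi> z) <= M"
 shows "EX c. ALL z. 0 < norm (z - a) & norm (z - a) <= s -->
      norm (\<psi> z) <= M & norm (\<psi> z - c) <= 2 * M / s * norm (z - a)"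
proof -
 have r: "r > 0" using s by simp
 have "eventually (%z. norm (\<psi> z) <= K) (at a)"
  unfolding eventually_at using bd r by (auto intro!: exI[of _ r] simp: dist_norm)
 then obtain g where g: "g holomorphic_on ball a r" "!!z. z : ball a r - {a} ==> g z = \<psi> z"
  using holomorphic_on_extend_bounded[OF hol] r by auto
 have gs: "norm (g z) <= M" if "norm (z - a) = s" for z
  using g(2)[of z] that s M[OF that] by (auto simp: dist_norm norm_minus_commute)
 have sub: "cball a s \<subseteq> ball a r" using s by auto
 have gle: "norm (g z) <= M" if "norm (z - a) <= s" for z
 proof (rule maximum_modulus_frontier[where f = g and S = "cball a s"])
  show "g holomorphic_on interior (cball a s)" using holomorphic_on_subset[OF g(1)] sub interior_subset by blast
  show "continuous_on (closure (cball a s)) g"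
   using holomorphic_on_imp_continuous_on[OF holomorphic_on_subset[OF g(1) sub]] by simp
  show "norm (g z) <= M" if "z : frontier (cball a s)" for z
   using that gs[of z] s by (auto simp: dist_norm norm_minus_commute)
 qed (use that in \<open>auto simp: dist_norm norm_minus_commute\<close>)
 \<comment> \<open>The difference quotient at a, at most 2 M / s in modulus on the circle and hence
   inside it.\<close>
 define \<xi> where "\<xi> z = (if z = a then deriv g a else (g z - g a) / (z - a))" for z
 have h: "\<xi> holomorphic_on ball a r"
  unfolding \<xi>_def[abs_def] using pole_lemma[OF g(1), of a] r by simp
 have \<xi>s: "norm (\<xi> z) <= 2 * M / s" if "norm (z - a) = s" for z
 proof -
  have "norm (g z - g a) <= 2 * M"
   using norm_triangle_ineq4[of "g z" "g a"] gle[of a] gs[OF that] s by simp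
  thus ?thesis using that s by (auto simp: \<xi>_def norm_divide divide_right_mono)
 qed
 have \<xi>le: "norm (\<xi> z) <= 2 * M / s" if "norm (z - a) <= s" for z
 proof (rule maximum_modulus_frontier[where f = \<xi> and S = "cball a s"])
  show "\<xi> holomorphic_on interior (cball a s)" using holomorphic_on_subset[OF h] sub interior_subset by blast
  show "continuous_on (closure (cball a s)) \<xi>"
   using holomorphic_on_imp_continuous_on[OF holomorphic_on_subset[OF h sub]] by simp
  show "norm (\<xi> z) <= 2 * M / s" if "z : frontier (cball a s)" for z
   using that \<xi>s[of z] s by (auto simp: dist_norm norm_minus_commute)
 qed (use that in \<open>auto simp: dist_norm norm_minus_commute\<close>)
 show ?thesis
 proof (intro exI allI impI conjI)
  fix z assume z: "0 < norm (z - a) & norm (z - a) <= s"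
  hence e: "g z = \<psi> z" using g(2)[of z] s by (auto simp: dist_norm norm_minus_commute)
  thus "norm (\<psi> z) <= M" using gle[of z] z by simp
  have "\<psi> z - g a = \<xi> z * (z - a)" using z by (auto simp: \<xi>_def e)
  thus "norm (\<psi> z - g a) <= 2 * M / s * norm (z - a)"
   using mult_right_mono[OF \<xi>le[of z], of "norm (z - a)"] z by (simp add: norm_mult)
 qed
qed

section \<open>Resolvents\<close>

context banach_carrier
begin

lemma resolvent_ofD:
 assumes "resolvent_of T z S"
 shows "bop S" "x : X ==> S (z \<odot> x - T x) = x" "x : X ==> z \<odot> S x - T (S x) = x"
 using assms by (auto simp: resolvent_of_def)

lemma resolvent_commute:
 assumes T: "bop T" and S: "resolvent_of T z S" and V: "bop V"
  and VT: "!!x. x : X ==> V (T x) = T (V x)" and x: "x : X"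
 shows "S (V x) = V (S x)"
proof -
 note SX = bopX[OF resolvent_ofD(1)[OF S]] and VX = bopX[OF V] and TX = bopX[OF T]
 have "V x = V (z \<odot> S x - T (S x))" using resolvent_ofD(3)[OF S x] by simp
 also have "... = z \<odot> V (S x) - T (V (S x))"
  using SX[OF x] TX[OF SX[OF x]] VT[OF SX[OF x]]
  by (simp add: lin_diff[OF bop_lin[OF V]] linD(3)[OF bop_lin[OF V]])
 finally show ?thesis using resolvent_ofD(2)[OF S VX[OF SX[OF x]]] by simp
qed

lemma resolvent_identity:
 assumes T: "bop T" and S: "resolvent_of T z S" and S': "resolvent_of T w S'" and x: "x : X"
 shows "S' x = S x + (z - w) \<odot> S' (S x)"
proof -
 note SX = bopX[OF resolvent_ofD(1)[OF S] x] and TX = bopX[OF T]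
  and lin = bop_lin[OF resolvent_ofD(1)[OF S']]
 have "x = (w \<odot> S x - T (S x)) + (z - w) \<odot> S x"
  using resolvent_ofD(3)[OF S x] by (simp add: scale_left_diff_distrib algebra_simps)
 hence "S' x = S' (w \<odot> S x - T (S x)) + S' ((z - w) \<odot> S x)"
  using linD(2)[OF lin, of "w \<odot> S x - T (S x)" "(z - w) \<odot> S x"] SX TX[OF SX] by simp
 thus ?thesis using resolvent_ofD(2)[OF S' SX] linD(3)[OF lin SX] by simp
qed

lemma resolvent_commute_resolvent:
 assumes T: "bop T" and S: "resolvent_of T z S" and S': "resolvent_of T w S'" and x: "x : X"
 shows "S (S' x) = S' (S x)"
proof -
 have "S' (T y) = T (S' y)" if "y : X" for y
  using resolvent_commute[OF T S' T _ that] by simp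
 thus ?thesis using resolvent_commute[OF T S resolvent_ofD(1)[OF S']] x by simp
qed

text \<open>In the resolvent identity the correction term is at most half of
  \<open>N (S' x)\<close>, a finite number, and is absorbed by the left side. So the resolvent is
  locally bounded where it exists.\<close>

lemma resolvent_local_bound:
 assumes T: "bop T" and S: "resolvent_of T z S" and S': "resolvent_of T w S'"
  and C: "bounded_by S C" and wz: "norm (w - z) * C <= 1/2"
 shows "bounded_by S' (2 * C)"
proof -
 note b = resolvent_ofD(1)[OF S] resolvent_ofD(1)[OF S']
 note SX = bopX[OF b(1)] bopX[OF b(2)]
 have "N (S' x) <= 2 * C * N x" if x: "x : X" for x
 proof -
  have "N (S' x) <= N (S x) + N ((z - w) \<odot> S' (S x))"
   unfolding resolvent_identity[OF T S S' x] using SX x by (intro N_triangle) auto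
  also have "N ((z - w) \<odot> S' (S x)) = norm (w - z) * N (S (S' x))"
   using SX x by (simp add: N_scale resolvent_commute_resolvent[OF T S S' x] norm_minus_commute)
  also have "... <= norm (w - z) * (C * N (S' x))"
   by (intro mult_left_mono bounded_byD(3)[OF C] SX x) simp
  also have "... <= 1/2 * N (S' x)"
   using mult_right_mono[OF wz N_nonneg[OF SX(2)[OF x]]] by (simp add: mult.assoc)
  finally show ?thesis using bounded_byD(3)[OF C x] by simp
 qed
 thus ?thesis using bop_lin[OF b(2)] bounded_byD(2)[OF C] by (auto simp: bounded_by_def)
qed

text \<open>The resolvent identity, iterated with its exact remainder; the coefficients will become
  Taylor coefficients.\<close>

lemma resolvent_expansion:
 assumes T: "bop T" and S: "resolvent_of T z S" and S': "resolvent_of T w S'" and x: "x : X"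
 shows "S' x = (\<Sum>k<n. (z - w) ^ k \<odot> (S ^^ Suc k) x) + (z - w) ^ n \<odot> S' ((S ^^ n) x)"
proof (induction n)
 case (Suc n)
 have X: "(S ^^ n) x : X" using bopX[OF bop_funpow[OF resolvent_ofD(1)[OF S]] x] .
 have "S' ((S ^^ n) x) = (S ^^ Suc n) x + (z - w) \<odot> S' ((S ^^ Suc n) x)"
  using resolvent_identity[OF T S S' X] by simp
 hence "(z - w) ^ n \<odot> S' ((S ^^ n) x) =
   (z - w) ^ n \<odot> (S ^^ Suc n) x + (z - w) ^ Suc n \<odot> S' ((S ^^ Suc n) x)"
  by (simp only: scale_right_distrib scale_scale power_Suc2)
 with Suc show ?case by (simp only: sum.lessThan_Suc add.assoc)
qed simp

end

locale resolvent_disc = banach_carrier scale X N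
 for scale :: "complex => 'v::ab_group_add => 'v" (infixr "\<odot>" 75) and X N +
 fixes T :: "'v => 'v" and R :: "complex => 'v => 'v" and \<Omega> :: "complex set"
 assumes T_bop: "bop T" and \<Omega>_open: "open \<Omega>"
  and R: "z : \<Omega> ==> resolvent_of T z (R z)"
begin

lemma R_bop: "z : \<Omega> ==> bop (R z)"
 using R resolvent_ofD(1) by blast

text \<open>On the ball of radius \<open>d w\<close> the local bound is twice the constant at w. A
  finite subcover leaves finitely many such constants, and their sum dominates each of them.\<close>

lemma R_bound_compact:
 assumes K: "compact K" "K \<subseteq> \<Omega>"
 shows "EX C>=0. ALL w:K. bounded_by (R w) C"
proof -
 have "EX C. bounded_by (R w) C" if "w : K" for w
  using R_bop[of w] that K by (auto simp: bop_def)
 then obtain C where C: "!!w. w : K ==> bounded_by (R w) (C w)" by metis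
 have C0: "w : K ==> 0 <= C w" for w using bounded_byD(2)[OF C] .
 define d where "d w = 1 / (2 * (C w + 1))" for w
 have d0: "d w > 0" if "w : K" for w using C0[OF that] by (simp add: d_def)
 have "K \<subseteq> (\<Union>w\<in>K. ball w (d w))" using d0 by auto
 then obtain F where F: "F \<subseteq> K" "finite F" "K \<subseteq> (\<Union>w\<in>F. ball w (d w))"
  using compactE_image[OF K(1), of K "%w. ball w (d w)"] by auto
 define A where "A = (\<Sum>w\<in>F. 2 * C w)"
 have "bounded_by (R v) A" if v: "v : K" for v
 proof -
  obtain w where w: "w : F" "dist w v < d w" using F v by auto
  hence wK: "w : K" using F by auto
  have "norm (v - w) * C w <= d w * C w"
   using w C0[OF wK] by (intro mult_right_mono) (auto simp: dist_norm norm_minus_commute)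
  also have "... <= 1/2" using C0[OF wK] by (simp add: d_def field_simps)
  finally have "bounded_by (R v) (2 * C w)"
   using resolvent_local_bound[OF T_bop R R C[OF wK]] wK v K by auto
  moreover have "2 * C w <= A"
   unfolding A_def using w F C0 by (intro member_le_sum) auto
  ultimately show ?thesis by (rule bounded_by_mono)
 qed
 moreover have "A >= 0" unfolding A_def using C0 F by (intro sum_nonneg) auto
 ultimately show ?thesis by blast
qed

text \<open>The remainder of the iterated resolvent identity is of order
  \<open>(norm u * C) ^ n\<close>, hence geometric for small u. Analyticity is expressed through
  scalar functions of z, to which the classical theorems apply directly.\<close>

lemma resolvent_functional_expansion:
 assumes \<phi>: "!!x y. x : X ==> y : X ==> \<phi> (x + y) = \<phi> x + \<phi> y" "!!c x. x : X ==> \<phi> (c \<odot> x) = c * \<phi> x"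
  "!!x. x : X ==> norm (\<phi> x) <= A * N x"
  and z: "z : \<Omega>" and f: "f : X"
 shows "(%u. \<phi> (R (z + u) f)) has_fps_expansion Abs_fps (%k. (-1) ^ k * \<phi> ((R z ^^ Suc k) f))"
proof (rule has_fps_expansionI)
 obtain C where C: "bounded_by (R z) C" using R_bop[OF z] by (auto simp: bop_def)
 have C0: "C >= 0" using bounded_byD(2)[OF C] .
 obtain e where e: "e > 0" "ball z e \<subseteq> \<Omega>" using \<Omega>_open z by (auto simp: open_contains_ball)
 define d where "d = min e (1 / (2 * (C + 1)))"
 have d: "d > 0" using e C0 by (simp add: d_def)
 have \<phi>0: "\<phi> 0 = 0" using \<phi>(2)[of 0 0] by simp
 have \<phi>sum: "\<phi> (sum g I) = (\<Sum>i\<in>I. \<phi> (g i))" if "!!i. i : I ==> g i : X" for g and I :: "nat set"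
  using that by (induction I rule: infinite_finite_induct) (auto simp: \<phi>0 \<phi>(1))
 have RX: "(R z ^^ k) f : X" for k using bopX[OF bop_funpow[OF R_bop[OF z]] f] .
 \<comment> \<open>Nothing forces A to be nonnegative when the carrier is trivial, hence the
   absolute value.\<close>
 have A0: "norm (\<phi> x) <= \<bar>A\<bar> * N x" if "x : X" for x
  using \<phi>(3)[OF that] N_nonneg[OF that] by (meson abs_ge_self mult_right_mono order_trans)
 have "(%k. fps_nth (Abs_fps (%k. (-1) ^ k * \<phi> ((R z ^^ Suc k) f))) k * u ^ k) sums \<phi> (R (z + u) f)"
  if u: "norm u < d" for u
  unfolding sums_def
 proof (rule LIMSEQ_I)
  fix \<epsilon> :: real assume "\<epsilon> > 0"
  have zu: "z + u : \<Omega>" using u e by (auto simp: d_def dist_norm subset_iff)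
  have uC: "norm u * C <= 1/2"
  proof -
   have "norm u * C <= 1 / (2 * (C + 1)) * C" using u C0 by (intro mult_right_mono) (auto simp: d_def)
   also have "... <= 1/2" using C0 by (simp add: field_simps)
   finally show ?thesis .
  qed
  have C2: "bounded_by (R (z + u)) (2 * C)"
   using resolvent_local_bound[OF T_bop R[OF z] R[OF zu] C] uC by simp
  define r where "r n = (- u) ^ n * \<phi> (R (z + u) ((R z ^^ n) f))" for n
  have RzX: "R (z + u) ((R z ^^ n) f) : X" for n using bopX[OF R_bop[OF zu] RX] .
  have part: "(\<Sum>k<n. (-1) ^ k * \<phi> ((R z ^^ Suc k) f) * u ^ k) = \<phi> (R (z + u) f) - r n" for n
  proof -
   have "\<phi> (R (z + u) f) = \<phi> ((\<Sum>k<n. (- u) ^ k \<odot> (R z ^^ Suc k) f) + (- u) ^ n \<odot> R (z + u) ((R z ^^ n) f))"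
    using arg_cong[OF resolvent_expansion[OF T_bop R[OF z] R[OF zu] f, of n], of \<phi>] by simp
   also have "... = (\<Sum>k<n. (- u) ^ k * \<phi> ((R z ^^ Suc k) f)) + r n"
    using RX RzX by (simp add: \<phi> \<phi>sum r_def del: funpow.simps)
   finally show ?thesis by (simp add: power_minus[of u] mult_ac)
  qed
  have rle: "norm (r n) <= (1/2) ^ n * (\<bar>A\<bar> * (2 * C) * N f)" for n
  proof -
   have "norm (r n) <= norm u ^ n * (\<bar>A\<bar> * N (R (z + u) ((R z ^^ n) f)))"
    using A0[OF RzX] by (simp add: r_def norm_mult norm_power mult_left_mono)
   also have "... <= norm u ^ n * (\<bar>A\<bar> * (2 * C * (C ^ n * N f)))"
    using order_trans[OF bounded_byD(3)[OF C2 RX] mult_left_mono[OF bounded_byD(3)[OF bounded_by_funpow[OF C] f]]] C0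
    by (intro mult_left_mono) auto
   also have "... = (norm u * C) ^ n * (\<bar>A\<bar> * (2 * C) * N f)" by (simp add: power_mult_distrib mult_ac)
   also have "... <= (1/2) ^ n * (\<bar>A\<bar> * (2 * C) * N f)"
    using uC C0 N_nonneg[OF f] by (intro mult_right_mono power_mono) auto
   finally show ?thesis .
  qed
  have "(%n. (1/2) ^ n * (\<bar>A\<bar> * (2 * C) * N f)) \<longlonglongrightarrow> 0"
   by (auto intro!: tendsto_eq_intros LIMSEQ_power_zero)
  from order_tendstoD(2)[OF this \<open>\<epsilon> > 0\<close>] obtain M where
   M: "!!n. n >= M ==> (1/2) ^ n * (\<bar>A\<bar> * (2 * C) * N f) < \<epsilon>"
   by (auto simp: eventually_sequentially)
  have "norm ((\<Sum>k<n. fps_nth (Abs_fps (%k. (-1) ^ k * \<phi> ((R z ^^ Suc k) f))) k * u ^ k) - \<phi> (R (z + u) f)) < \<epsilon>"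
   if "n >= M" for n
   using rle[of n] M[OF that] part[of n] by (simp del: funpow.simps)
  thus "EX no. ALL n>=no. norm ((\<Sum>k<n. fps_nth (Abs_fps (%k. (-1) ^ k * \<phi> ((R z ^^ Suc k) f))) k * u ^ k) - \<phi> (R (z + u) f)) < \<epsilon>"
   by blast
 qed
 thus "eventually (%u. (%k. fps_nth (Abs_fps (%k. (-1) ^ k * \<phi> ((R z ^^ Suc k) f))) k * u ^ k) sums \<phi> (R (z + u) f)) (nhds 0)"
  unfolding eventually_nhds_metric using d by (auto intro!: exI[of _ d])
qed

text \<open>Uniqueness of the power series identifies the derivatives with powers of the resolvent,
  which Cauchy's inequality will then bound.\<close>

lemma resolvent_functional_analytic:
 assumes \<phi>: "!!x y. x : X ==> y : X ==> \<phi> (x + y) = \<phi> x + \<phi> y" "!!c x. x : X ==> \<phi> (c \<odot> x) = c * \<phi> x"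
  "!!x. x : X ==> norm (\<phi> x) <= A * N x"
  and f: "f : X"
 shows "(%z. \<phi> (R z f)) holomorphic_on \<Omega>"
  "z : \<Omega> ==> (deriv ^^ k) (%z. \<phi> (R z f)) z = fact k * ((-1) ^ k * \<phi> ((R z ^^ Suc k) f))"
proof -
 have an: "(%z. \<phi> (R z f)) analytic_on {z}" if "z : \<Omega>" for z
  by (rule has_fps_expansion_imp_analytic[where f = "%z. \<phi> (R z f)", OF resolvent_functional_expansion[OF \<phi> that f]])
 show "(%z. \<phi> (R z f)) holomorphic_on \<Omega>"
  by (rule analytic_imp_holomorphic, subst analytic_on_analytic_at) (use an in auto)
 assume z: "z : \<Omega>"
 have "fps_expansion (%z. \<phi> (R z f)) z = Abs_fps (%k. (-1) ^ k * \<phi> ((R z ^^ Suc k) f))"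
  using fps_expansion_unique_complex[OF analytic_at_imp_has_fps_expansion[OF an[OF z]] resolvent_functional_expansion[OF \<phi> z f]] .
 hence "fps_nth (fps_expansion (%z. \<phi> (R z f)) z) k = (-1) ^ k * \<phi> ((R z ^^ Suc k) f)" by simp
 thus "(deriv ^^ k) (%z. \<phi> (R z f)) z = fact k * ((-1) ^ k * \<phi> ((R z ^^ Suc k) f))"
  by (simp add: fps_expansion_def field_simps del: funpow.simps)
qed

end

text \<open>
  The abstract setting for \<open>X = L\<^sup>p\<close>: \<open>E = L\<^sup>p \<inter> L\<^sup>q\<close> with the norm \<open>N'\<close> of \<open>L\<^sup>q\<close>, \<open>D = L\<^sup>p \<inter> L\<^sup>1 \<inter> L\<^sup>\<infinity>\<close>,
  \<open>B f g = \<integral> f(x) g(-x) dx\<close> and \<open>J f (x) = cnj (f (-x))\<close>, so that \<open>B f (J g)\<close> is the inner product of \<open>L\<^sup>2\<close>.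
\<close>

locale duality_pairing = banach_carrier scale X N
 for scale :: "complex => 'v::ab_group_add => 'v" (infixr "\<odot>" 75) and X N +
 fixes D E :: "'v set" and N' :: "'v => real" and B :: "'v => 'v => complex" and J :: "'v => 'v"
 assumes D_E: "x : D ==> x : E" and E_X: "x : E ==> x : X" and E_subspace: "subspace E"
  and N'_nonneg: "x : E ==> 0 <= N' x"
  and B_add: "x : X ==> y : X ==> g : E ==> B (x + y) g = B x g + B y g"
  and B_scale: "x : X ==> g : E ==> B (c \<odot> x) g = c * B x g"
  and B_sym: "f : E ==> g : E ==> B f g = B g f"
  and B_le: "f : X ==> g : E ==> norm (B f g) <= N f * N' g"
  and E_intro: "f : X ==> 0 <= C ==> (!!g. g : D ==> norm (B f g) <= C * N g) ==> f : E & N' f <= C"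
  and N_le_dual: "f : X ==> 0 <= C ==> (!!g. g : D ==> norm (B f g) <= C * N' g) ==> N f <= C"
  and D_dense: "x : X ==> e > 0 ==> EX y:D. N (x - y) < e"
  and J_X: "x : X ==> J x : X" and J_D: "x : D ==> J x : D" and J_E: "x : E ==> J x : E"
  and J_J: "x : X ==> J (J x) = x"
  and J_add: "x : X ==> y : X ==> J (x + y) = J x + J y"
  and J_scale: "x : X ==> J (c \<odot> x) = cnj c \<odot> J x"
  and N_J: "x : X ==> N (J x) = N x"
  and B_J: "f : X ==> g : E ==> B (J f) (J g) = cnj (B f g)"
  and B_pos: "f : E ==> 0 <= Re (B f (J f))"
begin

lemma D_X: "x : D ==> x : X"
 using D_E E_X by blast

lemma B_diff: "x : X ==> y : X ==> g : E ==> B (x - y) g = B x g - B y g"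
 using B_add[of x "(-1) \<odot> y" g] B_scale[of y g "-1"] by (simp add: scale_minus_left)

lemma B_real: "f : E ==> B f (J f) = of_real (Re (B f (J f)))"
 using B_J[of f "J f"] B_sym[of f "J f"] J_E[of f] J_J[of f] E_X[of f]
 by (simp add: complex_eq_iff)

text \<open>The usual quadratic in a real parameter t, along the direction -t \<beta>. The form
  \<open>B u (J v)\<close> is only known to be semidefinite, so b = 0 is a separate case.\<close>

lemma B_Cauchy_Schwarz:
 assumes u: "u : E" and v: "v : E"
 shows "(norm (B u (J v)))\<^sup>2 <= Re (B u (J u)) * Re (B v (J v))"
proof -
 define \<beta> where "\<beta> = B u (J v)"
 define a where "a = Re (B u (J u))"
 define b where "b = Re (B v (J v))"
 have uX: "u : X" "v : X" "J u : X" "J v : X" using u v E_X J_X by auto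
 have JE: "J u : E" "J v : E" using u v J_E by auto
 have \<beta>': "B v (J u) = cnj \<beta>"
 proof -
  have "B v (J u) = B (J u) (J (J v))" using B_sym[OF v JE(1)] J_J uX by simp
  thus ?thesis using B_J[OF uX(1) JE(2)] by (simp add: \<beta>_def)
 qed
 have quad: "0 <= a - 2 * t * (norm \<beta>)\<^sup>2 + t\<^sup>2 * (norm \<beta>)\<^sup>2 * b" for t :: real
 proof -
  define c where "c = - complex_of_real t * \<beta>"
  define w where "w = u + c \<odot> v"
  have wE: "w : E" using u v E_subspace by (auto simp: w_def intro: subspace_add subspace_scale)
  have Jw: "J w = J u + cnj c \<odot> J v" using uX by (simp add: w_def J_add J_scale)
  have e: "B x (J w) = B x (J u) + cnj c * B x (J v)" if "x : E" for x
  proof -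
   have "B x (J w) = B (J w) x" using B_sym J_E wE that by blast
   also have "... = B (J u) x + cnj c * B (J v) x" using uX that by (simp add: Jw B_add B_scale)
   finally show ?thesis using B_sym[OF that JE(1)] B_sym[OF that JE(2)] by simp
  qed
  have "B w (J w) = B u (J w) + c * B v (J w)"
   using B_add[OF uX(1) X_closed(4)[OF uX(2)] J_E[OF wE], of c] B_scale[OF uX(2) J_E[OF wE], of c]
   by (simp flip: w_def)
  also have "... = of_real a + cnj c * \<beta> + c * cnj \<beta> + c * cnj c * of_real b"
   using e[OF u] e[OF v] B_real[OF u] B_real[OF v] by (simp add: \<beta>' algebra_simps a_def b_def flip: \<beta>_def)
  also have "... = of_real (a - 2 * t * (norm \<beta>)\<^sup>2 + t\<^sup>2 * (norm \<beta>)\<^sup>2 * b)"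
   using complex_norm_square[of \<beta>] by (simp add: c_def algebra_simps power2_eq_square)
  finally have "B w (J w) = of_real (a - 2 * t * (norm \<beta>)\<^sup>2 + t\<^sup>2 * (norm \<beta>)\<^sup>2 * b)" .
  thus ?thesis using B_pos[OF wE] by simp
 qed
 have ab: "a >= 0" "b >= 0" using B_pos u v by (auto simp: a_def b_def)
 have "(norm \<beta>)\<^sup>2 <= a * b"
 proof (cases "b = 0")
  case True
  have "(norm \<beta>)\<^sup>2 = 0"
  proof (rule ccontr)
   assume "(norm \<beta>)\<^sup>2 ~= 0"
   hence p: "(norm \<beta>)\<^sup>2 > 0" by simp
   \<comment> \<open>For b = 0 the quadratic is affine in t, and this value of t makes it
     negative.\<close>
   have "0 <= a - 2 * ((a + 1) / (norm \<beta>)\<^sup>2) * (norm \<beta>)\<^sup>2" using quad[of "(a + 1) / (norm \<beta>)\<^sup>2"] True by simp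
   also have "... = a - 2 * (a + 1)" using p by simp
   finally show False using ab by simp
  qed
  thus ?thesis using True by simp
 next
  case False
  hence "b > 0" using ab by simp
  have "0 <= a - 2 * (1 / b) * (norm \<beta>)\<^sup>2 + (1 / b)\<^sup>2 * (norm \<beta>)\<^sup>2 * b" using quad by blast
  also have "... = a - (norm \<beta>)\<^sup>2 / b" using \<open>b > 0\<close> by (simp add: power2_eq_square field_simps)
  finally show ?thesis using \<open>b > 0\<close> by (simp add: field_simps)
 qed
 thus ?thesis by (simp add: \<beta>_def a_def b_def)
qed

section \<open>Operators that are their own transpose\<close>

text \<open>Symmetry refers to the bilinear form, without conjugation of scalars: W is its own
  transpose. It is tested on D only, because \<open>B\<close> is controlled only when its second
  argument lies in E.\<close>

definition symmetric_op :: "('v => 'v) => bool" where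
 "symmetric_op W \<longleftrightarrow> bop W & (ALL f:D. ALL g:D. B (W f) g = B (W g) f)"

text \<open>Symmetry moves W onto the test function, where the bound on X applies;
  \<open>E_intro\<close> then yields membership in E with the same constant. In this way an estimate
  on L^p carries over to L^q.\<close>

lemma symmetric_op_E:
 assumes W: "symmetric_op W" "bounded_by W C" and f: "f : D"
 shows "W f : E" "N' (W f) <= C * N' f"
proof -
 have "W f : E & N' (W f) <= C * N' f"
 proof (rule E_intro)
  show "norm (B (W f) g) <= C * N' f * N g" if g: "g : D" for g
  proof -
   have "norm (B (W f) g) = norm (B (W g) f)" using W f g by (simp add: symmetric_op_def)
   also have "... <= N (W g) * N' f"
    using B_le[OF bopX[OF bounded_by_bop[OF W(2)] D_X[OF g]] D_E[OF f]] .
   also have "... <= C * N g * N' f"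
    using bounded_byD(3)[OF W(2) D_X[OF g]] N'_nonneg[OF D_E[OF f]] by (rule mult_right_mono)
   finally show ?thesis by (simp add: mult_ac)
  qed
 qed (use bopX[OF bounded_by_bop[OF W(2)] D_X[OF f]] bounded_byD(2)[OF W(2)] N'_nonneg[OF D_E[OF f]] in auto)
 thus "W f : E" "N' (W f) <= C * N' f" by auto
qed

text \<open>Both sides are continuous in h for N: the left through \<open>N' g\<close>, the right
  through \<open>N' (W g)\<close>, which makes sense because W maps D into E. So density of D
  suffices.\<close>

lemma symmetric_op_extend:
 assumes W: "symmetric_op W" and h: "h : X" and g: "g : D"
 shows "B (W h) g = B h (W g)"
proof -
 have bW: "bop W" using W by (simp add: symmetric_op_def)
 then obtain C where C: "bounded_by W C" by (auto simp: bop_def)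
 have C0: "C >= 0" using bounded_byD(2)[OF C] .
 have WgE: "W g : E" using symmetric_op_E[OF W C g] by simp
 define K where "K = C * N' g + N' (W g)"
 have K0: "K >= 0" using C0 N'_nonneg[OF D_E[OF g]] N'_nonneg[OF WgE] by (simp add: K_def)
 have "norm (B (W h) g - B h (W g)) <= e" if "e > 0" for e
 proof -
  obtain k where k: "k : D" "N (h - k) < e / (K + 1)"
   using D_dense[OF h, of "e / (K + 1)"] \<open>e > 0\<close> K0 by auto
  have kX: "k : X" "h - k : X" using k D_X h by auto
  have "B (W k) g = B k (W g)"
   using W k g B_sym[OF D_E[OF k(1)] WgE] by (simp add: symmetric_op_def)
  moreover have "B (W h) g = B (W (h - k)) g + B (W k) g"
   using B_diff[OF bopX[OF bW h] bopX[OF bW kX(1)] D_E[OF g]] lin_diff[OF bop_lin[OF bW] h kX(1)] by simp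
  moreover have "B h (W g) = B (h - k) (W g) + B k (W g)" using B_diff[OF h kX(1) WgE] by simp
  ultimately have "norm (B (W h) g - B h (W g)) <= norm (B (W (h - k)) g) + norm (B (h - k) (W g))"
   using norm_triangle_ineq4[of "B (W (h - k)) g" "B (h - k) (W g)"] by simp
  also have "... <= C * N (h - k) * N' g + N (h - k) * N' (W g)"
   using B_le[OF bopX[OF bW kX(2)] D_E[OF g]] B_le[OF kX(2) WgE]
    mult_right_mono[OF bounded_byD(3)[OF C kX(2)] N'_nonneg[OF D_E[OF g]]] by linarith
  also have "... = N (h - k) * K" by (simp add: K_def algebra_simps)
  also have "... <= e / (K + 1) * K" using k K0 by (intro mult_right_mono) auto
  also have "... <= e" using K0 \<open>e > 0\<close> by (simp add: field_simps)
  finally show ?thesis .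
 qed
 hence "norm (B (W h) g - B h (W g)) <= 0" by (rule field_le_epsilon[of _ 0, simplified])
 thus ?thesis by simp
qed

lemma symmetric_op_compose:
 assumes V: "symmetric_op V" and W: "symmetric_op W" and VW: "!!x. x : X ==> V (W x) = W (V x)"
 shows "symmetric_op (%x. V (W x))"
 unfolding symmetric_op_def
proof (intro conjI ballI)
 have b: "bop V" "bop W" using V W by (auto simp: symmetric_op_def)
 thus "bop (%x. V (W x))" by (rule bop_compose)
 obtain C C' where C: "bounded_by V C" "bounded_by W C'" using b by (auto simp: bop_def)
 fix f g assume fg: "f : D" "g : D"
 have "B (V (W f)) g = B (W f) (V g)" using symmetric_op_extend[OF V bopX[OF b(2) D_X] ] fg by blast
 also have "... = B (V g) (W f)" using B_sym symmetric_op_E[OF V C(1)] symmetric_op_E[OF W C(2)] fg by blast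
 also have "... = B (W (V g)) f" using symmetric_op_extend[OF W bopX[OF b(1) D_X] ] fg by metis
 finally show "B (V (W f)) g = B (V (W g)) f" using VW[OF D_X[OF fg(2)]] by simp
qed

lemma symmetric_op_funpow:
 assumes W: "symmetric_op W" shows "symmetric_op (W ^^ n)"
proof (induction n)
 case 0
 have "B f g = B g f" if "f : D" "g : D" for f g using that B_sym D_E by blast
 thus ?case using bop_id by (simp add: symmetric_op_def id_def)
next
 case (Suc n)
 have "symmetric_op (%x. W ((W ^^ n) x))"
  by (rule symmetric_op_compose[OF W Suc]) (simp add: funpow_swap1)
 thus ?case by (simp add: comp_def)
qed

lemma symmetric_op_add: assumes "symmetric_op V" "symmetric_op W" shows "symmetric_op (%x. V x + W x)"
 using assms bop_add B_add[OF bopX[OF _ D_X] bopX[OF _ D_X] D_E] by (auto simp: symmetric_op_def)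

lemma symmetric_op_scale: assumes "symmetric_op V" shows "symmetric_op (%x. c \<odot> V x)"
 using assms bop_scale B_scale[OF bopX[OF _ D_X] D_E] by (auto simp: symmetric_op_def)

lemma symmetric_op_sum: "(!!i. i : I ==> symmetric_op (T i)) ==> symmetric_op (%x. \<Sum>i\<in>I. c i \<odot> T i x)"
proof (induction I rule: infinite_finite_induct)
 case (insert i I)
 thus ?case using symmetric_op_add[OF symmetric_op_scale, of "T i" "%x. \<Sum>i\<in>I. c i \<odot> T i x" "c i"] by simp
qed (use bop_scale[OF bop_id, of 0] B_scale[OF _ D_E, of 0 _ 0] in \<open>auto simp: symmetric_op_def\<close>)

lemma symmetric_op_ces_diff:
 assumes T: "symmetric_op T" shows "symmetric_op (%x. ces T i x - ces T j x)"
proof -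
 have s: "symmetric_op (%x. ces T n x)" for n
  using symmetric_op_scale[OF symmetric_op_sum[where I = "{1..n}" and c = "%_. 1" and T = "%k. T ^^ k", OF symmetric_op_funpow[OF T]], of "1 / of_nat n"]
  by (simp add: ces_def)
 show ?thesis using symmetric_op_add[OF s[of i] symmetric_op_scale[OF s[of j], of "-1"]] by simp
qed

lemma bounded_by_conj:
 assumes W: "bounded_by W C" shows "bounded_by (%x. J (W (J x))) C"
proof -
 have X: "x : X ==> W (J x) : X" for x using bopX[OF bounded_by_bop[OF W] J_X] .
 have "lin (%x. J (W (J x)))"
  using X J_X linD(2,3)[OF bounded_byD(1)[OF W]] by (auto simp: lin_def J_add J_scale)
 thus ?thesis
  using bounded_byD(2)[OF W] bounded_byD(3)[OF W J_X] X by (auto simp: bounded_by_def N_J)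
qed

lemma conj_funpow: "x : X ==> bop W ==> ((%x. J (W (J x))) ^^ n) x = J ((W ^^ n) (J x))"
 by (induction n) (simp_all add: J_J bopX[OF bop_funpow] J_X)

text \<open>\<open>J W J\<close> is the adjoint of W for the inner product \<open>B f (J g)\<close>;
  normality of W means that the two commute.\<close>

lemma symmetric_op_conj:
 assumes W: "symmetric_op W" shows "symmetric_op (%x. J (W (J x)))"
proof -
 have b: "bop W" using W by (simp add: symmetric_op_def)
 have "B (J (W (J f))) g = B (J (W (J g))) f" if f: "f : D" and g: "g : D" for f g
 proof -
  have e: "B (J (W (J f))) g = cnj (B (W (J f)) (J g))" if "f : D" "g : D" for f g
   using B_J[OF bopX[OF b J_X[OF D_X[OF that(1)]]] D_E[OF J_D[OF that(2)]]] J_J[OF D_X[OF that(2)]] by simp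
  show ?thesis using e[OF f g] e[OF g f] W J_D f g by (simp add: symmetric_op_def)
 qed
 moreover obtain C where "bounded_by W C" using b by (auto simp: bop_def)
 ultimately show ?thesis
  using bounded_by_bop[OF bounded_by_conj] by (auto simp: symmetric_op_def)
qed

text \<open>A normal symmetric operator is bounded on \<open>L\<^sup>2\<close> by its spectral radius on \<open>X\<close>.\<close>

lemma normal_L2_bound:
 assumes S: "symmetric_op S" and normal: "!!x. x : X ==> S (J (S (J x))) = J (S (J (S x)))"
  and growth: "!!n. bounded_by (S ^^ n) (K * q ^ n)" and q: "q >= 0" and f: "f : D"
 shows "Re (B (S f) (J (S f))) <= q\<^sup>2 * Re (B f (J f))"
proof -
 have bS: "bop S" using S by (simp add: symmetric_op_def)
 define S' where "S' x = J (S (J x))" for x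
 have S': "symmetric_op S'" unfolding S'_def[abs_def] by (rule symmetric_op_conj[OF S])
 have bS': "bop S'" using S' by (simp add: symmetric_op_def)
 have comm: "S (S' x) = S' (S x)" if "x : X" for x using normal[OF that] by (simp add: S'_def)
 note SnX = bopX[OF bop_funpow[OF bS]] and S'nX = bopX[OF bop_funpow[OF bS']]
 have comm1: "(S ^^ n) (S' x) = S' ((S ^^ n) x)" if "x : X" for n x
  using that by (induction n) (auto simp: comm SnX)
 have commn: "(S ^^ n) ((S' ^^ m) x) = (S' ^^ m) ((S ^^ n) x)" if "x : X" for n m x
  using that by (induction m) (auto simp: comm1 S'nX)
 have Jf: "J f : D" "J f : E" "f : X" "f : E" "J f : X" using f J_D D_E D_X by auto
 have K0: "K * q ^ n >= 0" for n using bounded_byD(2)[OF growth] .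
 have K: "K >= 0" using K0[of 0] by simp
 have SnE: "(S ^^ n) f : E" for n using symmetric_op_E[OF symmetric_op_funpow[OF S] growth f] by simp
 have S'n: "(S' ^^ n) x = J ((S ^^ n) (J x))" if "x : X" for n x
  unfolding S'_def[abs_def] using conj_funpow[OF that bS] .
 have JSn: "J ((S ^^ n) f) = (S' ^^ n) (J f)" for n using S'n[OF Jf(5)] J_J[OF Jf(3)] by simp
 have growth': "bounded_by (S' ^^ n) (K * q ^ n)" for n
 proof -
  have "bounded_by (%x. J ((S ^^ n) (J x))) (K * q ^ n)" by (rule bounded_by_conj[OF growth])
  thus ?thesis using S'n by (auto simp: bounded_by_def lin_def)
 qed
 \<comment> \<open>By normality this is the n-th power of the positive operator
   \<open>S' S\<close>.\<close>
 define U where "U n x = (S' ^^ n) ((S ^^ n) x)" for n x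
 have U: "symmetric_op (U n)" for n
  unfolding U_def[abs_def]
  by (rule symmetric_op_compose[OF symmetric_op_funpow[OF S'] symmetric_op_funpow[OF S]]) (simp add: commn)
 have bU: "bop (U n)" for n using U by (simp add: symmetric_op_def)
 \<comment> \<open>The square of the L^2 norm of \<open>(S ^^ n) f\<close>.\<close>
 define a where "a n = Re (B ((S ^^ n) f) (J ((S ^^ n) f)))" for n
 have a0: "a n >= 0" for n unfolding a_def using B_pos[OF SnE] .
 have a_eq: "B ((S ^^ n) f) (J ((S ^^ n) f)) = B (U n f) (J f)" for n
  unfolding JSn U_def using symmetric_op_extend[OF symmetric_op_funpow[OF S'] SnX[OF Jf(3)] Jf(1)] by simp
 obtain CU where CU: "!!n. bounded_by (U n) (CU n)" using bU unfolding bop_def by metis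
 have UE: "U n f : E" for n using symmetric_op_E[OF U CU f] by simp
 have UU: "U n (U n x) = U (2 * n) x" if x: "x : X" for n x
 proof -
  have "U n (U n x) = (S' ^^ n) ((S' ^^ n) ((S ^^ n) ((S ^^ n) x)))"
   unfolding U_def using commn SnX S'nX x by simp
  thus ?thesis by (simp add: U_def mult_2 funpow_add)
 qed
 \<comment> \<open>\<open>a n\<close> is the inner product of \<open>U n f\<close> with f, and the
   squared norm of \<open>U n f\<close> is \<open>a (2 * n)\<close>; the claim is the Cauchy-Schwarz
   inequality.\<close>
 have sq: "(a n)\<^sup>2 <= a (2 * n) * a 0" for n
 proof -
  have JU: "J (U n f) = U n (J f)"
  proof -
   have "J (U n f) = (S ^^ n) (J ((S ^^ n) f))"
    unfolding U_def using S'n[OF SnX[OF Jf(3)]] J_J[OF SnX[OF J_X[OF SnX[OF Jf(3)]]]] by simp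
   thus ?thesis unfolding JSn U_def using commn[OF Jf(5)] by simp
  qed
  have "(norm (B (U n f) (J f)))\<^sup>2 <= Re (B (U n f) (J (U n f))) * Re (B f (J f))"
   by (rule B_Cauchy_Schwarz[OF UE Jf(4)])
  also have "B (U n f) (J (U n f)) = B (U n (U n f)) (J f)"
   unfolding JU using symmetric_op_extend[OF U bopX[OF bU Jf(3)] Jf(1)] by simp
  also have "... = B (U (2 * n) f) (J f)" using UU[OF Jf(3)] by simp
  finally have "(norm (B (U n f) (J f)))\<^sup>2 <= a (2 * n) * a 0" by (simp add: a_def flip: a_eq)
  moreover have "norm (B (U n f) (J f)) = a n"
   unfolding a_eq[symmetric] using B_real[OF SnE, of n] a0[of n] by (simp add: a_def) (metis norm_of_real abs_of_nonneg)
  ultimately show ?thesis by simp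
 qed
 define L where "L = K\<^sup>2 * N f * N' (J f)"
 \<comment> \<open>The growth on X bounds one factor of the pairing and, transposed to E, the other
   one.\<close>
 have upper: "a n <= L * (q\<^sup>2) ^ n" for n
 proof -
  have J': "J ((S ^^ n) f) : E" using J_E[OF SnE] .
  have "a n <= norm (B ((S ^^ n) f) (J ((S ^^ n) f)))" unfolding a_def by (rule complex_Re_le_cmod)
  also have "... <= N ((S ^^ n) f) * N' (J ((S ^^ n) f))" using B_le[OF SnX[OF Jf(3)] J'] .
  also have "... <= (K * q ^ n * N f) * (K * q ^ n * N' (J f))"
   using bounded_byD(3)[OF growth Jf(3), of n] symmetric_op_E(2)[OF symmetric_op_funpow[OF S'] growth' Jf(1), of n] N'_nonneg[OF J']
    K0[of n] N_nonneg[OF Jf(3)]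
   by (intro mult_mono) (auto simp: JSn)
  also have "... = L * (q\<^sup>2) ^ n" by (simp add: L_def power2_eq_square power_mult_distrib algebra_simps)
  finally show ?thesis .
 qed
 \<comment> \<open>If the ratio \<rho> of \<open>a 1\<close> to \<open>a 0\<close> exceeded
   \<open>q\<^sup>2\<close>, repeated doubling would make \<open>a (2 ^ k)\<close> at least
   \<open>a 0 * \<rho> ^ (2 ^ k)\<close>, against \<open>upper\<close>. The constant K of the growth
   disappears in this way.\<close>
 have "a 1 <= q\<^sup>2 * a 0"
 proof (rule ccontr)
  assume "\<not> a 1 <= q\<^sup>2 * a 0"
  hence lt: "q\<^sup>2 * a 0 < a 1" by simp
  have "a 0 > 0"
  proof (rule ccontr)
   assume "\<not> a 0 > 0"
   hence "a 0 = 0" using a0[of 0] by simp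
   hence "(a 1)\<^sup>2 <= 0" using sq[of 1] by simp
   thus False using lt \<open>a 0 = 0\<close> by simp
  qed
  define \<rho> where "\<rho> = a 1 / a 0"
  have \<rho>: "q\<^sup>2 < \<rho>" using lt \<open>a 0 > 0\<close> by (simp add: \<rho>_def field_simps)
  have \<rho>0: "\<rho> > 0" using \<rho> zero_le_power2[of q] by linarith
  have lower: "a 0 * \<rho> ^ (2 ^ k) <= a (2 ^ k)" for k
  proof (induction k)
   case 0 thus ?case using \<open>a 0 > 0\<close> by (simp add: \<rho>_def)
  next
   case (Suc k)
   have "(a 0 * \<rho> ^ (2 ^ k))\<^sup>2 <= (a (2 ^ k))\<^sup>2"
    using Suc \<open>a 0 > 0\<close> \<rho>0 by (intro power_mono) auto
   also have "... <= a (2 ^ Suc k) * a 0" using sq[of "2 ^ k"] by simp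
   finally have "a 0 * (a 0 * \<rho> ^ (2 ^ Suc k)) <= a 0 * a (2 ^ Suc k)"
    by (simp add: power2_eq_square mult_2 power_add algebra_simps)
   thus ?case using \<open>a 0 > 0\<close> by simp
  qed
  have "(q\<^sup>2 / \<rho>) < 1" using \<rho> \<rho>0 by simp
  hence lim: "(%n. L * (q\<^sup>2 / \<rho>) ^ n) \<longlonglongrightarrow> 0"
   using \<rho>0 by (auto intro!: tendsto_eq_intros LIMSEQ_power_zero)
  obtain M where M: "!!n. n >= M ==> L * (q\<^sup>2 / \<rho>) ^ n < a 0"
   using order_tendstoD(2)[OF lim \<open>a 0 > 0\<close>] by (auto simp: eventually_sequentially)
  have "M <= 2 ^ M" using less_exp[of M] by simp
  hence "L * (q\<^sup>2 / \<rho>) ^ (2 ^ M) < a 0" using M by blast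
  moreover have "a 0 * \<rho> ^ (2 ^ M) <= L * (q\<^sup>2) ^ (2 ^ M)" using lower upper order_trans by blast
  ultimately show False using \<rho>0 by (simp add: power_divide field_simps)
 qed
 thus ?thesis by (simp add: a_def)
qed

text \<open>The a priori constant C of V multiplies only the distance to D, and so it drops out of
  the result.\<close>

lemma bounded_on_dense:
 assumes V: "bop V" and c: "c >= 0" "!!y. y : D ==> N (V y) <= c * N y" and x: "x : X"
 shows "N (V x) <= c * N x"
proof (rule field_le_epsilon)
 fix e :: real assume e: "e > 0"
 obtain C where C: "bounded_by V C" using V by (auto simp: bop_def)
 have C0: "C >= 0" using bounded_byD(2)[OF C] .
 obtain y where y: "y : D" "N (x - y) < e / (C + c + 1)"
  using D_dense[OF x, of "e / (C + c + 1)"] e C0 c by (metis add_nonneg_pos add_nonneg_nonneg zero_less_divide_iff zero_less_one)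
 have yX: "y : X" "x - y : X" using y D_X x by auto
 have "N (V x) <= N (V (x - y)) + N (V y)"
  using N_triangle[OF bopX[OF V yX(2)] bopX[OF V yX(1)]] linD(2)[OF bop_lin[OF V] yX(2,1)] by simp
 also have "... <= C * N (x - y) + c * N y"
  using bounded_byD(3)[OF C yX(2)] c(2)[OF y(1)] by simp
 also have "... <= C * N (x - y) + c * (N (x - y) + N x)"
  using N_le_add[OF yX(1) x] N_diff_commute[OF x yX(1)] c(1) by (simp add: mult_left_mono)
 also have "... = N (x - y) * (C + c) + c * N x" by (simp add: algebra_simps)
 also have "N (x - y) * (C + c) <= e / (C + c + 1) * (C + c)"
  using y C0 c by (intro mult_right_mono) auto
 also have "... <= e" using C0 c e by (simp add: field_simps)
 finally show "N (V x) <= c * N x + e" by simp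
qed

section \<open>From an isolated point of the spectrum to convergence of the means\<close>

theorem isolated_spectrum_imp_ume:
 assumes T: "bounded_by T 1" and TD: "!!f. f : D ==> T f : D"
  and Tsym: "!!f g. f : D ==> g : D ==> B (T f) g = B f (T g)"
  and normal: "!!x. x : X ==> T (J (T (J x))) = J (T (J (T x)))"
  and r: "r > 0" and res: "!!z. 0 < norm (z - 1) ==> norm (z - 1) < r ==> EX S. resolvent_of T z S"
 shows "EX P. bop P & converges_to (ces T) P"
proof -
 have bT: "bop T" using T by (rule bounded_by_bop)
 have linT: "lin T" using bT by (rule bop_lin)
 define \<Omega> where "\<Omega> = ball (1::complex) r - {1}"
 have "EX S. resolvent_of T z S" if "z : \<Omega>" for z
  using res[of z] that by (auto simp: \<Omega>_def dist_norm norm_minus_commute)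
 then obtain R where R: "!!z. z : \<Omega> ==> resolvent_of T z (R z)" by metis
 interpret RD: resolvent_disc scale X N T R \<Omega>
  by unfold_locales (use bT R in \<open>auto simp: \<Omega>_def\<close>)
 note Rb = RD.R_bop
 have Tk: "bounded_by (T ^^ k) 1" for k using bounded_by_funpow[OF T, of k] by simp
 have TkX: "(T ^^ k) x : X" if "x : X" for k x using bopX[OF bounded_by_bop[OF Tk] that] .
 have hol: "(%z. B (R z f) g) holomorphic_on \<Omega>" if "f : X" "g : E" for f g
  by (rule RD.resolvent_functional_analytic(1)[of "%x. B x g" "N' g"])
    (use that B_le in \<open>auto simp: B_add B_scale mult.commute\<close>)
 have der: "(deriv ^^ k) (%z. B (R z f) g) z = fact k * ((-1) ^ k * B ((R z ^^ Suc k) f) g)"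
  if "f : X" "g : E" "z : \<Omega>" for f g z k
  by (rule RD.resolvent_functional_analytic(2)[of "%x. B x g" "N' g"])
    (use that B_le in \<open>auto simp: B_add B_scale mult.commute\<close>)
 \<comment> \<open>A finite Neumann expansion that holds at every nonzero point of \<Omega>; its
   remainder is sure to tend to 0 when |z| > 1.\<close>
 have neumann: "B (R z f) g = (\<Sum>k<n. (1 / z) ^ Suc k * B ((T ^^ k) f) g) + (1 / z) ^ n * B ((T ^^ n) (R z f)) g"
  if z: "z : \<Omega>" "z ~= 0" and f: "f : X" and g: "g : E" for z f g n
 proof (induction n)
  case (Suc n)
  have RX: "R z f : X" using bopX[OF Rb[OF z(1)] f] .
  have "(T ^^ n) (z \<odot> R z f - T (R z f)) = (T ^^ n) f" using resolvent_ofD(3)[OF R[OF z(1)] f] by simp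
  hence "z \<odot> (T ^^ n) (R z f) = (T ^^ n) f + (T ^^ Suc n) (R z f)"
   using lin_diff[OF bounded_byD(1)[OF Tk], of "z \<odot> R z f" "T (R z f)" n]
    linD(3)[OF bounded_byD(1)[OF Tk] RX, of n z] RX bopX[OF bT RX]
   by (simp add: funpow_swap1 algebra_simps)
  hence "B (z \<odot> (T ^^ n) (R z f)) g = B ((T ^^ n) f + (T ^^ Suc n) (R z f)) g" by simp
  hence "z * B ((T ^^ n) (R z f)) g = B ((T ^^ n) f) g + B ((T ^^ Suc n) (R z f)) g"
   using B_scale[OF TkX[OF RX] g] B_add[OF TkX[OF f] TkX[OF RX] g] by (simp del: funpow.simps)
  hence "B ((T ^^ n) (R z f)) g = (1 / z) * B ((T ^^ n) f) g + (1 / z) * B ((T ^^ Suc n) (R z f)) g"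
   using z(2) by (simp add: field_simps)
  hence "(1 / z) ^ n * B ((T ^^ n) (R z f)) g =
    (1 / z) ^ Suc n * B ((T ^^ n) f) g + (1 / z) ^ Suc n * B ((T ^^ Suc n) (R z f)) g"
   by (simp add: algebra_simps del: funpow.simps)
  with Suc show ?case by (simp only: sum.lessThan_Suc add.assoc)
 qed simp
 have TkD: "(T ^^ k) f : D" if "f : D" for f k using that by (induction k) (auto simp: TD)
 have Tksym: "B ((T ^^ k) f) g = B ((T ^^ k) g) f" if fg: "f : D" "g : D" for f g k
 proof -
  have "B ((T ^^ k) f) g = B f ((T ^^ k) g)" using fg(2)
  proof (induction k arbitrary: g)
   case (Suc k)
   have "B (T ((T ^^ k) f)) g = B ((T ^^ k) f) (T g)" by (rule Tsym[OF TkD[OF fg(1)] Suc.prems])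
   also have "... = B f ((T ^^ k) (T g))" by (rule Suc.IH[OF TD[OF Suc.prems]])
   finally show ?case by (simp add: funpow_swap1)
  qed simp
  thus ?thesis using B_sym[OF D_E[OF fg(1)] D_E[OF TkD[OF fg(2)]]] by simp
 qed
 \<comment> \<open>Transposing the equation for \<open>R z\<close> would require \<open>R z\<close>
   to act on E, which is not known. For |z| > 1 symmetry can be read off from the Neumann expansion,
   and it spreads over the connected set \<Omega> by analytic continuation.\<close>
 have Rsym: "symmetric_op (R z)" if "z : \<Omega>" for z
  unfolding symmetric_op_def
 proof (intro conjI ballI)
  fix f g assume fg: "f : D" "g : D"
  show "B (R z f) g = B (R z g) f"
  proof (rule analytic_continuation_open[where s = "\<Omega> \<inter> {z. 1 < norm z}" and s' = \<Omega> and z = z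
     and f = "%z. B (R z f) g" and g = "%z. B (R z g) f"])
   show "open (\<Omega> \<inter> {z. 1 < norm z})"
    unfolding \<Omega>_def by (intro open_Int open_Collect_less continuous_intros open_delete) auto
   \<comment> \<open>The real point 1 + r/2 is the witness that \<Omega> reaches outside the closed
     unit disc.\<close>
   have "norm (complex_of_real (1 + r / 2)) = 1 + r / 2"
    unfolding norm_of_real using r by simp
   moreover have "complex_of_real (1 + r / 2) - 1 = complex_of_real (r / 2)" by simp
   hence "norm (complex_of_real (1 + r / 2) - 1) = r / 2"
    using r by (simp only: norm_of_real)
   ultimately have "complex_of_real (1 + r / 2) : \<Omega> \<inter> {z. 1 < norm z}"
    using r unfolding \<Omega>_def ball_def dist_norm norm_minus_commute[of 1] by (auto simp del: of_real_add)
   thus "\<Omega> \<inter> {z. 1 < norm z} ~= {}" by blast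
   show "open \<Omega>" by (simp add: \<Omega>_def open_delete)
   show "connected \<Omega>" unfolding \<Omega>_def by (rule connected_punctured_ball) simp
   show "B (R w f) g = B (R w g) f" if w: "w : \<Omega> \<inter> {z. 1 < norm z}" for w
   proof -
    define c where "c = N (R w f) * N' g + N (R w g) * N' f"
    have w': "w : \<Omega>" "w ~= 0" "norm (1 / w) < 1" using w by (auto simp: norm_divide divide_less_eq)
    have le: "norm (B (R w f) g - B (R w g) f) <= norm (1 / w) ^ n * c" for n
    proof -
     have RX: "R w f : X" "R w g : X" using bopX[OF Rb[OF w'(1)]] D_X fg by auto
     have "B (R w f) g - B (R w g) f =
       (1 / w) ^ n * (B ((T ^^ n) (R w f)) g - B ((T ^^ n) (R w g)) f)"
      by (subst neumann[OF w'(1,2) D_X D_E, of f g n], (use fg in simp_all)[2],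
        subst neumann[OF w'(1,2) D_X D_E, of g f n], (use fg in simp_all)[2])
        (simp add: Tksym[OF fg] algebra_simps)
     hence "norm (B (R w f) g - B (R w g) f) =
       norm (1 / w) ^ n * norm (B ((T ^^ n) (R w f)) g - B ((T ^^ n) (R w g)) f)"
      by (simp add: norm_mult norm_power)
     also have "... <= norm (1 / w) ^ n * c"
     proof (rule mult_left_mono)
      have 1: "norm (B ((T ^^ n) (R w f)) g) <= N (R w f) * N' g" if "f : D" "g : D" for f g
      proof -
       have X: "R w f : X" using bopX[OF Rb[OF w'(1)] D_X[OF that(1)]] .
       have "norm (B ((T ^^ n) (R w f)) g) <= N ((T ^^ n) (R w f)) * N' g"
        by (rule B_le[OF TkX[OF X] D_E[OF that(2)]])
       also have "... <= N (R w f) * N' g"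
        using bounded_byD(3)[OF Tk X, of n] N'_nonneg[OF D_E[OF that(2)]] by (intro mult_right_mono) auto
       finally show ?thesis .
      qed
      show "norm (B ((T ^^ n) (R w f)) g - B ((T ^^ n) (R w g)) f) <= c"
       using norm_triangle_ineq4[of "B ((T ^^ n) (R w f)) g" "B ((T ^^ n) (R w g)) f"] 1[OF fg] 1[OF fg(2,1)]
       by (simp add: c_def)
     qed simp
     finally show ?thesis .
    qed
    have "(%n. norm (1 / w) ^ n * c) \<longlonglongrightarrow> 0"
     using w' by (auto intro!: tendsto_eq_intros LIMSEQ_power_zero)
    hence "norm (B (R w f) g - B (R w g) f) <= 0"
     by (rule LIMSEQ_le_const) (use le in auto)
    thus ?thesis by simp
   qed
  qed (use that fg hol D_X D_E in auto)
 qed (rule Rb[OF that])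
 \<comment> \<open>\<open>J (R z) J\<close> is the resolvent of \<open>J T J\<close> at the
   conjugate point, and resolvents of commuting operators commute.\<close>
 have Rnormal: "R z (J (R z (J x))) = J (R z (J (R z x)))" if z: "z : \<Omega>" and x: "x : X" for z x
 proof -
  define T' where "T' x = J (T (J x))" for x
  define S' where "S' x = J (R z (J x))" for x
  note RX = bopX[OF Rb[OF z]] and TX = bopX[OF bT]
  obtain C where C: "bounded_by (R z) C" using Rb[OF z] by (auto simp: bop_def)
  have bT': "bop T'" unfolding T'_def[abs_def] by (rule bounded_by_bop[OF bounded_by_conj[OF T]])
  have S': "resolvent_of T' (cnj z) S'"
   unfolding resolvent_of_def
  proof (intro conjI ballI)
   show "bop S'" unfolding S'_def[abs_def] by (rule bounded_by_bop[OF bounded_by_conj[OF C]])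
   fix x assume x: "x : X"
   have Jd: "J (a - b) = J a - J b" if "a : X" "b : X" for a b
    using J_add[of "a - b" b] that by (simp add: algebra_simps)
   have "J (cnj z \<odot> x - T' x) = z \<odot> J x - T (J x)"
    using x J_X TX by (simp add: T'_def Jd J_scale J_J)
   thus "S' (cnj z \<odot> x - T' x) = x"
    using resolvent_ofD(2)[OF R[OF z] J_X[OF x]] x by (simp add: S'_def J_J)
   have "cnj z \<odot> S' x - T' (S' x) = J (z \<odot> R z (J x) - T (R z (J x)))"
    using x J_X TX RX by (simp add: T'_def S'_def Jd J_scale J_J)
   thus "cnj z \<odot> S' x - T' (S' x) = x"
    using resolvent_ofD(3)[OF R[OF z] J_X[OF x]] x by (simp add: J_J)
  qed
  have 1: "R z (T' y) = T' (R z y)" if "y : X" for y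
   by (rule resolvent_commute[OF bT R[OF z] bT' _ that]) (use normal in \<open>simp add: T'_def\<close>)
  have "S' (R z x) = R z (S' x)"
   by (rule resolvent_commute[OF bT' S' Rb[OF z] 1 x])
  thus ?thesis by (simp add: S'_def)
 qed
 have L2: "norm ((z - 1) * B (R z f) g) <= 2 * sqrt (Re (B f (J f)) * Re (B (J g) g))"
  if z: "0 < norm (z - 1)" "norm (z - 1) < r / 2" and fg: "f : D" "g : D" for z f g
 proof -
  \<comment> \<open>The closed disc of radius \<rho> about z avoids 1 and stays in \<Omega>.
    Cauchy's inequality on it bounds the powers of \<open>R z\<close> by a multiple of
    \<open>(1 / \<rho>) ^ n\<close>, so \<open>normal_L2_bound\<close> yields the bound 1/\<rho> on
    L^2. The factor 2 of the claim is |z - 1| / \<rho>; the multiple, which depends on z, is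
    gone.\<close>
  define \<rho> where "\<rho> = norm (z - 1) / 2"
  have \<rho>: "\<rho> > 0" using z by (simp add: \<rho>_def)
  have sub: "cball z \<rho> \<subseteq> \<Omega>"
  proof
   fix w assume "w : cball z \<rho>"
   hence wz: "norm (w - z) <= norm (z - 1) / 2" by (simp add: \<rho>_def dist_norm norm_minus_commute)
   have "norm (w - 1) <= norm (w - z) + norm (z - 1)" using norm_triangle_ineq[of "w - z" "z - 1"] by simp
   hence "norm (w - 1) < r" using wz z r by linarith
   moreover have "w ~= 1" using wz z by (auto simp: norm_minus_commute)
   ultimately show "w : \<Omega>" by (auto simp: \<Omega>_def dist_norm norm_minus_commute)
  qed
  hence z\<Omega>: "z : \<Omega>" using \<rho> by auto
  obtain C where C: "C >= 0" "!!w. w : cball z \<rho> ==> bounded_by (R w) C"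
   using RD.R_bound_compact[OF compact_cball sub] by blast
  \<comment> \<open>The maximum with 1 covers the power 0.\<close>
  define K where "K = max 1 (C * \<rho>)"
  have growth: "bounded_by (R z ^^ n) (K * (1 / \<rho>) ^ n)" for n
  proof (cases n)
   case 0
   thus ?thesis using bounded_by_mono[OF bounded_by_id, of K] by (simp add: K_def id_def)
  next
   case (Suc k)
   have lin: "lin (R z ^^ n)" by (rule bop_lin[OF bop_funpow[OF Rb[OF z\<Omega>]]])
   have "N ((R z ^^ n) f) <= C / \<rho> ^ k * N f" if f: "f : X" for f
   proof (rule N_le_dual)
    show "(R z ^^ n) f : X" using lin f linD by blast
    show "0 <= C / \<rho> ^ k * N f" using C \<rho> N_nonneg[OF f] by simp
    fix g assume g: "g : D"
    have "norm ((deriv ^^ k) (%z. B (R z f) g) z) <= fact k * (C * N f * N' g) / \<rho> ^ k"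
    proof (rule Cauchy_inequality[OF _ _ \<rho>])
     show "(%z. B (R z f) g) holomorphic_on ball z \<rho>"
      using holomorphic_on_subset[OF hol[OF f D_E[OF g]]] sub by force
     show "continuous_on (cball z \<rho>) (%z. B (R z f) g)"
      using holomorphic_on_imp_continuous_on[OF holomorphic_on_subset[OF hol[OF f D_E[OF g]] sub]] .
     fix w assume "norm (z - w) = \<rho>"
     hence w: "w : cball z \<rho>" by (simp add: dist_norm)
     have "norm (B (R w f) g) <= N (R w f) * N' g"
      using B_le[OF bopX[OF bounded_by_bop[OF C(2)[OF w]] f] D_E[OF g]] .
     also have "... <= C * N f * N' g"
      using bounded_byD(3)[OF C(2)[OF w] f] N'_nonneg[OF D_E[OF g]] by (rule mult_right_mono)
     finally show "norm (B (R w f) g) <= C * N f * N' g" .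
    qed
    hence "fact k * norm (B ((R z ^^ n) f) g) <= fact k * (C / \<rho> ^ k * N f * N' g)"
     unfolding der[OF f D_E[OF g] z\<Omega>] Suc by (simp add: norm_mult norm_power del: funpow.simps)
    thus "norm (B ((R z ^^ n) f) g) <= C / \<rho> ^ k * N f * N' g"
     by (subst (asm) mult_le_cancel_left_pos) auto
   qed
   hence "bounded_by (R z ^^ n) (C / \<rho> ^ k)" using lin C \<rho> by (auto simp: bounded_by_def)
   moreover have "C / \<rho> ^ k <= K * (1 / \<rho>) ^ n"
   proof -
    have "C / \<rho> ^ k = (C * \<rho>) * (1 / \<rho>) ^ n" using \<rho> Suc by (simp add: field_simps)
    also have "... <= K * (1 / \<rho>) ^ n" using \<rho> by (intro mult_right_mono) (auto simp: K_def)
    finally show ?thesis .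
   qed
   ultimately show ?thesis by (rule bounded_by_mono)
  qed
  have S: "Re (B (R z f) (J (R z f))) <= (1 / \<rho>)\<^sup>2 * Re (B f (J f))"
   by (rule normal_L2_bound[OF Rsym[OF z\<Omega>] Rnormal[OF z\<Omega>] growth _ fg(1)]) (use \<rho> in auto)
  have RE: "R z f : E" using symmetric_op_E(1)[OF Rsym[OF z\<Omega>] _ fg(1)] C(2)[of z] \<rho> by auto
  have Jg: "J g : E" "J (J g) = g" using J_E D_E J_J D_X fg by auto
  have p: "Re (B (J g) g) >= 0" using B_pos[OF Jg(1)] Jg(2) by simp
  have "(norm (B (R z f) g))\<^sup>2 <= Re (B (R z f) (J (R z f))) * Re (B (J g) g)"
   using B_Cauchy_Schwarz[OF RE Jg(1)] Jg(2) by simp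
  also have "... <= (1 / \<rho>)\<^sup>2 * Re (B f (J f)) * Re (B (J g) g)" by (rule mult_right_mono[OF S p])
  finally have "norm (B (R z f) g) <= sqrt ((1 / \<rho>)\<^sup>2 * (Re (B f (J f)) * Re (B (J g) g)))"
   by (intro real_le_rsqrt) (simp add: mult.assoc)
  also have "... = (1 / \<rho>) * sqrt (Re (B f (J f)) * Re (B (J g) g))"
   using \<rho> by (simp add: real_sqrt_mult real_sqrt_divide)
  finally have "norm (z - 1) * norm (B (R z f) g) <= norm (z - 1) * ((1 / \<rho>) * sqrt (Re (B f (J f)) * Re (B (J g) g)))"
   by (rule mult_left_mono) simp
  also have "... = 2 * sqrt (Re (B f (J f)) * Re (B (J g) g))" using z by (simp add: \<rho>_def)
  finally show ?thesis by (simp add: norm_mult)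
 qed
 \<comment> \<open>The circle for the L^p estimate must lie inside the disc of radius r/2 on which
   the L^2 bound holds.\<close>
 define s where "s = r / 4"
 have s: "s > 0" "s < r / 2" using r by (auto simp: s_def)
 have "sphere 1 s \<subseteq> \<Omega>" using s by (auto simp: \<Omega>_def)
 then obtain C where C: "C >= 0" "!!w. w : sphere 1 s ==> bounded_by (R w) C"
  using RD.R_bound_compact[OF compact_sphere] by blast
 define \<Phi> where "\<Phi> z x = (z - 1) \<odot> R z x" for z x
 have b\<Phi>: "bop (\<Phi> z)" if "z : \<Omega>" for z unfolding \<Phi>_def[abs_def] by (rule bop_scale[OF Rb[OF that]])
 have lip: "N (\<Phi> z x - \<Phi> w x) <= 2 * C * (norm (z - 1) + norm (w - 1)) * N x"
  if z: "0 < norm (z - 1)" "norm (z - 1) <= s" and w: "0 < norm (w - 1)" "norm (w - 1) <= s" and x: "x : X" for z w x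
 proof -
  have zw: "z : \<Omega>" "w : \<Omega>" using z w s by (auto simp: \<Omega>_def dist_norm norm_minus_commute)
  note bd = bop_diff[OF b\<Phi>[OF zw(1)] b\<Phi>[OF zw(2)]]
  \<comment> \<open>For test functions the scalar function \<psi> is bounded near 1 by the L^2
    estimate, hence extends over 1. How much it varies is governed by the bound C of the resolvent
    on the circle of radius s, and that estimate involves N and N' alone.\<close>
  have D: "N (\<Phi> z f - \<Phi> w f) <= 2 * C * (norm (z - 1) + norm (w - 1)) * N f" if f: "f : D" for f
  proof (rule N_le_dual)
   have fX: "f : X" using D_X f by auto
   show "\<Phi> z f - \<Phi> w f : X" using bopX[OF bd fX] .
   show "0 <= 2 * C * (norm (z - 1) + norm (w - 1)) * N f" using C N_nonneg[OF fX] by simp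
   fix g assume g: "g : D"
   define \<psi> where "\<psi> u = (u - 1) * B (R u f) g" for u
   have "EX c. ALL u. 0 < norm (u - 1) & norm (u - 1) <= s -->
      norm (\<psi> u) <= s * C * N f * N' g & norm (\<psi> u - c) <= 2 * (s * C * N f * N' g) / s * norm (u - 1)"
   proof (rule bounded_isolated_singularity_lipschitz[OF _ s])
    have "ball 1 (r / 2) - {1} \<subseteq> \<Omega>" using r by (auto simp: \<Omega>_def)
    thus "\<psi> holomorphic_on ball 1 (r / 2) - {1}"
     unfolding \<psi>_def by (intro holomorphic_intros holomorphic_on_subset[OF hol[OF fX D_E[OF g]]])
    show "norm (\<psi> u) <= 2 * sqrt (Re (B f (J f)) * Re (B (J g) g))"
     if "0 < norm (u - 1)" "norm (u - 1) < r / 2" for u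
     unfolding \<psi>_def by (rule L2[OF that f g])
    fix u :: complex assume u: "norm (u - 1) = s"
    hence Cu: "bounded_by (R u) C" using C(2)[of u] by (simp add: dist_norm norm_minus_commute)
    have "norm (B (R u f) g) <= N (R u f) * N' g"
     using B_le[OF bopX[OF bounded_by_bop[OF Cu] fX] D_E[OF g]] .
    also have "... <= C * N f * N' g"
     using bounded_byD(3)[OF Cu fX] N'_nonneg[OF D_E[OF g]] by (rule mult_right_mono)
    finally have "s * norm (B (R u f) g) <= s * (C * N f * N' g)" using s by (intro mult_left_mono) auto
    thus "norm (\<psi> u) <= s * C * N f * N' g" using u by (simp add: \<psi>_def norm_mult mult_ac)
   qed
   then obtain c where c: "norm (\<psi> u - c) <= 2 * (s * C * N f * N' g) / s * norm (u - 1)"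
    if "0 < norm (u - 1)" "norm (u - 1) <= s" for u by blast
   have "B (\<Phi> z f - \<Phi> w f) g = \<psi> z - \<psi> w"
    using bopX[OF b\<Phi> fX] bopX[OF Rb fX] zw D_E[OF g] by (simp add: B_diff) (simp add: \<Phi>_def \<psi>_def B_scale)
   hence "norm (B (\<Phi> z f - \<Phi> w f) g) <= norm (\<psi> z - c) + norm (\<psi> w - c)"
    using norm_triangle_ineq4[of "\<psi> z - c" "\<psi> w - c"] by simp
   also have "... <= 2 * C * (norm (z - 1) + norm (w - 1)) * N f * N' g"
    using c[OF z] c[OF w] s by (simp add: field_simps)
   finally show "norm (B (\<Phi> z f - \<Phi> w f) g) <= 2 * C * (norm (z - 1) + norm (w - 1)) * N f * N' g" .
  qed
  show ?thesis by (rule bounded_on_dense[OF bd _ D x]) (use C in auto)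
 qed
 \<comment> \<open>Distances of points that approach 1 along the real axis from the right.\<close>
 define d where "d k = s / real (Suc k)" for k
 have d: "d k > 0" "d k <= s" for k using s by (auto simp: d_def field_simps)
 have d0: "d \<longlonglongrightarrow> 0" unfolding d_def[abs_def] using s LIMSEQ_Suc[OF lim_const_over_n[of s]] by simp
 have dmono: "d j <= d k" if "k <= j" for j k using that s by (simp add: d_def frac_le)
 define U where "U k = \<Phi> (1 + of_real (d k))" for k
 have nd: "norm (1 + complex_of_real (d k) - 1) = d k" for k using d[of k] by simp
 have U\<Omega>: "1 + complex_of_real (d k) : \<Omega>" for k using d[of k] s by (auto simp: \<Omega>_def dist_norm)
 have bU: "bop (U k)" for k unfolding U_def by (rule b\<Phi>[OF U\<Omega>])
 have Ulip: "N (U j x - U k x) <= 2 * C * (d j + d k) * N x" if "x : X" for j k x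
  unfolding U_def using lip[OF _ _ _ _ that, of "1 + of_real (d j)" "1 + of_real (d k)"] d[of j] d[of k] by (simp add: nd)
 have "EX P. bop P & converges_to U P"
 proof (rule cauchy_operators_converge[OF bU])
  fix e :: real assume e: "e > 0"
  have lim: "(%k. 4 * C * d k) \<longlonglongrightarrow> 0" using d0 by (auto intro!: tendsto_eq_intros)
  obtain M where M: "!!k. k >= M ==> 4 * C * d k < e"
   using order_tendstoD(2)[OF lim e] by (auto simp: eventually_sequentially)
  have "N (U m x - U n x) <= e * N x" if "m >= M" "n >= M" "x : X" for m n x
  proof -
   have "2 * C * (d m + d n) <= e" using M[OF that(1)] M[OF that(2)] by (simp add: algebra_simps)
   thus ?thesis by (rule order_trans[OF Ulip[OF that(3), of m n] mult_right_mono[OF _ N_nonneg[OF that(3)]]])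
  qed
  thus "EX M. ALL m>=M. ALL n>=M. ALL x:X. N (U m x - U n x) <= e * N x" by blast
 qed
 then obtain P where P: "bop P" "converges_to U P" by blast
 note PX = bopX[OF P(1)] and UX = bopX[OF bU] and TX = bopX[OF bT]
 have UP: "tends (%k. U k x) (P x)" if "x : X" for x by (rule converges_to_tends[OF P(2,1) bU that])
 have UPle: "N (U k x - P x) <= 4 * C * d k * N x" if x: "x : X" for k x
 proof -
  have "N (P x - U k x) <= 4 * C * d k * N x"
  proof (rule tends_N_le[OF UP[OF x], of k])
   fix j assume "j >= k"
   hence "2 * C * (d j + d k) <= 4 * C * d k" using dmono[of k j] C by (simp add: algebra_simps mult_left_mono)
   thus "N (U j x - U k x) <= 4 * C * d k * N x"
    by (rule order_trans[OF Ulip[OF x, of j k] mult_right_mono[OF _ N_nonneg[OF x]]])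
  qed (rule UX[OF x])
  thus ?thesis using N_diff_commute[OF UX[OF x] PX[OF x]] by simp
 qed
 \<comment> \<open>The equation (z - T) R(z) = 1, multiplied by z - 1, which is
   \<open>d k\<close>.\<close>
 have AU: "U k x - T (U k x) = of_real (d k) \<odot> (x - U k x)" if x: "x : X" for k x
 proof -
  define z where "z = 1 + complex_of_real (d k)"
  have RX: "R z x : X" using bopX[OF Rb x] U\<Omega> by (simp add: z_def)
  have "(z - 1) \<odot> (z \<odot> R z x - T (R z x)) = (z - 1) \<odot> x"
   using resolvent_ofD(3)[OF R x, of z] U\<Omega> by (simp add: z_def)
  hence "z \<odot> U k x - T (U k x) = (z - 1) \<odot> x"
   using RX by (simp add: U_def \<Phi>_def z_def[symmetric] linD(3)[OF linT] scale_right_diff_distrib mult.commute)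
  hence "U k x - T (U k x) = (z - 1) \<odot> x - (z - 1) \<odot> U k x"
   by (simp add: scale_left_diff_distrib algebra_simps)
  thus ?thesis by (simp add: z_def scale_right_diff_distrib)
 qed
 have TP: "T (P x) = P x" if x: "x : X" for x
 proof -
  have "tends (%k. U k x - T (U k x)) (P x - T (P x))"
   using tends_diff[OF UP[OF x] tends_bop[OF bT UP[OF x]]] .
  moreover have "tends (%k. of_real (d k) \<odot> (x - U k x)) (0 \<odot> (x - P x))"
   using tends_scale_seq[OF tends_diff[OF tends_const[OF x] UP[OF x]], of "%k. of_real (d k)" 0]
    tendsto_of_real[OF d0, where 'a = complex] by simp
  ultimately have "P x - T (P x) = 0"
   using tends_unique[of "%k. of_real (d k) \<odot> (x - U k x)" "P x - T (P x)" 0] by (simp add: AU[OF x])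
  thus ?thesis by simp
 qed
 have "converges_to (ces T) P"
  unfolding converges_to_def
 proof (intro allI impI)
  fix e :: real assume e: "e > 0"
  have "(%k. 4 * C * d k) \<longlonglongrightarrow> 0" using d0 by (auto intro!: tendsto_eq_intros)
  hence "eventually (%k. 4 * C * d k < e / 2) sequentially" using e by (intro order_tendstoD(2)) auto
  then obtain k where k: "4 * C * d k < e / 2" by (auto simp: eventually_sequentially)
  define z where "z = 1 + complex_of_real (d k)"
  have z: "z : \<Omega>" using U\<Omega> by (simp add: z_def)
  obtain K where K: "bounded_by (R z) K" using Rb[OF z] by (auto simp: bop_def)
  have "eventually (%n. 2 * K / real n < e / 2) sequentially"
   using e by (intro order_tendstoD(2)[OF lim_const_over_n]) auto
  then obtain M where M: "!!n. n >= M ==> 2 * K / real n < e / 2" by (auto simp: eventually_sequentially)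
  have "N (ces T n x - P x) <= e * N x" if n: "n >= Suc M" and x: "x : X" for n x
  proof -
   define w where "w = R z x"
   have X: "w : X" "U k x - P x : X" "P x : X" "T w : X" using bopX[OF Rb[OF z] x] UX PX TX x by (simp_all add: w_def)
   have "z \<odot> w - T w = x" using resolvent_ofD(3)[OF R[OF z] x] by (simp add: w_def)
   \<comment> \<open>x splits into a part of small norm, a fixed vector, and a coboundary
     \<open>w - T w\<close> whose means are of order 1/n.\<close>
   hence x_eq: "x = (U k x - P x) + P x + (w - T w)"
    by (simp add: U_def \<Phi>_def w_def z_def scale_left_distrib algebra_simps)
   have lin: "lin (ces T n)" by (rule bop_lin[OF bop_ces[OF bT]])
   have cX: "ces T n y : X" if "y : X" for y by (rule linD(1)[OF lin that])
   have "(T ^^ j) (P x) = P x" for j by (induction j) (auto simp: TP[OF x])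
   hence "ces T n (P x) = P x" using n by (simp add: ces_def sum_constant_scale)
   moreover have "ces T n ((U k x - P x) + P x + (w - T w)) = ces T n (U k x - P x) + ces T n (P x) + (ces T n w - ces T n (T w))"
    using X by (simp only: linD(2)[OF lin] lin_diff[OF lin] X_closed)
   ultimately have "ces T n x - P x = ces T n (U k x - P x) + (ces T n w - ces T n (T w))"
    unfolding x_eq[symmetric] by simp
   hence "N (ces T n x - P x) <= N (ces T n (U k x - P x)) + N (ces T n w - ces T n (T w))"
    using N_triangle[of "ces T n (U k x - P x)" "ces T n w - ces T n (T w)"] cX X by simp
   also have "... <= e / 2 * N x + e / 2 * N x"
   proof (rule add_mono)
    show "N (ces T n (U k x - P x)) <= e / 2 * N x"
     using ces_le[OF T X(2), of n] UPle[OF x, of k] mult_right_mono[OF less_imp_le[OF k] N_nonneg[OF x]] by linarith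
    have "N (ces T n w - ces T n (T w)) <= 2 / n * N w" using ces_shift_le[OF T X(1), of n 1] by simp
    also have "... <= 2 / n * (K * N x)" using bounded_byD(3)[OF K x] by (intro mult_left_mono) (simp_all add: w_def)
    also have "... <= e / 2 * N x" using mult_right_mono[OF less_imp_le[OF M[of n]] N_nonneg[OF x]] n by simp
    finally show "N (ces T n w - ces T n (T w)) <= e / 2 * N x" .
   qed
   finally show ?thesis by simp
  qed
  thus "EX M. ALL n>=M. ALL x:X. N (ces T n x - P x) <= e * N x" by blast
 qed
 thus ?thesis using P by blast
qed

end

section \<open>Iterated integrals for Radon measures\<close>

text \<open>Inner regularity is asked for open sets only. In this form it holds for Haar measure as
  well as for finite regular measures.\<close>

definition radon :: "'a::t2_space measure => bool" where
 "radon m \<longleftrightarrow> sets m = sets borel &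
   (ALL x. EX U. open U & x : U & emeasure m U < \<infinity>) &
   (ALL U. open U --> emeasure m U = (SUP K\<in>{K. compact K & K \<subseteq> U}. emeasure m K))"

lemma radonD:
 assumes "radon m"
 shows "sets m = sets borel" "space m = UNIV" "EX U. open U & x : U & emeasure m U < \<infinity>"
  "open U ==> emeasure m U = (SUP K\<in>{K. compact K & K \<subseteq> U}. emeasure m K)"
 using assms sets_eq_imp_space_eq[of m borel] by (auto simp: radon_def)

lemma radon_borel_measurable: "radon m ==> borel_measurable m = borel_measurable borel"
 by (rule measurable_cong_sets) (simp_all add: radonD)

lemma emeasure_density_indicator:
 "A : sets M ==> X : sets M ==> emeasure (density M (indicator A)) X = emeasure M (A \<inter> X)"
 by (simp add: emeasure_density flip: indicator_inter_arith)

lemma SUP_mult_indicator: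
 fixes c :: ennreal
 assumes "x \<notin> (\<Union>n. B n) ==> c = 0" shows "(SUP n. c * indicator (B n) x) = c"
proof (cases "x : (\<Union>n. B n)")
 case True
 then obtain n where "x : B n" by auto
 hence "c <= (SUP n. c * indicator (B n) x)" by (intro SUP_upper2[of n]) auto
 moreover have "(SUP n. c * indicator (B n) x) <= c" by (intro SUP_least) (auto split: split_indicator)
 ultimately show ?thesis by (intro antisym)
qed (use assms in simp)

lemma emeasure_finite_UN:
 assumes "finite I" "!!i. i : I ==> A i : sets M" "!!i. i : I ==> emeasure M (A i) < top"
 shows "emeasure M (\<Union>i\<in>I. A i) < top"
proof -
 have "emeasure M (\<Union>i\<in>I. A i) <= (\<Sum>i\<in>I. emeasure M (A i))" using assms(1,2) by (intro emeasure_subadditive_finite) auto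
 also have "... < top" using assms(3) by (simp add: ennreal_sum_less_top assms(1))
 finally show ?thesis .
qed

text \<open>A compact subset of the union lies in finitely many members, hence in one of them. This
  plays the part of monotone convergence for the uncountable families that a topology without
  countable base brings in.\<close>

lemma radon_Union_directed:
 assumes m: "radon m" and op: "!!i. i : I ==> open (U i)" and I: "I ~= {}"
  and dir: "!!i j. i : I ==> j : I ==> EX k:I. U i \<subseteq> U k & U j \<subseteq> U k"
 shows "emeasure m (\<Union>i\<in>I. U i) = (SUP i\<in>I. emeasure m (U i))"
proof (rule antisym)
 have finite_dir: "EX k:I. (\<Union>i\<in>F. U i) \<subseteq> U k" if "finite F" "F \<subseteq> I" for F
  using that
 proof (induction F)
  case empty thus ?case using I by auto
 next
  case (insert i F)
  then obtain k where k: "k : I" "(\<Union>i\<in>F. U i) \<subseteq> U k" by auto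
  obtain l where "l : I" "U i \<subseteq> U l" "U k \<subseteq> U l" using dir[of i k] insert k by auto
  thus ?case using k by (intro bexI[of _ l]) auto
 qed
 have s: "U i : sets m" if "i : I" for i using op[OF that] radonD(1)[OF m] by simp
 have "emeasure m K <= (SUP i\<in>I. emeasure m (U i))" if K: "compact K" "K \<subseteq> (\<Union>i\<in>I. U i)" for K
 proof -
  obtain F where F: "F \<subseteq> I" "finite F" "K \<subseteq> (\<Union>i\<in>F. U i)"
   using compactE_image[OF K(1), of I U] op K(2) by metis
  then obtain k where k: "k : I" "K \<subseteq> U k" using finite_dir[OF F(2,1)] by auto
  have "emeasure m K <= emeasure m (U k)" by (rule emeasure_mono[OF k(2) s[OF k(1)]])
  thus ?thesis using k(1) by (rule SUP_upper2[rotated])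
 qed
 moreover have "open (\<Union>i\<in>I. U i)" using op by auto
 ultimately show "emeasure m (\<Union>i\<in>I. U i) <= (SUP i\<in>I. emeasure m (U i))"
  unfolding radonD(4)[OF m \<open>open (\<Union>i\<in>I. U i)\<close>] by (intro SUP_least) auto
 have "(\<Union>i\<in>I. U i) : sets m" using \<open>open (\<Union>i\<in>I. U i)\<close> radonD(1)[OF m] by simp
 thus "(SUP i\<in>I. emeasure m (U i)) <= emeasure m (\<Union>i\<in>I. U i)"
  by (intro SUP_least emeasure_mono) auto
qed

section \<open>Directed families of lower semicontinuous functions\<close>

text \<open>A layer-cake sum with mesh 1 / 2^n up to height 2^n. It depends on g only through strict
  level sets, which are open when g is a lower semicontinuous function.\<close>

definition dyadic_lower :: "nat => ennreal => ennreal" where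
 "dyadic_lower n g = (\<Sum>k=1..4^n. ennreal (1 / 2 ^ n) * indicator {ennreal (real k / 2 ^ n)<..} g)"

lemma dyadic_lower_le: "dyadic_lower n g <= g"
proof (cases "g = \<infinity>")
 case False
 then obtain r where r: "g = ennreal r" "r >= 0" by (cases g) auto
 define A where "A = {k\<in>{1..4^n}. real k / 2 ^ n < r}"
 have "dyadic_lower n g = (\<Sum>k\<in>A. ennreal (1 / 2 ^ n))"
  unfolding dyadic_lower_def A_def r
  by (intro sum.mono_neutral_cong_right) (auto simp: indicator_def ennreal_less_iff)
 also have "... = ennreal (real (card A) / 2 ^ n)"
  by (simp add: ennreal_of_nat_eq_real_of_nat flip: ennreal_mult')
 also have "real (card A) / 2 ^ n <= r"
 proof -
  have "A \<subseteq> {1..nat \<lfloor>r * 2 ^ n\<rfloor>}" by (auto simp: A_def field_simps le_nat_iff le_floor_iff)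
  hence "card A <= nat \<lfloor>r * 2 ^ n\<rfloor>" using card_mono[of "{1..nat \<lfloor>r * 2 ^ n\<rfloor>}" A] by simp
  hence "real (card A) <= r * 2 ^ n" using r by (simp add: le_nat_iff le_floor_iff)
  thus ?thesis by (simp add: field_simps)
 qed
 finally show ?thesis using r by (simp add: ennreal_leI)
qed simp

lemma dyadic_lower_liminf: "g <= liminf (%n. dyadic_lower n g)"
proof (rule dense_le)
 fix c assume c: "c < g"
 then obtain c1 where c1: "c < c1" "c1 < g" using dense by blast
 then obtain a b where ab: "c = ennreal a" "a >= 0" "c1 = ennreal b" "b >= 0"
  by (metis ennreal_cases less_top_ennreal order_less_trans top.not_eq_extremum)
 have "a < b" using c1 ab by (simp add: ennreal_less_iff)
 \<comment> \<open>The height has to exceed b, and the mesh has to be below b - a.\<close>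
 obtain n0 where n0: "b < 2 ^ n0" "1 / (b - a) < 2 ^ n0"
  using real_arch_pow[of 2 "max b (1 / (b - a))"] by auto
 have "c <= dyadic_lower n g" if n: "n >= n0" for n
 proof -
  have 2: "(2::real) ^ n0 <= 2 ^ n" using n by (simp add: power_increasing)
  have bn: "b < 2 ^ n" "1 / (b - a) < 2 ^ n" using n0 2 by linarith+
  hence inv: "1 / 2 ^ n < b - a" using \<open>a < b\<close> by (simp add: field_simps)
  define K where "K = nat \<lfloor>b * 2 ^ n\<rfloor>"
  have K1: "real K <= b * 2 ^ n" "b * 2 ^ n < real K + 1" using ab by (auto simp: K_def)
  have "b * 2 ^ n < 2 ^ n * 2 ^ n" using bn(1) by simp
  hence "real K < 2 ^ n * 2 ^ n" using K1 by linarith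
  hence "real K < 4 ^ n" by (simp flip: power_mult_distrib)
  hence K4: "K <= 4 ^ n" by (metis of_nat_less_numeral_power_cancel_iff less_imp_le)
  have "ennreal a <= ennreal (real K / 2 ^ n)"
  proof (rule ennreal_leI)
   have "a * 2 ^ n + 1 <= b * 2 ^ n" using inv by (simp add: field_simps)
   thus "a <= real K / 2 ^ n" using K1 by (simp add: field_simps)
  qed
  also have "... = (\<Sum>k=1..K. ennreal (1 / 2 ^ n))"
   by (simp add: ennreal_of_nat_eq_real_of_nat flip: ennreal_mult')
  also have "... <= (\<Sum>k=1..K. ennreal (1 / 2 ^ n) * indicator {ennreal (real k / 2 ^ n)<..} g)"
  proof (rule sum_mono)
   fix k assume "k : {1..K}"
   hence "real k / 2 ^ n <= b" using K1 by (simp add: field_simps)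
   hence "ennreal (real k / 2 ^ n) < g" using c1 ab ennreal_leI order_le_less_trans by blast
   thus "ennreal (1 / 2 ^ n) <= ennreal (1 / 2 ^ n) * indicator {ennreal (real k / 2 ^ n)<..} g" by simp
  qed
  also have "... <= dyadic_lower n g"
   unfolding dyadic_lower_def using K4 by (intro sum_mono2) auto
  finally show ?thesis using ab by simp
 qed
 thus "c <= liminf (%n. dyadic_lower n g)"
  by (intro Liminf_bounded) (auto simp: eventually_sequentially)
qed

lemma SUP_sum_directed_ennreal:
 fixes f :: "'k => 'i => ennreal"
 assumes I: "I ~= {}" and dir: "!!i j. i : I ==> j : I ==> EX l:I. ALL k. f k i <= f k l & f k j <= f k l"
  and K: "finite K"
 shows "(\<Sum>k\<in>K. SUP i\<in>I. f k i) = (SUP i\<in>I. \<Sum>k\<in>K. f k i)"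
 using K
proof induction
 case (insert k K)
 have "(\<Sum>k\<in>insert k K. SUP i\<in>I. f k i) = (SUP i\<in>I. f k i) + (SUP i\<in>I. \<Sum>k\<in>K. f k i)"
  using insert by simp
 also have "... = (SUP i\<in>I. f k i + (\<Sum>k\<in>K. f k i))"
 proof (rule SUP_add_directed_ennreal[symmetric])
  fix i j assume "i : I" "j : I"
  then obtain l where "l : I" "ALL k. f k i <= f k l & f k j <= f k l" using dir by blast
  thus "EX l:I. f k i + (\<Sum>k\<in>K. f k j) <= f k l + (\<Sum>k\<in>K. f k l)"
   by (intro bexI[of _ l] add_mono sum_mono) auto
 qed
 finally show ?case using insert by simp
qed (use I in simp)

text \<open>The integral of a layer-cake sum is a finite combination of measures of open level sets,
  to which \<open>radon_Union_directed\<close> applies; Fatou's lemma then removes the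
  discretisation.\<close>

lemma nn_integral_SUP_directed:
 fixes F :: "'i => 'a::t2_space => ennreal"
 assumes m: "radon m" and I: "I ~= {}"
  and lsc: "!!i t. i : I ==> open {x. t < F i x}"
  and dir: "!!i j. i : I ==> j : I ==> EX k:I. ALL x. F i x <= F k x & F j x <= F k x"
 shows "(\<integral>\<^sup>+x. (SUP i\<in>I. F i x) \<partial>m) = (SUP i\<in>I. \<integral>\<^sup>+x. F i x \<partial>m)"
proof (rule antisym)
 note [simp] = radonD(1,2)[OF m]
 define G where "G x = (SUP i\<in>I. F i x)" for x
 have Gt: "{x. t < G x} = (\<Union>i\<in>I. {x. t < F i x})" for t by (auto simp: G_def less_SUP_iff)
 have Gmeas: "G : borel_measurable m"
  by (rule borel_measurableI_greater) (simp add: Gt lsc borel_open open_UN)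
 have Fmeas: "F i : borel_measurable m" if "i : I" for i
  by (rule borel_measurableI_greater) (simp add: lsc[OF that] borel_open)
 have dG: "(%x. dyadic_lower n (g x)) : borel_measurable m" if "g : borel_measurable m" for g n
  using that unfolding dyadic_lower_def by measurable
 have int: "(\<integral>\<^sup>+x. dyadic_lower n (g x) \<partial>m) = (\<Sum>k=1..4^n. ennreal (1 / 2 ^ n) * emeasure m {x. ennreal (real k / 2 ^ n) < g x})"
  if g: "g : borel_measurable m" for g n
 proof -
  have "(\<integral>\<^sup>+x. dyadic_lower n (g x) \<partial>m)
    = (\<Sum>k=1..4^n. \<integral>\<^sup>+x. ennreal (1 / 2 ^ n) * indicator {ennreal (real k / 2 ^ n)<..} (g x) \<partial>m)"
   unfolding dyadic_lower_def using g by (intro nn_integral_sum) measurable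
  also have "... = (\<Sum>k=1..4^n. ennreal (1 / 2 ^ n) * (\<integral>\<^sup>+x. indicator {x. ennreal (real k / 2 ^ n) < g x} x \<partial>m))"
   using g by (intro sum.cong refl trans[OF nn_integral_cmult] arg_cong2[where f = "(*)"] nn_integral_cong)
    (auto simp: indicator_def)
  also have "... = (\<Sum>k=1..4^n. ennreal (1 / 2 ^ n) * emeasure m {x. ennreal (real k / 2 ^ n) < g x})"
   using g measurable_sets[OF g, of "{t<..}" for t] by (intro sum.cong refl arg_cong2[where f = "(*)"] nn_integral_indicator)
    (auto simp: vimage_def greaterThan_def)
  finally show ?thesis .
 qed
 have "(\<integral>\<^sup>+x. dyadic_lower n (G x) \<partial>m) <= (SUP i\<in>I. \<integral>\<^sup>+x. F i x \<partial>m)" for n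
 proof -
  have "(\<integral>\<^sup>+x. dyadic_lower n (G x) \<partial>m) =
    (\<Sum>k=1..4^n. ennreal (1 / 2 ^ n) * (SUP i\<in>I. emeasure m {x. ennreal (real k / 2 ^ n) < F i x}))"
   unfolding int[OF Gmeas] Gt
  proof (intro sum.cong refl arg_cong2[where f = "(*)"] radon_Union_directed[OF m lsc I])
   fix k i j assume "i : I" "j : I"
   then obtain l where "l : I" "ALL x. F i x <= F l x & F j x <= F l x" using dir by blast
   thus "EX l:I. {x. ennreal (real k / 2 ^ n) < F i x} \<subseteq> {x. ennreal (real k / 2 ^ n) < F l x} &
     {x. ennreal (real k / 2 ^ n) < F j x} \<subseteq> {x. ennreal (real k / 2 ^ n) < F l x}"
    by (intro bexI[of _ l]) (auto intro: order_less_le_trans)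
  qed
  also have "... = (\<Sum>k=1..4^n. SUP i\<in>I. ennreal (1 / 2 ^ n) * emeasure m {x. ennreal (real k / 2 ^ n) < F i x})"
   by (simp only: SUP_mult_left_ennreal)
  also have "... = (SUP i\<in>I. \<Sum>k=1..4^n. ennreal (1 / 2 ^ n) * emeasure m {x. ennreal (real k / 2 ^ n) < F i x})"
  proof (rule SUP_sum_directed_ennreal[OF I])
   fix i j assume "i : I" "j : I"
   then obtain l where l: "l : I" "ALL x. F i x <= F l x & F j x <= F l x" using dir by blast
   have "{x. t < F l x} : sets m" for t using lsc[OF l(1)] by simp
   thus "EX l:I. ALL k. ennreal (1 / 2 ^ n) * emeasure m {x. ennreal (real k / 2 ^ n) < F i x}
      <= ennreal (1 / 2 ^ n) * emeasure m {x. ennreal (real k / 2 ^ n) < F l x} &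
     ennreal (1 / 2 ^ n) * emeasure m {x. ennreal (real k / 2 ^ n) < F j x}
      <= ennreal (1 / 2 ^ n) * emeasure m {x. ennreal (real k / 2 ^ n) < F l x}"
    using l by (intro bexI[of _ l] allI conjI mult_left_mono emeasure_mono) (auto intro: order_less_le_trans)
  qed simp
  also have "... = (SUP i\<in>I. \<integral>\<^sup>+x. dyadic_lower n (F i x) \<partial>m)"
   by (intro SUP_cong refl int[symmetric] Fmeas)
  also have "... <= (SUP i\<in>I. \<integral>\<^sup>+x. F i x \<partial>m)"
   by (intro SUP_mono' nn_integral_mono dyadic_lower_le)
  finally show ?thesis .
 qed
 hence "liminf (%n. \<integral>\<^sup>+x. dyadic_lower n (G x) \<partial>m) <= (SUP i\<in>I. \<integral>\<^sup>+x. F i x \<partial>m)"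
  by (intro order_trans[OF Liminf_le_Limsup Limsup_bounded]) auto
 moreover have "(\<integral>\<^sup>+x. G x \<partial>m) <= (\<integral>\<^sup>+x. liminf (%n. dyadic_lower n (G x)) \<partial>m)"
  by (intro nn_integral_mono dyadic_lower_liminf)
 moreover have "... <= liminf (%n. \<integral>\<^sup>+x. dyadic_lower n (G x) \<partial>m)"
  by (rule nn_integral_liminf[OF dG[OF Gmeas]])
 ultimately show "(\<integral>\<^sup>+x. (SUP i\<in>I. F i x) \<partial>m) <= (SUP i\<in>I. \<integral>\<^sup>+x. F i x \<partial>m)"
  unfolding G_def by (meson order_trans)
 show "(SUP i\<in>I. \<integral>\<^sup>+x. F i x \<partial>m) <= (\<integral>\<^sup>+x. (SUP i\<in>I. F i x) \<partial>m)"
  by (intro SUP_least nn_integral_mono SUP_upper)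
qed

section \<open>Iterated integrals over open sets\<close>

lemma open_slices:
 assumes "open W" shows "open {y. (x, y) : W}" "open {x. (x, y) : W}"
proof -
 have "open ((%y. (x, y)) -` W)" "open ((%x. (x, y)) -` W)"
  by (intro open_vimage[OF assms] continuous_intros)+
 thus "open {y. (x, y) : W}" "open {x. (x, y) : W}" by (simp_all add: vimage_def)
qed

text \<open>Inner regularity provides a compact K inside the slice whose measure already exceeds t.
  Finitely many boxes around K, as in the tube lemma, keep K inside all neighbouring slices.\<close>

lemma emeasure_slice_lsc:
 fixes b :: "'b::t2_space measure" and W :: "('a::t2_space \<times> 'b) set"
 assumes b: "radon b" and W: "open W"
 shows "open {x. t < emeasure b {y. (x, y) : W}}"
proof (subst open_subopen, intro ballI)
 fix x assume "x : {x. t < emeasure b {y. (x, y) : W}}"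
 moreover have slice: "open {y. (x, y) : W}" for x
  by (rule open_slices(1)[OF W])
 ultimately have "t < (SUP K\<in>{K. compact K & K \<subseteq> {y. (x, y) : W}}. emeasure b K)"
  using radonD(4)[OF b] by simp
 then obtain K where K: "compact K" "K \<subseteq> {y. (x, y) : W}" "t < emeasure b K"
  by (auto simp: less_SUP_iff)
 have "EX A B. open A & open B & x : A & y : B & A \<times> B \<subseteq> W" if "y : K" for y
 proof -
  have "(x, y) : W" using K(2) that by auto
  then obtain A B where "open A" "open B" "(x, y) : A \<times> B" "A \<times> B \<subseteq> W"
   by (rule open_prod_elim[OF W])
  thus ?thesis by (intro exI[of _ A] exI[of _ B]) auto
 qed
 then obtain A B where AB: "!!y. y : K ==> open (A y) & open (B y) & x : A y & y : B y & A y \<times> B y \<subseteq> W"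
  by metis
 obtain F where F: "F \<subseteq> K" "finite F" "K \<subseteq> (\<Union>y\<in>F. B y)"
 proof (rule compactE_image[OF K(1), of K B])
  show "open (B y)" if "y : K" for y using AB[OF that] by blast
  show "K \<subseteq> (\<Union>y\<in>K. B y)" using AB by blast
 qed
 have "\<Inter>(A ` F) \<subseteq> {x. t < emeasure b {y. (x, y) : W}}"
 proof
  fix x' assume x': "x' : \<Inter>(A ` F)"
  hence "K \<subseteq> {y. (x', y) : W}" using F AB by blast
  hence "emeasure b K <= emeasure b {y. (x', y) : W}"
   using slice radonD(1)[OF b] by (intro emeasure_mono) auto
  thus "x' : {x. t < emeasure b {y. (x, y) : W}}" using K(3) by simp
 qed
 moreover have "open (\<Inter>(A ` F))" "x : \<Inter>(A ` F)" using F AB by (auto intro!: open_INT)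
 ultimately show "EX T. open T & x : T & T \<subseteq> {x. t < emeasure b {y. (x, y) : W}}" by blast
qed

lemma open_swap: "open W ==> open (prod.swap -` W :: ('b::topological_space \<times> 'a::topological_space) set)"
 by (intro open_vimage) (simp_all add: continuous_on_swap)

text \<open>On a finite union of boxes with sides of finite measure both measures can be cut down to
  finite ones, for which the product measure is at hand.\<close>

lemma fubini_open_boxes:
 fixes a :: "'a::t2_space measure" and b :: "'b::t2_space measure"
 assumes a: "radon a" and b: "radon b" and R: "finite R"
  and box: "!!A B. (A, B) : R ==> open A & open B & emeasure a A < \<infinity> & emeasure b B < \<infinity>"
  and S: "S = (\<Union>(A, B)\<in>R. A \<times> B)"
 shows "(\<integral>\<^sup>+x. emeasure b {y. (x, y) : S} \<partial>a) = (\<integral>\<^sup>+y. emeasure a {x. (x, y) : S} \<partial>b)"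
proof -
 note [simp] = radonD(1,2)[OF a] radonD(1,2)[OF b]
 define A0 where "A0 = \<Union>(fst ` R)"
 define B0 where "B0 = \<Union>(snd ` R)"
 have AB: "open A0" "open B0" using box by (auto simp: A0_def B0_def)
 hence sAB: "A0 : sets a" "B0 : sets b" by auto
 have fA: "emeasure a A0 < \<infinity>" and fB: "emeasure b B0 < \<infinity>"
  using emeasure_finite_UN[OF R, of fst a] emeasure_finite_UN[OF R, of snd b] box by (fastforce simp: A0_def B0_def)+
 define M where "M = density a (indicator A0)"
 define M' where "M' = density b (indicator B0)"
 interpret M: finite_measure M
  by (rule finite_measureI) (use fA sAB in \<open>simp add: M_def emeasure_density_indicator\<close>)
 interpret M': finite_measure M'
  by (rule finite_measureI) (use fB sAB in \<open>simp add: M'_def emeasure_density_indicator\<close>)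
 interpret P: pair_sigma_finite M M' ..
 \<comment> \<open>A finite union of boxes belongs to the product sigma-algebra; an arbitrary open
   set need not.\<close>
 have S_meas: "S : sets (M \<Otimes>\<^sub>M M')"
  unfolding S using R box by (intro sets.finite_UN) (auto simp: M_def M'_def intro!: pair_measureI)
 have "open S" unfolding S using box by (auto intro!: open_Times)
 hence sl: "{y. (x, y) : S} : sets borel" "{x. (x, y) : S} : sets borel" for x y
  by (auto intro: borel_open open_slices)
 have S_sub: "x : A0 & y : B0" if xy: "(x, y) : S" for x y
 proof -
  obtain A B where "(A, B) : R" "x : A" "y : B" using xy by (auto simp: S)
  thus ?thesis
   unfolding A0_def B0_def by (metis UnionI fst_conv image_eqI snd_conv)
 qed
 have sub: "{y. (x, y) : S} \<subseteq> B0" "{x. (x, y) : S} \<subseteq> A0" "x \<notin> A0 ==> {y. (x, y) : S} = {}"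
  "y \<notin> B0 ==> {x. (x, y) : S} = {}" for x y
  using S_sub by auto
 have e1: "emeasure M' (Pair x -` S) = emeasure b {y. (x, y) : S}" for x
  using sl sub(1)[of x] sAB by (auto simp: M'_def emeasure_density_indicator vimage_def Int_absorb1)
 have e2: "emeasure M ((%x. (x, y)) -` S) = emeasure a {x. (x, y) : S}" for y
  using sl sub(2)[of y] sAB by (auto simp: M_def emeasure_density_indicator vimage_def Int_absorb1)
 have m1: "(%x. emeasure b {y. (x, y) : S}) : borel_measurable borel"
  by (rule borel_measurableI_greater) (simp add: emeasure_slice_lsc[OF b \<open>open S\<close>])
 have m2: "(%y. emeasure a {x. (x, y) : S}) : borel_measurable borel"
  using emeasure_slice_lsc[OF a open_swap[OF \<open>open S\<close>]]
  by (intro borel_measurableI_greater) (simp add: prod.swap_def)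
 have "(\<integral>\<^sup>+x. emeasure b {y. (x, y) : S} \<partial>a) = (\<integral>\<^sup>+x. emeasure b {y. (x, y) : S} \<partial>M)"
  unfolding M_def using sAB m1 sub(3)
  by (subst nn_integral_density)
   (auto simp: radon_borel_measurable[OF a] radon_borel_measurable[OF b] intro!: nn_integral_cong split: split_indicator)
 also have "... = emeasure (M \<Otimes>\<^sub>M M') S"
  by (simp add: M'.emeasure_pair_measure_alt[OF S_meas] e1)
 also have "... = (\<integral>\<^sup>+y. emeasure a {x. (x, y) : S} \<partial>M')"
  by (simp add: P.emeasure_pair_measure_alt2[OF S_meas] e2)
 also have "... = (\<integral>\<^sup>+y. emeasure a {x. (x, y) : S} \<partial>b)"
  unfolding M'_def using sAB m2 sub(4)
  by (subst nn_integral_density)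
   (auto simp: radon_borel_measurable[OF a] radon_borel_measurable[OF b] intro!: nn_integral_cong split: split_indicator)
 finally show ?thesis .
qed

text \<open>Directed convergence twice: for the measure of each slice, and for the integral of these
  measures, which depend on the point in a lower semicontinuous way.\<close>

lemma slice_integral_directed:
 fixes a :: "'a::t2_space measure" and b :: "'b::t2_space measure"
 assumes a: "radon a" and b: "radon b" and I: "I ~= {}" and op: "!!R. R : I ==> open (S R)"
  and dir: "!!R R'. R : I ==> R' : I ==> EX k:I. S R \<subseteq> S k & S R' \<subseteq> S k"
 shows "(\<integral>\<^sup>+x. emeasure b {y. (x, y) : (\<Union>R\<in>I. S R)} \<partial>a) = (SUP R\<in>I. \<integral>\<^sup>+x. emeasure b {y. (x, y) : S R} \<partial>a)"
proof -
 have "{y. (x, y) : (\<Union>R\<in>I. S R)} = (\<Union>R\<in>I. {y. (x, y) : S R})" for x by auto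
 moreover have "emeasure b (\<Union>R\<in>I. {y. (x, y) : S R}) = (SUP R\<in>I. emeasure b {y. (x, y) : S R})" for x
  by (rule radon_Union_directed[OF b open_slices(1)[OF op] I]) (use dir in blast)+
 moreover have "(\<integral>\<^sup>+x. (SUP R\<in>I. emeasure b {y. (x, y) : S R}) \<partial>a) = (SUP R\<in>I. \<integral>\<^sup>+x. emeasure b {y. (x, y) : S R} \<partial>a)"
 proof (rule nn_integral_SUP_directed[OF a I])
  show "open {x. t < emeasure b {y. (x, y) : S R}}" if "R : I" for R t
   by (rule emeasure_slice_lsc[OF b op[OF that]])
  fix R R' assume "R : I" "R' : I"
  then obtain k where k: "k : I" "S R \<subseteq> S k" "S R' \<subseteq> S k" using dir by blast
  have "emeasure b {y. (x, y) : A} <= emeasure b {y. (x, y) : S k}" if "A \<subseteq> S k" for A x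
   using that open_slices(1)[OF op[OF k(1)]] radonD(1)[OF b] by (intro emeasure_mono) auto
  thus "EX k:I. ALL x. emeasure b {y. (x, y) : S R} <= emeasure b {y. (x, y) : S k} &
    emeasure b {y. (x, y) : S R'} <= emeasure b {y. (x, y) : S k}" using k by blast
 qed
 ultimately show ?thesis by simp
qed

text \<open>The finite unions of boxes inside W with sides of finite measure form a directed family
  with union W.\<close>

lemma fubini_open:
 fixes a :: "'a::t2_space measure" and b :: "'b::t2_space measure"
 assumes a: "radon a" and b: "radon b" and W: "open W"
 shows "(\<integral>\<^sup>+x. emeasure b {y. (x, y) : W} \<partial>a) = (\<integral>\<^sup>+y. emeasure a {x. (x, y) : W} \<partial>b)"
proof -
 define box where "box p \<longleftrightarrow> open (fst p) & open (snd p) & emeasure a (fst p) < \<infinity> & emeasure b (snd p) < \<infinity> &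
   fst p \<times> snd p \<subseteq> W" for p
 define I where "I = {R. finite R & (ALL p:R. box p)}"
 define S where "S R = (\<Union>(A, B)\<in>R. A \<times> B)" for R :: "('a set \<times> 'b set) set"
 have I: "I ~= {}" unfolding I_def by (auto intro!: exI[of _ "{}"])
 have Un: "R \<union> R' : I" "S R \<subseteq> S (R \<union> R')" "S R' \<subseteq> S (R \<union> R')" if "R : I" "R' : I" for R R'
  using that by (auto simp: I_def S_def)
 have Sop: "open (S R)" if "R : I" for R
  using that unfolding S_def I_def box_def by (intro open_UN ballI) (auto intro!: open_Times)
 have W_eq: "W = (\<Union>R\<in>I. S R)"
 proof (rule equalityI; rule subsetI)
  fix z assume z: "z : W"
  obtain A B where AB: "open A" "open B" "z : A \<times> B" "A \<times> B \<subseteq> W"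
   by (rule open_prod_elim[OF W z])
  obtain U V where U: "open U" "fst z : U" "emeasure a U < \<infinity>" and V: "open V" "snd z : V" "emeasure b V < \<infinity>"
   using radonD(3)[OF a, of "fst z"] radonD(3)[OF b, of "snd z"] by auto
  have "emeasure a (A \<inter> U) <= emeasure a U" "emeasure b (B \<inter> V) <= emeasure b V"
   using U V radonD(1)[OF a] radonD(1)[OF b] by (auto intro!: emeasure_mono)
  hence "box (A \<inter> U, B \<inter> V)" using AB U V by (auto simp: box_def intro: le_less_trans)
  hence "{(A \<inter> U, B \<inter> V)} : I" by (simp add: I_def)
  thus "z : (\<Union>R\<in>I. S R)" using AB U V by (intro UN_I) (auto simp: S_def mem_Times_iff)
 next
  fix z assume "z : (\<Union>R\<in>I. S R)"
  then obtain R A B where "R : I" "(A, B) : R" "z : A \<times> B" by (auto simp: S_def)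
  moreover from this have "A \<times> B \<subseteq> W" by (auto simp: I_def box_def dest!: bspec[of _ _ "(A, B)"])
  ultimately show "z : W" by auto
 qed
 have dir: "EX k:I. S R \<subseteq> S k & S R' \<subseteq> S k" if "R : I" "R' : I" for R R' using Un[OF that] by blast
 have dir': "EX k:I. prod.swap -` S R \<subseteq> prod.swap -` S k & prod.swap -` S R' \<subseteq> prod.swap -` S k" if "R : I" "R' : I" for R R'
  using dir[OF that] by blast
 have "(\<integral>\<^sup>+x. emeasure b {y. (x, y) : W} \<partial>a) = (SUP R\<in>I. \<integral>\<^sup>+x. emeasure b {y. (x, y) : S R} \<partial>a)"
  unfolding W_eq by (rule slice_integral_directed[OF a b I Sop dir])
 also have "... = (SUP R\<in>I. \<integral>\<^sup>+y. emeasure a {x. (x, y) : S R} \<partial>b)"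
 proof (intro SUP_cong refl fubini_open_boxes[OF a b])
  show "S R = (\<Union>(A, B)\<in>R. A \<times> B)" for R by (simp add: S_def)
 qed (auto simp: I_def box_def)
 also have "... = (\<integral>\<^sup>+y. emeasure a {x. (x, y) : W} \<partial>b)"
  using slice_integral_directed[OF b a I open_swap[OF Sop] dir'] by (simp add: W_eq)
 finally show ?thesis .
qed

section \<open>Iterated integrals of Borel functions\<close>

text \<open>Finite slices and a finite double integral are what the passage to complements in a
  Dynkin argument requires.\<close>

definition fubini_domain :: "'a::t2_space measure => 'b::t2_space measure => ('a \<times> 'b) set => bool" where
 "fubini_domain a b W \<longleftrightarrow> open W & (ALL x. emeasure b {y. (x, y) : W} < \<infinity>) &
   (ALL y. emeasure a {x. (x, y) : W} < \<infinity>) & (\<integral>\<^sup>+x. emeasure b {y. (x, y) : W} \<partial>a) < \<infinity>"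

text \<open>The slices are regarded as measures on the product space itself. Open sets form an
  intersection-stable generator, so the identity spreads to all Borel sets, where complements are
  handled by subtracting finite quantities, and then to functions by monotone limits.\<close>

lemma kernel_fubini:
 fixes M :: "'a::topological_space => 'c::topological_space measure" and M' :: "'b::topological_space => 'c measure"
 assumes s [simp]: "!!x. sets (M x) = sets borel" "!!y. sets (M' y) = sets borel" "sets a = sets borel" "sets b = sets borel"
  and fin: "!!x. emeasure (M x) UNIV < top" "!!y. emeasure (M' y) UNIV < top" "(\<integral>\<^sup>+x. emeasure (M x) UNIV \<partial>a) < top"
  and op: "!!V. open V ==> (%x. emeasure (M x) V) : borel_measurable borel & (%y. emeasure (M' y) V) : borel_measurable borel &
   (\<integral>\<^sup>+x. emeasure (M x) V \<partial>a) = (\<integral>\<^sup>+y. emeasure (M' y) V \<partial>b)"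
  and f: "f : borel_measurable borel"
 shows "(%x. integral\<^sup>N (M x) f) : borel_measurable borel & (%y. integral\<^sup>N (M' y) f) : borel_measurable borel &
  (\<integral>\<^sup>+x. integral\<^sup>N (M x) f \<partial>a) = (\<integral>\<^sup>+y. integral\<^sup>N (M' y) f \<partial>b)"
proof -
 have [simp]: "space (M x) = UNIV" "space (M' y) = UNIV" for x y
  using sets_eq_imp_space_eq[OF s(1)] sets_eq_imp_space_eq[OF s(2)] by auto
 have [simp]: "borel_measurable (M x) = borel_measurable borel" "borel_measurable (M' y) = borel_measurable borel"
  "borel_measurable a = borel_measurable borel" "borel_measurable b = borel_measurable borel" for x y
  by (auto intro!: measurable_cong_sets)
 have sets: "(%x. emeasure (M x) E) : borel_measurable borel & (%y. emeasure (M' y) E) : borel_measurable borel &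
   (\<integral>\<^sup>+x. emeasure (M x) E \<partial>a) = (\<integral>\<^sup>+y. emeasure (M' y) E \<partial>b)" if "E : sets borel" for E
 proof -
  have I: "Int_stable {S :: 'c set. open S}" "{S :: 'c set. open S} \<subseteq> Pow UNIV" by (auto simp: Int_stable_def)
  have "E : sigma_sets UNIV {S. open S}" using that by (simp add: borel_def)
  thus ?thesis
  proof (induction rule: sigma_sets_induct_disjoint[OF I, consumes 1, case_names basic empty compl union])
   case (compl F)
   hence F: "F : sets borel" by (simp add: borel_def)
   have le: "emeasure (M x) F <= emeasure (M x) UNIV" "emeasure (M' y) F <= emeasure (M' y) UNIV" for x y
    using F by (auto intro: emeasure_mono)
   have nt: "emeasure (M x) F ~= top" "emeasure (M' y) F ~= top" for x y
    using le_less_trans[OF le(1) fin(1)] le_less_trans[OF le(2) fin(2)] by (auto simp: less_top)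
   have d: "emeasure (M x) (UNIV - F) = emeasure (M x) UNIV - emeasure (M x) F"
    "emeasure (M' y) (UNIV - F) = emeasure (M' y) UNIV - emeasure (M' y) F" for x y
    using emeasure_Diff[of "M x" F UNIV] emeasure_Diff[of "M' y" F UNIV] nt F by auto
   have "(\<integral>\<^sup>+x. emeasure (M x) F \<partial>a) ~= top"
    using nn_integral_mono[of a "%x. emeasure (M x) F", OF le(1)] fin(3) by (auto simp: less_top)
   thus ?case
    unfolding d using compl.IH op[of UNIV] le by (subst (1 2) nn_integral_diff) auto
  next
   case (union F)
   hence F: "range F \<subseteq> sets borel" by (auto simp: borel_def)
   have "emeasure (M x) (\<Union>i. F i) = (\<Sum>i. emeasure (M x) (F i))" "emeasure (M' y) (\<Union>i. F i) = (\<Sum>i. emeasure (M' y) (F i))" for x y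
    using suminf_emeasure[of F "M x"] suminf_emeasure[of F "M' y"] F union(1) by simp_all
   moreover have [measurable]: "(%x. emeasure (M x) (F i)) : borel_measurable borel" "(%y. emeasure (M' y) (F i)) : borel_measurable borel" for i
    using union.IH by auto
   ultimately show ?case using union.IH by (simp add: nn_integral_suminf)
  qed (use op in auto)
 qed
 show ?thesis using f
 proof (induction rule: borel_measurable_induct)
  case (set A)
  thus ?case using sets[of A] by simp
 next
  case (mult u c)
  thus ?case by (auto simp: nn_integral_cmult)
 next
  case (add u v)
  thus ?case by (auto simp: nn_integral_add)
 next
  case (seq U)
  have "(SUP i. U i) = (%z. SUP i. U i z)" by (intro ext SUP_apply)
  hence i: "integral\<^sup>N (M x) (SUP i. U i) = (SUP i. integral\<^sup>N (M x) (U i))" "integral\<^sup>N (M' y) (SUP i. U i) = (SUP i. integral\<^sup>N (M' y) (U i))" for x y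
   using seq(1,3) by (simp_all only:) (simp_all add: nn_integral_monotone_convergence_SUP)
  have "incseq (%i x. integral\<^sup>N (M x) (U i))" "incseq (%i y. integral\<^sup>N (M' y) (U i))"
   using seq(3) by (auto simp: incseq_def le_fun_def intro!: nn_integral_mono)
  thus ?case unfolding i using seq.IH by (auto simp: nn_integral_monotone_convergence_SUP intro!: borel_measurable_SUP)
 qed (auto cong: nn_integral_cong)
qed

text \<open>A slice of W carried to the product space along p. Slice integrals thereby become
  integrals against Borel measures on the product.\<close>

definition push_restricted :: "'b set => 'a measure => ('a => 'b) => 'b::topological_space measure" where
 "push_restricted W c p = distr (density c (indicator (p -` W))) borel p"

lemma push_restricted:
 fixes p :: "'a::topological_space => 'b::topological_space"
 assumes c: "sets c = sets borel" and p: "continuous_on UNIV p" and W: "open W"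
 shows "g : borel_measurable borel ==> integral\<^sup>N (push_restricted W c p) g = (\<integral>\<^sup>+z. g (p z) * indicator W (p z) \<partial>c)"
  and "E : sets borel ==> emeasure (push_restricted W c p) E = emeasure c {z. p z : E \<inter> W}"
proof -
 have pm: "p : borel_measurable c" using borel_measurable_continuous_onI[OF p] measurable_cong_sets[OF c refl] by blast
 have "p -` W : sets c" using open_vimage[OF W p] c by simp
 thus K: "integral\<^sup>N (push_restricted W c p) g = (\<integral>\<^sup>+z. g (p z) * indicator W (p z) \<partial>c)" if "g : borel_measurable borel" for g
  unfolding push_restricted_def using pm measurable_compose[OF pm that] that
  by (subst nn_integral_distr) (auto simp: nn_integral_density mult.commute intro!: nn_integral_cong split: split_indicator)
 assume E: "E : sets borel"
 have "p -` (E \<inter> W) : sets borel"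
  using measurable_sets[OF borel_measurable_continuous_onI[OF p], of "E \<inter> W"] E W by simp
 moreover have "(\<integral>\<^sup>+z. indicator E (p z) * indicator W (p z) \<partial>c) = (\<integral>\<^sup>+z. indicator (p -` (E \<inter> W)) z \<partial>c)"
  by (intro nn_integral_cong) (auto split: split_indicator)
 moreover have "emeasure (push_restricted W c p) E = integral\<^sup>N (push_restricted W c p) (indicator E)"
  using E by (simp add: push_restricted_def)
 ultimately show "emeasure (push_restricted W c p) E = emeasure c {z. p z : E \<inter> W}"
  using K[of "indicator E"] E c by (simp add: vimage_def)
qed

lemma fubini_domain_function:
 fixes a :: "'a::t2_space measure" and b :: "'b::t2_space measure" and f :: "'a \<times> 'b => ennreal"
 assumes a: "radon a" and b: "radon b" and W: "fubini_domain a b W" and f: "f : borel_measurable borel"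
 shows "(%x. \<integral>\<^sup>+y. f (x, y) * indicator W (x, y) \<partial>b) : borel_measurable borel &
  (%y. \<integral>\<^sup>+x. f (x, y) * indicator W (x, y) \<partial>a) : borel_measurable borel &
  (\<integral>\<^sup>+x. \<integral>\<^sup>+y. f (x, y) * indicator W (x, y) \<partial>b \<partial>a) = (\<integral>\<^sup>+y. \<integral>\<^sup>+x. f (x, y) * indicator W (x, y) \<partial>a \<partial>b)"
proof -
 note [simp] = radonD(1,2)[OF a] radonD(1,2)[OF b] radon_borel_measurable[OF a] radon_borel_measurable[OF b]
 have W': "open W" "!!x. emeasure b {y. (x, y) : W} < \<infinity>" "!!y. emeasure a {x. (x, y) : W} < \<infinity>"
  "(\<integral>\<^sup>+x. emeasure b {y. (x, y) : W} \<partial>a) < \<infinity>"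
  using W by (auto simp: fubini_domain_def)
 have p: "continuous_on UNIV (Pair x)" "continuous_on UNIV (%x. (x, y))" for x :: 'a and y :: 'b
  by (intro continuous_intros)+
 have "(%x. integral\<^sup>N (push_restricted W b (Pair x)) f) : borel_measurable borel & (%y. integral\<^sup>N (push_restricted W a (%x. (x, y))) f) : borel_measurable borel &
  (\<integral>\<^sup>+x. integral\<^sup>N (push_restricted W b (Pair x)) f \<partial>a) = (\<integral>\<^sup>+y. integral\<^sup>N (push_restricted W a (%x. (x, y))) f \<partial>b)"
 proof (rule kernel_fubini)
  fix V :: "('a \<times> 'b) set" assume V: "open V"
  hence o: "open (V \<inter> W)" using W'(1) by auto
  have "(%x. emeasure b {y. (x, y) : V \<inter> W}) : borel_measurable borel"
   by (rule borel_measurableI_greater) (use emeasure_slice_lsc[OF b o] in simp)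
  moreover have "(%y. emeasure a {x. (x, y) : V \<inter> W}) : borel_measurable borel"
   by (rule borel_measurableI_greater) (use emeasure_slice_lsc[OF a open_swap[OF o]] in \<open>simp add: prod.swap_def\<close>)
  ultimately show "(%x. emeasure (push_restricted W b (Pair x)) V) : borel_measurable borel & (%y. emeasure (push_restricted W a (%x. (x, y))) V) : borel_measurable borel &
   (\<integral>\<^sup>+x. emeasure (push_restricted W b (Pair x)) V \<partial>a) = (\<integral>\<^sup>+y. emeasure (push_restricted W a (%x. (x, y))) V \<partial>b)"
   using V fubini_open[OF a b o] by (simp add: push_restricted p W'(1))
 qed (use W' f in \<open>simp_all add: push_restricted p, simp_all add: push_restricted_def\<close>)
 thus ?thesis using f by (simp add: push_restricted p W'(1))
qed

lemma fubini_sigma_domain: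
 fixes a :: "'a::t2_space measure" and b :: "'b::t2_space measure" and f :: "'a \<times> 'b => ennreal"
 assumes a: "radon a" and b: "radon b" and W: "!!n::nat. fubini_domain a b (W n)" "incseq W"
  and f: "f : borel_measurable borel" and supp: "!!z. z \<notin> (\<Union>n. W n) ==> f z = 0"
 shows "(%x. \<integral>\<^sup>+y. f (x, y) \<partial>b) : borel_measurable borel"
  "(\<integral>\<^sup>+x. \<integral>\<^sup>+y. f (x, y) \<partial>b \<partial>a) = (\<integral>\<^sup>+y. \<integral>\<^sup>+x. f (x, y) \<partial>a \<partial>b)"
proof -
 note [simp] = radonD(1,2)[OF a] radonD(1,2)[OF b] radon_borel_measurable[OF a] radon_borel_measurable[OF b]
 have Wb: "W n : sets borel" for n using W by (simp add: fubini_domain_def)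
 have P1: "Pair x : borel \<rightarrow>\<^sub>M (borel :: ('a \<times> 'b) measure)" for x
  by (intro borel_measurable_continuous_onI continuous_intros)
 have P2: "(%x. (x, y)) : borel \<rightarrow>\<^sub>M (borel :: ('a \<times> 'b) measure)" for y
  by (intro borel_measurable_continuous_onI continuous_intros)
 have gW: "(%z. f z * indicator (W n) z) : borel_measurable borel" for n
  using f Wb by measurable
 have U: "(%y. f (x, y) * indicator (W n) (x, y)) : borel_measurable borel"
   "(%x. f (x, y) * indicator (W n) (x, y)) : borel_measurable borel" for n x y
  using measurable_compose[OF P1 gW] measurable_compose[OF P2 gW] .
 have mono: "f z * indicator (W n) z <= f z * indicator (W n') z" if "n <= n'" for n n' z
  using incseqD[OF W(2) that] by (auto intro!: mult_left_mono split: split_indicator)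
 have eq: "f z = (SUP n. f z * indicator (W n) z)" for z
  by (rule SUP_mult_indicator[symmetric]) (rule supp)
 have e1: "(\<integral>\<^sup>+y. f (x, y) \<partial>b) = (SUP n. \<integral>\<^sup>+y. f (x, y) * indicator (W n) (x, y) \<partial>b)" for x
  by (subst eq, intro nn_integral_monotone_convergence_SUP) (auto simp: incseq_def le_fun_def mono U)
 have e2: "(\<integral>\<^sup>+x. f (x, y) \<partial>a) = (SUP n. \<integral>\<^sup>+x. f (x, y) * indicator (W n) (x, y) \<partial>a)" for y
  by (subst eq, intro nn_integral_monotone_convergence_SUP) (auto simp: incseq_def le_fun_def mono U)
 have inc1: "incseq (%n x. \<integral>\<^sup>+y. f (x, y) * indicator (W n) (x, y) \<partial>b)"
   "incseq (%n y. \<integral>\<^sup>+x. f (x, y) * indicator (W n) (x, y) \<partial>a)"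
  using mono by (auto simp: incseq_def le_fun_def intro!: nn_integral_mono)
 note F = fubini_domain_function[OF a b W(1) f]
 show "(%x. \<integral>\<^sup>+y. f (x, y) \<partial>b) : borel_measurable borel" unfolding e1
  using F by (intro borel_measurable_SUP) auto
 show "(\<integral>\<^sup>+x. \<integral>\<^sup>+y. f (x, y) \<partial>b \<partial>a) = (\<integral>\<^sup>+y. \<integral>\<^sup>+x. f (x, y) \<partial>a \<partial>b)"
 proof -
  have "(\<integral>\<^sup>+x. (SUP n. \<integral>\<^sup>+y. f (x, y) * indicator (W n) (x, y) \<partial>b) \<partial>a) =
    (SUP n. \<integral>\<^sup>+x. \<integral>\<^sup>+y. f (x, y) * indicator (W n) (x, y) \<partial>b \<partial>a)"
   by (rule nn_integral_monotone_convergence_SUP[OF inc1(1)]) (use F in simp)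
  moreover have "(\<integral>\<^sup>+y. (SUP n. \<integral>\<^sup>+x. f (x, y) * indicator (W n) (x, y) \<partial>a) \<partial>b) =
    (SUP n. \<integral>\<^sup>+y. \<integral>\<^sup>+x. f (x, y) * indicator (W n) (x, y) \<partial>a \<partial>b)"
   by (rule nn_integral_monotone_convergence_SUP[OF inc1(2)]) (use F in simp)
  ultimately show ?thesis unfolding e1 e2 using F by simp
 qed
qed

lemma radon_finite_fubini:
 fixes a :: "'a::t2_space measure" and b :: "'b::t2_space measure" and f :: "'a \<times> 'b => ennreal"
 assumes a: "radon a" "emeasure a UNIV < \<infinity>" and b: "radon b" "emeasure b UNIV < \<infinity>"
  and f: "f : borel_measurable borel"
 shows "(\<integral>\<^sup>+x. \<integral>\<^sup>+y. f (x, y) \<partial>b \<partial>a) = (\<integral>\<^sup>+y. \<integral>\<^sup>+x. f (x, y) \<partial>a \<partial>b)"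
proof (rule fubini_sigma_domain(2)[OF a(1) b(1), of "%_. UNIV"])
 show "fubini_domain a b UNIV"
  using a b by (simp add: fubini_domain_def radonD(2)[OF a(1)] ennreal_mult_less_top)
qed (use f in \<open>auto simp: incseq_def\<close>)

lemma radon_null_measure: "radon (null_measure borel :: 'b::t2_space measure)"
proof -
 have "(SUP x\<in>A. 0 :: ennreal) = 0" for A :: "'b set set" by (simp flip: bot_ennreal)
 thus ?thesis unfolding radon_def by (auto intro!: exI[of _ UNIV])
qed

text \<open>Measurability in x concerns b alone, so the null measure is put on the first factor; the
  whole product is then a Fubini domain.\<close>

lemma radon_slice_integral_measurable:
 fixes b :: "'b::t2_space measure" and f :: "'a::t2_space \<times> 'b => ennreal"
 assumes b: "radon b" "emeasure b UNIV < \<infinity>" and f: "f : borel_measurable borel"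
 shows "(%x. \<integral>\<^sup>+y. f (x, y) \<partial>b) : borel_measurable borel"
proof (rule fubini_sigma_domain(1)[OF radon_null_measure b(1), of "%_. UNIV"])
 show "fubini_domain (null_measure borel) b UNIV"
  using b by (simp add: fubini_domain_def)
qed (use f in \<open>auto simp: incseq_def\<close>)

section \<open>Haar measure\<close>

locale haar =
 fixes m :: "'a::{topological_ab_group_add, t2_space} measure"
 assumes lc: "locally_compact_space (euclidean :: 'a topology)" and haar: "haar_measure m"
begin

lemma sets_m [simp]: "sets m = sets borel" and space_m [simp]: "space m = UNIV"
 using haar sets_eq_imp_space_eq[of m borel] by (auto simp: haar_measure_def)

lemma m_measurable [simp]: "borel_measurable m = borel_measurable borel" "measurable N m = measurable N borel"
 "measurable m N = measurable borel N"
 by (auto intro!: measurable_cong_sets)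

lemma compact_nbhd: "EX U K. open U & compact K & (x::'a) : U & U \<subseteq> K"
 using lc by (auto simp: locally_compact_space_def)

lemma finite_compact: "compact K ==> emeasure m K < \<infinity>"
 using haar by (simp add: haar_measure_def)

lemma outer: "A : sets borel ==> emeasure m A = (INF U\<in>{U. open U & A \<subseteq> U}. emeasure m U)"
 using haar by (simp add: haar_measure_def)

lemma radon_m: "radon m"
 unfolding radon_def
proof (intro conjI allI impI)
 fix x :: 'a
 obtain U K where U: "open U" "compact K" "x : U" "U \<subseteq> K" using compact_nbhd by blast
 hence "emeasure m U <= emeasure m K" by (intro emeasure_mono) (auto simp: borel_compact)
 thus "EX U. open U & x : U & emeasure m U < \<infinity>"
  using U finite_compact[OF U(2)] by (intro exI[of _ U]) (auto intro: le_less_trans)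
qed (use haar in \<open>auto simp: haar_measure_def\<close>)

lemma open_outer:
 assumes A: "A : sets borel" and lt: "emeasure m A < e"
 shows "EX U. open U & A \<subseteq> U & emeasure m U < e"
 using lt unfolding outer[OF A] by (auto simp: INF_less_iff)

lemma shift_measurable [measurable]: "(%x::'a. x + g) : borel \<rightarrow>\<^sub>M borel" "(%x::'a. g + x) : borel \<rightarrow>\<^sub>M borel"
 "(%x::'a. x - g) : borel \<rightarrow>\<^sub>M borel" "(%x::'a. g - x) : borel \<rightarrow>\<^sub>M borel" "(uminus :: 'a => 'a) : borel \<rightarrow>\<^sub>M borel"
 by (intro borel_measurable_continuous_onI continuous_intros)+

lemma emeasure_shift: "A : sets borel ==> emeasure m {x. x + g : A} = emeasure m A"
proof -
 assume A: "A : sets borel"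
 have "{x. x + g : A} = (%x. - g + x) ` A"
 proof (rule set_eqI)
  show "x : {x. x + g : A} \<longleftrightarrow> x : (%x. - g + x) ` A" for x
   by (auto simp: image_iff intro!: bexI[of _ "x + g"] simp: algebra_simps)
 qed
 thus ?thesis using haar A by (simp only: haar_measure_def)
qed

lemma distr_shift: "distr m borel (%x. x + g) = m"
 by (rule measure_eqI) (simp_all add: emeasure_distr vimage_def emeasure_shift)

lemma nn_integral_shift: "f : borel_measurable borel ==> (\<integral>\<^sup>+x. f (x + g) \<partial>m) = (\<integral>\<^sup>+x. f x \<partial>m)"
 using nn_integral_distr[of "%x. x + g" m borel f] by (simp add: distr_shift)

lemma compact_translates_cover:
 assumes K: "compact (K::'a set)" and U: "open U" "U ~= {}"
 shows "EX F. finite F & K \<subseteq> (\<Union>g\<in>F. {x. x + g : U})"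
proof -
 obtain u where u: "u : U" using U by auto
 have "open {x. x + g : U}" for g
  using open_vimage[OF U(1), of "%x. x + g"] by (simp add: vimage_def continuous_intros)
 moreover have "K \<subseteq> (\<Union>g\<in>UNIV. {x. x + g : U})"
 proof
  fix x assume "x : K"
  have "x + (u - x) : U" using u by simp
  thus "x : (\<Union>g\<in>UNIV. {x. x + g : U})" by blast
 qed
 ultimately obtain F where "finite F" "K \<subseteq> (\<Union>g\<in>F. {x. x + g : U})"
  using compactE_image[OF K, of UNIV "%g. {x. x + g : U}"] by metis
 thus ?thesis by blast
qed

text \<open>Finitely many translates of a null open set would cover any compact set; so all compact
  sets would be null, and by inner regularity the whole group.\<close>

lemma open_positive:
 assumes U: "open U" "U ~= {}" shows "emeasure m U > 0"
proof (rule ccontr)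
 assume "\<not> emeasure m U > 0"
 hence U0: "emeasure m U = 0" by simp
 have "emeasure m K = 0" if K: "compact K" for K
 proof -
  obtain F where F: "finite F" "K \<subseteq> (\<Union>g\<in>F. {x. x + g : U})" using compact_translates_cover[OF K U] by blast
  have s: "{x. x + g : U} : null_sets m" for g
   using emeasure_shift[of U g] U0 U(1) measurable_sets[of "%x. x + g" borel borel U]
   by (auto simp: null_sets_def vimage_def)
  have "(\<Union>g\<in>F. {x. x + g : U}) : null_sets m" by (rule null_sets_UN') (use F s in \<open>auto intro: countable_finite\<close>)
  hence "K : null_sets m"
   by (rule null_sets_subset) (use F K in \<open>auto simp: borel_compact\<close>)
  thus ?thesis by auto
 qed
 hence "emeasure m UNIV = 0" using radonD(4)[OF radon_m, of UNIV] by (simp add: flip: bot_ennreal)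
 thus False using haar by (simp add: haar_measure_def)
qed

text \<open>The double integral of 1_U(x) 1_V(x + z) is evaluated in two ways: integrating over z
  first it is m(V) m(U), and after replacing x by x - z it is m(V) m(-U). V is chosen with 0 < m(V)
  < \<infinity> so that this factor cancels, also when m(U) is infinite.\<close>

lemma emeasure_uminus_open:
 assumes U: "open U" shows "emeasure m {x. - x : U} = emeasure m U"
proof -
 obtain V K where V: "open V" "compact K" "(0::'a) : V" "V \<subseteq> K" using compact_nbhd by blast
 have Vfin: "emeasure m V < \<infinity>"
  using finite_compact[OF V(2)] emeasure_mono[of V K m] V by (auto simp: borel_compact intro: le_less_trans)
 have Vpos: "emeasure m V > 0" using open_positive[OF V(1)] V(3) by auto
 have oU: "open {x. - x : U}"
  using open_vimage[OF U, of uminus] by (simp add: vimage_def continuous_intros)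
 have ind: "(\<integral>\<^sup>+x. c * indicator A x \<partial>m) = c * emeasure m A" if "A : sets borel" for c A
  using that by (simp add: nn_integral_cmult)
 define W1 where "W1 = {(x::'a, z). x : U & x + z : V}"
 have cont: "open {z::'a\<times>'a. h z : S}" if "open S" "continuous_on UNIV h" for S :: "'a set" and h
  using open_vimage[OF that] by (simp add: vimage_def)
 have fst_snd: "continuous_on UNIV (fst :: 'a \<times> 'a => 'a)" "continuous_on UNIV (snd :: 'a \<times> 'a => 'a)"
  by (auto intro: continuous_on_fst continuous_on_snd continuous_on_id)
 have "open W1"
  unfolding W1_def case_prod_beta' Collect_conj_eq
  by (intro open_Int cont U V continuous_on_add fst_snd)
 have "emeasure m V * emeasure m U = (\<integral>\<^sup>+x. emeasure m {z. (x, z) : W1} \<partial>m)"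
 proof -
  have "emeasure m {z. (x, z) : W1} = emeasure m V * indicator U x" for x
   using emeasure_shift[of V x] V(1) by (auto simp: W1_def add.commute split: split_indicator)
  thus ?thesis using ind[of U "emeasure m V"] U by simp
 qed
 also have "... = (\<integral>\<^sup>+z. emeasure m {x. (x, z) : W1} \<partial>m)"
  by (rule fubini_open[OF radon_m radon_m \<open>open W1\<close>])
 \<comment> \<open>For fixed z the variable x is shifted by -z, which turns the condition on x + z
   into one on x.\<close>
 also have "... = (\<integral>\<^sup>+z. emeasure m {x. x - z : U & x : V} \<partial>m)"
 proof (rule nn_integral_cong)
  fix z
  have "{x. x - z : U & x : V} : sets borel"
   using open_Int[OF open_vimage[OF U, of "%x. x - z"] V(1)] by (auto simp: vimage_def Int_def continuous_intros)
  from emeasure_shift[OF this, of z] show "emeasure m {x. (x, z) : W1} = emeasure m {x. x - z : U & x : V}"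
   by (simp add: W1_def)
 qed
 also have "... = (\<integral>\<^sup>+x. emeasure m {z. x - z : U & x : V} \<partial>m)"
 proof -
  define W2 where "W2 = {(z::'a, x). x - z : U & x : V}"
  have "open W2"
   unfolding W2_def case_prod_beta' Collect_conj_eq
   by (intro open_Int cont U V continuous_on_diff fst_snd)
  from fubini_open[OF radon_m radon_m this] show ?thesis by (simp add: W2_def)
 qed
 also have "... = emeasure m V * emeasure m {x. - x : U}"
 proof -
  have "emeasure m {z. x - z : U & x : V} = emeasure m {x. - x : U} * indicator V x" for x
  proof (cases "x : V")
   case True
   have "{z. z + - x : {x. - x : U}} = {z. x - z : U & x : V}" using True by simp
   thus ?thesis using emeasure_shift[of "{x. - x : U}" "- x"] oU True by simp
  qed simp
  thus ?thesis using ind[of V "emeasure m {x. - x : U}"] V(1) by (simp add: mult.commute)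
 qed
 finally show ?thesis
  using Vfin Vpos by (auto simp: ennreal_mult_cancel_left)
qed

lemma emeasure_uminus_le:
 assumes A: "A : sets borel" shows "emeasure m {x. - x : A} <= emeasure m A"
 unfolding outer[OF A]
proof (rule INF_greatest)
 fix U assume "U : {U. open U & A \<subseteq> U}"
 hence U: "open U" "A \<subseteq> U" by auto
 have "emeasure m {x. - x : A} <= emeasure m {x. - x : U}"
  using U open_vimage[OF U(1), of uminus] by (intro emeasure_mono) (auto simp: vimage_def continuous_intros)
 thus "emeasure m {x. - x : A} <= emeasure m U" using emeasure_uminus_open[OF U(1)] by simp
qed

lemma emeasure_uminus:
 assumes A: "A : sets borel" shows "emeasure m {x. - x : A} = emeasure m A"
proof (rule antisym[OF emeasure_uminus_le[OF A]])
 have "{x. - x : A} : sets borel" using measurable_sets[OF shift_measurable(5) A] by (simp add: vimage_def)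
 from emeasure_uminus_le[OF this] show "emeasure m A <= emeasure m {x. - x : A}" by simp
qed

lemma distr_uminus: "distr m borel uminus = m"
 by (rule measure_eqI) (simp_all add: emeasure_distr vimage_def emeasure_uminus)

text \<open>The exhausting sets are open because they have to produce Fubini domains.\<close>

definition sigma_supported :: "('a => ennreal) => bool" where
 "sigma_supported f \<longleftrightarrow> (EX U::nat => 'a set. incseq U & (ALL n. open (U n) & emeasure m (U n) < \<infinity>) & (ALL x. x \<notin> (\<Union>n. U n) --> f x = 0))"

text \<open>Level sets have finite measure by Markov's inequality and are enlarged to open sets by
  outer regularity.\<close>

lemma sigma_supported_finite_integral:
 assumes f: "f : borel_measurable borel" and fin: "(\<integral>\<^sup>+x. f x \<partial>m) < \<infinity>"
 shows "sigma_supported f"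
proof -
 define A where "A n = {x. 1 <= of_nat (Suc n) * f x}" for n
 have A: "A n : sets borel" for n
  using measurable_sets[of "%x. of_nat (Suc n) * f x" borel borel "{1..}"] f by (simp add: A_def vimage_def)
 have "emeasure m (A n) < \<infinity>" for n
 proof -
  have "emeasure m (A n) = emeasure m {x\<in>UNIV. 1 <= of_nat (Suc n) * f x}" by (simp add: A_def)
  also have "... <= of_nat (Suc n) * (\<integral>\<^sup>+x. f x * indicator UNIV x \<partial>m)"
   using nn_integral_Markov_inequality[of f UNIV m "of_nat (Suc n)"] f by (simp del: of_nat_Suc)
  also have "... < \<infinity>" using fin by (simp add: ennreal_mult_less_top of_nat_less_top del: of_nat_Suc)
  finally show ?thesis .
 qed
 hence "EX U. open U & A n \<subseteq> U & emeasure m U < \<infinity>" for n using open_outer[OF A] by blast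
 then obtain U where U: "!!n. open (U n) & A n \<subseteq> U n & emeasure m (U n) < \<infinity>" by metis
 define V where "V n = (\<Union>k\<le>n. U k)" for n
 have "emeasure m (V n) < \<infinity>" for n
  using emeasure_finite_UN[of "{..n}" U m] U by (simp add: V_def)
 moreover have "incseq V" unfolding V_def by (rule incseq_SucI) (auto intro: le_SucI)
 moreover have "open (V n)" for n unfolding V_def using U by auto
 moreover have "f x = 0" if "x \<notin> (\<Union>n. V n)" for x
 proof (rule ccontr)
  assume "f x ~= 0"
  have "EX n. x : A n"
  proof (cases "f x")
   case (real r)
   hence "r > 0" using \<open>f x ~= 0\<close> by (cases "r = 0") auto
   then obtain n where "1 / r <= real (Suc n)" by (meson real_arch_simple le_Suc_eq of_nat_le_iff order_trans)
   hence "1 <= real (Suc n) * r" using \<open>r > 0\<close> by (simp add: field_simps)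
   hence "ennreal 1 <= ennreal (real (Suc n) * r)" by (rule ennreal_leI)
   hence "x : A n" using real by (simp add: A_def ennreal_mult ennreal_of_nat_eq_real_of_nat del: of_nat_Suc)
   thus ?thesis ..
  next
   case top
   thus ?thesis by (auto simp: A_def ennreal_mult_top simp del: of_nat_Suc)
  qed
  then obtain n where "x : A n" ..
  hence "x : V n" using U by (auto simp: V_def)
  thus False using that by blast
 qed
 ultimately show ?thesis unfolding sigma_supported_def by (intro exI[of _ V]) blast
qed

end

section \<open>Lebesgue spaces\<close>

lemma Lp_space_finite:
 "P >= 0 ==> f : Lp_space (ennreal P) M \<longleftrightarrow> f : borel_measurable M & integrable M (%x. norm (f x) powr P)"
 by (simp add: Lp_space_def)

lemma Lp_norm_finite: "P >= 0 ==> Lp_norm (ennreal P) M f = (LINT x|M. norm (f x) powr P) powr (1 / P)"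
 by (simp add: Lp_norm_def)

lemma Lp_space_inf:
 "f : Lp_space top M \<longleftrightarrow> f : borel_measurable M & (EX C>=0. AE x in M. norm (f x) <= C)"
proof -
 have "(EX C>=0. AE x in M. norm (f x) <= C)" if f: "f : borel_measurable M" and fin: "esssup M (%x. ennreal (norm (f x))) < top"
 proof -
  obtain C where C: "esssup M (%x. ennreal (norm (f x))) = ennreal C" "C >= 0"
   using fin by (cases "esssup M (%x. ennreal (norm (f x)))") auto
  have "AE x in M. ennreal (norm (f x)) <= ennreal C" using esssup_AE[of "%x. ennreal (norm (f x))" M] C by simp
  hence "AE x in M. norm (f x) <= C" by eventually_elim (use C in simp)
  thus ?thesis using C by auto
 qed
 moreover have "esssup M (%x. ennreal (norm (f x))) < top"
  if f: "f : borel_measurable M" and C: "C >= 0" "AE x in M. norm (f x) <= C" for C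
 proof -
  have "esssup M (%x. ennreal (norm (f x))) <= ennreal C"
   using f C(2) by (intro esssup_I) (auto elim!: eventually_mono intro: ennreal_leI)
  thus ?thesis by (rule le_less_trans) simp
 qed
 ultimately show ?thesis by (auto simp: Lp_space_def)
qed

lemma Lp_norm_inf_AE: "f : Lp_space top M ==> AE x in M. norm (f x) <= Lp_norm top M f"
proof -
 assume f: "f : Lp_space top M"
 have "AE x in M. ennreal (norm (f x)) <= esssup M (%x. ennreal (norm (f x)))"
  using f by (intro esssup_AE)
 thus ?thesis
 proof eventually_elim
  case (elim x)
  thus ?case using f enn2real_mono[OF elim] by (simp add: Lp_norm_def Lp_space_def)
 qed
qed

lemma Lp_norm_inf_le:
 assumes "f : borel_measurable M" "AE x in M. norm (f x) <= C" "C >= 0" shows "Lp_norm top M f <= C"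
proof -
 have "esssup M (%x. ennreal (norm (f x))) <= ennreal C"
  using assms by (intro esssup_I) (auto elim!: eventually_mono intro: ennreal_leI)
 hence "enn2real (esssup M (%x. ennreal (norm (f x)))) <= enn2real (ennreal C)"
  by (intro enn2real_mono) auto
 thus ?thesis using assms by (simp add: Lp_norm_def)
qed

lemma Lp_norm_nonneg: "0 <= Lp_norm p M f"
 by (simp add: Lp_norm_def)

lemma Lp_measurable: "f : Lp_space p M ==> f : borel_measurable M"
 by (auto simp: Lp_space_def split: if_splits)

section \<open>Conjugate exponents and Hoelder's inequality\<close>

definition conjugate_exponents :: "ennreal => ennreal => bool" where
 "conjugate_exponents p q \<longleftrightarrow> (p = 1 & q = top) \<or> (p = top & q = 1) \<or>
   (EX P Q. p = ennreal P & q = ennreal Q & 1 < P & 1 < Q & 1 / P + 1 / Q = 1)"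

lemma conjugate_exponents_cases [consumes 1, case_names one_inf inf_one finite]:
 assumes "conjugate_exponents p q"
 obtains "p = 1" "q = top" | "p = top" "q = 1"
 | P Q where "p = ennreal P" "q = ennreal Q" "1 < P" "1 < Q" "1 / P + 1 / Q = 1"
 using assms by (auto simp: conjugate_exponents_def)

lemma conjugate_exponents_sym: "conjugate_exponents p q ==> conjugate_exponents q p"
 unfolding conjugate_exponents_def by (auto simp: add.commute)

lemma conjugate_exponent_exists: "1 <= p ==> EX q. conjugate_exponents p q"
proof (cases p)
 case (real P)
 assume "1 <= p"
 hence "1 <= P" using real by simp
 show ?thesis
 proof (cases "P = 1")
  case False
  hence "1 < P" using \<open>1 <= P\<close> by simp
  hence "1 < P / (P - 1)" "1 / P + 1 / (P / (P - 1)) = 1" by (auto simp: field_simps)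
  thus ?thesis using real \<open>1 < P\<close> unfolding conjugate_exponents_def by blast
 qed (use real in \<open>auto simp: conjugate_exponents_def\<close>)
qed (auto simp: conjugate_exponents_def)

lemma Young_inequality:
 fixes a b P Q :: real
 assumes "a >= 0" "b >= 0" "1 < P" "1 < Q" "1 / P + 1 / Q = 1"
 shows "a * b <= a powr P / P + b powr Q / Q"
proof (cases "a = 0 \<or> b = 0")
 case True
 thus ?thesis using assms by (auto intro!: add_nonneg_nonneg)
next
 case False
 hence ab: "a > 0" "b > 0" using assms by auto
 have "(a powr P) powr (1 / P) * (b powr Q) powr (1 / Q) <= 1 / P * a powr P + 1 / Q * b powr Q"
  using assms ab by (intro Youngs_inequality_0) auto
 thus ?thesis using ab assms by (simp add: powr_powr)
qed

lemma Lp_AE_cong: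
 assumes "f : Lp_space p M" "g : borel_measurable M" "AE x in M. f x = g x"
 shows "g : Lp_space p M" "Lp_norm p M g = Lp_norm p M f"
proof -
 have f: "f : borel_measurable M" using assms(1) by (rule Lp_measurable)
 have ae: "AE x in M. norm (f x) powr r = norm (g x) powr r" for r
  using assms(3) by eventually_elim simp
 have 1: "integrable M (%x. norm (f x) powr enn2real p) = integrable M (%x. norm (g x) powr enn2real p)"
  "(LINT x|M. norm (f x) powr enn2real p) = (LINT x|M. norm (g x) powr enn2real p)"
  using f assms(2) by (intro integrable_cong_AE[OF _ _ ae] integral_cong_AE[OF _ _ ae]; measurable)+
 have 2: "esssup M (%x. ennreal (norm (f x))) = esssup M (%x. ennreal (norm (g x)))"
  using assms(3) by (intro esssup_AE_cong) (use f assms(2) in \<open>auto elim!: eventually_mono\<close>)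
 show "g : Lp_space p M" "Lp_norm p M g = Lp_norm p M f"
  using assms(1,2) 1 2 by (auto simp: Lp_space_def Lp_norm_def)
qed

lemma Lp_scale:
 assumes p: "1 <= p" and f0: "f : Lp_space p M" shows "(%x. c * f x) : Lp_space p M"
  "Lp_norm p M (%x. c * f x) = norm c * Lp_norm p M f"
proof -
 have f: "f : borel_measurable M" using f0 by (rule Lp_measurable)
 have "(%x. c * f x) : Lp_space p M & Lp_norm p M (%x. c * f x) = norm c * Lp_norm p M f" for c
 proof (cases "p = top")
  case True
  have le: "(%x. c * f x) : Lp_space top M & Lp_norm top M (%x. c * f x) <= norm c * Lp_norm top M f"
   if "f : Lp_space top M" for c f
  proof -
   have "AE x in M. norm (c * f x) <= norm c * Lp_norm top M f"
    using Lp_norm_inf_AE[OF that] by eventually_elim (simp add: norm_mult mult_left_mono)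
   thus ?thesis
    using Lp_measurable[OF that] Lp_norm_nonneg[of top M f]
    by (auto simp: Lp_space_inf intro!: Lp_norm_inf_le exI[of _ "norm c * Lp_norm top M f"])
  qed
  show ?thesis
  proof (cases "c = 0")
   case True
   thus ?thesis using le[of f 0] f0 \<open>p = top\<close> Lp_norm_nonneg[of top M "%_. 0"] by (auto intro!: antisym)
  next
   case False
   have "Lp_norm top M f <= norm (1 / c) * Lp_norm top M (%x. c * f x)"
    using le[of "%x. c * f x" "1 / c"] le[of f c] f0 \<open>p = top\<close> False by simp
   thus ?thesis using le[of f c] f0 \<open>p = top\<close> False by (auto simp: norm_divide field_simps intro!: antisym)
  qed
 next
  case False
  then obtain P where P: "p = ennreal P" "P >= 1" using p by (cases p) auto
  hence "integrable M (%x. norm (f x) powr P)" using f0 by (simp add: Lp_space_finite)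
  moreover have "((norm c) powr P * (LINT x|M. norm (f x) powr P)) powr (1 / P) = norm c * (LINT x|M. norm (f x) powr P) powr (1 / P)"
   using P by (simp add: powr_mult powr_powr)
  ultimately show ?thesis using P f
   by (simp add: Lp_space_finite Lp_norm_finite norm_mult powr_mult)
 qed
 thus "(%x. c * f x) : Lp_space p M" "Lp_norm p M (%x. c * f x) = norm c * Lp_norm p M f" by auto
qed

text \<open>Only membership, from a crude estimate of powers. The triangle inequality comes later
  from duality, uniformly in p.\<close>

lemma Lp_add:
 assumes "1 <= p" "f : Lp_space p M" "g : Lp_space p M"
 shows "(%x. f x + g x) : Lp_space p M"
proof (cases p)
 case top
 have "AE x in M. norm (f x + g x) <= Lp_norm top M f + Lp_norm top M g"
  using Lp_norm_inf_AE[of f M] Lp_norm_inf_AE[of g M] assms top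
  by (auto elim!: eventually_elim2 intro: norm_triangle_mono)
 thus ?thesis
  using assms Lp_norm_nonneg[of top M f] Lp_norm_nonneg[of top M g] top
  by (auto simp: Lp_space_inf intro!: exI[of _ "Lp_norm top M f + Lp_norm top M g"])
next
 case (real P)
 hence P: "P >= 1" using assms by simp
 have fg: "f : borel_measurable M" "g : borel_measurable M"
  "integrable M (%x. norm (f x) powr P)" "integrable M (%x. norm (g x) powr P)"
  using assms real P by (auto simp: Lp_space_finite)
 have "norm (a + b) powr P <= 2 powr P * (norm a powr P + norm b powr P)" for a b :: complex
 proof -
  have "norm (a + b) <= 2 * max (norm a) (norm b)" using norm_triangle_ineq[of a b] by simp
  hence "norm (a + b) powr P <= (2 * max (norm a) (norm b)) powr P" using P by (intro powr_mono2) auto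
  also have "... = 2 powr P * max (norm a) (norm b) powr P" by (simp add: powr_mult)
  also have "max (norm a) (norm b) powr P <= norm a powr P + norm b powr P" by (auto simp: max_def)
  finally show ?thesis by simp
 qed
 hence "AE x in M. norm (norm (f x + g x) powr P) <= norm (2 powr P * (norm (f x) powr P + norm (g x) powr P))"
  by simp
 hence "integrable M (%x. norm (f x + g x) powr P)"
  by (rule Bochner_Integration.integrable_bound[rotated 2]) (use fg in auto)
 thus ?thesis using fg real P by (simp add: Lp_space_finite)
qed

lemma Lp_norm_eq_0:
 assumes "1 <= p" "f : Lp_space p M" shows "Lp_norm p M f = 0 \<longleftrightarrow> (AE x in M. f x = 0)"
proof (cases p)
 case top
 have f: "f : borel_measurable M" using assms(2) by (rule Lp_measurable)
 show ?thesis
 proof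
  assume "Lp_norm p M f = 0"
  thus "AE x in M. f x = 0" using Lp_norm_inf_AE[of f M] assms top by auto
 next
  assume "AE x in M. f x = 0"
  hence "Lp_norm top M f <= 0" by (intro Lp_norm_inf_le f) auto
  thus "Lp_norm p M f = 0" using top Lp_norm_nonneg[of top M f] by simp
 qed
next
 case (real P)
 hence P: "P >= 1" using assms by simp
 have fg: "f : borel_measurable M" "integrable M (%x. norm (f x) powr P)"
  using assms real P by (auto simp: Lp_space_finite)
 hence "Lp_norm p M f = 0 \<longleftrightarrow> (LINT x|M. norm (f x) powr P) = 0" using real P by (simp add: Lp_norm_finite)
 also have "... \<longleftrightarrow> (AE x in M. norm (f x) powr P = 0)" by (intro integral_nonneg_eq_0_iff_AE fg) auto
 also have "... \<longleftrightarrow> (AE x in M. f x = 0)" by simp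
 finally show ?thesis .
qed

lemma Holder_inequality_one_inf:
 assumes f: "f : Lp_space 1 M" and g: "g : Lp_space top M"
 shows "integrable M (%x. f x * g x)" "(LINT x|M. norm (f x * g x)) <= Lp_norm 1 M f * Lp_norm top M g"
proof -
 have fi: "integrable M (%x. norm (f x))" "Lp_norm 1 M f = (LINT x|M. norm (f x))" and m: "f : borel_measurable M" "g : borel_measurable M"
  using f g Lp_space_finite[of 1 f M] Lp_norm_finite[of 1 M f] 
  by (auto simp: Lp_measurable integral_nonneg)
 have bd: "AE x in M. norm (f x * g x) <= norm (f x) * Lp_norm top M g"
  using Lp_norm_inf_AE[OF g] by eventually_elim (simp add: norm_mult mult_left_mono)
 show i: "integrable M (%x. f x * g x)"
  by (rule Bochner_Integration.integrable_bound[of M "%x. norm (f x) * Lp_norm top M g"]) (use fi m bd in \<open>auto elim!: eventually_mono\<close>)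
 have "(LINT x|M. norm (f x * g x)) <= (LINT x|M. norm (f x) * Lp_norm top M g)"
  using bd fi i by (intro integral_mono_AE) auto
 thus "(LINT x|M. norm (f x * g x)) <= Lp_norm 1 M f * Lp_norm top M g" using fi by simp
qed

theorem Holder_inequality:
 assumes pq: "conjugate_exponents p q" and f: "f : Lp_space p M" and g: "g : Lp_space q M"
 shows "integrable M (%x. f x * g x)" "(LINT x|M. norm (f x * g x)) <= Lp_norm p M f * Lp_norm q M g"
proof -
 have "integrable M (%x. f x * g x) & (LINT x|M. norm (f x * g x)) <= Lp_norm p M f * Lp_norm q M g"
  using pq
 proof (cases rule: conjugate_exponents_cases)
  case one_inf
  thus ?thesis using Holder_inequality_one_inf[of f M g] f g by simp
 next
  case inf_one
  thus ?thesis using Holder_inequality_one_inf[of g M f] f g by (simp add: mult.commute)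
 next
  case (finite P Q)
  have m: "f : borel_measurable M" "g : borel_measurable M"
   and i: "integrable M (%x. norm (f x) powr P)" "integrable M (%x. norm (g x) powr Q)"
   using f g finite by (auto simp: Lp_space_finite)
  have prod: "integrable M (%x. f x * g x)"
  proof (rule Bochner_Integration.integrable_bound[of M "%x. norm (f x) powr P / P + norm (g x) powr Q / Q"])
   show "AE x in M. norm (f x * g x) <= norm (norm (f x) powr P / P + norm (g x) powr Q / Q)"
    using Young_inequality[of "norm (f _)" "norm (g _)" P Q] finite
    by (intro AE_I2) (auto simp: norm_mult intro: order_trans[OF _ abs_ge_self])
  qed (use m i in auto)
  define a where "a = Lp_norm p M f"
  define b where "b = Lp_norm q M g"
  have ab: "a >= 0" "b >= 0" by (auto simp: a_def b_def Lp_norm_nonneg)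
  have a: "(LINT x|M. norm (f x) powr P) = a powr P" and b: "(LINT x|M. norm (g x) powr Q) = b powr Q"
   using finite by (auto simp: a_def b_def Lp_norm_finite powr_powr)
  have "(LINT x|M. norm (f x * g x)) <= a * b"
  proof (cases "a = 0 \<or> b = 0")
   case True
   hence "(AE x in M. f x = 0) \<or> (AE x in M. g x = 0)"
    using Lp_norm_eq_0[of p f M] Lp_norm_eq_0[of q g M] f g finite by (auto simp: a_def b_def)
   hence "AE x in M. norm (f x * g x) = 0" by (auto elim: eventually_mono)
   hence "(LINT x|M. norm (f x * g x)) = 0" by (rule integral_eq_zero_AE)
   thus ?thesis using ab by simp
  next
   case False
   hence p: "a > 0" "b > 0" using ab by auto
   have "norm (f x * g x) / (a * b) <= norm (f x) powr P / a powr P / P + norm (g x) powr Q / b powr Q / Q" for x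
    using Young_inequality[of "norm (f x) / a" "norm (g x) / b" P Q] finite p by (simp add: norm_mult powr_divide)
   hence "(LINT x|M. norm (f x * g x) / (a * b)) <=
     (LINT x|M. norm (f x) powr P / a powr P / P + norm (g x) powr Q / b powr Q / Q)"
    using prod i by (intro integral_mono) auto
   also have "... = a powr P / a powr P / P + b powr Q / b powr Q / Q" using i a b by simp
   also have "... = 1" using p finite by simp
   finally show ?thesis using p by (simp add: field_simps)
  qed
  thus ?thesis using prod by (simp add: a_def b_def)
 qed
 thus "integrable M (%x. f x * g x)" "(LINT x|M. norm (f x * g x)) <= Lp_norm p M f * Lp_norm q M g" by auto
qed

lemma Holder_integral:
 assumes pq: "conjugate_exponents p q" and f: "f : Lp_space p M" and g: "g : Lp_space q M"
 shows "norm (LINT x|M. f x * g x) <= Lp_norm p M f * Lp_norm q M g"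
 using Holder_inequality(2)[OF assms] integral_norm_bound[of M "%x. f x * g x"] by linarith

section \<open>Test functions and the dual norm\<close>

definition bounded_integrable :: "'a measure => ('a => complex) set" where
 "bounded_integrable M = Lp_space 1 M \<inter> Lp_space top M"

text \<open>Here the exhausting sets are merely measurable and M is arbitrary; for Haar measure this
  amounts to \<open>sigma_supported\<close> of the modulus.\<close>

definition sigma_support :: "'a measure => ('a => complex) => bool" where
 "sigma_support M f \<longleftrightarrow> (EX A::nat => 'a set. (ALL n. A n : sets M & emeasure M (A n) < top) &
   (ALL x:space M. x \<notin> (\<Union>n. A n) --> f x = 0))"

lemma Lp_space_one: "f : Lp_space 1 M \<longleftrightarrow> f : borel_measurable M & integrable M (%x. norm (f x))"
 using Lp_space_finite[of 1 f M] by simp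

lemma Lp_norm_one: "Lp_norm 1 M f = (LINT x|M. norm (f x))"
 using Lp_norm_finite[of 1 M f] by (simp add: integral_nonneg)

lemma bounded_integrableI:
 assumes f: "f : borel_measurable M" and A: "A : sets M" "emeasure M A < top" and K: "!!x. norm (f x) <= K"
  and supp: "!!x. x : space M ==> x \<notin> A ==> f x = 0"
 shows "f : bounded_integrable M"
proof -
 have K0: "K >= 0" using order_trans[OF norm_ge_zero K] .
 have "integrable M (%x. norm (f x))"
 proof (rule Bochner_Integration.integrable_bound[of M "%x. K * indicator A x"])
  show "integrable M (%x. K * indicator A x)" using A by (intro integrable_mult_right integrable_real_indicator) auto
  show "AE x in M. norm (norm (f x)) <= norm (K * indicator A x)"
   using K supp K0 by (intro AE_I2) (auto split: split_indicator)
 qed (use f in auto)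
 moreover have "f : Lp_space top M"
  using f K K0 by (auto simp: Lp_space_inf)
 ultimately show ?thesis using f by (auto simp: bounded_integrable_def Lp_space_one)
qed

lemma bounded_integrable_Lp:
 assumes p: "1 <= p" and f: "f : bounded_integrable M" shows "f : Lp_space p M"
proof (cases p)
 case (real P)
 hence P: "P >= 1" using p by simp
 have m: "f : borel_measurable M" "integrable M (%x. norm (f x))"
  using f by (auto simp: bounded_integrable_def Lp_space_one)
 obtain K where K: "K >= 0" "AE x in M. norm (f x) <= K" using f by (auto simp: bounded_integrable_def Lp_space_inf)
 have "integrable M (%x. norm (f x) powr P)"
 proof (rule Bochner_Integration.integrable_bound[of M "%x. K powr (P - 1) * norm (f x)"])
  show "AE x in M. norm (norm (f x) powr P) <= norm (K powr (P - 1) * norm (f x))"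
   using K(2)
  proof eventually_elim
   case (elim x)
   have "norm (f x) powr P = norm (f x) powr (P - 1) * norm (f x)"
    using powr_mult_base[of "norm (f x)" "P - 1"] by (simp add: mult.commute)
   also have "... <= K powr (P - 1) * norm (f x)"
    using elim P by (intro mult_right_mono powr_mono2) auto
   finally show ?case by simp
  qed
 qed (use m in auto)
 thus ?thesis using m real P by (simp add: Lp_space_finite)
qed (use f in \<open>auto simp: bounded_integrable_def\<close>)

lemma sigma_support_Lp:
 assumes p: "1 <= p" and f: "f : Lp_space p M" and fin: "p = top ==> emeasure M (space M) < top"
 shows "sigma_support M f"
proof (cases p)
 case top
 thus ?thesis
  unfolding sigma_support_def using fin by (intro exI[of _ "%_. space M"]) auto
next
 case (real P)
 hence P: "P >= 1" using p by simp
 have m: "f : borel_measurable M" "integrable M (%x. norm (f x) powr P)" using f real P by (auto simp: Lp_space_finite)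
 define A where "A n = {x\<in>space M. 1 <= ennreal (Suc n) * ennreal (norm (f x) powr P)}" for n :: nat
 have fin: "(\<integral>\<^sup>+x. ennreal (norm (f x) powr P) \<partial>M) < top"
  using m(2) by (simp add: integrable_iff_bounded)
 have "emeasure M (A n) < top" for n
 proof -
  have "emeasure M (A n) <= ennreal (Suc n) * (\<integral>\<^sup>+x. ennreal (norm (f x) powr P) * indicator (space M) x \<partial>M)"
   unfolding A_def using m(1) by (intro nn_integral_Markov_inequality) auto
  also have "(\<integral>\<^sup>+x. ennreal (norm (f x) powr P) * indicator (space M) x \<partial>M) = (\<integral>\<^sup>+x. ennreal (norm (f x) powr P) \<partial>M)"
   by (intro nn_integral_cong) auto
  also have "ennreal (Suc n) * ... < top" using fin by (simp add: ennreal_mult_less_top)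
  finally show ?thesis .
 qed
 moreover have "A n : sets M" for n unfolding A_def using m(1) by measurable
 moreover have "f x = 0" if "x : space M" "x \<notin> (\<Union>n. A n)" for x
 proof (rule ccontr)
  assume "f x ~= 0"
  hence p: "0 < norm (f x) powr P" by simp
  then obtain n where "1 / (norm (f x) powr P) <= real n" using real_arch_simple by blast
  hence "1 <= real n * norm (f x) powr P" using p by (simp add: field_simps)
  also have "... <= real (Suc n) * norm (f x) powr P" using p by simp
  finally have "ennreal 1 <= ennreal (real (Suc n) * norm (f x) powr P)" by (rule ennreal_leI)
  thus False using that by (auto simp: A_def ennreal_mult simp del: of_nat_Suc)
 qed
 ultimately show ?thesis unfolding sigma_support_def by (intro exI[of _ A]) auto
qed

lemma Lp_finite_from_truncations:
 fixes f :: "'a => complex"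
 assumes f: "f : borel_measurable M" and P: "P >= 1" and C: "C >= 0"
  and B: "!!n::nat. B n : sets M" "incseq B" "!!x. x : space M ==> x \<notin> (\<Union>n. B n) ==> f x = 0"
  and I: "!!n. integrable M (%x. norm (f x) powr P * indicator (B n) x)"
  and le: "!!n. (LINT x|M. norm (f x) powr P * indicator (B n) x) <= C powr P"
 shows "f : Lp_space (ennreal P) M & Lp_norm (ennreal P) M f <= C"
proof -
 have eq: "(SUP n. ennreal (norm (f x) powr P) * indicator (B n) x) = ennreal (norm (f x) powr P)" if "x : space M" for x
  by (rule SUP_mult_indicator) (simp add: B(3)[OF that])
 have "(\<integral>\<^sup>+x. ennreal (norm (f x) powr P) \<partial>M) = (\<integral>\<^sup>+x. (SUP n. ennreal (norm (f x) powr P) * indicator (B n) x) \<partial>M)"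
  by (intro nn_integral_cong) (simp add: eq)
 also have "... = (SUP n. \<integral>\<^sup>+x. ennreal (norm (f x) powr P) * indicator (B n) x \<partial>M)"
 proof (rule nn_integral_monotone_convergence_SUP)
  show "incseq (%n x. ennreal (norm (f x) powr P) * indicator (B n) x)"
   using incseqD[OF B(2)] by (auto simp: incseq_def le_fun_def intro!: mult_left_mono split: split_indicator)
 qed (use f B in measurable)
 also have "... <= ennreal (C powr P)"
 proof (rule SUP_least)
  fix n
  have "(\<integral>\<^sup>+x. ennreal (norm (f x) powr P) * indicator (B n) x \<partial>M) = (\<integral>\<^sup>+x. ennreal (norm (f x) powr P * indicator (B n) x) \<partial>M)"
   by (intro nn_integral_cong) (auto split: split_indicator)
  also have "... = ennreal (LINT x|M. norm (f x) powr P * indicator (B n) x)"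
   by (intro nn_integral_eq_integral I) auto
  finally show "(\<integral>\<^sup>+x. ennreal (norm (f x) powr P) * indicator (B n) x \<partial>M) <= ennreal (C powr P)"
   using le[of n] by (simp add: ennreal_leI)
 qed
 finally have fin: "(\<integral>\<^sup>+x. ennreal (norm (f x) powr P) \<partial>M) <= ennreal (C powr P)" .
 have i: "integrable M (%x. norm (f x) powr P)"
  using f fin by (auto simp: integrable_iff_bounded intro: le_less_trans)
 have "ennreal (LINT x|M. norm (f x) powr P) <= ennreal (C powr P)"
  using fin nn_integral_eq_integral[OF i] by simp
 hence "(LINT x|M. norm (f x) powr P) <= C powr P" by simp
 hence "(LINT x|M. norm (f x) powr P) powr (1 / P) <= (C powr P) powr (1 / P)"
  using P by (intro powr_mono2 Bochner_Integration.integral_nonneg) auto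
 hence "(LINT x|M. norm (f x) powr P) powr (1 / P) <= C" using P C by (simp add: powr_powr)
 thus ?thesis using f i P by (simp add: Lp_space_finite Lp_norm_finite)
qed

text \<open>On these sets f is bounded and the measure is finite, so functions built from f on them
  are legitimate test functions even before f is known to lie in any L^p.\<close>

lemma truncation_sets:
 fixes f :: "'a => complex"
 assumes f: "f : borel_measurable M" and supp: "sigma_support M f"
 obtains B :: "nat => 'a set" where "!!n. B n : sets M" "!!n. emeasure M (B n) < top" "incseq B"
  "!!n x. x : B n ==> norm (f x) <= real n" "!!x. x : space M ==> x \<notin> (\<Union>n. B n) ==> f x = 0"
proof -
 obtain A where A: "!!n::nat. A n : sets M" "!!n. emeasure M (A n) < top" "!!x. x : space M ==> x \<notin> (\<Union>n. A n) ==> f x = 0"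
  using supp unfolding sigma_support_def by metis
 define B where "B n = (\<Union>k\<le>n. A k) \<inter> {x\<in>space M. norm (f x) <= real n}" for n
 show ?thesis
 proof
  show "B n : sets M" for n unfolding B_def using A f by measurable
  have "emeasure M (B n) <= emeasure M (\<Union>k\<le>n. A k)" for n using A unfolding B_def by (intro emeasure_mono) auto
  thus "emeasure M (B n) < top" for n by (rule le_less_trans) (use A in \<open>intro emeasure_finite_UN, auto\<close>)
  show "incseq B" unfolding B_def by (rule incseq_SucI) (auto intro: le_SucI)
  show "norm (f x) <= real n" if "x : B n" for n x using that by (auto simp: B_def)
  show "f x = 0" if x: "x : space M" "x \<notin> (\<Union>n. B n)" for x
  proof (rule ccontr)
   assume "f x ~= 0"
   then obtain k where k: "x : A k" using A(3)[of x] x(1) by auto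
   obtain n where n: "norm (f x) <= real n" using real_arch_simple by blast
   have "x : B (max k n)" using k n x(1) by (auto simp: B_def)
   thus False using x(2) by blast
  qed
 qed
qed

text \<open>Both the converse of Hoelder's inequality and a membership criterion: \<open>f\<close> is not assumed to lie in \<open>L\<^sup>p\<close>.\<close>

theorem Lp_dual_norm:
 fixes f :: "'a => complex"
 assumes pq: "conjugate_exponents p q" and f: "f : borel_measurable M" and supp: "sigma_support M f" and C: "C >= 0"
  and h: "!!g. g : bounded_integrable M ==> integrable M (%x. f x * g x) ==>
       norm (LINT x|M. f x * g x) <= C * Lp_norm q M g"
 shows "f : Lp_space p M & Lp_norm p M f <= C"
proof -
 obtain B :: "nat => 'a set" where Bs: "!!n. B n : sets M" and Bfin: "!!n. emeasure M (B n) < top" and Binc: "incseq B"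
  and Bn: "!!n x. x : B n ==> norm (f x) <= real n" and Bsupp: "!!x. x : space M ==> x \<notin> (\<Union>n. B n) ==> f x = 0"
  using truncation_sets[OF f supp] by metis
 \<comment> \<open>Multiplying f by \<open>sg\<close> gives the modulus of f, so \<open>sg\<close>
   times a nonnegative weight is the extremal test function.\<close>
 define sg where "sg x = cnj (sgn (f x))" for x
 have sg: "sg : borel_measurable M" 
 proof -
  have [measurable]: "cnj : borel_measurable borel"
   by (intro borel_measurable_continuous_onI continuous_on_cnj continuous_on_id)
  show ?thesis unfolding sg_def sgn_div_norm using f by measurable
 qed
 have sg1: "norm (sg x) <= 1" "f x ~= 0 ==> norm (sg x) = 1" "f x * sg x = of_real (norm (f x))" for x
  by (auto simp: sg_def norm_sgn) (simp add: sgn_div_norm complex_norm_square[symmetric] scaleR_conv_of_real field_simps power2_eq_square)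
 have test: "(LINT x|M. norm (f x) * (w x * indicator S x)) <= C * Lp_norm q M (%x. sg x * of_real (w x * indicator S x))"
  "integrable M (%x. norm (f x) * (w x * indicator S x))"
  if S: "S : sets M" "S \<subseteq> B n" and w: "w : borel_measurable M" "!!x. x : S ==> 0 <= w x & w x <= K" for S w n and K :: real
 proof -
  have fin: "emeasure M S < top" using le_less_trans[OF emeasure_mono[OF S(2) Bs] Bfin] .
  have g: "(%x. sg x * of_real (w x * indicator S x)) : bounded_integrable M"
  proof (rule bounded_integrableI[OF _ S(1) fin])
   show "norm (sg x * of_real (w x * indicator S x)) <= max K 0" for x
    using mult_mono[OF sg1(1)[of x], of "w x" K] w(2)[of x] by (auto simp: norm_mult split: split_indicator)
  qed (use sg w S in auto)
  have eq: "f x * (sg x * of_real (w x * indicator S x)) = of_real (norm (f x) * (w x * indicator S x))" for x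
   using sg1(3)[of x] by (simp add: mult.assoc[symmetric])
  have "(%x. complex_of_real (norm (f x) * (w x * indicator S x))) : bounded_integrable M"
  proof (rule bounded_integrableI[OF _ S(1) fin])
   show "norm (complex_of_real (norm (f x) * (w x * indicator S x))) <= real n * max K 0" for x
    using mult_mono[of "norm (f x)" "real n" "w x" K] w(2)[of x] S(2) Bn[of x n] by (auto simp: norm_mult split: split_indicator)
  qed (use f w S in auto)
  hence i: "integrable M (%x. complex_of_real (norm (f x) * (w x * indicator S x)))"
   using integrable_norm_cancel[of M "%x. complex_of_real (norm (f x) * (w x * indicator S x))"]
   by (auto simp: bounded_integrable_def Lp_space_one)
  thus "integrable M (%x. norm (f x) * (w x * indicator S x))"
   using integrable_Re[OF i] by simp
  have "(LINT x|M. complex_of_real (norm (f x) * (w x * indicator S x))) = of_real (LINT x|M. norm (f x) * (w x * indicator S x))"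
   by (rule integral_complex_of_real)
  hence "(LINT x|M. norm (f x) * (w x * indicator S x)) <= norm (LINT x|M. f x * (sg x * of_real (w x * indicator S x)))"
   unfolding eq by simp
  also have "... <= C * Lp_norm q M (%x. sg x * of_real (w x * indicator S x))"
   using h[OF g] i unfolding eq by simp
  finally show "(LINT x|M. norm (f x) * (w x * indicator S x)) <= C * Lp_norm q M (%x. sg x * of_real (w x * indicator S x))" .
 qed
 from pq show ?thesis
 proof (cases rule: conjugate_exponents_cases)
  case one_inf
  have t: "(LINT x|M. norm (f x) * (1 * indicator (B n) x)) <= C * Lp_norm q M (%x. sg x * of_real (1 * indicator (B n) x))"
   "integrable M (%x. norm (f x) * (1 * indicator (B n) x))" for n
   using test[OF Bs order_refl, of "%_. 1" n 1] by auto
  have L: "Lp_norm top M (%x. sg x * of_real (1 * indicator (B n) x)) <= 1" for n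
  proof (rule Lp_norm_inf_le)
   show "(%x. sg x * of_real (1 * indicator (B n) x)) : borel_measurable M" using sg Bs by measurable
   show "AE x in M. norm (sg x * of_real (1 * indicator (B n) x)) <= 1"
    using sg1(1) by (intro AE_I2) (auto simp: norm_mult split: split_indicator)
  qed simp
  have "(LINT x|M. norm (f x) * (1 * indicator (B n) x)) <= C" for n
   using order_trans[OF t(1)[unfolded one_inf(2)] mult_left_mono[OF L C]] by simp
  thus ?thesis
   using Lp_finite_from_truncations[OF f order_refl C Bs Binc Bsupp] t(2) C one_inf by simp
 next
  case inf_one
  \<comment> \<open>Where |f| is at least C + e, testing with the indicator of such a set S gives
    that (C + e) m(S) is at most C m(S). The truncation makes m(S) finite, so it is 0.\<close>
  have null: "emeasure M (B n \<inter> {x\<in>space M. C + e <= norm (f x)}) = 0" if e: "e > 0" for n e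
  proof -
   define S where "S = B n \<inter> {x\<in>space M. C + e <= norm (f x)}"
   have S: "S : sets M" "S \<subseteq> B n" unfolding S_def using Bs f by auto
   have fin: "emeasure M S < top" using le_less_trans[OF emeasure_mono[OF S(2) Bs] Bfin] .
   have t: "(LINT x|M. norm (f x) * (1 * indicator S x)) <= C * Lp_norm q M (%x. sg x * of_real (1 * indicator S x))"
    "integrable M (%x. norm (f x) * (1 * indicator S x))"
    using test[OF S, of "%_. 1" 1] by auto
   have "Lp_norm 1 M (%x. sg x * of_real (1 * indicator S x)) = (LINT x|M. norm (sg x * of_real (1 * indicator S x)))"
    by (rule Lp_norm_one)
   also have "... <= (LINT x|M. indicator S x)"
    using sg1(1) S fin sg
    by (intro integral_mono' integrable_real_indicator) (auto simp: norm_mult split: split_indicator)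
   also have "... = measure M S" using S sets.sets_into_space[OF S(1)] by (simp add: Int_absorb2)
   finally have L: "Lp_norm 1 M (%x. sg x * of_real (1 * indicator S x)) <= measure M S" .
   have "(LINT x|M. norm (f x) * (1 * indicator S x)) <= C * measure M S"
    by (rule order_trans[OF t(1)[unfolded inf_one(2)] mult_left_mono[OF L C]])
   moreover have "(C + e) * measure M S <= (LINT x|M. norm (f x) * (1 * indicator S x))"
   proof -
    have "(C + e) * measure M S = (LINT x|M. (C + e) * indicator S x)"
     using S sets.sets_into_space[OF S(1)] by (simp add: Int_absorb2)
    also have "... <= (LINT x|M. norm (f x) * (1 * indicator S x))"
     using t(2) S fin by (intro integral_mono integrable_mult_right integrable_real_indicator)
      (auto simp: S_def split: split_indicator)
    finally show ?thesis .
   qed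
   ultimately have "e * measure M S <= 0" by (simp add: algebra_simps)
   hence "measure M S = 0" using e measure_nonneg[of M S] by (simp add: mult_le_0_iff)
   thus ?thesis using fin unfolding S_def by (auto simp: measure_def enn2real_eq_0_iff)
  qed
  have "AE x in M. ALL n k::nat. x \<notin> B n \<inter> {x\<in>space M. C + 1 / Suc k <= norm (f x)}"
   unfolding AE_all_countable
  proof (intro allI)
   fix n k :: nat
   have "B n \<inter> {x\<in>space M. C + 1 / Suc k <= norm (f x)} : null_sets M"
    using null[of "1 / Suc k" n] Bs f by (auto simp: null_sets_def)
   thus "AE x in M. x \<notin> B n \<inter> {x\<in>space M. C + 1 / Suc k <= norm (f x)}" by (rule AE_not_in)
  qed
  hence "AE x in M. norm (f x) <= C"
   using AE_space
  proof eventually_elim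
   case (elim x)
   show ?case
   proof (rule ccontr)
    assume "\<not> norm (f x) <= C"
    hence p: "norm (f x) - C > 0" by simp
    then obtain k :: nat where "1 / Suc k < norm (f x) - C" using nat_approx_posE[OF p] by auto
    moreover have "f x ~= 0" using p C by auto
    then obtain n where "x : B n" using Bsupp elim(2) by auto
    ultimately show False using elim(1)[rule_format, of n k] elim(2) by auto
   qed
  qed
  thus ?thesis using f C inf_one Lp_norm_inf_le[OF f _ C] by (auto simp: Lp_space_inf)
 next
  case (finite P Q)
  \<comment> \<open>The extremal weight is |f|^(P-1), and this identity makes its Q-th power
    |f|^P.\<close>
  have PQ: "(P - 1) * Q = P" using finite by (simp add: field_simps)
  have t: "(LINT x|M. norm (f x) * (norm (f x) powr (P - 1) * indicator (B n) x)) <=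
    C * Lp_norm q M (%x. sg x * of_real (norm (f x) powr (P - 1) * indicator (B n) x))"
   "integrable M (%x. norm (f x) * (norm (f x) powr (P - 1) * indicator (B n) x))" for n
  proof -
   have "0 <= norm (f x) powr (P - 1) & norm (f x) powr (P - 1) <= real n powr (P - 1)" if "x : B n" for x
    using Bn[OF that] finite by (auto intro: powr_mono2)
   moreover have "(%x. norm (f x) powr (P - 1)) : borel_measurable M" using f by measurable
   ultimately show "(LINT x|M. norm (f x) * (norm (f x) powr (P - 1) * indicator (B n) x)) <=
     C * Lp_norm q M (%x. sg x * of_real (norm (f x) powr (P - 1) * indicator (B n) x))"
    "integrable M (%x. norm (f x) * (norm (f x) powr (P - 1) * indicator (B n) x))"
    using test[OF Bs order_refl, of "%x. norm (f x) powr (P - 1)" n "real n powr (P - 1)"] by blast+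
  qed
  have eq: "norm (f x) * (norm (f x) powr (P - 1) * indicator S x) = norm (f x) powr P * indicator S x" for x and S :: "'a set"
   using powr_mult_base[of "norm (f x)" "P - 1"] by (simp add: mult.assoc[symmetric])
  note t = t[unfolded eq]
  define I where "I n = (LINT x|M. norm (f x) powr P * indicator (B n) x)" for n
  have I0: "I n >= 0" for n unfolding I_def by (intro Bochner_Integration.integral_nonneg) auto
  have "Lp_norm q M (%x. sg x * of_real (norm (f x) powr (P - 1) * indicator (B n) x)) = I n powr (1 / Q)" for n
  proof -
   have "norm (sg x * of_real (norm (f x) powr (P - 1) * indicator (B n) x)) powr Q = norm (f x) powr P * indicator (B n) x" for x
    using sg1(2)[of x] finite by (cases "f x = 0") (auto simp: norm_mult powr_powr PQ split: split_indicator)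
   thus ?thesis using finite by (simp add: Lp_norm_finite I_def)
  qed
  \<comment> \<open>\<open>I n\<close> is finite thanks to the truncation and may be divided off,
    which leaves \<open>I n powr (1 / P)\<close> at most C.\<close>
  hence "I n <= C * I n powr (1 / Q)" for n using t(1)[of n] by (simp add: I_def)
  hence "I n <= C powr P" for n
  proof (cases "I n = 0")
   case False
   hence pos: "I n > 0" using I0[of n] by simp
   assume "!!n. I n <= C * I n powr (1 / Q)"
   hence "I n / I n powr (1 / Q) <= C" using pos by (simp add: divide_le_eq)
   moreover have "I n / I n powr (1 / Q) = I n powr (1 / P)"
   proof -
    have "1 / P = 1 - 1 / Q" using finite by simp
    thus ?thesis using pos by (simp add: powr_diff)
   qed
   ultimately have "(I n powr (1 / P)) powr P <= C powr P" using finite by (intro powr_mono2) auto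
   thus ?thesis using pos finite by (simp add: powr_powr)
  qed simp
  thus ?thesis
   using Lp_finite_from_truncations[OF f _ C Bs Binc Bsupp, of P] t(2) finite by (simp add: I_def)
 qed
qed

corollary Lp_norm_le_dual:
 assumes pq: "conjugate_exponents p q" and f: "f : Lp_space p M" and fin: "p = top ==> emeasure M (space M) < top"
  and C: "C >= 0" and h: "!!g. g : bounded_integrable M ==> norm (LINT x|M. f x * g x) <= C * Lp_norm q M g"
 shows "Lp_norm p M f <= C"
proof -
 have "1 <= p" using pq by (cases rule: conjugate_exponents_cases) auto
 thus ?thesis using Lp_dual_norm[OF pq Lp_measurable[OF f] sigma_support_Lp[OF _ f fin] C h] by auto
qed

lemma conjugate_exponents_ge_1:
 assumes "conjugate_exponents p q" shows "1 <= p" "1 <= q"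
 using assms by (cases rule: conjugate_exponents_cases; simp)+

section \<open>Triangle inequality, density and completeness\<close>

text \<open>The norm is determined by integrals against test functions, and these are additive in f;
  one argument serves all exponents.\<close>

theorem Minkowski_inequality:
 assumes p: "1 <= p" and f: "f : Lp_space p M" and g: "g : Lp_space p M" and fin: "p = top ==> emeasure M (space M) < top"
 shows "Lp_norm p M (%x. f x + g x) <= Lp_norm p M f + Lp_norm p M g"
proof -
 obtain q where q: "conjugate_exponents p q" using conjugate_exponent_exists[OF p] by blast
 show ?thesis
 proof (rule Lp_norm_le_dual[OF q Lp_add[OF p f g] fin])
  fix h assume "h : bounded_integrable M"
  hence h: "h : Lp_space q M" using bounded_integrable_Lp conjugate_exponents_ge_1[OF q] by blast
  have "(LINT x|M. (f x + g x) * h x) = (LINT x|M. f x * h x) + (LINT x|M. g x * h x)"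
   using Holder_inequality(1)[OF q f h] Holder_inequality(1)[OF q g h] by (simp add: distrib_right)
  thus "norm (LINT x|M. (f x + g x) * h x) <= (Lp_norm p M f + Lp_norm p M g) * Lp_norm q M h"
   using norm_triangle_ineq[of "LINT x|M. f x * h x" "LINT x|M. g x * h x"] Holder_integral[OF q f h] Holder_integral[OF q g h]
   by (simp add: distrib_right)
 qed (auto simp: Lp_norm_nonneg)
qed

lemma Lp_diff:
 assumes "1 <= p" "f : Lp_space p M" "g : Lp_space p M" shows "(%x. f x - g x) : Lp_space p M"
 using Lp_add[OF assms(1,2) Lp_scale(1)[OF assms(1,3), of "-1"]] by simp

lemma bounded_integrable_finite_measure:
 assumes "f : Lp_space top M" "emeasure M (space M) < top" shows "f : bounded_integrable M"
proof -
 obtain C where C: "AE x in M. norm (f x) <= C" and f: "f : borel_measurable M"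
  using assms by (auto simp: Lp_space_inf)
 interpret finite_measure M by (rule finite_measureI) (use assms in auto)
 have "integrable M (%x. norm (f x))" by (rule integrable_const_bound[of _ C]) (use C f in auto)
 thus ?thesis using assms f by (auto simp: bounded_integrable_def Lp_space_one)
qed

theorem bounded_integrable_dense:
 assumes p: "1 <= p" and f: "f : Lp_space p M" and fin: "p = top ==> emeasure M (space M) < top" and e: "e > 0"
 shows "EX g:bounded_integrable M. Lp_norm p M (%x. f x - g x) < e"
proof (cases p)
 case top
 have "Lp_norm p M (%x. f x - f x) = 0"
  using Lp_norm_eq_0[OF p Lp_diff[OF p f f]] by simp
 thus ?thesis using bounded_integrable_finite_measure[of f M] f fin e top by (intro bexI[of _ f]) auto
next
 case (real P)
 hence P: "P >= 1" using p by simp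
 have m: "f : borel_measurable M" "integrable M (%x. norm (f x) powr P)" using f real P by (auto simp: Lp_space_finite)
 obtain B :: "nat => 'a set" where Bs: "!!n. B n : sets M" and Bfin: "!!n. emeasure M (B n) < top" and Binc: "incseq B"
  and Bn: "!!n x. x : B n ==> norm (f x) <= real n" and Bsupp: "!!x. x : space M ==> x \<notin> (\<Union>n. B n) ==> f x = 0"
  using truncation_sets[OF m(1) sigma_support_Lp[OF p f fin]] by metis
 define g where "g n x = f x * indicator (B n) x" for n x
 have g: "g n : bounded_integrable M" for n
  by (rule bounded_integrableI[where A = "B n" and K = "real n"]) (use m Bs Bn Bfin in \<open>auto simp: g_def[abs_def] split: split_indicator\<close>)
 have [measurable]: "g n : borel_measurable M" "f : borel_measurable M" for n
  using g[of n] m by (auto simp: bounded_integrable_def Lp_space_one)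
 have "(%n. LINT x|M. norm (f x - g n x) powr P) \<longlonglongrightarrow> (LINT x|M. 0)"
 proof (rule integral_dominated_convergence[where w = "%x. norm (f x) powr P"])
  show "AE x in M. (%n. norm (f x - g n x) powr P) \<longlonglongrightarrow> 0"
  proof (rule AE_I2)
   fix x assume x: "x : space M"
   have "EX N. ALL n>=N. f x = g n x"
   proof (cases "x : (\<Union>n. B n)")
    case True
    then obtain N where "x : B N" by auto
    hence "x : B n" if "n >= N" for n using incseqD[OF Binc that] by auto
    thus ?thesis by (auto simp: g_def intro!: exI[of _ N])
   qed (use Bsupp[OF x] in \<open>auto simp: g_def\<close>)
   hence "eventually (%n. norm (f x - g n x) powr P = 0) sequentially"
    by (auto simp: eventually_sequentially)
   thus "(%n. norm (f x - g n x) powr P) \<longlonglongrightarrow> 0" by (rule tendsto_eventually)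
  qed
  show "AE x in M. norm (norm (f x - g n x) powr P) <= norm (f x) powr P" for n
   using P by (intro AE_I2) (auto simp: g_def split: split_indicator)
 qed (use m in auto)
 hence lim: "(%n. LINT x|M. norm (f x - g n x) powr P) \<longlonglongrightarrow> 0" by simp
 have "e powr P > 0" using e by simp
 then obtain n where n: "(LINT x|M. norm (f x - g n x) powr P) < e powr P"
  using order_tendstoD(2)[OF lim \<open>e powr P > 0\<close>] by (auto simp: eventually_sequentially)
 hence "(LINT x|M. norm (f x - g n x) powr P) powr (1 / P) < (e powr P) powr (1 / P)"
  using P by (intro powr_less_mono2 Bochner_Integration.integral_nonneg) auto
 hence "Lp_norm p M (%x. f x - g n x) < e" using P e real by (simp add: Lp_norm_finite powr_powr)
 thus ?thesis using g by blast
qed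

lemma sigma_support_common:
 assumes "!!n::nat. sigma_support M (f n)"
 shows "EX A::nat => 'a set. (ALL k. A k : sets M & emeasure M (A k) < top) & (ALL n. ALL x:space M. x \<notin> (\<Union>k. A k) --> f n x = 0)"
proof -
 obtain A where A: "!!n k::nat. A n k : sets M" "!!n k. emeasure M (A n k) < top" "!!n x. x : space M ==> x \<notin> (\<Union>k. A n k) ==> f n x = 0"
  using assms unfolding sigma_support_def by metis
 define A' where "A' j = A (fst (prod_decode j)) (snd (prod_decode j))" for j
 have "f n x = 0" if "x : space M" "x \<notin> (\<Union>j. A' j)" for n x
 proof (rule A(3)[OF that(1)])
  have "A n k = A' (prod_encode (n, k))" for k by (simp add: A'_def)
  thus "x \<notin> (\<Union>k. A n k)" using that(2) by auto
 qed
 thus ?thesis using A by (intro exI[of _ A']) (auto simp: A'_def)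
qed

text \<open>Pairing with a strictly positive g in L^q turns a Cauchy sequence of L^p into one of
  L^1, which has a subsequence that converges almost everywhere. Fatou's lemma under the dual norm
  then gives convergence in L^p, again for all exponents at once.\<close>

theorem Lp_complete:
 fixes s :: "nat => 'a => complex"
 assumes p: "1 <= p" and fin: "p = top ==> emeasure M (space M) < top" and s: "!!n. s n : Lp_space p M"
  and cauchy: "!!e. e > 0 ==> EX K. ALL m>=K. ALL n>=K. Lp_norm p M (%x. s m x - s n x) < e"
 shows "EX l:Lp_space p M. (%n. Lp_norm p M (%x. s n x - l x)) \<longlonglongrightarrow> 0"
proof -
 obtain q where q: "conjugate_exponents p q" using conjugate_exponent_exists[OF p] by blast
 have q1: "1 <= q" using conjugate_exponents_ge_1[OF q] by simp
 have sm [measurable]: "s n : borel_measurable M" for n using Lp_measurable[OF s] .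
 obtain K where K: "!!e m n. e > 0 ==> m >= K e ==> n >= K e ==> Lp_norm p M (%x. s m x - s n x) < e"
  using cauchy by metis
 obtain A where A: "!!k::nat. A k : sets M" "!!k. emeasure M (A k) < top"
  "!!n x. x : space M ==> x \<notin> (\<Union>k. A k) ==> s n x = 0"
  using sigma_support_common[of M s] sigma_support_Lp[OF p s fin] by metis
 define S where "S = (\<Union>k. A k)"
 have [measurable]: "S : sets M" using A(1) by (auto simp: S_def)
 \<comment> \<open>M itself may fail to be sigma-finite, but its restriction to the common support
   of the sequence is sigma-finite, which provides a positive integrable weight.\<close>
 interpret N: sigma_finite_measure "density M (indicator S)"
 proof
  show "EX C. countable C & C \<subseteq> sets (density M (indicator S)) & \<Union> C = space (density M (indicator S)) & (ALL a:C. emeasure (density M (indicator S)) a ~= \<infinity>)"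
  proof (intro exI[of _ "insert (space M - S) (range A)"] conjI ballI)
   fix a assume "a : insert (space M - S) (range A)"
   thus "emeasure (density M (indicator S)) a ~= \<infinity>"
    using A by (auto simp: emeasure_density_indicator S_def less_top Int_absorb1 UN_upper)
  qed (use A(1) sets.sets_into_space[OF A(1)] in \<open>auto simp: S_def\<close>)
 qed
 obtain w :: "'a => real" where w: "w : borel_measurable M" "!!x. 0 < w x" "!!x. w x <= 1" "integrable (density M (indicator S)) w"
  using N.obtain_positive_integrable_function by auto
 note [measurable] = w(1)
 \<comment> \<open>Positive on S, bounded by 1 and integrable: a test function for every q.\<close>
 define g where "g x = complex_of_real (indicator S x * w x)" for x
 have gm [measurable]: "g : borel_measurable M" unfolding g_def[abs_def] by measurable
 have "norm (g x) <= 1" for x using w(3)[of x] less_imp_le[OF w(2)[of x]] by (auto simp: g_def split: split_indicator)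
 hence "g : Lp_space top M" by (auto simp: Lp_space_inf intro!: exI[of _ 1])
 moreover have "integrable M (%x. indicator S x *\<^sub>R w x)"
  using w(4) integrable_density[of w M "indicator S"] by (simp add: ennreal_indicator)
 hence "integrable M (%x. norm (g x))"
  using less_imp_le[OF w(2)] by (simp add: g_def norm_mult)
 ultimately have "g : bounded_integrable M" by (simp add: bounded_integrable_def Lp_space_one)
 hence gq: "g : Lp_space q M" by (rule bounded_integrable_Lp[OF q1])
 have c: "0 <= Lp_norm q M g" by (rule Lp_norm_nonneg)
 note Hol = Holder_inequality[OF q _ gq]
 obtain r where r: "strict_mono r" "AE x in M. Cauchy (%i. s (r i) x * g x)"
 proof (rule cauchy_L1_AE_cauchy_subseq[of M "%n x. s n x * g x"])
  show "integrable M (%x. s n x * g x)" for n by (rule Hol(1)[OF s])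
  fix e :: real assume e: "e > 0"
  have e': "e / (Lp_norm q M g + 1) > 0" using e c by (simp add: add_nonneg_pos)
  have "(LINT x|M. norm (s i x * g x - s j x * g x)) < e" if "i >= K (e / (Lp_norm q M g + 1))" "j >= K (e / (Lp_norm q M g + 1))" for i j
  proof -
   have "(LINT x|M. norm (s i x * g x - s j x * g x)) <= Lp_norm p M (%x. s i x - s j x) * Lp_norm q M g"
    using Hol(2)[OF Lp_diff[OF p s s], of i j] by (simp add: left_diff_distrib)
   also have "... <= e / (Lp_norm q M g + 1) * Lp_norm q M g" by (intro mult_right_mono less_imp_le[OF K[OF e' that]] c)
   also have "... < e" using e c by (simp add: field_simps add_nonneg_pos)
   finally show ?thesis .
  qed
  thus "EX N. ALL i>=N. ALL j>=N. (LINT x|M. norm (s i x * g x - s j x * g x)) < e" by blast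
 qed blast
 define u where "u k = s (r k)" for k
 have um [measurable]: "u k : borel_measurable M" for k by (simp add: u_def)
 define l where "l x = lim (%k. u k x)" for x
 have lm [measurable]: "l : borel_measurable M" unfolding l_def[abs_def] by (rule borel_measurable_lim_metric) (rule um)
 have zero: "u k x = 0" "l x = 0" if "x : space M" "x \<notin> S" for k x
  using A(3)[OF that[unfolded S_def]] by (simp_all add: u_def l_def lim_const)
 have conv: "AE x in M. (%k. u k x) \<longlonglongrightarrow> l x"
  using r(2) AE_space
 proof eventually_elim
  case (elim x)
  show ?case
  proof (cases "x : S")
   case True
   hence g0: "g x ~= 0" using w(2)[of x] by (simp add: g_def)
   obtain c where "(%i. s (r i) x * g x) \<longlonglongrightarrow> c" using elim(1) Cauchy_convergent_iff convergent_def by blast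
   from tendsto_divide[OF this tendsto_const g0] have "convergent (%i. u i x)"
    using g0 by (auto simp: u_def convergent_def)
   thus ?thesis unfolding l_def by (simp add: convergent_LIMSEQ_iff)
  qed (use zero elim(2) in simp)
 qed
 \<comment> \<open>\<open>Lp_dual_norm\<close> acts as a membership criterion here: that the limit
   lies in L^p is part of what it yields.\<close>
 have close: "(%x. s n x - l x) : Lp_space p M & Lp_norm p M (%x. s n x - l x) <= e" if e: "e > 0" and n: "n >= K e" for n e
 proof (rule Lp_dual_norm[OF q])
  show "sigma_support M (%x. s n x - l x)"
   unfolding sigma_support_def using A zero(2)[unfolded S_def] by (intro exI[of _ A]) auto
  fix g assume g: "g : bounded_integrable M" and i: "integrable M (%x. (s n x - l x) * g x)"
  have gq: "g : Lp_space q M" by (rule bounded_integrable_Lp[OF q1 g])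
  have [measurable]: "g : borel_measurable M" using Lp_measurable[OF gq] .
  have "ennreal (norm (LINT x|M. (s n x - l x) * g x)) <= (\<integral>\<^sup>+x. ennreal (norm ((s n x - l x) * g x)) \<partial>M)"
   by (rule integral_norm_bound_ennreal[OF i])
  also have "... = (\<integral>\<^sup>+x. liminf (%k. ennreal (norm ((s n x - u k x) * g x))) \<partial>M)"
  proof (rule nn_integral_cong_AE)
   show "AE x in M. ennreal (norm ((s n x - l x) * g x)) = liminf (%k. ennreal (norm ((s n x - u k x) * g x)))"
    using conv
   proof eventually_elim
    case (elim x)
    have "(%k. ennreal (norm ((s n x - u k x) * g x))) \<longlonglongrightarrow> ennreal (norm ((s n x - l x) * g x))"
     by (intro tendsto_intros elim)
    thus ?case by (rule lim_imp_Liminf[symmetric, rotated]) simp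
   qed
  qed
  also have "... <= liminf (%k. \<integral>\<^sup>+x. ennreal (norm ((s n x - u k x) * g x)) \<partial>M)"
   by (rule nn_integral_liminf) simp
  also have "... <= ennreal (e * Lp_norm q M g)"
  proof (rule order_trans[OF Liminf_le_Limsup Limsup_bounded])
   show "eventually (%k. (\<integral>\<^sup>+x. ennreal (norm ((s n x - u k x) * g x)) \<partial>M) <= ennreal (e * Lp_norm q M g)) sequentially"
    unfolding eventually_sequentially
   proof (intro exI allI impI)
    fix k assume "K e <= k"
    hence rk: "r k >= K e" using seq_suble[OF r(1), of k] by simp
    have d: "(%x. s n x - u k x) : Lp_space p M" unfolding u_def by (rule Lp_diff[OF p s s])
    have "(\<integral>\<^sup>+x. ennreal (norm ((s n x - u k x) * g x)) \<partial>M) = ennreal (LINT x|M. norm ((s n x - u k x) * g x))"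
     using Holder_inequality(1)[OF q d gq] by (intro nn_integral_eq_integral) auto
    also have "(LINT x|M. norm ((s n x - u k x) * g x)) <= e * Lp_norm q M g"
     using Holder_inequality(2)[OF q d gq] mult_right_mono[OF less_imp_le[OF K[OF e n rk]] Lp_norm_nonneg[of q M g]]
     by (simp add: u_def)
    finally show "(\<integral>\<^sup>+x. ennreal (norm ((s n x - u k x) * g x)) \<partial>M) <= ennreal (e * Lp_norm q M g)"
     by (simp add: ennreal_leI)
   qed
  qed simp
  finally show "norm (LINT x|M. (s n x - l x) * g x) <= e * Lp_norm q M g"
   using e Lp_norm_nonneg[of q M g] by (subst (asm) ennreal_le_iff) auto
 qed (use e in auto)
 have "(%x. s (K 1) x - (s (K 1) x - l x)) : Lp_space p M"
  by (rule Lp_diff[OF p s conjunct1[OF close[of 1 "K 1"]]]) simp_all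
 hence "l : Lp_space p M" by simp
 moreover have "(%n. Lp_norm p M (%x. s n x - l x)) \<longlonglongrightarrow> 0"
 proof (rule LIMSEQ_I)
  fix e :: real assume e: "e > 0"
  have "norm (Lp_norm p M (%x. s n x - l x) - 0) < e" if "n >= K (e / 2)" for n
   using close[of "e / 2" n] that e Lp_norm_nonneg[of p M "%x. s n x - l x"] by simp
  thus "EX N. ALL n>=N. norm (Lp_norm p M (%x. s n x - l x) - 0) < e" by blast
 qed
 ultimately show ?thesis by blast
qed

section \<open>Averages of translates\<close>

definition finite_radon :: "'a::t2_space measure => bool" where
 "finite_radon b \<longleftrightarrow> radon b & emeasure b UNIV < top"

definition reflect :: "'a::{topological_ab_group_add, t2_space} measure => 'a measure" where
 "reflect b = distr b borel uminus"

text \<open>The sign is opposite to the one in a convolution: convolving with a means averaging over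
  \<open>reflect a\<close>. Where the integrand is not integrable the value is 0.\<close>

definition avg :: "'a::{topological_ab_group_add, t2_space} measure => ('a => complex) => 'a => complex" where
 "avg b f s = (LINT y|b. f (s + y))"

lemma finite_radonD:
 assumes "finite_radon b"
 shows "radon b" "emeasure b UNIV < top" "sets b = sets borel" "space b = UNIV" "finite_measure b"
  "borel_measurable b = borel_measurable borel"
proof -
 have r: "radon b" and f: "emeasure b UNIV < top" using assms by (auto simp: finite_radon_def)
 show "finite_measure b" by (rule finite_measureI) (use f radonD(2)[OF r] in simp)
qed (use assms radonD(1,2)[of b] radon_borel_measurable[of b] in \<open>simp_all add: finite_radon_def\<close>)

lemma finite_radonI:
 fixes b :: "'a::t2_space measure"
 assumes s: "sets b = sets borel" and fin: "emeasure b UNIV < top"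
  and K: "!!U e::real. open U ==> 0 < e ==> EX K. compact K & K \<subseteq> U & emeasure b U <= emeasure b K + ennreal e"
 shows "finite_radon b"
proof -
 have "emeasure b U = (SUP K\<in>{K. compact K & K \<subseteq> U}. emeasure b K)" if U: "open U" for U
 proof (rule antisym)
  show "emeasure b U <= (SUP K\<in>{K. compact K & K \<subseteq> U}. emeasure b K)"
  proof (rule ennreal_le_epsilon)
   fix e :: real assume "0 < e"
   then obtain C where "compact C" "C \<subseteq> U" "emeasure b U <= emeasure b C + ennreal e" using K[OF U] by blast
   thus "emeasure b U <= (SUP K\<in>{K. compact K & K \<subseteq> U}. emeasure b K) + ennreal e"
    by (elim order_trans) (intro add_right_mono SUP_upper, auto)
  qed
  show "(SUP K\<in>{K. compact K & K \<subseteq> U}. emeasure b K) <= emeasure b U"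
   by (rule SUP_least) (use U s in \<open>auto intro: emeasure_mono\<close>)
 qed
 thus ?thesis using s fin by (auto simp: finite_radon_def radon_def intro!: exI[of _ UNIV])
qed

lemma finite_radonE:
 assumes b: "finite_radon b" and U: "open U" and e: "0 < (e::real)"
 obtains K where "compact K" "K \<subseteq> U" "emeasure b U <= emeasure b K + ennreal e"
proof (cases "measure b U <= e")
 \<comment> \<open>Then the empty set suffices; otherwise \<open>measure b U - e\<close> is positive
   and survives the cut-off in \<open>ennreal\<close>.\<close>
 case True
 interpret finite_measure b by (rule finite_radonD(5)[OF b])
 show ?thesis using True by (intro that[of "{}"]) (simp_all add: emeasure_eq_measure ennreal_leI)
next
 case False
 interpret finite_measure b by (rule finite_radonD(5)[OF b])
 have "ennreal (measure b U - e) < emeasure b U" using e False by (simp add: emeasure_eq_measure ennreal_less_iff)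
 then obtain K where K: "compact K" "K \<subseteq> U" "ennreal (measure b U - e) < emeasure b K"
  unfolding radonD(4)[OF finite_radonD(1)[OF b] U] by (auto simp: less_SUP_iff)
 hence "measure b U - e < measure b K" using False by (simp add: emeasure_eq_measure ennreal_less_iff)
 thus ?thesis using K(1,2) e by (intro that[of K]) (auto simp: emeasure_eq_measure simp flip: ennreal_plus intro!: ennreal_leI)
qed

section \<open>Sigma-finite supports and iterated integrals of translates\<close>

context haar
begin

definition sigma_finite_set :: "'a set => bool" where
 "sigma_finite_set S \<longleftrightarrow> (EX A::nat => 'a set. (ALL n. A n : sets borel & emeasure m (A n) < top) & S \<subseteq> (\<Union>n. A n))"

lemma sigma_finite_set_subset: "sigma_finite_set S ==> R \<subseteq> S ==> sigma_finite_set R"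
 unfolding sigma_finite_set_def by (meson subset_trans)

lemma sigma_finite_set_UN:
 assumes "!!n::nat. sigma_finite_set (S n)" shows "sigma_finite_set (\<Union>n. S n)"
proof -
 obtain A where A: "!!n k::nat. A n k : sets borel" "!!n k. emeasure m (A n k) < top" "!!n. S n \<subseteq> (\<Union>k. A n k)"
  using assms unfolding sigma_finite_set_def by metis
 define A' where "A' j = A (fst (prod_decode j)) (snd (prod_decode j))" for j
 have eq: "A n k = A' (prod_encode (n, k))" for n k by (simp add: A'_def)
 have "(\<Union>n. S n) \<subseteq> (\<Union>j. A' j)"
 proof
  fix x assume "x : (\<Union>n. S n)"
  then obtain n k where "x : A n k" using A(3) by blast
  thus "x : (\<Union>j. A' j)" unfolding eq by blast
 qed
 thus ?thesis unfolding sigma_finite_set_def using A by (intro exI[of _ A']) (auto simp: A'_def)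
qed

lemma sigma_supported_iff: "sigma_supported f \<longleftrightarrow> sigma_finite_set {x. f x ~= 0}"
proof
 assume "sigma_supported f"
 then obtain U where U: "incseq U" "!!n. open (U n) & emeasure m (U n) < top" "!!x. x \<notin> (\<Union>n. U n) ==> f x = 0"
  unfolding sigma_supported_def by auto
 have "ALL n. U n : sets borel & emeasure m (U n) < top" "{x. f x ~= 0} \<subseteq> (\<Union>n. U n)" using U(2) by auto (metis U(3) UN_E)
 thus "sigma_finite_set {x. f x ~= 0}" unfolding sigma_finite_set_def by blast
next
 assume "sigma_finite_set {x. f x ~= 0}"
 then obtain A where A: "!!n. A n : sets borel" "!!n::nat. emeasure m (A n) < top" "{x. f x ~= 0} \<subseteq> (\<Union>n. A n)"
  unfolding sigma_finite_set_def by auto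
 have "EX U. open U & A n \<subseteq> U & emeasure m U < top" for n using open_outer[OF A(1,2)] by blast
 then obtain U where U: "!!n. open (U n) & A n \<subseteq> U n & emeasure m (U n) < top" by metis
 define V where "V n = (\<Union>k\<le>n. U k)" for n
 have "emeasure m (V n) < top" for n
  using emeasure_finite_UN[of "{..n}" U m] U by (simp add: V_def)
 moreover have "incseq V" unfolding V_def by (rule incseq_SucI) (auto intro: le_SucI)
 moreover have "open (V n)" for n unfolding V_def using U by auto
 moreover have "f x = 0" if "x \<notin> (\<Union>n. V n)" for x
 proof (rule ccontr)
  assume "f x ~= 0"
  then obtain n where "x : A n" using A(3) by auto
  hence "x : V n" using U[of n] by (auto simp: V_def)
  thus False using that by blast
 qed
 ultimately show "sigma_supported f" unfolding sigma_supported_def by (intro exI[of _ V]) auto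
qed

lemma sigma_support_iff: "sigma_support m f \<longleftrightarrow> sigma_finite_set {x. f x ~= 0}"
 unfolding sigma_support_def sigma_finite_set_def by (intro ex_cong1) (simp, blast)

lemma sigma_supportedE:
 assumes "sigma_supported f"
 obtains U :: "nat => 'a set" where "incseq U" "!!n. open (U n)" "!!n. emeasure m (U n) < top" "!!x. x \<notin> (\<Union>n. U n) ==> f x = 0"
proof -
 obtain U :: "nat => 'a set" where U: "incseq U & (ALL n. open (U n) & emeasure m (U n) < \<infinity>) & (ALL x. x \<notin> (\<Union>n. U n) --> f x = 0)"
  using assms unfolding sigma_supported_def by blast
 show ?thesis by (rule that[of U]) (use U in auto)
qed

lemma sum_measurable: "(f :: 'a => ennreal) : borel_measurable borel ==> (%z. f (fst z + snd z)) : borel_measurable borel"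
 by (rule measurable_compose[of "%z. fst z + snd z" borel borel])
   (auto intro!: borel_measurable_continuous_onI continuous_on_add continuous_on_fst continuous_on_snd continuous_on_id)

lemma fst_measurable: "(f :: 'a => ennreal) : borel_measurable borel ==> (%z. f (fst (z :: 'a \<times> 'a))) : borel_measurable borel"
 by (rule measurable_compose[of "%z. fst z" borel borel])
   (auto intro!: borel_measurable_continuous_onI continuous_on_fst continuous_on_id)

lemma diff_measurable: "(f :: 'a => ennreal) : borel_measurable borel ==> (%z. f (fst z - snd z)) : borel_measurable borel"
 by (rule measurable_compose[of "%z. fst z - snd z" borel borel])
   (auto intro!: borel_measurable_continuous_onI continuous_on_diff continuous_on_fst continuous_on_snd continuous_on_id)

lemma translate_integral_measurable:
 fixes f :: "'a => ennreal"
 assumes b: "finite_radon b" and f: "f : borel_measurable borel"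
 shows "(%s. \<integral>\<^sup>+y. f (s + y) \<partial>b) : borel_measurable borel" "(%s. \<integral>\<^sup>+y. f (s - y) \<partial>b) : borel_measurable borel"
 using radon_slice_integral_measurable[OF finite_radonD(1)[OF b] _ sum_measurable[OF f]]
  radon_slice_integral_measurable[OF finite_radonD(1)[OF b] _ diff_measurable[OF f]] finite_radonD(2)[OF b] by auto

text \<open>These are the regions where integrands such as f(s + y), g(s - y) and g(s) live. For
  fixed y their slices are translates of U, so the double integral is m(U) times the mass of
  \<beta>.\<close>

lemma fubini_domains:
 assumes \<beta>: "finite_radon \<beta>" and U: "open U" "emeasure m U < top"
 shows "fubini_domain m \<beta> {(s, y). s + y : U}" "fubini_domain m \<beta> {(s, y). s - y : U}" "fubini_domain m \<beta> {(s, y). s : U}"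
proof -
 note [simp] = finite_radonD(3,4)[OF \<beta>]
 have b: "emeasure \<beta> A < top" for A
  using emeasure_mono[of A UNIV \<beta>] finite_radonD(2)[OF \<beta>] by (auto intro: le_less_trans)
 have o: "open {(s::'a, y). s + y : U}" "open {(s::'a, y). s - y : U}" "open {(s::'a, y::'a). s : U}"
  using open_vimage[OF U(1), of "%z. fst z + snd z"] open_vimage[OF U(1), of "%z. fst z - snd z"]
   open_vimage[OF U(1), of "fst :: 'a \<times> 'a => 'a"]
  by (simp_all add: vimage_def case_prod_beta' continuous_on_add continuous_on_diff continuous_on_fst continuous_on_snd continuous_on_id)
 have s: "emeasure m {x. x + y : U} = emeasure m U" "emeasure m {x. x - y : U} = emeasure m U" for y
  using emeasure_shift[of U y] emeasure_shift[of U "- y"] U by auto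
 have fin: "(\<integral>\<^sup>+y. emeasure m U \<partial>\<beta>) < top" using finite_radonD(2)[OF \<beta>] U by (simp add: ennreal_mult_less_top)
 have "(\<integral>\<^sup>+x. emeasure \<beta> {y. (x, y) : W} \<partial>m) < top" if "open W" "!!y. emeasure m {x. (x, y) : W} = emeasure m U" for W
  using fubini_open[OF radon_m finite_radonD(1)[OF \<beta>] that(1)] fin that(2) by simp
 from this[OF o(1)] this[OF o(2)] this[OF o(3)]
 show "fubini_domain m \<beta> {(s, y). s + y : U}" "fubini_domain m \<beta> {(s, y). s - y : U}" "fubini_domain m \<beta> {(s, y). s : U}"
  using o b s U by (auto simp: fubini_domain_def)
qed

lemma nn_integral_translates:
 assumes b: "finite_radon b" and f: "f : borel_measurable borel" and supp: "sigma_supported f"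
 shows "(\<integral>\<^sup>+s. \<integral>\<^sup>+y. f (s + y) \<partial>b \<partial>m) = emeasure b UNIV * (\<integral>\<^sup>+x. f x \<partial>m)"
proof -
 obtain U where U: "incseq U" "!!n. open (U n)" "!!n. emeasure m (U n) < top" "!!x. x \<notin> (\<Union>n. U n) ==> f x = 0"
  using sigma_supportedE[OF supp] by metis
 have "(\<integral>\<^sup>+s. \<integral>\<^sup>+y. f (s + y) \<partial>b \<partial>m) = (\<integral>\<^sup>+y. \<integral>\<^sup>+s. f (s + y) \<partial>m \<partial>b)"
 proof -
  have inc: "incseq (%n. {(s, y). s + y : U n})" using U(1) by (auto simp: incseq_def)
  have z: "f (fst z + snd z) = 0" if "z \<notin> (\<Union>n. {(s, y). s + y : U n})" for z
   using that by (intro U(4)) (auto simp: case_prod_beta)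
  show ?thesis
   using fubini_sigma_domain(2)[OF radon_m finite_radonD(1)[OF b] fubini_domains(1)[OF b U(2,3)] inc sum_measurable[OF f] z] by simp
 qed
 thus ?thesis using finite_radonD(4)[OF b] by (simp add: nn_integral_shift[OF f] mult.commute)
qed

text \<open>Exchange of the integrals, the translation of s by -y, and a second exchange. The
  support of g makes both exchanges possible; f is an arbitrary Borel function.\<close>

lemma nn_integral_translates_mult:
 assumes b: "finite_radon b" and f: "f : borel_measurable borel" and g: "g : borel_measurable borel" and supp: "sigma_supported g"
 shows "(\<integral>\<^sup>+s. (\<integral>\<^sup>+y. f (s + y) \<partial>b) * g s \<partial>m) = (\<integral>\<^sup>+y. \<integral>\<^sup>+s. f (s + y) * g s \<partial>m \<partial>b)"
  "(\<integral>\<^sup>+s. (\<integral>\<^sup>+y. f (s + y) \<partial>b) * g s \<partial>m) = (\<integral>\<^sup>+s. f s * (\<integral>\<^sup>+y. g (s - y) \<partial>b) \<partial>m)"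
proof -
 note [simp] = finite_radonD(3,4,6)[OF b]
 note [measurable] = f g
 obtain U where U: "incseq U" "!!n. open (U n)" "!!n. emeasure m (U n) < top" "!!x. x \<notin> (\<Union>n. U n) ==> g x = 0"
  using sigma_supportedE[OF supp] by metis
 have "(\<integral>\<^sup>+s. \<integral>\<^sup>+y. f (s + y) * g s \<partial>b \<partial>m) = (\<integral>\<^sup>+y. \<integral>\<^sup>+s. f (s + y) * g s \<partial>m \<partial>b)"
 proof -
  have inc: "incseq (%n. {(s :: 'a, y :: 'a). s : U n})" using U(1) by (auto simp: incseq_def)
  have z: "f (fst z + snd z) * g (fst z) = 0" if "z \<notin> (\<Union>n. {(s, y). s : U n})" for z
  proof -
   have "g (fst z) = 0" using that by (intro U(4)) (auto simp: case_prod_beta)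
   thus ?thesis by simp
  qed
  have fm: "(%z. f (fst z + snd z) * g (fst z)) : borel_measurable borel"
   by (intro borel_measurable_times_ennreal sum_measurable fst_measurable f g)
  show ?thesis
   using fubini_sigma_domain(2)[OF radon_m finite_radonD(1)[OF b] fubini_domains(3)[OF b U(2,3)] inc fm z] by simp
 qed
 moreover have "(\<integral>\<^sup>+y. f (s + y) * g s \<partial>b) = (\<integral>\<^sup>+y. f (s + y) \<partial>b) * g s" for s
  by (rule nn_integral_multc) simp
 ultimately show 1: "(\<integral>\<^sup>+s. (\<integral>\<^sup>+y. f (s + y) \<partial>b) * g s \<partial>m) = (\<integral>\<^sup>+y. \<integral>\<^sup>+s. f (s + y) * g s \<partial>m \<partial>b)" by simp
 have "(\<integral>\<^sup>+s. f (s + y) * g s \<partial>m) = (\<integral>\<^sup>+s. f s * g (s - y) \<partial>m)" for y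
  using nn_integral_shift[of "%s. f s * g (s - y)" y] by simp
 hence "(\<integral>\<^sup>+y. \<integral>\<^sup>+s. f (s + y) * g s \<partial>m \<partial>b) = (\<integral>\<^sup>+y. \<integral>\<^sup>+s. f s * g (s - y) \<partial>m \<partial>b)" by simp
 also have "... = (\<integral>\<^sup>+s. \<integral>\<^sup>+y. f s * g (s - y) \<partial>b \<partial>m)"
 proof -
  have inc: "incseq (%n. {(s, y). s - y : U n})" using U(1) by (auto simp: incseq_def)
  have z: "f (fst z) * g (fst z - snd z) = 0" if "z \<notin> (\<Union>n. {(s, y). s - y : U n})" for z
  proof -
   have "g (fst z - snd z) = 0" using that by (intro U(4)) (auto simp: case_prod_beta)
   thus ?thesis by simp
  qed
  have fm: "(%z. f (fst z) * g (fst z - snd z)) : borel_measurable borel"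
   by (intro borel_measurable_times_ennreal diff_measurable fst_measurable f g)
  show ?thesis
   using fubini_sigma_domain(2)[OF radon_m finite_radonD(1)[OF b] fubini_domains(2)[OF b U(2,3)] inc fm z] by simp
 qed
 also have "(%s. \<integral>\<^sup>+y. f s * g (s - y) \<partial>b) = (%s. f s * (\<integral>\<^sup>+y. g (s - y) \<partial>b))"
  by (intro ext nn_integral_cmult) simp
 finally show "(\<integral>\<^sup>+s. (\<integral>\<^sup>+y. f (s + y) \<partial>b) * g s \<partial>m) = (\<integral>\<^sup>+s. f s * (\<integral>\<^sup>+y. g (s - y) \<partial>b) \<partial>m)"
  using 1 by simp
qed

lemma AE_shift: "Measurable.pred borel P ==> AE x in m. P x ==> AE x in m. P (x + y)"
 using AE_distr_iff[of "%x. x + y" m borel P, unfolded distr_shift] by (simp add: pred_def)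

lemma AE_uminus: "Measurable.pred borel P ==> AE x in m. P x ==> AE x in m. P (- x)"
 using AE_distr_iff[of uminus m borel P, unfolded distr_uminus] by (simp add: pred_def)

lemma Lp_shift:
 assumes p: "1 <= p" and f: "f : Lp_space p m"
 shows "(%x. f (x + y)) : Lp_space p m" "Lp_norm p m (%x. f (x + y)) <= Lp_norm p m f"
proof -
 have fm [measurable]: "f : borel_measurable borel" using Lp_measurable[OF f] by simp
 have "(%x. f (x + y)) : Lp_space p m & Lp_norm p m (%x. f (x + y)) <= Lp_norm p m f"
 proof (cases p)
  case top
  have "AE x in m. norm (f x) <= Lp_norm top m f" using Lp_norm_inf_AE f top by blast
  hence "AE x in m. norm (f (x + y)) <= Lp_norm top m f" by (intro AE_shift) measurable
  thus ?thesis using top Lp_norm_nonneg[of top m f] by (auto simp: Lp_space_inf intro!: Lp_norm_inf_le)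
 next
  case (real P)
  hence P: "P >= 1" using p by simp
  have i: "integrable m (%x. norm (f x) powr P)" using f real P by (simp add: Lp_space_finite)
  have "integrable m (%x. norm (f (x + y)) powr P)" "(LINT x|m. norm (f (x + y)) powr P) = (LINT x|m. norm (f x) powr P)"
   using integrable_distr_eq[of "%x. x + y" m borel "%x. norm (f x) powr P"] integral_distr[of "%x. x + y" m borel "%x. norm (f x) powr P"] i
   by (simp_all add: distr_shift)
  thus ?thesis using real P by (simp add: Lp_space_finite Lp_norm_finite)
 qed
 thus "(%x. f (x + y)) : Lp_space p m" "Lp_norm p m (%x. f (x + y)) <= Lp_norm p m f" by auto
qed

lemma Lp_uminus:
 assumes p: "1 <= p" and f: "f : Lp_space p m"
 shows "(%x. f (- x)) : Lp_space p m" "Lp_norm p m (%x. f (- x)) <= Lp_norm p m f"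
proof -
 have fm [measurable]: "f : borel_measurable borel" using Lp_measurable[OF f] by simp
 have "(%x. f (- x)) : Lp_space p m & Lp_norm p m (%x. f (- x)) <= Lp_norm p m f"
 proof (cases p)
  case top
  have "AE x in m. norm (f x) <= Lp_norm top m f" using Lp_norm_inf_AE f top by blast
  hence "AE x in m. norm (f (- x)) <= Lp_norm top m f" by (intro AE_uminus) measurable
  thus ?thesis using top Lp_norm_nonneg[of top m f] by (auto simp: Lp_space_inf intro!: Lp_norm_inf_le)
 next
  case (real P)
  hence P: "P >= 1" using p by simp
  have i: "integrable m (%x. norm (f x) powr P)" using f real P by (simp add: Lp_space_finite)
  have "integrable m (%x. norm (f (- x)) powr P)" "(LINT x|m. norm (f (- x)) powr P) = (LINT x|m. norm (f x) powr P)"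
   using integrable_distr_eq[of uminus m borel "%x. norm (f x) powr P"] integral_distr[of uminus m borel "%x. norm (f x) powr P"] i
   by (simp_all add: distr_uminus)
  thus ?thesis using real P by (simp add: Lp_space_finite Lp_norm_finite)
 qed
 thus "(%x. f (- x)) : Lp_space p m" "Lp_norm p m (%x. f (- x)) <= Lp_norm p m f" by auto
qed

lemma integral_uminus:
 fixes f :: "'a => 'b::{banach, second_countable_topology}"
 assumes "f : borel_measurable borel" shows "(LINT x|m. f (- x)) = (LINT x|m. f x)"
 using integral_distr[of uminus m borel f] assms by (simp add: distr_uminus)

lemma norm_ennreal_measurable: "f : borel_measurable borel ==> (%x. ennreal (norm (f x :: complex))) : borel_measurable borel"
 by measurable

section \<open>The averaging operator on Lebesgue spaces\<close>

lemma avg_integrand_measurable: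
 fixes f :: "'a => 'b::topological_space"
 shows "f : borel_measurable borel ==> (%y. f (s + y)) : borel_measurable borel"
 by (rule measurable_compose[OF shift_measurable(2)])

lemma avg_integrable_iff:
 fixes f :: "'a => complex"
 assumes b: "finite_radon b" and f: "f : borel_measurable borel"
 shows "integrable b (%y. f (s + y)) \<longleftrightarrow> (\<integral>\<^sup>+y. ennreal (norm (f (s + y))) \<partial>b) < top"
 using avg_integrand_measurable[OF f, of s] by (simp add: integrable_iff_bounded finite_radonD(6)[OF b])

text \<open>f(s + y) need not be measurable for the product sigma-algebra. Measurability in s is
  therefore deduced from that of extended nonnegative integrals on the set where the integral
  exists; elsewhere the average is 0.\<close>

lemma avg_measurable:
 fixes f :: "'a => complex"
 assumes b: "finite_radon b" and f: "f : borel_measurable borel"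
 shows "avg b f : borel_measurable borel"
proof -
 note [measurable] = f
 define F where "F s = (\<integral>\<^sup>+y. ennreal (norm (f (s + y))) \<partial>b)" for s
 define h where "h u s = enn2real (\<integral>\<^sup>+y. ennreal (u (f (s + y))) \<partial>b)" for u :: "complex => real" and s
 have [measurable]: "F : borel_measurable borel"
  unfolding F_def[abs_def] by (rule translate_integral_measurable(1)[OF b norm_ennreal_measurable]) measurable
 have [measurable]: "h u : borel_measurable borel" if [measurable]: "u : borel_measurable borel" for u
  unfolding h_def[abs_def] using translate_integral_measurable(1)[where f = "%x. ennreal (u (f x))", OF b] by measurable
 have "avg b f s = (if F s < top then Complex (h Re s - h (%z. - Re z) s) (h Im s - h (%z. - Im z) s) else 0)" for s
 proof (cases "F s < top")
  case True
  hence i: "integrable b (%y. f (s + y))" using avg_integrable_iff[OF b f] by (simp add: F_def)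
  have "Re (avg b f s) = (LINT y|b. Re (f (s + y)))" "Im (avg b f s) = (LINT y|b. Im (f (s + y)))"
   using i by (simp_all add: avg_def)
  moreover have "(LINT y|b. Re (f (s + y))) = h Re s - h (%z. - Re z) s"
   unfolding h_def by (rule real_lebesgue_integral_def) (use i in simp)
  moreover have "(LINT y|b. Im (f (s + y))) = h Im s - h (%z. - Im z) s"
   unfolding h_def by (rule real_lebesgue_integral_def) (use i in simp)
  ultimately show ?thesis using True by (simp add: complex_eq_iff)
 next
  case False
  hence "\<not> integrable b (%y. f (s + y))" using avg_integrable_iff[OF b f] by (simp add: F_def)
  thus ?thesis using False by (simp add: avg_def not_integrable_integral_eq)
 qed
 hence "avg b f = (%s. if F s < top then of_real (h Re s - h (%z. - Re z) s) + \<i> * of_real (h Im s - h (%z. - Im z) s) else 0)"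
  by (auto simp: complex_eq_iff)
 moreover have "... : borel_measurable borel" by measurable
 ultimately show ?thesis by simp
qed

lemma norm_avg_le: "finite_radon b ==> f : borel_measurable borel ==> ennreal (norm (avg b f s)) <= (\<integral>\<^sup>+y. ennreal (norm (f (s + y))) \<partial>b)"
 by (cases "integrable b (%y. f (s + y))") (auto simp: avg_def not_integrable_integral_eq intro: integral_norm_bound_ennreal)

text \<open>For each piece U n the function \<open>H n\<close> has a finite integral, so its support
  is sigma-finite. Where all \<open>H n\<close> vanish, the translate of f is 0 almost everywhere
  for b.\<close>

lemma sigma_supported_translates:
 assumes b: "finite_radon b" and f: "f : borel_measurable borel" and supp: "sigma_supported f"
 shows "sigma_supported (%s. \<integral>\<^sup>+y. f (s + y) \<partial>b)"
proof -
 obtain U where U: "incseq U" "!!n. open (U n)" "!!n. emeasure m (U n) < top" "!!x. x \<notin> (\<Union>n. U n) ==> f x = 0"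
  using sigma_supportedE[OF supp] by metis
 define H where "H n s = (\<integral>\<^sup>+y. indicator (U n) (s + y) \<partial>b)" for n s
 have ind: "indicator (U n) : borel_measurable borel" for n using U(2) by simp
 have Hs: "sigma_supported (H n)" for n
 proof (rule sigma_supported_finite_integral)
  show "H n : borel_measurable borel" unfolding H_def[abs_def] by (rule translate_integral_measurable(1)[OF b ind])
  have "sigma_supported (indicator (U n))"
   by (rule sigma_supported_finite_integral[OF ind]) (use U(2,3) in simp)
  hence "(\<integral>\<^sup>+s. H n s \<partial>m) = emeasure b UNIV * emeasure m (U n)"
   unfolding H_def using nn_integral_translates[OF b ind] U(2) by simp
  thus "(\<integral>\<^sup>+s. H n s \<partial>m) < \<infinity>" using U(3) finite_radonD(2)[OF b] by (simp add: ennreal_mult_less_top)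
 qed
 have "sigma_finite_set (\<Union>n. {s. H n s ~= 0})"
  by (rule sigma_finite_set_UN) (use Hs sigma_supported_iff in blast)
 moreover have "{s. (\<integral>\<^sup>+y. f (s + y) \<partial>b) ~= 0} \<subseteq> (\<Union>n. {s. H n s ~= 0})"
 proof (rule subsetI, rule ccontr)
  fix s assume s: "s : {s. (\<integral>\<^sup>+y. f (s + y) \<partial>b) ~= 0}" "s \<notin> (\<Union>n. {s. H n s ~= 0})"
  have m1: "(%y. indicator (U n) (s + y) :: ennreal) : borel_measurable b" for n
   using avg_integrand_measurable[OF ind] by (simp add: finite_radonD(6)[OF b])
  have "H n s = 0" for n using s(2) by auto
  hence "AE y in b. indicator (U n) (s + y) = (0::ennreal)" for n
   unfolding H_def using nn_integral_0_iff_AE[OF m1] by blast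
  hence "AE y in b. ALL n. indicator (U n) (s + y) = (0::ennreal)" by (simp add: AE_all_countable)
  hence "AE y in b. f (s + y) = 0"
   by eventually_elim (auto intro!: U(4) split: split_indicator_asm)
  hence "(\<integral>\<^sup>+y. f (s + y) \<partial>b) = (\<integral>\<^sup>+y. 0 \<partial>b)" by (rule nn_integral_cong_AE)
  thus False using s(1) by simp
 qed
 ultimately show ?thesis unfolding sigma_supported_iff by (rule sigma_finite_set_subset)
qed

lemma Lp_sigma_supported:
 assumes p: "1 <= p" and fin: "p = top ==> emeasure m UNIV < top" and f: "f : Lp_space p m"
 shows "sigma_supported (%x. ennreal (norm (f x)))"
 using sigma_support_Lp[OF p f] fin unfolding sigma_support_iff sigma_supported_iff by simp

text \<open>Minkowski's integral inequality in dual form: Hoelder's inequality is applied to each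
  translate of f, whose norm is at most that of f.\<close>

lemma translates_dual_bound:
 assumes b: "finite_radon b" and pq: "conjugate_exponents p q" and f: "f : Lp_space p m" and g: "g : bounded_integrable m"
 shows "(\<integral>\<^sup>+s. (\<integral>\<^sup>+y. ennreal (norm (f (s + y))) \<partial>b) * ennreal (norm (g s)) \<partial>m) <= ennreal (measure b UNIV * Lp_norm p m f * Lp_norm q m g)"
proof -
 note pq1 = conjugate_exponents_ge_1[OF pq]
 have gq: "g : Lp_space q m" by (rule bounded_integrable_Lp[OF pq1(2) g])
 have fm [measurable]: "f : borel_measurable borel" and gm [measurable]: "g : borel_measurable borel"
  using Lp_measurable[OF f] Lp_measurable[OF gq] by auto
 have gs: "sigma_supported (%x. ennreal (norm (g x)))"
  using Lp_sigma_supported[of 1 g] g by (simp add: bounded_integrable_def)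
 have "(\<integral>\<^sup>+s. (\<integral>\<^sup>+y. ennreal (norm (f (s + y))) \<partial>b) * ennreal (norm (g s)) \<partial>m)
   = (\<integral>\<^sup>+y. \<integral>\<^sup>+s. ennreal (norm (f (s + y))) * ennreal (norm (g s)) \<partial>m \<partial>b)"
  by (rule nn_integral_translates_mult(1)[OF b _ _ gs]) measurable
 also have "... <= (\<integral>\<^sup>+y. ennreal (Lp_norm p m f * Lp_norm q m g) \<partial>b)"
 proof (rule nn_integral_mono)
  fix y
  note fy = Lp_shift[OF pq1(1) f, of y]
  have "(\<integral>\<^sup>+s. ennreal (norm (f (s + y))) * ennreal (norm (g s)) \<partial>m) = (\<integral>\<^sup>+s. ennreal (norm (f (s + y) * g s)) \<partial>m)"
   by (simp add: norm_mult ennreal_mult)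
  also have "... = ennreal (LINT s|m. norm (f (s + y) * g s))"
   using Holder_inequality(1)[OF pq fy(1) gq] by (intro nn_integral_eq_integral) auto
  also have "(LINT s|m. norm (f (s + y) * g s)) <= Lp_norm p m f * Lp_norm q m g"
   by (rule order_trans[OF Holder_inequality(2)[OF pq fy(1) gq]]) (intro mult_right_mono fy Lp_norm_nonneg)
  finally show "(\<integral>\<^sup>+s. ennreal (norm (f (s + y))) * ennreal (norm (g s)) \<partial>m) <= ennreal (Lp_norm p m f * Lp_norm q m g)"
   by (simp add: ennreal_leI)
 qed
 also have "... = ennreal (measure b UNIV * Lp_norm p m f * Lp_norm q m g)"
  using finite_measure.emeasure_eq_measure[OF finite_radonD(5)[OF b], of UNIV] finite_radonD(4)[OF b] Lp_norm_nonneg[of p m f] Lp_norm_nonneg[of q m g]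
  by (simp add: ennreal_mult[symmetric] mult_ac)
 finally show ?thesis .
qed

text \<open>The average of |f| has finite integrals over sets of finite measure, so it is finite
  almost everywhere on countably many such sets; off them it vanishes.\<close>

lemma avg_integrable_AE:
 assumes b: "finite_radon b" and p: "1 <= p" and fin: "p = top ==> emeasure m UNIV < top" and f: "f : Lp_space p m"
 shows "AE s in m. integrable b (%y. f (s + y))"
proof -
 obtain q where pq: "conjugate_exponents p q" using conjugate_exponent_exists[OF p] by blast
 have fm [measurable]: "f : borel_measurable borel" using Lp_measurable[OF f] by simp
 define F where "F s = (\<integral>\<^sup>+y. ennreal (norm (f (s + y))) \<partial>b)" for s
 have [measurable]: "F : borel_measurable borel"
  unfolding F_def[abs_def] by (rule translate_integral_measurable(1)[OF b norm_ennreal_measurable]) measurable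
 have "sigma_supported F"
  unfolding F_def[abs_def] by (rule sigma_supported_translates[OF b _ Lp_sigma_supported[OF p fin f]]) measurable
 then obtain U where U: "incseq U" "!!n. open (U n)" "!!n. emeasure m (U n) < top" "!!x. x \<notin> (\<Union>n. U n) ==> F x = 0"
  using sigma_supportedE by metis
 have "AE s in m. F s * indicator (U n) s ~= top" for n
 proof -
  define g where "g x = complex_of_real (indicator (U n) x)" for x
  have g: "g : bounded_integrable m"
   by (rule bounded_integrableI[where A = "U n" and K = 1]) (use U in \<open>auto simp: g_def[abs_def] split: split_indicator\<close>)
  have "(\<integral>\<^sup>+s. F s * indicator (U n) s \<partial>m) = (\<integral>\<^sup>+s. F s * ennreal (norm (g s)) \<partial>m)"
   by (intro nn_integral_cong) (auto simp: g_def split: split_indicator)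
  also have "... < top"
   unfolding F_def by (rule le_less_trans[OF translates_dual_bound[OF b pq f g]]) simp
  finally show ?thesis
   using U(2) by (intro nn_integral_PInf_AE[unfolded infinity_ennreal_def]) auto
 qed
 hence "AE s in m. ALL n. F s * indicator (U n) s ~= top" by (simp add: AE_all_countable)
 hence "AE s in m. F s < top"
 proof eventually_elim
  case (elim s)
  show ?case
  proof (cases "s : (\<Union>n. U n)")
   case True
   then obtain n where "s : U n" by auto
   thus ?thesis using elim[rule_format, of n] by (simp add: less_top)
  qed (simp add: U(4))
 qed
 thus ?thesis by eventually_elim (simp add: avg_integrable_iff[OF b fm] F_def)
qed

lemma avg_sigma_support:
 assumes b: "finite_radon b" and f: "f : borel_measurable borel" and supp: "sigma_supported (%x. ennreal (norm (f x)))"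
 shows "sigma_support m (avg b f)"
proof -
 have "sigma_supported (%s. \<integral>\<^sup>+y. ennreal (norm (f (s + y))) \<partial>b)"
  by (rule sigma_supported_translates[OF b norm_ennreal_measurable[OF f] supp])
 hence "sigma_finite_set {s. (\<integral>\<^sup>+y. ennreal (norm (f (s + y))) \<partial>b) ~= 0}" by (simp add: sigma_supported_iff)
 moreover have "{s. avg b f s ~= 0} \<subseteq> {s. (\<integral>\<^sup>+y. ennreal (norm (f (s + y))) \<partial>b) ~= 0}"
 proof
  fix s assume "s : {s. avg b f s ~= 0}"
  thus "s : {s. (\<integral>\<^sup>+y. ennreal (norm (f (s + y))) \<partial>b) ~= 0}"
   using norm_avg_le[OF b f, of s] by auto
 qed
 ultimately show ?thesis unfolding sigma_support_iff by (rule sigma_finite_set_subset)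
qed

text \<open>The estimate against test functions proves the bound and, by
  \<open>Lp_dual_norm\<close>, also membership.\<close>

theorem avg_Lp:
 assumes b: "finite_radon b" and p: "1 <= p" and fin: "p = top ==> emeasure m UNIV < top" and f: "f : Lp_space p m"
 shows "avg b f : Lp_space p m" "Lp_norm p m (avg b f) <= measure b UNIV * Lp_norm p m f"
proof -
 obtain q where pq: "conjugate_exponents p q" using conjugate_exponent_exists[OF p] by blast
 have fm [measurable]: "f : borel_measurable borel" using Lp_measurable[OF f] by simp
 have "avg b f : Lp_space p m & Lp_norm p m (avg b f) <= measure b UNIV * Lp_norm p m f"
 proof (rule Lp_dual_norm[OF pq])
  show "avg b f : borel_measurable m" using avg_measurable[OF b fm] by simp
  show "sigma_support m (avg b f)" by (rule avg_sigma_support[OF b fm Lp_sigma_supported[OF p fin f]])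
  show "0 <= measure b UNIV * Lp_norm p m f" by (simp add: Lp_norm_nonneg)
  fix g assume g: "g : bounded_integrable m" and i: "integrable m (%x. avg b f x * g x)"
  have "ennreal (norm (LINT x|m. avg b f x * g x)) <= (\<integral>\<^sup>+x. ennreal (norm (avg b f x * g x)) \<partial>m)"
   by (rule integral_norm_bound_ennreal[OF i])
  also have "... <= (\<integral>\<^sup>+s. (\<integral>\<^sup>+y. ennreal (norm (f (s + y))) \<partial>b) * ennreal (norm (g s)) \<partial>m)"
   using norm_avg_le[OF b fm] by (intro nn_integral_mono) (simp add: norm_mult ennreal_mult mult_right_mono)
  also have "... <= ennreal (measure b UNIV * Lp_norm p m f * Lp_norm q m g)"
   by (rule translates_dual_bound[OF b pq f g])
  finally show "norm (LINT x|m. avg b f x * g x) <= measure b UNIV * Lp_norm p m f * Lp_norm q m g"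
   by (subst (asm) ennreal_le_iff) (auto simp: Lp_norm_nonneg)
 qed
 thus "avg b f : Lp_space p m" "Lp_norm p m (avg b f) <= measure b UNIV * Lp_norm p m f" by auto
qed

text \<open>The indicator of the exceptional set has integral 0, and so has its average over
  translates.\<close>

lemma AE_translates:
 fixes b :: "'a measure"
 assumes b: "finite_radon b" and P: "Measurable.pred borel P" and ae: "AE x in m. P x"
 shows "AE s in m. AE y in b. P (s + y)"
proof -
 define h where "h = (indicator {x. \<not> P x} :: 'a => ennreal)"
 have h [measurable]: "h : borel_measurable borel" unfolding h_def using P by measurable
 have h0: "(\<integral>\<^sup>+x. h x \<partial>m) = 0"
 proof -
  have "AE x in m. h x = 0" using ae by eventually_elim (simp add: h_def)
  thus ?thesis by (subst nn_integral_0_iff_AE) simp_all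
 qed
 have "(\<integral>\<^sup>+s. \<integral>\<^sup>+y. h (s + y) \<partial>b \<partial>m) = 0"
  using nn_integral_translates[OF b h sigma_supported_finite_integral[OF h]] h0 by simp
 hence "AE s in m. (\<integral>\<^sup>+y. h (s + y) \<partial>b) = 0"
  using translate_integral_measurable(1)[OF b h] by (subst (asm) nn_integral_0_iff_AE) simp_all
 thus ?thesis
 proof eventually_elim
  case (elim s)
  have "AE y in b. h (s + y) = 0"
   using elim avg_integrand_measurable[OF h, of s] by (subst (asm) nn_integral_0_iff_AE) (simp_all add: finite_radonD(6)[OF b])
  thus ?case by eventually_elim (simp add: h_def indicator_def split: if_splits)
 qed
qed

lemma avg_AE_cong:
 assumes b: "finite_radon b" and f: "f : borel_measurable borel" and g: "g : borel_measurable borel" and eq: "AE x in m. f x = g x"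
 shows "AE s in m. avg b f s = avg b g s"
proof -
 have "AE s in m. AE y in b. f (s + y) = g (s + y)" by (rule AE_translates[OF b _ eq]) (use f g in measurable)
 thus ?thesis
 proof eventually_elim
  case (elim s)
  thus ?case unfolding avg_def
   using avg_integrand_measurable[OF f] avg_integrand_measurable[OF g]
   by (intro integral_cong_AE) (simp_all add: finite_radonD(6)[OF b])
 qed
qed

lemma avg_scale: "avg b (%x. c * f x) s = c * avg b f s"
 by (simp add: avg_def)

lemma avg_add_AE:
 assumes b: "finite_radon b" and p: "1 <= p" and fin: "p = top ==> emeasure m UNIV < top"
  and f: "f : Lp_space p m" and g: "g : Lp_space p m"
 shows "AE s in m. avg b (%x. f x + g x) s = avg b f s + avg b g s"
proof -
 have "AE s in m. integrable b (%y. f (s + y))" by (rule avg_integrable_AE[OF b p fin f])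
 moreover have "AE s in m. integrable b (%y. g (s + y))" by (rule avg_integrable_AE[OF b p fin g])
 ultimately show ?thesis by eventually_elim (simp add: avg_def)
qed

end

section \<open>Convolution of finite measures and adjoints\<close>

lemma Lp_dominated:
 assumes p: "1 <= p" and f: "f : Lp_space p M" and g: "g : borel_measurable M" and le: "!!x. norm (g x) <= norm (f x)"
 shows "g : Lp_space p M"
proof (cases p)
 case top
 obtain C where "C >= 0" "AE x in M. norm (f x) <= C" using f by (auto simp: top Lp_space_inf)
 hence "AE x in M. norm (g x) <= C" by (auto elim!: eventually_mono intro: order_trans[OF le])
 thus ?thesis using \<open>C >= 0\<close> g by (auto simp: top Lp_space_inf)
next
 case (real P)
 have "integrable M (%x. norm (g x) powr P)"
  by (rule Bochner_Integration.integrable_bound[of _ "%x. norm (f x) powr P"])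
    (use f g real in \<open>auto simp: Lp_space_finite intro!: powr_mono2 le\<close>)
 thus ?thesis using g real by (simp add: Lp_space_finite)
qed

text \<open>Closure of S under domination keeps the four nonnegative parts of f in S. Identities
  thus reduce to nonnegative functions, where integrals can be exchanged freely.\<close>

lemma complex_function_induct:
 fixes Q :: "('a => complex) => bool"
 assumes f: "f : S" and meas: "S \<subseteq> borel_measurable M"
  and dom: "!!f g. f : S ==> g : borel_measurable M ==> (!!x. norm (g x) <= norm (f x)) ==> g : S"
  and S_add: "!!f g. f : S ==> g : S ==> (%x. f x + g x) : S" and S_scale: "!!c f. f : S ==> (%x. c * f x) : S"
  and pos: "!!u. u : borel_measurable M ==> (!!x. 0 <= u x) ==> (%x. complex_of_real (u x)) : S ==> Q (%x. complex_of_real (u x))"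
  and add: "!!f g. f : S ==> g : S ==> Q f ==> Q g ==> Q (%x. f x + g x)"
  and scale: "!!c f. f : S ==> Q f ==> Q (%x. c * f x)"
 shows "Q f"
proof -
 have fm [measurable]: "f : borel_measurable M" using f meas by auto
 have part: "(%x. complex_of_real (u (f x))) : S & Q (%x. complex_of_real (u (f x)))"
  if "u : borel_measurable borel" "!!z. 0 <= u z & u z <= norm z" for u
 proof -
  have m: "(%x. u (f x)) : borel_measurable M" using that(1) by measurable
  have "(%x. complex_of_real (u (f x))) : S" by (rule dom[OF f]) (use m that(2) in auto)
  thus ?thesis using pos[OF m] that(2) by auto
 qed
 define u1 u2 u3 u4 :: "complex => real" where "u1 = (%z. max 0 (Re z))" and "u2 = (%z. max 0 (- Re z))"
  and "u3 = (%z. max 0 (Im z))" and "u4 = (%z. max 0 (- Im z))"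
 have b: "\<bar>Re z\<bar> <= norm z" "\<bar>Im z\<bar> <= norm z" for z :: complex by (rule abs_Re_le_cmod, rule abs_Im_le_cmod)
 have u: "u1 : borel_measurable borel" "u2 : borel_measurable borel" "u3 : borel_measurable borel" "u4 : borel_measurable borel"
  "0 <= u1 z & u1 z <= norm z" "0 <= u2 z & u2 z <= norm z" "0 <= u3 z & u3 z <= norm z" "0 <= u4 z & u4 z <= norm z" for z
  unfolding u1_def u2_def u3_def u4_def using b(1)[of z] b(2)[of z] by auto
 note q = part[OF u(1) u(5)] part[OF u(2) u(6)] part[OF u(3) u(7)] part[OF u(4) u(8)]
 define A where "A = (%x. complex_of_real (u1 (f x)) + (-1) * complex_of_real (u2 (f x)))"
 define B where "B = (%x. \<i> * complex_of_real (u3 (f x)) + (- \<i>) * complex_of_real (u4 (f x)))"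
 have A: "A : S" "Q A" unfolding A_def using q by (intro S_add S_scale add scale; simp)+
 have B: "B : S" "Q B" unfolding B_def using q by (intro S_add S_scale add scale; simp)+
 have "f = (%x. A x + B x)"
  by (auto simp: fun_eq_iff complex_eq_iff A_def B_def u1_def u2_def u3_def u4_def max_def)
 thus ?thesis using add[OF A(1) B(1) A(2) B(2)] by simp
qed

lemma Lp_induct [consumes 2, case_names pos add scale]:
 fixes Q :: "('a => complex) => bool"
 assumes p: "1 <= p" and f: "f : Lp_space p M"
  and pos: "!!u. u : borel_measurable M ==> (!!x. 0 <= u x) ==> (%x. complex_of_real (u x)) : Lp_space p M ==> Q (%x. complex_of_real (u x))"
  and add: "!!f g. f : Lp_space p M ==> g : Lp_space p M ==> Q f ==> Q g ==> Q (%x. f x + g x)"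
  and scale: "!!c f. f : Lp_space p M ==> Q f ==> Q (%x. c * f x)"
 shows "Q f"
 by (rule complex_function_induct[of f "Lp_space p M" M])
   (use f p in \<open>auto intro: Lp_measurable Lp_dominated Lp_add Lp_scale pos add scale\<close>)

lemma nn_integral_reflect:
 assumes "finite_radon b" "f : borel_measurable borel"
 shows "(\<integral>\<^sup>+y. f y \<partial>reflect b) = (\<integral>\<^sup>+y. f (- y) \<partial>b)"
 unfolding reflect_def using assms
 by (intro nn_integral_distr) (auto simp: finite_radonD(3) cong: measurable_cong_sets intro!: borel_measurable_continuous_onI continuous_intros)

lemma uminus_measurable_radon: "finite_radon b ==> uminus : measurable b (borel :: 'a::{topological_ab_group_add, t2_space} measure)"
 by (simp add: finite_radonD(3) cong: measurable_cong_sets) (intro borel_measurable_continuous_onI continuous_intros)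

lemma finite_radon_reflect:
 fixes b :: "'a::{topological_ab_group_add, t2_space} measure"
 assumes b: "finite_radon b" shows "finite_radon (reflect b)" "emeasure (reflect b) UNIV = emeasure b UNIV"
proof -
 have e: "emeasure (reflect b) A = emeasure b (uminus -` A)" if "A : sets borel" for A
  using emeasure_distr[OF uminus_measurable_radon[OF b] that] finite_radonD(4)[OF b] by (simp add: reflect_def)
 show u: "emeasure (reflect b) UNIV = emeasure b UNIV" using e[of UNIV] by simp
 show "finite_radon (reflect b)"
 proof (rule finite_radonI)
  fix U :: "'a set" and \<epsilon> :: real assume U: "open U" "0 < \<epsilon>"
  have "open (uminus -` U)" using U(1) by (rule open_vimage) (intro continuous_intros)
  from finite_radonE[OF b this U(2)] obtain K where K: "compact K" "K \<subseteq> uminus -` U" "emeasure b (uminus -` U) <= emeasure b K + ennreal \<epsilon>" .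
  have c: "compact (uminus ` K)" by (rule compact_continuous_image[OF _ K(1)]) (intro continuous_intros)
  hence "emeasure (reflect b) (uminus ` K) = emeasure b K" by (simp add: e borel_compact inj_vimage_image_eq)
  thus "EX K. compact K & K \<subseteq> U & emeasure (reflect b) U <= emeasure (reflect b) K + ennreal \<epsilon>"
   using K(2,3) c U(1) by (intro exI[of _ "uminus ` K"]) (auto simp: e)
 qed (use u finite_radonD(2)[OF b] in \<open>simp_all add: reflect_def\<close>)
qed

lemma avg_reflect:
 assumes b: "finite_radon b" and f: "f : borel_measurable borel"
 shows "avg (reflect b) f s = (LINT y|b. f (s - y))"
proof -
 have "(%y. f (s + y)) : borel_measurable borel"
  by (rule measurable_compose[OF _ f]) (intro borel_measurable_continuous_onI continuous_intros)
 thus ?thesis unfolding avg_def reflect_def by (subst integral_distr[OF uminus_measurable_radon[OF b]]) simp_all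
qed

lemma avg_minus:
 assumes "finite_radon b" "f : borel_measurable borel"
 shows "avg b (%x. f (- x)) s = avg (reflect b) f (- s)"
 unfolding avg_reflect[OF assms] by (simp add: avg_def)

lemma avg_cnj: "avg b (%x. cnj (f x)) s = cnj (avg b f s)"
 by (simp add: avg_def)

section \<open>Convolution of finite Radon measures\<close>

text \<open>Defined through slices, since the preimage of a Borel set under addition need not lie in
  the product sigma-algebra.\<close>

definition radon_conv :: "'a::{topological_ab_group_add, t2_space} measure => 'a measure => 'a measure" where
 "radon_conv b c = measure_of UNIV (sets borel) (%A. \<integral>\<^sup>+y. emeasure c {z. y + z : A} \<partial>b)"

lemma sets_radon_conv [simp]: "sets (radon_conv b c) = sets borel"
 by (simp add: radon_conv_def) (metis sets.sigma_sets_eq space_borel)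

lemma space_radon_conv [simp]: "space (radon_conv b c) = UNIV"
 by (simp add: radon_conv_def)

context haar
begin

lemma compact_nbhd_inside:
 assumes "open U" "(x::'a) : U"
 shows "EX V K. open V & compact K & x : V & V \<subseteq> K & K \<subseteq> U"
proof -
 have "Hausdorff_space (euclidean :: 'a topology)"
  unfolding Hausdorff_space_def by (auto simp: disjnt_def dest!: hausdorff)
 hence "neighbourhood_base_of (%C. compactin euclidean C & closedin euclidean C) (euclidean :: 'a topology)"
  by (intro iffD1[OF locally_compact_regular_space_neighbourhood_base] conjI lc locally_compact_Hausdorff_imp_regular_space)
 hence "!!W x. openin euclidean W & x : W ==>
   EX U V. openin euclidean U & (compactin euclidean V & closedin euclidean V) & (x::'a) : U & U \<subseteq> V & V \<subseteq> W"
  unfolding neighbourhood_base_of by (elim allE impE) assumption+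
 from this[of U x] show ?thesis using assms by auto
qed

lemma emeasure_translate_measurable:
 fixes c :: "'a measure"
 assumes c: "finite_radon c" and A: "A : sets borel"
 shows "(%y. emeasure c {z. y + z : A}) : borel_measurable borel" "{z. y + z : A} : sets borel"
  "(\<integral>\<^sup>+z. indicator A (y + z) \<partial>c) = emeasure c {z. y + z : A}"
proof -
 show s: "{z. y + z : A} : sets borel" for y
  using measurable_sets[OF shift_measurable(2) A, of y] by (simp add: vimage_def)
 show eq: "(\<integral>\<^sup>+z. indicator A (y + z) \<partial>c) = emeasure c {z. y + z : A}" for y
 proof -
  have "(\<integral>\<^sup>+z. indicator A (y + z) \<partial>c) = (\<integral>\<^sup>+z. indicator {z. y + z : A} z \<partial>c)"
   by (intro nn_integral_cong) (simp split: split_indicator)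
  thus ?thesis using s[of y] finite_radonD(3)[OF c] by simp
 qed
 show "(%y. emeasure c {z. y + z : A}) : borel_measurable borel"
  using translate_integral_measurable(1)[where f = "indicator A", OF c] A by (simp add: eq)
qed

lemma emeasure_radon_conv:
 fixes b c :: "'a measure"
 assumes b: "finite_radon b" and c: "finite_radon c" and A: "A : sets borel"
 shows "emeasure (radon_conv b c) A = (\<integral>\<^sup>+y. emeasure c {z. y + z : A} \<partial>b)"
proof (rule emeasure_measure_of[OF radon_conv_def])
 show "positive (sets (radon_conv b c)) (%A. \<integral>\<^sup>+y. emeasure c {z. y + z : A} \<partial>b)"
  by (simp add: positive_def)
 show "countably_additive (sets (radon_conv b c)) (%A. \<integral>\<^sup>+y. emeasure c {z. y + z : A} \<partial>b)"
 proof (rule countably_additiveI)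
  fix B :: "nat => 'a set" assume B: "range B \<subseteq> sets (radon_conv b c)" "disjoint_family B"
  hence Bs: "B i : sets borel" for i by auto
  have "(\<Sum>i. \<integral>\<^sup>+y. emeasure c {z. y + z : B i} \<partial>b) = (\<integral>\<^sup>+y. (\<Sum>i. emeasure c {z. y + z : B i}) \<partial>b)"
   by (rule nn_integral_suminf[symmetric]) (simp add: emeasure_translate_measurable(1)[OF c Bs] finite_radonD(6)[OF b])
  also have "... = (\<integral>\<^sup>+y. emeasure c {z. y + z : (\<Union>i. B i)} \<partial>b)"
  proof (intro nn_integral_cong)
   fix y
   have "(\<Sum>i. emeasure c {z. y + z : B i}) = emeasure c (\<Union>i. {z. y + z : B i})"
    by (rule suminf_emeasure)
      (use B emeasure_translate_measurable(2)[OF c Bs] finite_radonD(3)[OF c] in \<open>auto simp: disjoint_family_on_def\<close>)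
   also have "(\<Union>i. {z. y + z : B i}) = {z. y + z : (\<Union>i. B i)}" by auto
   finally show "(\<Sum>i. emeasure c {z. y + z : B i}) = emeasure c {z. y + z : (\<Union>i. B i)}" .
  qed
  finally show "(\<Sum>i. \<integral>\<^sup>+y. emeasure c {z. y + z : B i} \<partial>b) = (\<integral>\<^sup>+y. emeasure c {z. y + z : \<Union> (range B)} \<partial>b)" .
 qed
qed (use A in \<open>auto simp: radon_conv_def\<close>)

lemma nn_integral_radon_conv:
 fixes b \<gamma> :: "'a measure"
 assumes b: "finite_radon b" and \<gamma>: "finite_radon \<gamma>" and f: "f : borel_measurable borel"
 shows "(\<integral>\<^sup>+x. f x \<partial>radon_conv b \<gamma>) = (\<integral>\<^sup>+y. \<integral>\<^sup>+z. f (y + z) \<partial>\<gamma> \<partial>b)"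
proof -
 have i: "(%z. w (y + z)) : borel_measurable \<gamma>" "(%y. \<integral>\<^sup>+z. w (y + z) \<partial>\<gamma>) : borel_measurable b" "w : borel_measurable (radon_conv b \<gamma>)"
  if w: "w : borel_measurable borel" for w :: "'a => ennreal" and y
  using w avg_integrand_measurable[OF w] translate_integral_measurable(1)[OF \<gamma> w]
  by (simp_all add: finite_radonD(6)[OF b] finite_radonD(6)[OF \<gamma>] cong: measurable_cong_sets)
 from f show ?thesis
proof (induction f rule: borel_measurable_induct)
 case (cong f g)
 hence "f = g" by auto
 thus ?case using cong by simp
next
 case (set A)
 thus ?case using emeasure_radon_conv[OF b \<gamma>] emeasure_translate_measurable(3)[OF \<gamma>] by simp
next
 case (mult u c)
 show ?case using mult(4) i[OF mult(2)] by (simp add: nn_integral_cmult)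
next
 case (add u v)
 show ?case using add.IH i[OF \<open>u : borel_measurable borel\<close>] i[OF \<open>v : borel_measurable borel\<close>] by (simp add: nn_integral_add)
next
 case (seq U)
 have inc: "incseq (%i y. \<integral>\<^sup>+z. U i (y + z) \<partial>\<gamma>)"
  using \<open>incseq U\<close> by (auto simp: incseq_def le_fun_def intro!: nn_integral_mono)
 have Um: "U j : borel_measurable borel" for j using seq by blast
 have inc2: "incseq (%i z. U i (y + z))" for y using \<open>incseq U\<close> by (auto simp: incseq_def le_fun_def)
 have "(\<integral>\<^sup>+x. (SUP i. U i) x \<partial>radon_conv b \<gamma>) = (SUP i. \<integral>\<^sup>+x. U i x \<partial>radon_conv b \<gamma>)"
  unfolding SUP_apply by (rule nn_integral_monotone_convergence_SUP) (fact \<open>incseq U\<close>, rule i(3)[OF Um])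
 also have "... = (SUP i. \<integral>\<^sup>+y. \<integral>\<^sup>+z. U i (y + z) \<partial>\<gamma> \<partial>b)" by (simp only: seq.IH)
 also have "... = (\<integral>\<^sup>+y. (SUP i. \<integral>\<^sup>+z. U i (y + z) \<partial>\<gamma>) \<partial>b)"
  by (rule nn_integral_monotone_convergence_SUP[symmetric]) (fact inc, rule i(2)[OF Um])
 also have "... = (\<integral>\<^sup>+y. \<integral>\<^sup>+z. (SUP i. U i (y + z)) \<partial>\<gamma> \<partial>b)"
  by (intro nn_integral_cong nn_integral_monotone_convergence_SUP[symmetric] inc2 i(1) Um)
 finally show ?case by (simp only: SUP_apply)
qed
qed

text \<open>Exchange of integrals together with commutativity of the group; this is why all averages
  commute.\<close>

lemma radon_conv_commute:
 fixes b c :: "'a measure"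
 assumes b: "finite_radon b" and c: "finite_radon c"
 shows "radon_conv b c = radon_conv c b"
proof (rule measure_eqI)
 fix A assume "A : sets (radon_conv b c)"
 hence A: "A : sets borel" by simp
 have "(\<integral>\<^sup>+y. \<integral>\<^sup>+z. indicator A (y + z) \<partial>c \<partial>b) = (\<integral>\<^sup>+z. \<integral>\<^sup>+y. indicator A (y + z) \<partial>b \<partial>c)"
  using radon_finite_fubini[of b c "%z. indicator A (fst z + snd z)"] finite_radonD(1,2)[OF b] finite_radonD(1,2)[OF c]
   sum_measurable[of "indicator A"] A by simp
 thus "emeasure (radon_conv b c) A = emeasure (radon_conv c b) A"
  using nn_integral_radon_conv[OF b c, of "indicator A"] nn_integral_radon_conv[OF c b, of "indicator A"] A
  by (simp add: add.commute)
qed simp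

text \<open>An open U is the directed union of open V with compact closure inside U. Directed
  convergence of slice integrals transfers this to the convolution, so some V has almost the full
  mass of U, and its closure is the compact set required.\<close>

lemma finite_radon_conv:
 fixes b c :: "'a measure"
 assumes b: "finite_radon b" and c: "finite_radon c"
 shows "finite_radon (radon_conv b c)" "emeasure (radon_conv b c) UNIV = emeasure b UNIV * emeasure c UNIV"
proof -
 show u: "emeasure (radon_conv b c) UNIV = emeasure b UNIV * emeasure c UNIV"
  using emeasure_radon_conv[OF b c, of UNIV] finite_radonD(4)[OF b] by (simp add: mult.commute)
 hence fin: "emeasure (radon_conv b c) UNIV < top"
  using finite_radonD(2)[OF b] finite_radonD(2)[OF c] by (simp add: ennreal_mult_less_top)
 show "finite_radon (radon_conv b c)"
 proof (rule finite_radonI[OF _ fin])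
  fix U :: "'a set" and e :: real assume U: "open U" and e: "0 < e"
  define I where "I = {V. open V & compact (closure V) & closure V \<subseteq> U}"
  have ne: "I ~= {}" unfolding I_def by (auto intro!: exI[of _ "{}"])
  define S where "S V = {(y, z). y + z : V}" for V :: "'a set"
  have dir: "EX k:I. S V \<subseteq> S k & S W \<subseteq> S k" if "V : I" "W : I" for V W
   using that by (intro bexI[of _ "V \<union> W"]) (auto simp: I_def S_def closure_Un)
  have "U \<subseteq> \<Union> I"
  proof
   fix x assume x: "x : U"
   obtain V K where V: "open V" "compact K" "x : V" "V \<subseteq> K" "K \<subseteq> U"
    using compact_nbhd_inside[OF U x] by auto
   have "closure V \<subseteq> K" using V closure_minimal[of V K] compact_imp_closed by blast
   moreover from this have "compact (closure V)" using V(2) by (metis closed_closure compact_Int_closed inf.absorb2)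
   ultimately show "x : \<Union> I" using V by (auto simp: I_def)
  qed
  hence UI: "U = \<Union> I" using closure_subset by (fastforce simp: I_def)
  have op: "open (S V)" if "V : I" for V
   using open_vimage[of V "%z. fst z + snd z"] that
   by (simp add: I_def S_def vimage_def case_prod_beta' continuous_on_add continuous_on_fst continuous_on_snd continuous_on_id)
  have eS: "(\<integral>\<^sup>+y. emeasure c {z. (y, z) : S V} \<partial>b) = emeasure (radon_conv b c) V" if "open V" for V
   using emeasure_radon_conv[OF b c, of V] that by (simp add: S_def)
  have SU: "S U = (\<Union>V\<in>I. S V)" by (auto simp: S_def UI)
  have "emeasure (radon_conv b c) U = (SUP V\<in>I. \<integral>\<^sup>+y. emeasure c {z. (y, z) : S V} \<partial>b)"
   unfolding eS[OF U, symmetric] SU by (rule slice_integral_directed[OF finite_radonD(1)[OF b] finite_radonD(1)[OF c] ne op dir])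
  also have "... = (SUP V\<in>I. emeasure (radon_conv b c) V)" by (rule SUP_cong) (auto simp: I_def eS)
  finally have eq: "emeasure (radon_conv b c) U = (SUP V\<in>I. emeasure (radon_conv b c) V)" .
  have "emeasure (radon_conv b c) U ~= \<infinity>"
   using le_less_trans[OF emeasure_mono[of U UNIV] fin] by simp
  from SUP_approx_ennreal[OF e ne eq this]
  obtain V where V: "V : I" "emeasure (radon_conv b c) U <= emeasure (radon_conv b c) V + ennreal e"
   using less_imp_le by blast
  have "emeasure (radon_conv b c) V <= emeasure (radon_conv b c) (closure V)"
   by (rule emeasure_mono) (auto simp: closure_subset)
  thus "EX K. compact K & K \<subseteq> U & emeasure (radon_conv b c) U <= emeasure (radon_conv b c) K + ennreal e"
   using V by (intro exI[of _ "closure V"]) (auto simp: I_def intro: order_trans add_right_mono)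
 qed simp
qed

lemma avg_nonneg:
 fixes b :: "'a measure"
 assumes b: "finite_radon b" and u: "u : borel_measurable borel" "!!x. 0 <= u x"
 shows "avg b (%x. complex_of_real (u x)) s = complex_of_real (enn2real (\<integral>\<^sup>+y. ennreal (u (s + y)) \<partial>b))"
 unfolding avg_def using u(2) avg_integrand_measurable[OF u(1), of s]
 by (simp add: integral_eq_nn_integral finite_radonD(6)[OF b])

lemma translates_finite_AE:
 fixes b :: "'a measure"
 assumes b: "finite_radon b" and p: "1 <= p" and fin: "p = top ==> emeasure m UNIV < top"
  and u: "u : borel_measurable borel" "!!x. 0 <= u x" and up: "(%x. complex_of_real (u x)) : Lp_space p m"
 shows "AE s in m. (\<integral>\<^sup>+y. ennreal (u (s + y)) \<partial>b) < top"
proof -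
 have "AE s in m. integrable b (%y. complex_of_real (u (s + y)))" by (rule avg_integrable_AE[OF b p fin up])
 thus ?thesis
proof eventually_elim
 case (elim s)
 have "(%x. complex_of_real (u x)) : borel_measurable borel" using u(1) by measurable
 from avg_integrable_iff[OF b this, of s] elim show ?case using u(2) by simp
qed
qed

section \<open>Composition and adjoint of averages\<close>

text \<open>For nonnegative functions both sides are the same iterated integral, except that
  infinite inner averages are replaced by 0; so the identity is claimed almost everywhere.\<close>

theorem avg_avg:
 assumes b: "finite_radon b" and \<gamma>: "finite_radon \<gamma>" and p: "1 <= p" and fin: "p = top ==> emeasure m UNIV < top"
  and f: "f : Lp_space p m"
 shows "AE s in m. avg b (avg \<gamma> f) s = avg (radon_conv b \<gamma>) f s"
 using p f
proof (induction f rule: Lp_induct)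
 case (pos u)
 hence u: "u : borel_measurable borel" "!!x. 0 <= u x" by auto
 note [measurable] = u(1)
 have eu: "(%x. ennreal (u x)) : borel_measurable borel" by measurable
 define F where "F x = (\<integral>\<^sup>+z. ennreal (u (x + z)) \<partial>\<gamma>)" for x
 have Fm [measurable]: "F : borel_measurable borel"
  unfolding F_def[abs_def] by (rule translate_integral_measurable(1)[OF \<gamma> eu])
 have "AE x in m. F x < top"
  unfolding F_def by (rule translates_finite_AE[OF \<gamma> p fin u pos(3)])
 hence "AE s in m. AE y in b. F (s + y) < top" by (intro AE_translates[OF b]) measurable
 thus ?case
 proof eventually_elim
  case (elim s)
  have "avg b (avg \<gamma> (%x. complex_of_real (u x))) s = avg b (%x. complex_of_real (enn2real (F x))) s"
   unfolding avg_nonneg[OF \<gamma> u, abs_def] F_def ..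
  also have "... = complex_of_real (enn2real (\<integral>\<^sup>+y. ennreal (enn2real (F (s + y))) \<partial>b))"
   by (rule avg_nonneg[OF b]) auto
  \<comment> \<open>\<open>enn2real\<close> sends infinite values to 0, which is harmless because F
    is finite at s + y for almost every y.\<close>
  also have "(\<integral>\<^sup>+y. ennreal (enn2real (F (s + y))) \<partial>b) = (\<integral>\<^sup>+y. F (s + y) \<partial>b)"
   by (rule nn_integral_cong_AE) (use elim in eventually_elim, simp)
  also have "... = (\<integral>\<^sup>+y. \<integral>\<^sup>+z. ennreal (u (s + (y + z))) \<partial>\<gamma> \<partial>b)" by (simp add: F_def add.assoc)
  also have "... = (\<integral>\<^sup>+x. ennreal (u (s + x)) \<partial>radon_conv b \<gamma>)"
   by (rule nn_integral_radon_conv[OF b \<gamma>, symmetric]) (rule avg_integrand_measurable[OF eu])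
  finally show ?case unfolding avg_nonneg[OF finite_radon_conv(1)[OF b \<gamma>] u] .
 qed
next
 case (add f g)
 have m: "f : borel_measurable borel" "g : borel_measurable borel" using add(1,2)[THEN Lp_measurable] by auto
 note [measurable] = m avg_measurable[OF \<gamma> m(1)] avg_measurable[OF \<gamma> m(2)]
 have fg: "(%x. f x + g x) : borel_measurable borel" by measurable
 have "AE s in m. avg b (avg \<gamma> (%x. f x + g x)) s = avg b (%x. avg \<gamma> f x + avg \<gamma> g x) s"
  by (rule avg_AE_cong[OF b avg_measurable[OF \<gamma> fg] _ avg_add_AE[OF \<gamma> p fin add(1,2)]]) measurable
 moreover have "AE s in m. avg b (%x. avg \<gamma> f x + avg \<gamma> g x) s = avg b (avg \<gamma> f) s + avg b (avg \<gamma> g) s"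
  by (rule avg_add_AE[OF b p fin avg_Lp(1)[OF \<gamma> p fin add(1)] avg_Lp(1)[OF \<gamma> p fin add(2)]])
 moreover have "AE s in m. avg (radon_conv b \<gamma>) (%x. f x + g x) s = avg (radon_conv b \<gamma>) f s + avg (radon_conv b \<gamma>) g s"
  by (rule avg_add_AE[OF finite_radon_conv(1)[OF b \<gamma>] p fin add(1,2)])
 ultimately show ?case using add(3,4) by eventually_elim simp
next
 case (scale c f)
 from scale(2) show ?case unfolding avg_scale[abs_def] by eventually_elim simp
qed

text \<open>Both functions are reduced to nonnegative ones, where
  \<open>nn_integral_translates_mult\<close> is the identity. Finiteness of the averages almost
  everywhere permits passing between extended and real values.\<close>

theorem avg_adjoint:
 assumes b: "finite_radon b" and pq: "conjugate_exponents p q"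
  and finp: "p = top ==> emeasure m UNIV < top" and finq: "q = top ==> emeasure m UNIV < top"
  and f: "f : Lp_space p m" and g: "g : Lp_space q m"
 shows "(LINT s|m. avg b f s * g s) = (LINT s|m. f s * avg (reflect b) g s)"
proof -
 note p = conjugate_exponents_ge_1[OF pq]
 note R = finite_radon_reflect(1)[OF b]
 have aL: "integrable m (%s. avg b f s * g s)" if "f : Lp_space p m" "g : Lp_space q m" for f g
  by (rule Holder_inequality(1)[OF pq avg_Lp(1)[OF b p(1) finp that(1)] that(2)])
 have aR: "integrable m (%s. f s * avg (reflect b) g s)" if "f : Lp_space p m" "g : Lp_space q m" for f g
  by (rule Holder_inequality(1)[OF pq that(1) avg_Lp(1)[OF R p(2) finq that(2)]])
 have mL: "avg b f : borel_measurable borel" "f : borel_measurable borel" if "f : Lp_space p m" for f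
  using avg_measurable[OF b] Lp_measurable[OF that] by auto
 have mR: "avg (reflect b) g : borel_measurable borel" "g : borel_measurable borel" if "g : Lp_space q m" for g
  using avg_measurable[OF R] Lp_measurable[OF that] by auto
 show ?thesis using p(1) f
 proof (induction f rule: Lp_induct)
  case (pos u)
  note u = pos
  show ?case using p(2) g
  proof (induction g rule: Lp_induct)
   case (pos v)
   have [measurable]: "u : borel_measurable borel" "v : borel_measurable borel" using u(1) pos(1) by auto
   define A where "A s = (\<integral>\<^sup>+y. ennreal (u (s + y)) \<partial>b)" for s
   define B where "B s = (\<integral>\<^sup>+y. ennreal (v (s - y)) \<partial>b)" for s
   have [measurable]: "A : borel_measurable borel" unfolding A_def[abs_def]
    by (rule translate_integral_measurable(1)[OF b]) measurable
   have [measurable]: "B : borel_measurable borel" unfolding B_def[abs_def]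
    by (rule translate_integral_measurable(2)[OF b]) measurable
   have Beq: "(\<integral>\<^sup>+y. ennreal (v (s + y)) \<partial>reflect b) = B s" for s
    unfolding B_def using nn_integral_reflect[OF b, of "%y. ennreal (v (s + y))"] by simp
   have 1: "avg b (%x. complex_of_real (u x)) s = complex_of_real (enn2real (A s))" for s
    unfolding A_def by (rule avg_nonneg[OF b]) (use u in auto)
   have 2: "avg (reflect b) (%x. complex_of_real (v x)) s = complex_of_real (enn2real (B s))" for s
    unfolding Beq[symmetric] by (rule avg_nonneg[OF R]) (use pos in auto)
   have finA: "AE s in m. A s < top"
    unfolding A_def by (rule translates_finite_AE[OF b p(1) finp]) (use u in auto)
   have "AE s in m. (\<integral>\<^sup>+y. ennreal (v (s + y)) \<partial>reflect b) < top"
    by (rule translates_finite_AE[OF R p(2) finq]) (use pos in auto)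
   hence finB: "AE s in m. B s < top" unfolding Beq .
   have vs: "sigma_supported (%x. ennreal (v x))"
    using Lp_sigma_supported[OF p(2) finq pos(3)] pos(2) by simp
   have "(LINT s|m. avg b (%x. complex_of_real (u x)) s * complex_of_real (v s)) = complex_of_real (LINT s|m. enn2real (A s) * v s)"
    unfolding 1 by (simp flip: of_real_mult)
   also have "(LINT s|m. enn2real (A s) * v s) = enn2real (\<integral>\<^sup>+s. ennreal (enn2real (A s) * v s) \<partial>m)"
    by (rule integral_eq_nn_integral) (use pos in auto)
   also have "(\<integral>\<^sup>+s. ennreal (enn2real (A s) * v s) \<partial>m) = (\<integral>\<^sup>+s. A s * ennreal (v s) \<partial>m)"
    by (rule nn_integral_cong_AE) (use finA in eventually_elim, use pos in \<open>simp add: ennreal_mult\<close>)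
   also have "... = (\<integral>\<^sup>+s. ennreal (u s) * B s \<partial>m)"
    unfolding A_def B_def by (rule nn_integral_translates_mult(2)[OF b _ _ vs]) measurable
   also have "... = (\<integral>\<^sup>+s. ennreal (u s * enn2real (B s)) \<partial>m)"
    by (rule nn_integral_cong_AE) (use finB in eventually_elim, use u in \<open>simp add: ennreal_mult\<close>)
   also have "enn2real ... = (LINT s|m. u s * enn2real (B s))"
    by (rule integral_eq_nn_integral[symmetric]) (use u in auto)
   also have "complex_of_real (LINT s|m. u s * enn2real (B s)) = (LINT s|m. complex_of_real (u s) * avg (reflect b) (%x. complex_of_real (v x)) s)"
    unfolding 2 by (simp flip: of_real_mult)
   finally show ?case .
  next
   case (add g h)
   have "(LINT s|m. complex_of_real (u s) * avg (reflect b) (%x. g x + h x) s)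
     = (LINT s|m. complex_of_real (u s) * (avg (reflect b) g s + avg (reflect b) h s))"
   proof (rule integral_cong_AE)
    show "AE s in m. complex_of_real (u s) * avg (reflect b) (%x. g x + h x) s = complex_of_real (u s) * (avg (reflect b) g s + avg (reflect b) h s)"
     by (rule eventually_mono[OF avg_add_AE[OF R p(2) finq add(1,2)]]) simp_all
   qed (use u mR[OF add(1)] mR[OF add(2)] mR[OF Lp_add[OF p(2) add(1,2)]] in \<open>auto intro!: borel_measurable_times borel_measurable_add\<close>)
   thus ?case
    using add(3,4) aL[OF u(3) add(1)] aL[OF u(3) add(2)] aR[OF u(3) add(1)] aR[OF u(3) add(2)]
    by (simp add: distrib_left)
  next
   case (scale c g)
   thus ?case by (simp add: avg_scale mult.left_commute)
  qed
 next
  case (add f h)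
  have "(LINT s|m. avg b (%x. f x + h x) s * g s) = (LINT s|m. (avg b f s + avg b h s) * g s)"
  proof (rule integral_cong_AE)
   show "AE s in m. avg b (%x. f x + h x) s * g s = (avg b f s + avg b h s) * g s"
    by (rule eventually_mono[OF avg_add_AE[OF b p(1) finp add(1,2)]]) simp_all
  qed (use mR[OF g] mL[OF add(1)] mL[OF add(2)] mL[OF Lp_add[OF p(1) add(1,2)]] in \<open>auto intro!: borel_measurable_times borel_measurable_add\<close>)
  thus ?case
   using add(3,4) aL[OF add(1) g] aL[OF add(2) g] aR[OF add(1) g] aR[OF add(2) g]
   by (simp add: distrib_right)
 next
  case (scale c f)
  thus ?case by (simp add: avg_scale mult.assoc)
 qed
qed

end

section \<open>Jordan decomposition\<close>

lemma ennreal_sums_le: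
 assumes "a sums s" shows "ennreal s <= (\<Sum>n. ennreal (a n))"
proof (rule LIMSEQ_le_const2)
 show "(%k. ennreal (\<Sum>n<k. a n)) \<longlonglongrightarrow> ennreal s"
  using assms by (intro tendsto_ennrealI) (simp add: sums_def)
 have "ennreal (\<Sum>n<k. a n) <= (\<Sum>n. ennreal (a n))" for k
 proof -
  have "ennreal (\<Sum>n<k. a n) <= ennreal (\<Sum>n<k. max 0 (a n))" by (intro ennreal_leI sum_mono) simp
  also have "... = (\<Sum>n<k. ennreal (max 0 (a n)))" by (rule sum_ennreal[symmetric]) simp
  also have "... = (\<Sum>n<k. ennreal (a n))" by (intro sum.cong refl) (simp add: max_def ennreal_neg)
  also have "... <= (\<Sum>n. ennreal (a n))" by (rule sum_le_suminf) auto
  finally show ?thesis .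
 qed
 thus "EX N. ALL k>=N. ennreal (\<Sum>n<k. a n) <= (\<Sum>n. ennreal (a n))" by blast
qed

definition borel_additive :: "('a::topological_space set => 'b::real_normed_vector) => bool" where
 "borel_additive \<nu> \<longleftrightarrow> (ALL A :: nat => 'a set. range A \<subseteq> sets borel & disjoint_family A --> (%n. \<nu> (A n)) sums \<nu> (\<Union>n. A n))"

lemma borel_additive_empty: "borel_additive \<nu> ==> \<nu> {} = 0"
proof -
 assume "borel_additive \<nu>"
 hence "(%n::nat. \<nu> {}) sums \<nu> (\<Union>n::nat. {})"
  unfolding borel_additive_def by (elim allE[of _ "%_. {}"] impE) (auto simp: disjoint_family_on_def)
 hence "(%n::nat. \<nu> {}) \<longlonglongrightarrow> 0" using summable_LIMSEQ_zero sums_summable by blast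
 thus ?thesis by (simp add: LIMSEQ_const_iff)
qed

lemma borel_additive_Un:
 assumes \<nu>: "borel_additive \<nu>" and A: "A : sets borel" "B : sets borel" "A \<inter> B = {}"
 shows "\<nu> (A \<union> B) = \<nu> A + \<nu> B"
proof -
 define C where "C n = (if n = 0 then A else if n = 1 then B else {})" for n :: nat
 have "range C \<subseteq> sets borel" "disjoint_family C" "(\<Union>n. C n) = A \<union> B"
  using A by (auto simp: C_def disjoint_family_on_def split: if_splits)
 hence "(%n. \<nu> (C n)) sums \<nu> (A \<union> B)" using \<nu> unfolding borel_additive_def by metis
 moreover have "(%n. \<nu> (C n)) sums (\<Sum>n\<in>{0,1}. \<nu> (C n))"
  by (rule sums_finite) (auto simp: C_def borel_additive_empty[OF \<nu>])
 ultimately have "\<nu> (A \<union> B) = (\<Sum>n\<in>{0,1}. \<nu> (C n))" by (rule sums_unique2)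
 thus ?thesis by (simp add: C_def)
qed

lemma sets_jordan_pos [simp]: "sets (jordan_pos \<nu>) = sets borel"
 by (simp add: jordan_pos_def) (metis sets.sigma_sets_eq space_borel)

lemma space_jordan_pos [simp]: "space (jordan_pos \<nu>) = UNIV"
 by (simp add: jordan_pos_def)

text \<open>Superadditivity on disjoint sets comes from finite additivity of \<nu>, and countable
  subadditivity from its countable additivity on the pieces of a competing set A.\<close>

lemma emeasure_jordan_pos:
 fixes \<nu> :: "'a::topological_space set => real"
 assumes \<nu>: "borel_additive \<nu>" and E: "E : sets borel"
 shows "emeasure (jordan_pos \<nu>) E = (SUP A\<in>{A : sets borel. A \<subseteq> E}. ennreal (\<nu> A))"
proof -
 define P where "P E = (SUP A\<in>{A : sets borel. A \<subseteq> E}. ennreal (\<nu> A))" for E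
 have upper: "ennreal (\<nu> A) <= P E" if "A : sets borel" "A \<subseteq> E" for A E
  unfolding P_def using that by (intro SUP_upper) auto
 have mono: "P E <= P F" if "E \<subseteq> F" for E F
  unfolding P_def by (rule SUP_subset_mono) (use that in auto)
 have add2: "P E + P F <= P (E \<union> F)" if "E \<inter> F = {}" for E F
 proof -
  have ne: "{A : sets borel. A \<subseteq> E} ~= {}" for E :: "'a set" by auto
  have "ennreal (\<nu> A) + ennreal (\<nu> B) <= P (E \<union> F)" if AB: "A : sets borel" "A \<subseteq> E" "B : sets borel" "B \<subseteq> F" for A B
  proof -
   have "A \<inter> B = {}" using AB \<open>E \<inter> F = {}\<close> by auto
   hence "\<nu> (A \<union> B) = \<nu> A + \<nu> B" using borel_additive_Un[OF \<nu>] AB by auto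
   moreover have "ennreal (\<nu> A) <= P (E \<union> F)" "ennreal (\<nu> B) <= P (E \<union> F)" "ennreal (\<nu> (A \<union> B)) <= P (E \<union> F)"
    using AB by (auto intro!: upper)
   \<comment> \<open>\<open>ennreal\<close> cuts off negative values, so a set with negative value
     contributes 0 and the other set alone is a sufficient competitor.\<close>
   ultimately show ?thesis
    by (cases "\<nu> A <= 0"; cases "\<nu> B <= 0") (auto simp: ennreal_neg)
  qed
  hence "(SUP B\<in>{B : sets borel. B \<subseteq> F}. ennreal (\<nu> A) + ennreal (\<nu> B)) <= P (E \<union> F)" if "A : sets borel" "A \<subseteq> E" for A
   using that by (intro SUP_least) auto
  hence "ennreal (\<nu> A) + P F <= P (E \<union> F)" if "A : sets borel" "A \<subseteq> E" for A
   using that ennreal_SUP_add_right[OF ne, of "ennreal (\<nu> A)" "%A. ennreal (\<nu> A)" F] by (simp add: P_def[of F])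
  hence "(SUP A\<in>{A : sets borel. A \<subseteq> E}. ennreal (\<nu> A) + P F) <= P (E \<union> F)" by (intro SUP_least) auto
  thus ?thesis
   using ennreal_SUP_add_left[OF ne, of "%A. ennreal (\<nu> A)" "P F" E] by (simp add: P_def[of E])
 qed
 have jd: "jordan_pos \<nu> = measure_of UNIV (sets borel) P" unfolding jordan_pos_def P_def[abs_def] ..
 have "emeasure (jordan_pos \<nu>) E = P E"
 proof (rule emeasure_measure_of[OF jd])
  have "P {} = 0" by (simp add: P_def borel_additive_empty[OF \<nu>] cong: conj_cong)
  thus "positive (sets (jordan_pos \<nu>)) P" by (simp add: positive_def)
  show "countably_additive (sets (jordan_pos \<nu>)) P"
  proof (rule countably_additiveI)
   fix B :: "nat => 'a set" assume B: "range B \<subseteq> sets (jordan_pos \<nu>)" "disjoint_family B"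
   hence Bs: "B i : sets borel" for i by auto
   have fin: "(\<Sum>i<k. P (B i)) <= P (\<Union>i<k. B i)" for k
   proof (induction k)
    case (Suc k)
    have "(\<Sum>i<Suc k. P (B i)) <= P (\<Union>i<k. B i) + P (B k)" using Suc by (simp add: add_right_mono)
    also have "... <= P ((\<Union>i<k. B i) \<union> B k)"
    proof (rule add2)
     have "B i \<inter> B k = {}" if "i < k" for i using disjoint_family_onD[OF B(2), of i k] that by simp
     thus "(\<Union>i<k. B i) \<inter> B k = {}" by blast
    qed
    also have "(\<Union>i<k. B i) \<union> B k = (\<Union>i<Suc k. B i)" by (auto simp: lessThan_Suc)
    finally show ?case .
   qed (simp add: \<open>P {} = 0\<close>)
   have le: "(\<Sum>i. P (B i)) <= P (\<Union>i. B i)"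
    unfolding suminf_eq_SUP by (intro SUP_least order_trans[OF fin mono]) auto
   have "P (\<Union>i. B i) <= (\<Sum>i. P (B i))" unfolding P_def[of "\<Union>i. B i"]
   proof (rule SUP_least)
    fix A assume A: "A : {A : sets borel. A \<subseteq> (\<Union>i. B i)}"
    have "range (%i. A \<inter> B i) \<subseteq> sets borel" "disjoint_family (%i. A \<inter> B i)" "(\<Union>i. A \<inter> B i) = A"
     using A Bs B(2) by (auto simp: disjoint_family_on_def)
    hence "(%i. \<nu> (A \<inter> B i)) sums \<nu> A" using \<nu> unfolding borel_additive_def by metis
    hence "ennreal (\<nu> A) <= (\<Sum>i. ennreal (\<nu> (A \<inter> B i)))" by (rule ennreal_sums_le)
    also have "... <= (\<Sum>i. P (B i))" using A Bs by (intro suminf_le upper) auto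
    finally show "ennreal (\<nu> A) <= (\<Sum>i. P (B i))" .
   qed
   with le show "(\<Sum>i. P (B i)) = P (\<Union> (range B))" by (rule antisym)
  qed
 qed (use E in auto)
 thus ?thesis by (simp add: P_def)
qed

text \<open>A partition of K, extended by a part A of U - K and the remainder, is a partition of U.
  Hence the Jordan part of U - K plus the variation on K is at most the variation on U, and inner
  regularity of the variation passes to the Jordan part.\<close>

lemma finite_radon_jordan_pos:
 fixes \<mu> :: "'a::t2_space set => complex"
 assumes \<mu>: "\<mu> : bounded_regular_measures" and \<nu>: "borel_additive \<nu>" and le: "!!A. \<bar>\<nu> A\<bar> <= norm (\<mu> A)"
 shows "finite_radon (jordan_pos \<nu>)"
proof -
 have \<mu>add: "borel_additive \<mu>" and fin: "total_variation \<mu> UNIV < top"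
  and reg: "!!E. E : sets borel ==> total_variation \<mu> E = (SUP K\<in>{K. compact K & K \<subseteq> E}. total_variation \<mu> K)"
  using \<mu> by (auto simp: bounded_regular_measures_def borel_additive_def)
 note e = emeasure_jordan_pos[OF \<nu>]
 have split: "ennreal (\<nu> A) + total_variation \<mu> K <= total_variation \<mu> U"
  if A: "A : sets borel" "A \<subseteq> U - K" and K: "K : sets borel" "K \<subseteq> U" and U: "U : sets borel" for A K U
 proof -
  define SS where "SS = {B :: nat => 'a set. range B \<subseteq> sets borel & disjoint_family B & (\<Union>n. B n) = K}"
  have ne: "SS ~= {}"
  proof -
   have "(%n::nat. if n = 0 then K else {}) : SS" using K by (auto simp: SS_def disjoint_family_on_def split: if_splits)
   thus ?thesis by blast
  qed
  have "ennreal (\<nu> A) + (\<Sum>n. ennreal (norm (\<mu> (B n)))) <= total_variation \<mu> U" if B: "B : SS" for B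
  proof -
   \<comment> \<open>A first, the rest of U - K second, then the given partition of K: a partition
     of U.\<close>
   define C where "C n = (case n of 0 => A | Suc k => (case k of 0 => U - K - A | Suc j => B j))" for n
   have C: "C 0 = A" "C (Suc 0) = U - K - A" "C (Suc (Suc j)) = B j" for j by (simp_all add: C_def)
   have BK: "B j \<subseteq> K" "B j : sets borel" for j using B by (auto simp: SS_def)
   have Cs: "C n : sets borel" for n
    using A K U BK(2) by (auto simp: C_def split: nat.split)
   have "B i \<inter> B j = {}" if "i ~= j" for i j using B that by (auto simp: SS_def disjoint_family_on_def)
   moreover have "A \<inter> B j = {}" "B j \<inter> A = {}" "(U - K - A) \<inter> B j = {}" "B j \<inter> (U - K - A) = {}" for j
    using A BK(1)[of j] by auto
   ultimately have disj: "disjoint_family C"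
    unfolding disjoint_family_on_def by (auto simp: C_def Diff_disjoint Int_commute[of _ A] simp del: Int_Diff split: nat.split)
   have un: "(\<Union>n. C n) = U"
   proof
    have "C n \<subseteq> U" for n using A K BK(1) by (auto simp: C_def split: nat.split)
    thus "(\<Union>n. C n) \<subseteq> U" by blast
    show "U \<subseteq> (\<Union>n. C n)"
    proof
     fix x assume x: "x : U"
     have "K = (\<Union>j. B j)" using B by (auto simp: SS_def)
     then consider "x : A" | "x : U - K - A" | j where "x : B j" using x by blast
     thus "x : (\<Union>n. C n)" by cases (use C in blast)+
    qed
   qed
   have "ennreal (\<nu> A) <= ennreal (norm (\<mu> A))" using le[of A] by (intro ennreal_leI) linarith
   hence "ennreal (\<nu> A) + (\<Sum>n. ennreal (norm (\<mu> (B n)))) <= ennreal (norm (\<mu> (C 0))) + (ennreal (norm (\<mu> (C 1))) + (\<Sum>n. ennreal (norm (\<mu> (C (n + 2))))))"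
    by (intro add_mono) (simp_all add: C add_increasing)
   also have "... = (\<Sum>n. ennreal (norm (\<mu> (C n))))"
    unfolding suminf_offset[of "%n. ennreal (norm (\<mu> (C n)))" 2, OF summableI]
    by (simp add: numeral_2_eq_2 add.assoc add.commute[of "suminf _"])
   also have "... <= total_variation \<mu> U"
    unfolding total_variation_def using Cs disj un by (intro SUP_upper) auto
   finally show ?thesis .
  qed
  hence "(SUP B\<in>SS. ennreal (\<nu> A) + (\<Sum>n. ennreal (norm (\<mu> (B n))))) <= total_variation \<mu> U" by (intro SUP_least) auto
  thus ?thesis
   unfolding total_variation_def[of \<mu> K] SS_def[symmetric] by (simp add: ennreal_SUP_add_right[OF ne])
 qed
 have tv_empty: "total_variation \<mu> {} = 0"
  unfolding total_variation_def
 proof (rule antisym[OF SUP_least])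
  fix A :: "nat => 'a set" assume "A : {A. range A \<subseteq> sets borel & disjoint_family A & (\<Union>n. A n) = {}}"
  hence "A n = {}" for n by auto
  thus "(\<Sum>n. ennreal (norm (\<mu> (A n)))) <= 0" by (simp add: borel_additive_empty[OF \<mu>add])
 qed simp
 have tv: "emeasure (jordan_pos \<nu>) (U - K) + total_variation \<mu> K <= total_variation \<mu> U"
  if "K : sets borel" "K \<subseteq> U" "U : sets borel" for K U
 proof -
  have ne: "{A : sets borel. A \<subseteq> U - K} ~= {}" by auto
  have "U - K : sets borel" using that by auto
  thus ?thesis
   unfolding e[OF \<open>U - K : sets borel\<close>] ennreal_SUP_add_left[OF ne, symmetric] using split that by (intro SUP_least) auto
 qed
 have finJ: "emeasure (jordan_pos \<nu>) UNIV < top"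
  using tv[of "{}" UNIV] fin by (simp add: tv_empty le_less_trans)
 have tv_mono: "total_variation \<mu> U < top" if "U : sets borel" for U
 proof -
  have "total_variation \<mu> U <= total_variation \<mu> UNIV"
   using tv[of U UNIV] that by (auto intro: order_trans[rotated] add_increasing)
  thus ?thesis using fin by (rule le_less_trans)
 qed
 show ?thesis
 proof (rule finite_radonI[OF sets_jordan_pos finJ])
  fix U :: "'a set" and \<epsilon> :: real assume U: "open U" and \<epsilon>: "0 < \<epsilon>"
  have Ub: "U : sets borel" using U by simp
  define t where "t = total_variation \<mu> U"
  have t: "t < top" using tv_mono[OF Ub] by (simp add: t_def)
  have "EX K. compact K & K \<subseteq> U & t <= total_variation \<mu> K + ennreal \<epsilon>"
  proof (rule ccontr)
   assume "\<not> (EX K. compact K & K \<subseteq> U & t <= total_variation \<mu> K + ennreal \<epsilon>)"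
   hence "total_variation \<mu> K + ennreal \<epsilon> <= t" if "compact K" "K \<subseteq> U" for K using that by (auto simp: not_le intro: less_imp_le)
   hence "(SUP K\<in>{K. compact K & K \<subseteq> U}. total_variation \<mu> K + ennreal \<epsilon>) <= t" by (intro SUP_least) auto
   moreover have "{K. compact K & K \<subseteq> U} ~= {}" by (auto intro: exI[of _ "{}"])
   ultimately have "t + ennreal \<epsilon> <= t"
    unfolding t_def reg[OF Ub, symmetric] by (simp add: ennreal_SUP_add_left reg[OF Ub, symmetric])
   moreover have "t < t + ennreal \<epsilon>" using t \<epsilon> by (cases t) (auto simp flip: ennreal_plus simp: ennreal_less_iff)
   ultimately show False by simp
  qed
  then obtain K where K: "compact K" "K \<subseteq> U" "t <= total_variation \<mu> K + ennreal \<epsilon>" by blast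
  have Kb: "K : sets borel" using K(1) by (rule borel_compact)
  have "emeasure (jordan_pos \<nu>) (U - K) + total_variation \<mu> K <= total_variation \<mu> K + ennreal \<epsilon>"
   using order_trans[OF tv[OF Kb K(2) Ub] K(3)[unfolded t_def]] .
  hence "emeasure (jordan_pos \<nu>) (U - K) <= ennreal \<epsilon>"
   using tv_mono[OF Kb] unfolding add.commute[of _ "total_variation \<mu> K"] ennreal_add_left_cancel_le by auto
  moreover have "emeasure (jordan_pos \<nu>) U = emeasure (jordan_pos \<nu>) K + emeasure (jordan_pos \<nu>) (U - K)"
   using K(2) Kb Ub by (subst plus_emeasure) (auto simp: Un_absorb1)
  ultimately show "EX K. compact K & K \<subseteq> U & emeasure (jordan_pos \<nu>) U <= emeasure (jordan_pos \<nu>) K + ennreal \<epsilon>"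
   using K(1,2) by (intro exI[of _ K]) (simp add: add_left_mono)
 qed
qed

lemma integral_jordan_pos_nonpos:
 fixes f :: "'a::topological_space => complex"
 assumes \<nu>: "borel_additive \<nu>" and neg: "!!A. A : sets borel ==> \<nu> A <= 0"
 shows "(LINT x|jordan_pos \<nu>. f x) = 0"
proof -
 have "emeasure (jordan_pos \<nu>) UNIV <= 0"
  by (subst emeasure_jordan_pos[OF \<nu>], simp, rule SUP_least) (simp add: ennreal_neg neg)
 hence "UNIV : null_sets (jordan_pos \<nu>)" by auto
 hence "AE x in jordan_pos \<nu>. f x = 0" by (rule AE_I') auto
 thus ?thesis by (rule integral_eq_zero_AE)
qed

text \<open>The integral over a complex measure combines four Jordan parts, each reflected because a
  convolution evaluates f at s - x. For positive \<mu> three of the integrals vanish.\<close>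

theorem convolution_avg:
 fixes \<mu> :: "'a::{topological_ab_group_add, t2_space} set => complex"
 assumes \<mu>: "\<mu> : bounded_regular_measures"
 shows "EX c (b :: nat => 'a measure). (ALL i. finite_radon (b i)) &
   (ALL f:borel_measurable borel. convolution \<mu> f = (%s. \<Sum>i<4. c i * avg (b i) f s))"
  and "positive_measure \<mu> ==> EX b :: 'a measure. finite_radon b &
   (ALL f:borel_measurable borel. convolution \<mu> f = avg b f)"
proof -
 have \<mu>add: "borel_additive \<mu>" using \<mu> by (auto simp: bounded_regular_measures_def borel_additive_def)
 have Re: "borel_additive (%A. Re (\<mu> A))" and Im: "borel_additive (%A. Im (\<mu> A))"
  using \<mu>add by (auto simp: borel_additive_def intro: sums_Re sums_Im)
 have nRe: "borel_additive (%A. - Re (\<mu> A))" and nIm: "borel_additive (%A. - Im (\<mu> A))"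
  using Re Im by (auto simp: borel_additive_def intro: sums_minus)
 define \<alpha> where "\<alpha> = (!) [jordan_pos (%A. Re (\<mu> A)), jordan_pos (%A. - Re (\<mu> A)), jordan_pos (%A. Im (\<mu> A)), jordan_pos (%A. - Im (\<mu> A))]"
 define c where "c = (!) [1, -1, \<i>, -\<i>]"
 have R: "finite_radon (jordan_pos (%A. Re (\<mu> A)))" "finite_radon (jordan_pos (%A. - Re (\<mu> A)))"
  "finite_radon (jordan_pos (%A. Im (\<mu> A)))" "finite_radon (jordan_pos (%A. - Im (\<mu> A)))"
  by (rule finite_radon_jordan_pos[OF \<mu>]; simp add: Re Im nRe nIm abs_Re_le_cmod abs_Im_le_cmod)+
 have av: "(LINT x|a. f (s - x)) = avg (reflect a) f s" if "finite_radon a" "f : borel_measurable borel" for f :: "'a => complex" and a s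
  using avg_reflect[OF that] by simp
 have four: "{..<4} = {0, 1, 2, 3 :: nat}" by auto
 show "EX c (b :: nat => 'a measure). (ALL i. finite_radon (b i)) &
   (ALL f:borel_measurable borel. convolution \<mu> f = (%s. \<Sum>i<4. c i * avg (b i) f s))"
 proof (intro exI conjI allI ballI)
  fix i :: nat
  \<comment> \<open>From index 4 on the value is a filler: all members of the sequence have to be
    finite Radon measures.\<close>
  show "finite_radon (if i < 4 then reflect (\<alpha> i) else reflect (\<alpha> 0))"
   using R finite_radon_reflect(1) by (auto simp: \<alpha>_def less_Suc_eq numeral_eq_Suc)
 next
  fix f :: "'a => complex" assume f: "f : borel_measurable borel"
  show "convolution \<mu> f = (%s. \<Sum>i<4. c i * avg (if i < 4 then reflect (\<alpha> i) else reflect (\<alpha> 0)) f s)"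
   unfolding convolution_def complex_measure_integral_def four
   by (simp add: av[OF R(1) f] av[OF R(2) f] av[OF R(3) f] av[OF R(4) f] c_def \<alpha>_def numeral_2_eq_2 numeral_3_eq_3 algebra_simps)
 qed
 assume pos: "positive_measure \<mu>"
 have z: "Im (\<mu> A) = 0" "0 <= Re (\<mu> A)" if "A : sets borel" for A
  using pos that by (auto simp: positive_measure_def nonneg_Reals_def)
 show "EX b :: 'a measure. finite_radon b & (ALL f:borel_measurable borel. convolution \<mu> f = avg b f)"
 proof (intro exI conjI ballI ext)
  show "finite_radon (reflect (jordan_pos (%A. Re (\<mu> A))))" by (rule finite_radon_reflect(1)[OF R(1)])
  fix f :: "'a => complex" and s assume f: "f : borel_measurable borel"
  show "convolution \<mu> f s = avg (reflect (jordan_pos (%A. Re (\<mu> A)))) f s"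
   unfolding convolution_def complex_measure_integral_def av[OF R(1) f]
   using z by (simp add: integral_jordan_pos_nonpos nRe Im nIm)
 qed
qed

section \<open>Representatives of $L^p$ classes\<close>

abbreviation fscale :: "complex => ('a => complex) => 'a => complex" where
 "fscale c f \<equiv> (%x. c * f x)"

lemma vector_space_functions: "vector_space (fscale :: complex => ('a => complex) => 'a => complex)"
 by unfold_locales (auto simp: fun_eq_iff algebra_simps)

definition null_functions :: "'a measure => ('a => complex) set" where
 "null_functions M = {f : borel_measurable M. AE x in M. f x = 0}"

text \<open>
  Selecting representatives linearly turns identities that hold almost everywhere into identities of
  functions, so that the theory of bounded operators on a vector space applies.
\<close>

lemma exists_lifting:
 "EX \<pi>. (ALL f g. \<pi> (%x. f x + g x) = (%x. \<pi> f x + \<pi> g x)) & (ALL c f. \<pi> (%x. c * f x) = (%x. c * \<pi> f x)) &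
   (ALL f. (%x. f x - \<pi> f x) : null_functions M) & (ALL f:null_functions M. \<pi> f = (%x. 0))"
proof -
 interpret V: vector_space "fscale :: complex => ('a => complex) => 'a => complex" by (rule vector_space_functions)
 interpret V2: vector_space_pair "fscale :: complex => ('a => complex) => 'a => complex" "fscale :: complex => ('a => complex) => 'a => complex" ..
 have "V.subspace (null_functions M)"
  unfolding V.subspace_def null_functions_def by (auto simp: plus_fun_def zero_fun_def)
 \<comment> \<open>A linear left inverse of the inclusion of the null functions, defined on all
   functions: a projection, whose complement is the lifting.\<close>
 then obtain g where g: "range g \<subseteq> null_functions M" "Vector_Spaces.linear fscale fscale g" "ALL v:null_functions M. g v = v"
  using V2.linear_exists_left_inverse_on[OF V.linear_id, of "null_functions M"] by (auto simp: id_def inj_on_def)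
 interpret g: Vector_Spaces.linear "fscale :: complex => ('a => complex) => 'a => complex" "fscale :: complex => ('a => complex) => 'a => complex" g by fact
 show ?thesis
 proof (intro exI[of _ "%f x. f x - g f x"] conjI allI ballI)
  fix f h :: "'a => complex" and c
  show "(%x. f x + h x - g (%x. f x + h x) x) = (%x. f x - g f x + (h x - g h x))"
   using g.add[of f h] by (auto simp: plus_fun_def fun_eq_iff)
  show "(%x. c * f x - g (%x. c * f x) x) = (%x. c * (f x - g f x))"
   using g.scale[of c f] by (auto simp: fun_eq_iff algebra_simps)
  show "(%x. f x - (f x - g f x)) : null_functions M" using g(1) by auto
 next
  fix f assume "f : null_functions M"
  thus "(%x. f x - g f x) = (%x. 0)" using g(3) by simp
 qed
qed

locale Lp_lifting =
 fixes M :: "'a measure" and p :: ennreal and \<pi> :: "('a => complex) => 'a => complex"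
 assumes p: "1 <= p" and fin: "p = top ==> emeasure M (space M) < top"
  and \<pi>_add: "\<pi> (%x. f x + g x) = (%x. \<pi> f x + \<pi> g x)" and \<pi>_scale: "\<pi> (%x. c * f x) = (%x. c * \<pi> f x)"
  and \<pi>_diff: "(%x. f x - \<pi> f x) : null_functions M" and \<pi>_null: "f : null_functions M ==> \<pi> f = (%x. 0)"
begin

definition X :: "('a => complex) set" where "X = {f : Lp_space p M. \<pi> f = f}"

lemma \<pi>_AE: "AE x in M. \<pi> f x = f x"
 using \<pi>_diff[of f] by (auto simp: null_functions_def elim!: eventually_mono)

lemma \<pi>_measurable: assumes "f : borel_measurable M" shows "\<pi> f : borel_measurable M"
proof -
 have "(%x. f x - (f x - \<pi> f x)) : borel_measurable M"
  by (rule borel_measurable_diff[OF assms]) (use \<pi>_diff[of f] in \<open>simp add: null_functions_def\<close>)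
 thus ?thesis by simp
qed

lemma \<pi>_minus: "\<pi> (%x. f x - g x) = (%x. \<pi> f x - \<pi> g x)"
 using \<pi>_add[of f "%x. (-1) * g x"] \<pi>_scale[of "-1" g] by simp

lemma \<pi>_eqI:
 assumes "f : borel_measurable M" "g : borel_measurable M" "AE x in M. f x = g x" shows "\<pi> f = \<pi> g"
proof -
 have "(%x. f x - g x) : null_functions M" using assms by (auto simp: null_functions_def elim!: eventually_mono)
 thus ?thesis using \<pi>_null \<pi>_minus[of f g] by (metis (no_types, lifting) eq_iff_diff_eq_0 ext)
qed

lemma \<pi>_\<pi>: "\<pi> (\<pi> f) = \<pi> f"
proof -
 have "\<pi> (%x. f x - \<pi> f x) = (%x. 0)" by (rule \<pi>_null[OF \<pi>_diff])
 thus ?thesis unfolding \<pi>_minus by (auto simp: fun_eq_iff)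
qed

lemma \<pi>_Lp: "f : Lp_space q M ==> \<pi> f : Lp_space q M" "f : Lp_space q M ==> Lp_norm q M (\<pi> f) = Lp_norm q M f"
proof -
 have "AE x in M. f x = \<pi> f x" using \<pi>_AE[of f] by eventually_elim simp
 thus "f : Lp_space q M ==> \<pi> f : Lp_space q M" "f : Lp_space q M ==> Lp_norm q M (\<pi> f) = Lp_norm q M f"
  using Lp_AE_cong[of f q M "\<pi> f"] \<pi>_measurable[OF Lp_measurable] by auto
qed

lemma \<pi>_X: "f : Lp_space p M ==> \<pi> f : X"
 by (simp add: X_def \<pi>_Lp \<pi>_\<pi>)

lemma X_Lp: "f : X ==> f : Lp_space p M" and \<pi>_id: "f : X ==> \<pi> f = f"
 by (auto simp: X_def)

lemma banach: "banach_carrier fscale X (Lp_norm p M)"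
proof -
 interpret V: vector_space "fscale :: complex => ('a => complex) => 'a => complex" by (rule vector_space_functions)
 have "(%x. 0) : Lp_space p M" by (cases p) (auto simp: Lp_space_inf Lp_space_finite)
 hence z: "(%x. 0) : X" using \<pi>_scale[of 0 "%x. 0"] by (simp add: X_def)
 show ?thesis
 proof
  show "V.subspace X"
   unfolding V.subspace_def using z
   by (auto simp: X_def plus_fun_def zero_fun_def \<pi>_add \<pi>_scale Lp_add[OF p] Lp_scale[OF p])
 next
  fix x y :: "'a => complex" and c assume x: "x : X"
  show "0 <= Lp_norm p M x" by (rule Lp_norm_nonneg)
  show "Lp_norm p M (fscale c x) = cmod c * Lp_norm p M x" by (rule Lp_scale(2)[OF p X_Lp[OF x]])
  show "Lp_norm p M (x + y) <= Lp_norm p M x + Lp_norm p M y" if "y : X"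
   using Minkowski_inequality[OF p X_Lp[OF x] X_Lp[OF that] fin] by (simp add: plus_fun_def)
  show "x = 0" if "Lp_norm p M x = 0"
   using \<pi>_null[of x] \<pi>_id[OF x] that Lp_norm_eq_0[OF p X_Lp[OF x]] Lp_measurable[OF X_Lp[OF x]]
   by (auto simp: null_functions_def zero_fun_def)
 next
  fix s :: "nat => 'a => complex" assume s: "!!n. s n : X" and c: "!!e. 0 < e ==> EX K. ALL m>=K. ALL n>=K. Lp_norm p M (s m - s n) < e"
  obtain l where l: "l : Lp_space p M" "(%n. Lp_norm p M (%x. s n x - l x)) \<longlonglongrightarrow> 0"
   using Lp_complete[of p M s, OF p fin X_Lp[OF s]] c by (auto simp: fun_diff_def)
  have "Lp_norm p M (s n - \<pi> l) = Lp_norm p M (%x. s n x - l x)" for n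
  proof -
   have "\<pi> (%x. s n x - l x) = s n - \<pi> l" unfolding \<pi>_minus by (simp add: \<pi>_id[OF s] fun_diff_def)
   thus ?thesis using \<pi>_Lp(2)[OF Lp_diff[OF p X_Lp[OF s] l(1)], of n] by simp
  qed
  thus "EX l:X. (%n. Lp_norm p M (s n - l)) \<longlonglongrightarrow> 0" using l \<pi>_X by (intro bexI[of _ "\<pi> l"]) auto
 qed
qed

sublocale banach_carrier fscale X "Lp_norm p M" by (rule banach)

section \<open>Operators on functions and on representatives\<close>

text \<open>T acts on functions and respects classes up to null sets, while S acts exactly on
  representatives. The relation is compatible with sums, compositions and Cesaro means.\<close>

definition represents :: "(('a => complex) => 'a => complex) => (('a => complex) => 'a => complex) => bool" where
 "represents T S \<longleftrightarrow> (ALL f:Lp_space p M. T f : borel_measurable M & (AE x in M. T f x = S (\<pi> f) x))"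

lemma represents_Lp:
 assumes r: "represents T S" and S: "bop S" and f: "f : Lp_space p M"
 shows "T f : Lp_space p M" "\<pi> (T f) = S (\<pi> f)" "Lp_norm p M (T f) = Lp_norm p M (S (\<pi> f))"
proof -
 have SX: "S (\<pi> f) : X" by (rule bopX[OF S \<pi>_X[OF f]])
 have T: "T f : borel_measurable M" "AE x in M. S (\<pi> f) x = T f x" using r f by (auto simp: represents_def elim!: eventually_mono)
 show "T f : Lp_space p M" "Lp_norm p M (T f) = Lp_norm p M (S (\<pi> f))" using Lp_AE_cong[OF X_Lp[OF SX] T] by auto
 show "\<pi> (T f) = S (\<pi> f)"
  using \<pi>_eqI[OF Lp_measurable[OF X_Lp[OF SX]] T] \<pi>_id[OF SX] by simp
qed

lemma represents_bounded:
 assumes S: "bop S" and r: "represents T S" shows "bounded_Lp_operator p M T"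
proof -
 obtain C where C: "bounded_by S C" using S by (auto simp: bop_def)
 have T: "T f : Lp_space p M" "AE x in M. T f x = S (\<pi> f) x" "Lp_norm p M (T f) = Lp_norm p M (S (\<pi> f))" if "f : Lp_space p M" for f
  using represents_Lp[OF r S that] that r by (auto simp: represents_def)
 show ?thesis
  unfolding bounded_Lp_operator_def
 proof (intro conjI ballI allI impI)
  fix f assume f: "f : Lp_space p M"
  show "T f : Lp_space p M" by (rule T(1)[OF f])
  fix g assume g: "g : Lp_space p M"
  show "AE x in M. T f x = T g x" if "AE x in M. f x = g x"
   using T(2)[OF f] T(2)[OF g] \<pi>_eqI[OF Lp_measurable[OF f] Lp_measurable[OF g] that]
   by (auto elim!: eventually_elim2)
  have [simp]: "S (%x. \<pi> f x + \<pi> g x) = (%x. S (\<pi> f) x + S (\<pi> g) x)"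
   using linD(2)[OF bop_lin[OF S] \<pi>_X[OF f] \<pi>_X[OF g]] by (simp add: plus_fun_def)
  show "AE x in M. T (%y. f y + g y) x = T f x + T g x"
   using T(2)[OF f] T(2)[OF g] T(2)[OF Lp_add[OF p f g], unfolded \<pi>_add]
   by eventually_elim simp
 next
  fix c f assume f: "f : Lp_space p M"
  show "AE x in M. T (%y. c * f y) x = c * T f x"
   using T(2)[OF f] T(2)[OF Lp_scale(1)[OF p f], of c, unfolded \<pi>_scale linD(3)[OF bop_lin[OF S] \<pi>_X[OF f]]]
   by eventually_elim simp
 next
  show "EX C. ALL f:Lp_space p M. Lp_norm p M (T f) <= C * Lp_norm p M f"
  proof (intro exI ballI)
   fix f assume f: "f : Lp_space p M"
   show "Lp_norm p M (T f) <= C * Lp_norm p M f"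
    using bounded_byD(3)[OF C \<pi>_X[OF f]] by (simp add: T(3)[OF f] \<pi>_Lp(2)[OF f])
  qed
 qed
qed

lemma bounded_represents:
 assumes T: "bounded_Lp_operator p M T"
 shows "represents T (%f. \<pi> (T f))" "bop (%f. \<pi> (T f))"
proof -
 have L: "T f : Lp_space p M" if "f : Lp_space p M" for f using T that by (auto simp: bounded_Lp_operator_def)
 show "represents T (%f. \<pi> (T f))" unfolding represents_def
 proof (intro ballI conjI)
  fix f assume f: "f : Lp_space p M"
  show "T f : borel_measurable M" by (rule Lp_measurable[OF L[OF f]])
  have "AE x in M. T (\<pi> f) x = T f x"
   using T f \<pi>_Lp(1)[OF f] \<pi>_AE[of f] unfolding bounded_Lp_operator_def by blast
  thus "AE x in M. T f x = \<pi> (T (\<pi> f)) x" using \<pi>_AE[of "T (\<pi> f)"] by eventually_elim simp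
 qed
 obtain C where C: "!!f. f : Lp_space p M ==> Lp_norm p M (T f) <= C * Lp_norm p M f"
  using T unfolding bounded_Lp_operator_def by blast
 have "bounded_by (%f. \<pi> (T f)) (max 0 C)"
  unfolding bounded_by_def lin_def
 proof (intro conjI ballI allI)
  fix f assume f: "f : X"
  note fL = X_Lp[OF f]
  show "\<pi> (T f) : X" by (rule \<pi>_X[OF L[OF fL]])
  show "Lp_norm p M (\<pi> (T f)) <= max 0 C * Lp_norm p M f"
   using C[OF fL] mult_right_mono[of C "max 0 C" "Lp_norm p M f"] Lp_norm_nonneg[of p M f] by (simp add: \<pi>_Lp(2)[OF L[OF fL]])
  fix g assume g: "g : X"
  note gL = X_Lp[OF g]
  have "AE x in M. T (%y. f y + g y) x = T f x + T g x" using T fL gL by (auto simp: bounded_Lp_operator_def)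
  hence "\<pi> (T (%y. f y + g y)) = \<pi> (%x. T f x + T g x)"
   by (rule \<pi>_eqI[OF Lp_measurable[OF L[OF Lp_add[OF p fL gL]]] Lp_measurable[OF Lp_add[OF p L[OF fL] L[OF gL]]]])
  thus "\<pi> (T (f + g)) = \<pi> (T f) + \<pi> (T g)" by (simp add: plus_fun_def \<pi>_add)
 next
  fix c f assume f: "f : X"
  note fL = X_Lp[OF f]
  have "AE x in M. T (%y. c * f y) x = c * T f x" using T fL by (auto simp: bounded_Lp_operator_def)
  hence "\<pi> (T (%y. c * f y)) = \<pi> (%x. c * T f x)"
   by (rule \<pi>_eqI[OF Lp_measurable[OF L[OF Lp_scale(1)[OF p fL]]] Lp_measurable[OF Lp_scale(1)[OF p L[OF fL]]]])
  thus "\<pi> (T (%x. c * f x)) = (%x. c * \<pi> (T f) x)" by (simp add: \<pi>_scale)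
 qed simp
 thus "bop (%f. \<pi> (T f))" by (rule bounded_by_bop)
qed

lemma represents_self: "bop S ==> represents (%f. S (\<pi> f)) S"
 unfolding represents_def using bopX[of S] \<pi>_X X_Lp Lp_measurable by blast

lemma represents_scale: "represents T S ==> represents (%f x. c * T f x) (%f. fscale c (S f))"
 unfolding represents_def by (auto elim!: eventually_mono)

lemma represents_add:
 assumes "represents T S" "represents T' S'" shows "represents (%f x. T f x + T' f x) (%f. S f + S' f)"
 unfolding represents_def
proof (intro ballI conjI)
 fix f assume "f : Lp_space p M"
 hence T: "T f : borel_measurable M" "T' f : borel_measurable M" "AE x in M. T f x = S (\<pi> f) x" "AE x in M. T' f x = S' (\<pi> f) x"
  using assms by (auto simp: represents_def)
 show "(%x. T f x + T' f x) : borel_measurable M" using T by (intro borel_measurable_add)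
 show "AE x in M. T f x + T' f x = (S (\<pi> f) + S' (\<pi> f)) x" using T(3,4) by eventually_elim simp
qed

lemma represents_diff:
 assumes "represents T S" "represents T' S'" shows "represents (%f x. T f x - T' f x) (%f. S f - S' f)"
 using represents_add[OF assms(1) represents_scale[OF assms(2), of "-1"]] by (simp add: fun_diff_def plus_fun_def)

lemma represents_sum:
 assumes "!!i. i : I ==> represents (T i) (S i)"
 shows "represents (%f x. \<Sum>i\<in>I. T i f x) (%f. \<Sum>i\<in>I. S i f)"
 using assms
proof (induction I rule: infinite_finite_induct)
 case (insert i I)
 hence "represents (T i) (S i)" "represents (%f x. \<Sum>i\<in>I. T i f x) (%f. \<Sum>i\<in>I. S i f)" by auto
 from represents_add[OF this] show ?case using insert(1,2) by (simp only: sum.insert[OF insert(1,2)] not_False_eq_True)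
qed (auto simp: represents_def)

lemma represents_compose:
 assumes r: "represents T S" "represents T' S'" and S: "bop S'"
 shows "represents (%f. T (T' f)) (%f. S (S' f))"
 unfolding represents_def
proof (intro ballI conjI)
 fix f assume f: "f : Lp_space p M"
 note T' = represents_Lp[OF r(2) S f]
 show "T (T' f) : borel_measurable M" using r(1) T'(1) by (simp add: represents_def)
 show "AE x in M. T (T' f) x = S (S' (\<pi> f)) x" using r(1) T'(1,2) by (auto simp: represents_def)
qed

lemma represents_funpow:
 assumes r: "represents T S" and S: "bop S" shows "represents (T ^^ n) (S ^^ n)"
proof (induction n)
 case 0
 show ?case unfolding represents_def using Lp_measurable \<pi>_AE by (auto simp: eq_commute[of _ "\<pi> _ _"])
next
 case (Suc n)
 thus ?case using represents_compose[OF r Suc bop_funpow[OF S]] by (simp add: comp_def)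
qed

lemma represents_cesaro:
 assumes r: "represents T S" and S: "bop S" shows "represents (cesaro_mean T n) (ces S n)"
proof -
 have "represents (%f x. (1 / of_nat n) * (\<Sum>k=1..n. (T ^^ k) f x)) (%f. fscale (1 / of_nat n) (\<Sum>k=1..n. (S ^^ k) f))"
  by (intro represents_scale represents_sum represents_funpow r S)
 thus ?thesis by (simp add: cesaro_mean_def[abs_def] ces_def[abs_def])
qed

lemma Lp_operator_norm_le:
 assumes r: "represents T S" and S: "bounded_by S C" shows "Lp_operator_norm p M T <= C"
 unfolding Lp_operator_norm_def
proof (rule cSUP_least)
 have "(0 :: 'a => complex) : X" by simp
 hence "0 : {f : Lp_space p M. Lp_norm p M f <= 1}" using X_Lp by simp
 thus "{f : Lp_space p M. Lp_norm p M f <= 1} ~= {}" by blast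
 fix f assume "f : {f : Lp_space p M. Lp_norm p M f <= 1}"
 hence f: "f : Lp_space p M" "Lp_norm p M f <= 1" by auto
 have "Lp_norm p M (T f) <= C * Lp_norm p M f"
  using bounded_byD(3)[OF S \<pi>_X[OF f(1)]] represents_Lp(3)[OF r bounded_by_bop[OF S] f(1)] by (simp add: \<pi>_Lp(2)[OF f(1)])
 also have "... <= C * 1" by (rule mult_left_mono[OF f(2) bounded_byD(2)[OF S]])
 finally show "Lp_norm p M (T f) <= C" by simp
qed

lemma Lp_operator_norm_bound:
 assumes r: "represents T S" and S: "bop S" shows "bounded_by S (Lp_operator_norm p M T)"
proof -
 obtain C where C: "bounded_by S C" using S by (auto simp: bop_def)
 have T: "Lp_norm p M (T f) <= C * Lp_norm p M f" if "f : Lp_space p M" for f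
  using bounded_byD(3)[OF C \<pi>_X[OF that]] represents_Lp(3)[OF r S that] by (simp add: \<pi>_Lp(2)[OF that])
 have "Lp_norm p M (T f) <= C" if "f : {f : Lp_space p M. Lp_norm p M f <= 1}" for f
  using T[of f] that mult_left_mono[of "Lp_norm p M f" 1 C] bounded_byD(2)[OF C] by auto
 \<comment> \<open>A supremum of reals is informative only for a set that is bounded above.\<close>
 hence bdd: "bdd_above (Lp_norm p M ` T ` {f : Lp_space p M. Lp_norm p M f <= 1})" by (intro bdd_aboveI[of _ C]) auto
 have up: "Lp_norm p M (T f) <= Lp_operator_norm p M T" if "f : Lp_space p M" "Lp_norm p M f <= 1" for f
  unfolding Lp_operator_norm_def by (rule cSUP_upper) (use that bdd in \<open>auto simp: image_image\<close>)
 have 0: "0 <= Lp_operator_norm p M T"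
  using up[of 0] X_Lp[of 0] Lp_norm_nonneg[of p M "T 0"] by (metis N_0 X_closed(1) order_trans zero_le_one)
 have "Lp_norm p M (S x) <= Lp_operator_norm p M T * Lp_norm p M x" if "x : X" for x
 proof (rule bounded_on_unit_ball[OF bop_lin[OF S] _ that])
  fix y assume y: "y : X" "Lp_norm p M y <= 1"
  show "Lp_norm p M (S y) <= Lp_operator_norm p M T"
   using up[OF X_Lp[OF y(1)] y(2)] represents_Lp(3)[OF r S X_Lp[OF y(1)]] \<pi>_id[OF y(1)] by simp
 qed
 thus ?thesis using 0 bop_lin[OF S] by (auto simp: bounded_by_def)
qed

lemma Lp_operator_norm_le_1_iff:
 "represents T S ==> bop S ==> Lp_operator_norm p M T <= 1 \<longleftrightarrow> bounded_by S 1"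
 using Lp_operator_norm_le Lp_operator_norm_bound bounded_by_mono by blast

section \<open>Ergodicity and spectrum in terms of representatives\<close>

theorem uniformly_mean_ergodic_iff:
 assumes r: "represents T S" and S: "bop S"
 shows "uniformly_mean_ergodic p M T \<longleftrightarrow> (EX P. bop P & converges_to (ces S) P)"
proof
 assume "uniformly_mean_ergodic p M T"
 then obtain P where P: "bounded_Lp_operator p M P"
  and lim: "(%n. Lp_operator_norm p M (%f x. cesaro_mean T n f x - P f x)) \<longlonglongrightarrow> 0"
  by (auto simp: uniformly_mean_ergodic_def)
 note rP = bounded_represents[OF P]
 have b: "bounded_by (%f. ces S n f - \<pi> (P f)) (Lp_operator_norm p M (%f x. cesaro_mean T n f x - P f x))" for n
  by (rule Lp_operator_norm_bound[OF represents_diff[OF represents_cesaro[OF r S] rP(1)] bop_diff[OF bop_ces[OF S] rP(2)]])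
 have "converges_to (ces S) (%f. \<pi> (P f))" unfolding converges_to_def
 proof (intro allI impI)
  fix e :: real assume "e > 0"
  then obtain K where K: "!!n. n >= K ==> Lp_operator_norm p M (%f x. cesaro_mean T n f x - P f x) < e"
   using order_tendstoD(2)[OF lim] by (auto simp: eventually_sequentially)
  show "EX K. ALL n>=K. ALL x:X. Lp_norm p M (ces S n x - \<pi> (P x)) <= e * Lp_norm p M x"
   using bounded_byD(3)[OF bounded_by_mono[OF b less_imp_le[OF K]]] by blast
 qed
 thus "EX P. bop P & converges_to (ces S) P" using rP by blast
next
 assume "EX P. bop P & converges_to (ces S) P"
 then obtain P where P: "bop P" "converges_to (ces S) P" by blast
 note rP = represents_self[OF P(1)]
 have rd: "represents (%f x. cesaro_mean T n f x - P (\<pi> f) x) (%f. ces S n f - P f)" for n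
  by (rule represents_diff[OF represents_cesaro[OF r S] rP])
 have "(%n. Lp_operator_norm p M (%f x. cesaro_mean T n f x - P (\<pi> f) x)) \<longlonglongrightarrow> 0"
 proof (rule LIMSEQ_I)
  fix e :: real assume e: "e > 0"
  then obtain K where K: "!!n x. n >= K ==> x : X ==> Lp_norm p M (ces S n x - P x) <= e / 2 * Lp_norm p M x"
   using P(2) unfolding converges_to_def by (meson half_gt_zero)
  have "norm (Lp_operator_norm p M (%f x. cesaro_mean T n f x - P (\<pi> f) x) - 0) < e" if "n >= K" for n
  proof -
   have bd: "bop (%f. ces S n f - P f)" by (rule bop_diff[OF bop_ces[OF S] P(1)])
   hence "bounded_by (%f. ces S n f - P f) (e / 2)" using K[OF that] e bop_lin by (auto simp: bounded_by_def)
   from Lp_operator_norm_le[OF rd this] bounded_byD(2)[OF Lp_operator_norm_bound[OF rd bd]] e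
   show ?thesis by simp
  qed
  thus "EX K. ALL n>=K. norm (Lp_operator_norm p M (%f x. cesaro_mean T n f x - P (\<pi> f) x) - 0) < e" by blast
 qed
 thus "uniformly_mean_ergodic p M T"
  unfolding uniformly_mean_ergodic_def using represents_bounded[OF P(1) rP] by blast
qed

lemma not_in_spectrum_iff:
 assumes r: "represents T S" and S: "bop S"
 shows "z \<notin> Lp_spectrum p M T \<longleftrightarrow> (EX R. resolvent_of S z R)"
proof
 note SX = bopX[OF S]
 assume "z \<notin> Lp_spectrum p M T"
 then obtain R where R: "bounded_Lp_operator p M R" and eq: "!!f. f : Lp_space p M ==>
    (AE x in M. R (%y. z * f y - T f y) x = f x) & (AE x in M. z * R f x - T (R f) x = f x)"
  unfolding Lp_spectrum_def by blast
 define R' where "R' f = \<pi> (R f)" for f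
 have rR: "represents R R'" and bR: "bop R'" using bounded_represents[OF R] unfolding R'_def by auto
 have RX: "R' f : X" if "f : X" for f by (rule bopX[OF bR that])
 have "R' (fscale z x - S x) = x & fscale z (R' x) - S (R' x) = x" if x: "x : X" for x
 proof -
  note xL = X_Lp[OF x]
  note TL = represents_Lp[OF r S xL]
  have d: "(%y. z * x y - T x y) : Lp_space p M" by (rule Lp_diff[OF p Lp_scale(1)[OF p xL] TL(1)])
  have \<pi>d: "\<pi> (%y. z * x y - T x y) = fscale z x - S x"
   unfolding \<pi>_minus \<pi>_scale TL(2) \<pi>_id[OF x] by (simp add: fun_diff_def)
  note Rd = represents_Lp[OF rR bR d]
  have "\<pi> (R (%y. z * x y - T x y)) = \<pi> x"
   using eq[OF xL] by (intro \<pi>_eqI[OF Lp_measurable[OF Rd(1)] Lp_measurable[OF xL]]) simp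
  hence 1: "R' (fscale z x - S x) = x" using Rd(2) \<pi>d \<pi>_id[OF x] by simp
  note Rx = represents_Lp[OF rR bR xL]
  note TRx = represents_Lp[OF r S Rx(1)]
  have "\<pi> (%y. z * R x y - T (R x) y) = \<pi> x"
   by (rule \<pi>_eqI[OF Lp_measurable[OF Lp_diff[OF p Lp_scale(1)[OF p Rx(1)] TRx(1)]] Lp_measurable[OF xL]]) (use eq[OF xL] in simp)
  hence "fscale z (R' x) - S (R' x) = x"
   unfolding \<pi>_minus \<pi>_scale TRx(2) Rx(2) \<pi>_id[OF x] by (simp add: fun_diff_def)
  with 1 show ?thesis by simp
 qed
 thus "EX R. resolvent_of S z R" using bR by (auto simp: resolvent_of_def)
next
 assume "EX R. resolvent_of S z R"
 then obtain R where bR: "bop R" and eq: "!!x. x : X ==> R (fscale z x - S x) = x & fscale z (R x) - S (R x) = x"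
  by (auto simp: resolvent_of_def)
 note SX = bopX[OF S] and RX = bopX[OF bR]
 define R' where "R' f = R (\<pi> f)" for f
 have rR: "represents R' R" unfolding R'_def[abs_def] by (rule represents_self[OF bR])
 have "(AE x in M. R' (%y. z * f y - T f y) x = f x) & (AE x in M. z * R' f x - T (R' f) x = f x)" if f: "f : Lp_space p M" for f
 proof
  note fX = \<pi>_X[OF f]
  have "R' (%y. z * f y - T f y) = \<pi> f"
   unfolding R'_def \<pi>_minus \<pi>_scale represents_Lp(2)[OF r S f] using eq[OF fX] by (simp add: fun_diff_def)
  thus "AE x in M. R' (%y. z * f y - T f y) x = f x" using \<pi>_AE[of f] by simp
  have RL: "R (\<pi> f) : Lp_space p M" by (rule X_Lp[OF RX[OF fX]])
  have "AE x in M. T (R (\<pi> f)) x = S (R (\<pi> f)) x"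
   using r RL \<pi>_id[OF RX[OF fX]] by (auto simp: represents_def)
  thus "AE x in M. z * R' f x - T (R' f) x = f x"
   using \<pi>_AE[of f] unfolding R'_def
  proof eventually_elim
   case (elim x)
   have "z * R (\<pi> f) x - S (R (\<pi> f)) x = \<pi> f x" using eq[OF fX] by (auto simp: fun_eq_iff)
   thus ?case using elim by simp
  qed
 qed
 thus "z \<notin> Lp_spectrum p M T" using represents_bounded[OF bR rR] by (auto simp: Lp_spectrum_def)
qed

lemma not_islimpt_spectrum_iff:
 assumes r: "represents T S" and S: "bop S"
 shows "\<not> (1 islimpt Lp_spectrum p M T) \<longleftrightarrow> (EX d>0. ALL z. 0 < norm (z - 1) & norm (z - 1) < d --> (EX R. resolvent_of S z R))"
 unfolding islimpt_approachable not_in_spectrum_iff[OF r S, symmetric] by (auto simp: dist_norm)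

corollary ume_imp_isolated:
 assumes r: "represents T S" and S: "bop S" and u: "uniformly_mean_ergodic p M T"
 shows "\<not> (1 islimpt Lp_spectrum p M T)"
 using u ume_resolvent_near_1[OF S] unfolding not_islimpt_spectrum_iff[OF r S] uniformly_mean_ergodic_iff[OF r S] by blast

lemma ume_imp_mean_ergodic:
 assumes r: "represents T S" and S: "bop S" and u: "uniformly_mean_ergodic p M T"
 shows "mean_ergodic p M T"
proof -
 obtain P where P: "bop P" "converges_to (ces S) P" using u uniformly_mean_ergodic_iff[OF r S] by blast
 note rP = represents_self[OF P(1)]
 have "(%n. Lp_norm p M (%x. cesaro_mean T n f x - P (\<pi> f) x)) \<longlonglongrightarrow> 0" if f: "f : Lp_space p M" for f
 proof -
  have "Lp_norm p M (%x. cesaro_mean T n f x - P (\<pi> f) x) = Lp_norm p M (ces S n (\<pi> f) - P (\<pi> f))" for n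
   using represents_Lp(3)[OF represents_diff[OF represents_cesaro[OF r S] rP] bop_diff[OF bop_ces[OF S] P(1)] f, of n] by simp
  thus ?thesis using converges_to_tends[OF P(2,1) bop_ces[OF S] \<pi>_X[OF f]] by (simp add: tends_def)
 qed
 thus ?thesis unfolding mean_ergodic_def using represents_bounded[OF P(1) rP] by blast
qed

end

section \<open>The duality between $L^p$ and $L^q$\<close>

lemma borel_measurable_cnj: "f : borel_measurable M ==> (%x. cnj (f x)) : borel_measurable M"
 by (rule measurable_compose[of f M borel cnj]) (auto intro!: borel_measurable_continuous_onI continuous_intros)

lemma zero_Lp: "(%x. 0) : Lp_space p M"
 by (cases p) (auto simp: Lp_space_inf Lp_space_finite)

lemma Lp_cnj:
 assumes "1 <= p" "f : Lp_space p M"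
 shows "(%x. cnj (f x)) : Lp_space p M" "Lp_norm p M (%x. cnj (f x)) = Lp_norm p M f"
proof -
 have "f : borel_measurable M" by (rule Lp_measurable[OF assms(2)])
 hence "(%x. cnj (f x)) : borel_measurable M" by (rule borel_measurable_cnj)
 thus "(%x. cnj (f x)) : Lp_space p M" by (rule Lp_dominated[OF assms]) simp
 show "Lp_norm p M (%x. cnj (f x)) = Lp_norm p M f" by (simp add: Lp_norm_def)
qed

context haar
begin

lemma Lp_norm_uminus:
 assumes p: "1 <= p" and f: "f : Lp_space p m" shows "Lp_norm p m (%x. f (- x)) = Lp_norm p m f"
 using Lp_uminus(2)[OF assms] Lp_uminus(2)[OF p Lp_uminus(1)[OF assms]] by simp

lemma bounded_integrable_uminus: "f : bounded_integrable m ==> (%x. f (- x)) : bounded_integrable m"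
 by (auto simp: bounded_integrable_def intro: Lp_uminus)

lemma uminus_AE_eq:
 fixes f g :: "'a => complex"
 assumes "f : borel_measurable borel" "g : borel_measurable borel" "AE x in m. f x = g x"
 shows "AE x in m. f (- x) = g (- x)"
 by (rule AE_uminus[OF _ assms(3)]) (use assms(1,2) in measurable)

lemma measurable_uminus_arg: "f : borel_measurable borel ==> (%x::'a. f (- x) :: complex) : borel_measurable borel"
 by (rule measurable_compose[OF shift_measurable(5)])

text \<open>Covers p = \<infinity> for infinite Haar measure, which \<open>avg_Lp\<close> leaves
  out; it keeps D, whose elements are bounded, invariant under averages.\<close>

lemma avg_top:
 assumes b: "finite_radon b" and f: "f : Lp_space top m"
 shows "avg b f : Lp_space top m"
proof -
 interpret finite_measure b by (rule finite_radonD(5)[OF b])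
 have fm [measurable]: "f : borel_measurable borel" using Lp_measurable[OF f] by simp
 obtain C where C: "C >= 0" "AE x in m. norm (f x) <= C" using f by (auto simp: Lp_space_inf)
 have "AE s in m. AE y in b. norm (f (s + y)) <= C" by (rule AE_translates[OF b _ C(2)]) measurable
 hence "AE s in m. norm (avg b f s) <= C * measure b UNIV"
 proof eventually_elim
  case (elim s)
  have i: "integrable b (%y. f (s + y))"
   by (rule integrable_const_bound[OF elim]) (use avg_integrand_measurable[OF fm, of s] in \<open>simp add: finite_radonD(6)[OF b]\<close>)
  have "norm (avg b f s) <= (LINT y|b. norm (f (s + y)))" unfolding avg_def by (intro integral_norm_bound)
  also have "... <= (LINT y|b. C)" by (rule integral_mono_AE) (use i elim in auto)
  finally show ?case using finite_radonD(4)[OF b] by (simp add: mult.commute)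
 qed
 moreover have "C * measure b UNIV >= 0" using C(1) by simp
 ultimately show ?thesis using avg_measurable[OF b fm] by (auto simp: Lp_space_inf)
qed

lemma avg_bounded_integrable:
 assumes b: "finite_radon b" and f: "f : bounded_integrable m"
 shows "avg b f : bounded_integrable m"
 using avg_top[OF b, of f] avg_Lp(1)[OF b, of 1 f] f by (simp add: bounded_integrable_def)

lemma bounded_Lp_operator_avg:
 assumes b: "finite_radon b" and p: "1 <= p" and fin: "p = top ==> emeasure m UNIV < top"
 shows "bounded_Lp_operator p m (avg b)"
 unfolding bounded_Lp_operator_def
proof (intro conjI ballI allI impI)
 show "EX C. ALL f:Lp_space p m. Lp_norm p m (avg b f) <= C * Lp_norm p m f"
  using avg_Lp(2)[OF b p fin] by blast
next
 fix f g assume fg: "f : Lp_space p m" "g : Lp_space p m"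
 show "AE x in m. avg b f x = avg b g x" if "AE x in m. f x = g x"
  using avg_AE_cong[OF b _ _ that] fg[THEN Lp_measurable] by simp
 show "AE x in m. avg b (%y. f y + g y) x = avg b f x + avg b g x"
  by (rule avg_add_AE[OF b p fin fg])
qed (use avg_Lp(1)[OF b p fin] in \<open>auto simp: avg_scale\<close>)

end

section \<open>Averages as operators on representatives\<close>

locale haar_Lp = haar m + Lp_lifting m p \<pi> for m :: "'a::{topological_ab_group_add, t2_space} measure" and p \<pi>
begin

lemma finp: "p = top ==> emeasure m UNIV < top"
 using fin by simp

definition A :: "'a measure => ('a => complex) => 'a => complex" where
 "A b f = \<pi> (avg b f)"

lemma represents_A: "finite_radon b ==> represents (avg b) (A b)"
 and bop_A: "finite_radon b ==> bop (A b)"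
 unfolding A_def[abs_def] using bounded_represents[OF bounded_Lp_operator_avg[OF _ p finp]] by auto

lemma A_X: "finite_radon b ==> f : X ==> A b f : X"
 by (rule bopX[OF bop_A])

lemma A_A:
 assumes b: "finite_radon b" and c: "finite_radon c" and f: "f : X"
 shows "A b (A c f) = A (radon_conv b c) f"
proof -
 note fL = X_Lp[OF f]
 have "A b (A c f) = A b (\<pi> (avg c f))" by (simp add: A_def)
 also have "... = \<pi> (avg b (avg c f))"
  by (rule represents_Lp(2)[OF represents_A[OF b] bop_A[OF b] avg_Lp(1)[OF c p finp fL], symmetric])
 also have "... = \<pi> (avg (radon_conv b c) f)"
  by (rule \<pi>_eqI)
    (use avg_avg[OF b c p finp fL] avg_measurable b c finite_radon_conv(1)[OF b c] Lp_measurable[OF fL] in auto)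
 finally show ?thesis by (simp add: A_def)
qed

lemma A_commute: "finite_radon b ==> finite_radon c ==> f : X ==> A b (A c f) = A c (A b f)"
 by (simp add: A_A radon_conv_commute)

lemma bounded_by_A:
 assumes "finite_radon b" shows "bounded_by (A b) (measure b UNIV)"
 using bop_lin[OF bop_A[OF assms]] avg_Lp[OF assms p finp] X_Lp
 by (auto simp: bounded_by_def A_def \<pi>_Lp)

end

locale haar_pairing = haar_Lp m p \<pi> for m :: "'a::{topological_ab_group_add, t2_space} measure" and p \<pi> +
 fixes q :: ennreal
 assumes pq: "conjugate_exponents p q" and finq: "q = top ==> emeasure m UNIV < top"
begin

definition D :: "('a => complex) set" where "D = X \<inter> bounded_integrable m"
definition E :: "('a => complex) set" where "E = X \<inter> Lp_space q m"
definition B :: "('a => complex) => ('a => complex) => complex" where "B f g = (LINT x|m. f x * g (- x))"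
text \<open>Reflection and conjugation need not preserve the chosen representatives, hence the final
  \<open>\<pi>\<close>.\<close>

definition J :: "('a => complex) => 'a => complex" where "J f = \<pi> (%x. cnj (f (- x)))"

lemma q: "1 <= q" using conjugate_exponents_ge_1[OF pq] by simp

lemma X_measurable: "f : X ==> f : borel_measurable borel"
 using Lp_measurable[OF X_Lp] by simp

lemma \<pi>_bm: "f : borel_measurable borel ==> \<pi> f : borel_measurable borel"
 using \<pi>_measurable by simp

lemma B_cong:
 assumes m: "f : borel_measurable borel" "f' : borel_measurable borel" "g : borel_measurable borel" "g' : borel_measurable borel"
  and eq: "AE x in m. f x = f' x" "AE x in m. g x = g' x"
 shows "B f g = B f' g'"
 unfolding B_def
proof (rule integral_cong_AE)
 show "AE x in m. f x * g (- x) = f' x * g' (- x)"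
  using eq(1) uminus_AE_eq[OF m(3,4) eq(2)] by eventually_elim simp
qed (use m measurable_uminus_arg[OF m(3)] measurable_uminus_arg[OF m(4)] in \<open>simp_all add: borel_measurable_times\<close>)

lemma B_\<pi>: "f : borel_measurable borel ==> g : borel_measurable borel ==> B f (\<pi> g) = B f g"
 "f : borel_measurable borel ==> g : borel_measurable borel ==> B (\<pi> f) g = B f g"
 using \<pi>_AE by (auto intro!: B_cong simp: \<pi>_bm)

lemma cnj_uminus:
 assumes "1 <= r" "f : Lp_space r m"
 shows "(%x. cnj (f (- x))) : Lp_space r m" "Lp_norm r m (%x. cnj (f (- x))) = Lp_norm r m f"
 using Lp_cnj[OF assms(1) Lp_uminus(1)[OF assms]] Lp_norm_uminus[OF assms] by auto

lemma cnj_uminus_measurable: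
 fixes f :: "'a => complex"
 shows "f : borel_measurable borel ==> (%x. cnj (f (- x))) : borel_measurable borel"
 by (rule borel_measurable_cnj[OF measurable_uminus_arg])

lemma J_Lp: "1 <= r ==> f : Lp_space r m ==> J f : Lp_space r m" "1 <= r ==> f : Lp_space r m ==> Lp_norm r m (J f) = Lp_norm r m f"
 unfolding J_def using \<pi>_Lp cnj_uminus by auto

lemma J_in_X: "f : X ==> J f : X"
 unfolding J_def by (intro \<pi>_X cnj_uminus p X_Lp)

lemma J_\<pi>: assumes "f : borel_measurable borel" shows "J (\<pi> f) = J f"
proof -
 have "AE x in m. \<pi> f (- x) = f (- x)" by (rule uminus_AE_eq[OF \<pi>_bm[OF assms] assms \<pi>_AE])
 hence "AE x in m. cnj (\<pi> f (- x)) = cnj (f (- x))" by eventually_elim simp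
 thus ?thesis unfolding J_def using cnj_uminus_measurable[OF assms] cnj_uminus_measurable[OF \<pi>_bm[OF assms]]
  by (intro \<pi>_eqI) simp_all
qed

lemma J_involution: "f : X ==> J (J f) = f"
 using J_\<pi>[OF cnj_uminus_measurable[OF X_measurable], of f] \<pi>_id[of f] by (simp add: J_def)

lemma bounded_integrable_measurable: "g : bounded_integrable m ==> g : borel_measurable borel"
 using Lp_measurable[of g 1 m] by (simp add: bounded_integrable_def)

lemma \<pi>_D: "g : bounded_integrable m ==> \<pi> g : D"
 using bounded_integrable_Lp[OF p, of g] by (auto simp: D_def bounded_integrable_def \<pi>_Lp \<pi>_X)

text \<open>Translates between plain integrals against test functions, as in
  \<open>Lp_dual_norm\<close>, and the reflected form \<open>B\<close> against elements of
  D.\<close>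

lemma B_test:
 assumes f: "f : borel_measurable borel" and g: "g : bounded_integrable m" and r: "1 <= r"
 shows "\<pi> (%x. g (- x)) : D" "B f (\<pi> (%x. g (- x))) = (LINT x|m. f x * g x)" "Lp_norm r m (\<pi> (%x. g (- x))) = Lp_norm r m g"
proof -
 have gr: "g : Lp_space r m" by (rule bounded_integrable_Lp[OF r g])
 show "\<pi> (%x. g (- x)) : D" by (rule \<pi>_D[OF bounded_integrable_uminus[OF g]])
 show "B f (\<pi> (%x. g (- x))) = (LINT x|m. f x * g x)"
  using B_\<pi>(1)[OF f measurable_uminus_arg[OF bounded_integrable_measurable[OF g]]] by (simp add: B_def)
 show "Lp_norm r m (\<pi> (%x. g (- x))) = Lp_norm r m g"
  using \<pi>_Lp(2)[OF Lp_uminus(1)[OF r gr]] Lp_norm_uminus[OF r gr] by simp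
qed

lemma pairing: "duality_pairing fscale X (Lp_norm p m) D E (Lp_norm q m) B J"
proof
 fix x y f g :: "'a => complex" and c C e
 show "x : D ==> x : E" using bounded_integrable_Lp[OF q] by (auto simp: D_def E_def)
 show "x : E ==> x : X" by (simp add: E_def)
 show "subspace E"
  unfolding subspace_def E_def
  by (auto simp: plus_fun_def zero_fun_def Lp_add[OF q] Lp_scale[OF q] zero_Lp intro: X_closed(2)[unfolded plus_fun_def] X_closed(4) X_closed(1)[unfolded zero_fun_def])
 show "0 <= Lp_norm q m x" by (rule Lp_norm_nonneg)
 have int: "integrable m (%x. f x * g (- x))" "norm (B f g) <= Lp_norm p m f * Lp_norm q m g"
  if "f : X" "g : E" for f g
  using Holder_inequality(1)[OF pq X_Lp[OF that(1)] Lp_uminus(1)[OF q]] Holder_integral[OF pq X_Lp[OF that(1)] Lp_uminus(1)[OF q]]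
   Lp_norm_uminus[OF q] that(2) by (simp_all add: B_def E_def)
 show "x : X ==> y : X ==> g : E ==> B (x + y) g = B x g + B y g"
  using int(1)[of x g] int(1)[of y g] by (simp add: B_def distrib_right)
 show "B (fscale c x) g = c * B x g"
  by (simp add: B_def mult.assoc)
 show "f : E ==> g : E ==> B f g = B g f"
 proof -
  assume fg: "f : E" "g : E"
  hence m: "f : borel_measurable borel" "g : borel_measurable borel" using X_measurable by (auto simp: E_def)
  have "(%x. f (- x) * g x) : borel_measurable borel"
   using m(2) measurable_uminus_arg[OF m(1)] by (rule borel_measurable_times[rotated])
  from integral_uminus[OF this] show ?thesis by (simp add: B_def mult.commute)
 qed
 show "f : X ==> g : E ==> norm (B f g) <= Lp_norm p m f * Lp_norm q m g" by (rule int(2))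
 show "f : E & Lp_norm q m f <= C" if f: "f : X" and C: "0 <= C" and h: "!!g. g : D ==> norm (B f g) <= C * Lp_norm p m g"
 proof -
  have "f : Lp_space q m & Lp_norm q m f <= C"
  proof (rule Lp_dual_norm[OF conjugate_exponents_sym[OF pq] Lp_measurable[OF X_Lp[OF f]] _ C])
   show "sigma_support m f" by (rule sigma_support_Lp[OF p X_Lp[OF f] fin])
   fix g assume g: "g : bounded_integrable m"
   show "norm (LINT x|m. f x * g x) <= C * Lp_norm p m g"
    using h[OF B_test(1)[OF X_measurable[OF f] g p]] B_test(2,3)[OF X_measurable[OF f] g p] by simp
  qed
  thus ?thesis using f by (simp add: E_def)
 qed
 show "Lp_norm p m f <= C" if f: "f : X" and C: "0 <= C" and h: "!!g. g : D ==> norm (B f g) <= C * Lp_norm q m g"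
 proof (rule Lp_norm_le_dual[OF pq X_Lp[OF f] fin C])
  fix g assume g: "g : bounded_integrable m"
  show "norm (LINT x|m. f x * g x) <= C * Lp_norm q m g"
   using h[OF B_test(1)[OF X_measurable[OF f] g q]] B_test(2,3)[OF X_measurable[OF f] g q] by simp
 qed
 show "EX y:D. Lp_norm p m (x - y) < e" if x: "x : X" and e: "0 < e"
 proof -
  obtain g where g: "g : bounded_integrable m" "Lp_norm p m (%t. x t - g t) < e"
   using bounded_integrable_dense[OF p X_Lp[OF x] fin e] by blast
  have "Lp_norm p m (\<pi> (%t. x t - g t)) = Lp_norm p m (%t. x t - g t)"
   by (rule \<pi>_Lp(2)[OF Lp_diff[OF p X_Lp[OF x] bounded_integrable_Lp[OF p g(1)]]])
  thus ?thesis using g(2) \<pi>_D[OF g(1)] by (intro bexI[of _ "\<pi> g"]) (simp_all add: \<pi>_minus \<pi>_id[OF x] fun_diff_def)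
 qed
 show "x : X ==> J x : X" by (rule J_in_X)
 show "x : D ==> J x : D" using J_Lp(1)[of 1 x] J_Lp(1)[of top x] J_in_X[of x] by (simp add: D_def bounded_integrable_def)
 show "x : E ==> J x : E" using J_Lp(1)[OF q, of x] J_in_X[of x] by (simp add: E_def)
 show "x : X ==> J (J x) = x" by (rule J_involution)
 show "J (x + y) = J x + J y" by (simp add: J_def \<pi>_add plus_fun_def)
 show "J (fscale c x) = fscale (cnj c) (J x)" by (simp add: J_def \<pi>_scale)
 show "x : X ==> Lp_norm p m (J x) = Lp_norm p m x" by (rule J_Lp(2)[OF p X_Lp])
 show "B (J f) (J g) = cnj (B f g)" if "f : X" "g : E"
 proof -
  have m: "f : borel_measurable borel" "g : borel_measurable borel" using that X_measurable by (auto simp: E_def)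
  have "B (J f) (J g) = (LINT x|m. cnj (f (- x) * g (- (- x))))"
   unfolding J_def B_\<pi>(2)[OF cnj_uminus_measurable[OF m(1)] \<pi>_bm[OF cnj_uminus_measurable[OF m(2)]]]
    B_\<pi>(1)[OF cnj_uminus_measurable[OF m(1)] cnj_uminus_measurable[OF m(2)]] by (simp add: B_def)
  also have "... = (LINT x|m. cnj (f x * g (- x)))"
  proof -
   have "(%x. cnj (f x * g (- x))) : borel_measurable borel"
    using m(1) measurable_uminus_arg[OF m(2)] by (intro borel_measurable_cnj borel_measurable_times)
   from integral_uminus[OF this] show ?thesis by simp
  qed
  finally show ?thesis by (simp only: Bochner_Integration.integral_cnj B_def)
 qed
 show "0 <= Re (B f (J f))" if "f : E"
 proof -
  have m: "f : borel_measurable borel" using that X_measurable by (auto simp: E_def)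
  have "B f (J f) = (LINT x|m. f x * cnj (f x))"
   unfolding J_def using B_\<pi>(1)[OF m cnj_uminus_measurable[OF m]] by (simp add: B_def)
  also have "... = (LINT x|m. complex_of_real ((norm (f x))\<^sup>2))" by (simp only: complex_norm_square)
  also have "... = complex_of_real (LINT x|m. (norm (f x))\<^sup>2)" by (rule integral_complex_of_real)
  finally show ?thesis by simp
 qed
qed

sublocale duality_pairing fscale X "Lp_norm p m" D E "Lp_norm q m" B J by (rule pairing)

lemma A_D: "finite_radon b ==> f : D ==> A b f : D"
 unfolding A_def by (rule \<pi>_D) (simp add: D_def avg_bounded_integrable)

text \<open>The adjoint formula replaces b by its reflection, and the reflection inside
  \<open>B\<close> undoes this.\<close>

lemma A_symmetric:
 assumes b: "finite_radon b" and f: "f : D" and g: "g : D"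
 shows "B (A b f) g = B f (A b g)"
proof -
 have m: "f : borel_measurable borel" "g : borel_measurable borel" using f g X_measurable by (auto simp: D_def)
 \<comment> \<open>Elements of D lie in L^2, and the exponent 2 raises no condition on the total
   mass of m.\<close>
 have "conjugate_exponents 2 2"
  unfolding conjugate_exponents_def by (intro disjI2 exI[of _ 2]) simp
 hence 2: "(LINT x|m. avg b f x * g (- x)) = (LINT x|m. f x * avg (reflect b) (%x. g (- x)) x)"
  by (rule avg_adjoint[OF b])
    (use f g bounded_integrable_Lp[of 2] Lp_uminus[of 2] in \<open>auto simp: D_def\<close>)
 have "B (A b f) g = B (avg b f) g" unfolding A_def by (rule B_\<pi>(2)[OF avg_measurable[OF b m(1)] m(2)])
 also have "... = B f (avg b g)"
  unfolding B_def 2 avg_reflect[OF b measurable_uminus_arg[OF m(2)]] by (simp add: avg_def)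
 also have "... = B f (A b g)" unfolding A_def by (rule B_\<pi>(1)[OF m(1) avg_measurable[OF b m(2)], symmetric])
 finally show ?thesis .
qed

lemma symmetric_A: "finite_radon b ==> symmetric_op (A b)"
 unfolding symmetric_op_def using bop_A A_symmetric B_sym[OF D_E D_E[OF A_D]] by auto

text \<open>J reverses the argument before and after averaging, which amounts to reflecting b, and
  the two conjugations cancel because b is positive. So the adjoint of an average is again an
  average.\<close>

lemma J_A_J:
 assumes b: "finite_radon b" and f: "f : X"
 shows "J (A b (J f)) = A (reflect b) f"
proof -
 define h where "h = (%x. cnj (f (- x)))"
 have h: "h : Lp_space p m" unfolding h_def by (rule cnj_uminus(1)[OF p X_Lp[OF f]])
 hence hm: "h : borel_measurable borel" using Lp_measurable by fastforce
 have "A b (J f) = \<pi> (avg b h)"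
  unfolding J_def h_def[symmetric] by (rule represents_Lp(2)[OF represents_A[OF b] bop_A[OF b] h, symmetric])
 hence "J (A b (J f)) = J (avg b h)" using J_\<pi>[OF avg_measurable[OF b hm]] by simp
 also have "... = A (reflect b) f"
 proof -
  have "cnj (avg b h (- x)) = avg (reflect b) f x" for x
   using avg_minus[OF b X_measurable[OF f], of "- x"] by (simp add: h_def avg_cnj)
  thus ?thesis by (simp add: J_def A_def)
 qed
 finally show ?thesis .
qed

end

section \<open>Complex combinations of averages\<close>

locale avg_combination = haar_pairing m p \<pi> q for m :: "'a::{topological_ab_group_add, t2_space} measure" and p \<pi> q +
 fixes c :: "nat => complex" and \<beta> :: "nat => 'a measure" and n :: nat
 assumes \<beta>: "!!i. finite_radon (\<beta> i)"
begin

definition S :: "('a => complex) => 'a => complex" where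
 "S f = (\<Sum>i<n. fscale (c i) (A (\<beta> i) f))"

lemma represents_S: "represents (%f s. \<Sum>i<n. c i * avg (\<beta> i) f s) S"
 unfolding S_def[abs_def] by (intro represents_sum represents_scale represents_A \<beta>)

lemma bop_S: "bop S"
 unfolding S_def[abs_def] by (rule bop_sum, rule bop_scale, rule bop_A, rule \<beta>)

lemma D_subspace: "subspace D"
 unfolding subspace_def
 using Lp_add[of 1 _ m] Lp_add[of top _ m] Lp_scale(1)[of 1 _ m] Lp_scale(1)[of top _ m] zero_Lp[of 1 m] zero_Lp[of top m]
 by (auto simp: D_def bounded_integrable_def plus_fun_def zero_fun_def
   intro: X_closed(2)[unfolded plus_fun_def] X_closed(4) X_closed(1)[unfolded zero_fun_def])

lemma S_D: "f : D ==> S f : D"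
 unfolding S_def by (intro subspace_sum[OF D_subspace] subspace_scale[OF D_subspace] A_D \<beta>)

lemma symmetric_S: "symmetric_op S"
 unfolding S_def[abs_def] by (rule symmetric_op_sum[OF symmetric_A[OF \<beta>]])

lemma S_symmetric: "f : D ==> g : D ==> B (S f) g = B f (S g)"
 using symmetric_S B_sym[OF D_E D_E[OF S_D]] by (simp add: symmetric_op_def)

text \<open>The adjoint of S combines the averages over the reflected measures with conjugate
  coefficients, and all averages commute.\<close>

lemma normal_S: assumes x: "x : X" shows "S (J (S (J x))) = J (S (J (S x)))"
proof -
 define S' where "S' x = (\<Sum>i<n. fscale (cnj (c i)) (A (reflect (\<beta> i)) x))" for x
 note R = finite_radon_reflect(1)[OF \<beta>]
 have JSJ: "J (S (J x)) = S' x" if x: "x : X" for x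
 proof -
  have "J (\<Sum>i<k. fscale (c i) (A (\<beta> i) (J x))) = (\<Sum>i<k. fscale (cnj (c i)) (A (reflect (\<beta> i)) x))" for k
  proof (induction k)
   case 0
   show ?case using J_scale[of 0 0] by simp
  next
   case (Suc k)
   have X: "fscale (c i) (A (\<beta> i) (J x)) : X" for i by (intro X_closed(4) A_X \<beta> J_X x)
   have "(\<Sum>i<k. fscale (c i) (A (\<beta> i) (J x))) : X" by (intro X_closed(6) X)
   from J_add[OF this X, of k] show ?case using Suc J_scale[OF A_X[OF \<beta> J_X[OF x]], of "c k" k] J_A_J[OF \<beta> x] by (simp add: plus_fun_def)
  qed
  thus ?thesis by (simp add: S_def S'_def)
 qed
 have AX: "fscale d (A (\<beta> i) x) : X" "fscale d (A (reflect (\<beta> i)) x) : X" for i d by (intro X_closed(4) A_X \<beta> R x)+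
 have lin: "lin (A (\<beta> i))" "lin (A (reflect (\<beta> i)))" for i by (intro bop_lin bop_A \<beta> R)+
 have "S (S' x) = (\<Sum>i<n. \<Sum>j<n. fscale (c i) (fscale (cnj (c j)) (A (\<beta> i) (A (reflect (\<beta> j)) x))))"
  unfolding S_def S'_def using A_X[OF R x]
  by (simp only: lin_sum[OF lin(1) AX(2)] linD(3)[OF lin(1)] scale_sum_right)
 also have "... = (\<Sum>j<n. \<Sum>i<n. fscale (cnj (c j)) (fscale (c i) (A (reflect (\<beta> j)) (A (\<beta> i) x))))"
  by (subst sum.swap) (simp only: A_commute[OF \<beta> R x] mult.left_commute)
 also have "... = S' (S x)"
  unfolding S_def S'_def using A_X[OF \<beta> x]
  by (simp only: lin_sum[OF lin(2) AX(1)] linD(3)[OF lin(2)] scale_sum_right)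
 finally show ?thesis using JSJ[OF x] JSJ[OF bopX[OF bop_S x]] by simp
qed

lemma represents_T:
 assumes T: "!!f. f : borel_measurable borel ==> T f = (%s. \<Sum>i<n. c i * avg (\<beta> i) f s)"
 shows "represents T S"
 unfolding represents_def
proof
 fix f assume f: "f : Lp_space p m"
 hence "f : borel_measurable borel" using Lp_measurable by fastforce
 thus "T f : borel_measurable m & (AE x in m. T f x = S (\<pi> f) x)"
  using represents_S f by (simp add: represents_def T)
qed

theorem isolated_imp_ume:
 assumes T: "!!f. f : borel_measurable borel ==> T f = (%s. \<Sum>i<n. c i * avg (\<beta> i) f s)"
  and norm: "Lp_operator_norm p m T <= 1" and iso: "\<not> (1 islimpt Lp_spectrum p m T)"
 shows "uniformly_mean_ergodic p m T"
proof -
 note r = represents_T[OF T]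
 obtain d where d: "d > 0" "!!z. 0 < norm (z - 1) ==> norm (z - 1) < d ==> EX R. resolvent_of S z R"
  using iso not_islimpt_spectrum_iff[OF r bop_S] by blast
 have "bounded_by S 1" using norm Lp_operator_norm_le_1_iff[OF r bop_S] by simp
 hence "EX P. bop P & converges_to (ces S) P"
  by (rule isolated_spectrum_imp_ume[OF _ S_D S_symmetric normal_S d])
 thus ?thesis using uniformly_mean_ergodic_iff[OF r bop_S] by simp
qed

end

section \<open>Uniformly mean ergodic convolution operators are contractions\<close>

text \<open>Linear growth of the powers stays below K (1 + e)^n for every e > 0, with K depending on
  e. Normality forgets K and leaves the norm bound 1 + e.\<close>

lemma (in avg_combination) ume_contraction_L2:
 assumes p2: "p = 2" and r: "represents T S" and u: "uniformly_mean_ergodic p m T"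
 shows "Lp_operator_norm p m T <= 1"
proof -
 obtain P where P: "bop P" "converges_to (ces S) P" using u uniformly_mean_ergodic_iff[OF r bop_S] by blast
 obtain C where C: "!!n x. n >= 1 ==> x : X ==> Lp_norm p m ((S ^^ n) x) <= C * n * Lp_norm p m x"
  using ume_power_growth[OF bop_S P] by blast
 have sq: "Re (B f (J f)) = (Lp_norm p m f)\<^sup>2" if f: "f : E" for f
 proof -
  have m: "f : borel_measurable borel" using f X_measurable by (auto simp: E_def)
  have "B f (J f) = (LINT x|m. f x * cnj (f x))"
   unfolding J_def using B_\<pi>(1)[OF m cnj_uminus_measurable[OF m]] by (simp add: B_def)
  also have "... = (LINT x|m. complex_of_real ((norm (f x))\<^sup>2))" by (simp only: complex_norm_square)
  also have "... = complex_of_real (LINT x|m. (norm (f x))\<^sup>2)" by (rule integral_complex_of_real)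
  finally have "Re (B f (J f)) = (LINT x|m. (norm (f x))\<^sup>2)" by simp
  moreover have "Lp_norm 2 m f = (LINT x|m. (norm (f x))\<^sup>2) powr (1 / 2)"
   using Lp_norm_finite[of 2 m f] by simp
  moreover have "(LINT x|m. (norm (f x))\<^sup>2) >= 0" by simp
  ultimately show ?thesis by (simp add: p2 powr_half_sqrt)
 qed
 have le: "Lp_norm p m (S f) <= (1 + e) * Lp_norm p m f" if f: "f : D" and e: "e > 0" for f e
 proof -
  \<comment> \<open>The 1 is for the power 0; |C| / e comes from Bernoulli's inequality.\<close>
  define K where "K = max 1 (\<bar>C\<bar> / e)"
  have growth: "bounded_by (S ^^ n) (K * (1 + e) ^ n)" for n
  proof -
   have "Lp_norm p m ((S ^^ n) x) <= K * (1 + e) ^ n * Lp_norm p m x" if x: "x : X" for x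
   proof (cases "n = 0")
    case True
    thus ?thesis using mult_right_mono[of 1 K "Lp_norm p m x"] N_nonneg[OF x] by (simp add: K_def)
   next
    case False
    have "1 + real n * e <= (1 + e) ^ n" using e by (intro Bernoulli_inequality) simp
    hence "real n <= (1 + e) ^ n / e" using e by (simp add: field_simps)
    hence "C * real n <= \<bar>C\<bar> * ((1 + e) ^ n / e)" by (intro mult_mono) auto
    also have "... = \<bar>C\<bar> / e * (1 + e) ^ n" by simp
    also have "... <= K * (1 + e) ^ n" using e by (intro mult_right_mono) (auto simp: K_def)
    finally have "C * real n * Lp_norm p m x <= K * (1 + e) ^ n * Lp_norm p m x" by (rule mult_right_mono) (rule N_nonneg[OF x])
    thus ?thesis using C[OF _ x, of n] False by simp
   qed
   moreover have "K * (1 + e) ^ n >= 0" using e by (simp add: K_def)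
   ultimately show ?thesis using bop_lin[OF bop_funpow[OF bop_S]] by (simp add: bounded_by_def)
  qed
  have "Re (B (S f) (J (S f))) <= (1 + e)\<^sup>2 * Re (B f (J f))"
   by (rule normal_L2_bound[OF symmetric_S normal_S growth _ f]) (use e in simp_all)
  hence "(Lp_norm p m (S f))\<^sup>2 <= ((1 + e) * Lp_norm p m f)\<^sup>2"
   unfolding sq[OF D_E[OF f]] sq[OF D_E[OF S_D[OF f]]] by (simp add: power_mult_distrib)
  thus ?thesis by (rule power2_le_imp_le) (use e N_nonneg[OF D_X[OF f]] in simp)
 qed
 have "Lp_norm p m (S f) <= 1 * Lp_norm p m f" if f: "f : D" for f
 proof (rule field_le_epsilon)
  fix e :: real assume e: "e > 0"
  define d where "d = e / (Lp_norm p m f + 1)"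
  have n: "Lp_norm p m f >= 0" by (rule N_nonneg[OF D_X[OF f]])
  hence d: "d > 0" using e by (simp add: d_def)
  have "d * Lp_norm p m f <= e" using n e by (simp add: d_def field_simps)
  thus "Lp_norm p m (S f) <= 1 * Lp_norm p m f + e" using le[OF f d] by (simp add: algebra_simps)
 qed
 hence "Lp_norm p m (S x) <= 1 * Lp_norm p m x" if "x : X" for x
  using bounded_on_dense[OF bop_S _ _ that, of 1] by auto
 hence "bounded_by S 1" using bop_lin[OF bop_S] by (simp add: bounded_by_def)
 thus ?thesis by (rule Lp_operator_norm_le[OF r])
qed

lemma Lp_norm_mono:
 assumes p: "1 <= p" and f: "f : Lp_space p M" and g: "g : borel_measurable M" and le: "!!x. norm (g x) <= norm (f x)"
 shows "Lp_norm p M g <= Lp_norm p M f"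
proof (cases p)
 case top
 have "AE x in M. norm (g x) <= Lp_norm top M f"
  using Lp_norm_inf_AE[of f M] f le unfolding top by (auto elim!: eventually_mono intro: order_trans)
 thus ?thesis using g Lp_norm_nonneg by (auto simp: top intro!: Lp_norm_inf_le)
next
 case (real P)
 have P: "P >= 1" using p real by simp
 have "g : Lp_space p M" by (rule Lp_dominated[OF assms])
 hence i: "integrable M (%x. norm (g x) powr P)" "integrable M (%x. norm (f x) powr P)"
  using f real by (simp_all add: Lp_space_finite)
 have "(LINT x|M. norm (g x) powr P) <= (LINT x|M. norm (f x) powr P)"
  using i P by (intro integral_mono) (auto intro!: powr_mono2 le)
 thus ?thesis using real P by (simp add: Lp_norm_finite powr_mono2)
qed

text \<open>The bound 1 + m(A) is crude but the same for every p, which is enough against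
  exponential growth.\<close>

lemma Lp_norm_indicator:
 fixes p :: ennreal
 assumes p: "1 <= p" and A: "A : sets M" "emeasure M A < top"
 shows "(%x. complex_of_real (indicator A x)) : Lp_space p M" "Lp_norm p M (%x. complex_of_real (indicator A x)) <= 1 + measure M A"
  "emeasure M A ~= 0 ==> 0 < Lp_norm p M (%x. complex_of_real (indicator A x))"
proof -
 define f where "f = (%x. complex_of_real (indicator A x))"
 have fm: "f : borel_measurable M" unfolding f_def using A by measurable
 have "f : bounded_integrable M"
  by (rule bounded_integrableI[where A = A and K = 1]) (use A fm in \<open>auto simp: f_def split: split_indicator\<close>)
 thus L: "(%x. complex_of_real (indicator A x)) : Lp_space p M"
  unfolding f_def by (rule bounded_integrable_Lp[OF p])
 show "Lp_norm p M (%x. complex_of_real (indicator A x)) <= 1 + measure M A"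
 proof (cases p)
  case top
  have "Lp_norm top M f <= 1" by (rule Lp_norm_inf_le[OF fm]) (auto simp: f_def split: split_indicator)
  thus ?thesis by (simp add: top f_def add_increasing2)
 next
  case (real P)
  have P: "P >= 1" using p real by simp
  have "norm (f x) powr P = indicator A x" for x using P by (simp add: f_def split: split_indicator)
  hence "Lp_norm p M f = measure M A powr (1 / P)"
   using A P by (simp add: real Lp_norm_finite)
  also have "... <= (1 + measure M A) powr (1 / P)" using P by (intro powr_mono2) auto
  also have "... <= (1 + measure M A) powr 1" using P by (intro powr_mono) auto
  finally show ?thesis by (simp add: f_def)
 qed
 assume "emeasure M A ~= 0"
 hence "\<not> (AE x in M. f x = 0)"
  using A(1) AE_iff_measurable[of A M "%x. f x = 0"] sets.sets_into_space[OF A(1)] by (auto simp: f_def indicator_def)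
 thus "0 < Lp_norm p M (%x. complex_of_real (indicator A x))"
  using Lp_norm_eq_0[OF p L] Lp_norm_nonneg[of p M f] by (auto simp: f_def less_le)
qed

section \<open>Positive measures: polynomial growth of sums of a compact set\<close>

context haar
begin

text \<open>n steps inside K lead from W j to W (n + j), and each step costs a factor \<beta>(K). A
  bounded real function u is carried along so that the lower bound holds at every point of W
  j.\<close>

lemma funpow_avg_indicator:
 fixes \<beta> :: "'a measure" and K :: "'a set"
 assumes \<beta>: "finite_radon \<beta>" and K: "K : sets borel" and W: "!!n. W n : sets borel" "!!n s y. s : W n ==> y : K ==> s + y : W (Suc n)"
 shows "EX u b. u : borel_measurable borel & (ALL x. 0 <= u x & u x <= b) &
  (avg \<beta> ^^ n) (%x. complex_of_real (indicator (W (n + j)) x)) = (%x. complex_of_real (u x)) & (ALL s:W j. measure \<beta> K ^ n <= u s)"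
proof (induction n arbitrary: j)
 case 0
 show ?case by (intro exI[of _ "indicator (W j)"] exI[of _ 1]) (use W in \<open>auto split: split_indicator\<close>)
next
 case (Suc n)
 interpret finite_measure \<beta> by (rule finite_radonD(5)[OF \<beta>])
 obtain u b where u: "u : borel_measurable borel" "!!x. 0 <= u x" "!!x. u x <= b"
  "(avg \<beta> ^^ n) (%x. complex_of_real (indicator (W (n + Suc j)) x)) = (%x. complex_of_real (u x))"
  "!!s. s : W (Suc j) ==> measure \<beta> K ^ n <= u s"
  using Suc[of "Suc j"] by blast
 define v where "v s = (LINT y|\<beta>. u (s + y))" for s
 have eq: "avg \<beta> (%x. complex_of_real (u x)) = (%s. complex_of_real (v s))"
  unfolding avg_def[abs_def] v_def by (intro ext integral_complex_of_real)
 have "(%x. complex_of_real (u x)) : borel_measurable borel" using u(1) by measurable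
 hence "(%s. Re (complex_of_real (v s))) : borel_measurable borel"
  using avg_measurable[OF \<beta>, of "%x. complex_of_real (u x)"] unfolding eq by (intro measurable_compose[OF _ borel_measurable_Re])
 hence vm: "v : borel_measurable borel" by simp
 have i: "integrable \<beta> (%y. u (s + y))" for s
  by (rule integrable_const_bound[of _ b]) (use u(2,3) avg_integrand_measurable[OF u(1), of s] in \<open>simp_all add: finite_radonD(6)[OF \<beta>]\<close>)
 have "v s <= (LINT y|\<beta>. b)" for s unfolding v_def by (rule integral_mono[OF i]) (use u(3) in auto)
 moreover have "0 <= v s" for s unfolding v_def using u(2) by (intro Bochner_Integration.integral_nonneg) auto
 moreover have "measure \<beta> K ^ Suc n <= v s" if s: "s : W j" for s
 proof -
  have "measure \<beta> K ^ Suc n = (LINT y|\<beta>. measure \<beta> K ^ n * indicator K y)"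
   using K finite_radonD(3)[OF \<beta>] by simp
  also have "... <= v s" unfolding v_def
  proof (rule integral_mono[OF _ i])
   show "integrable \<beta> (%y. measure \<beta> K ^ n * indicator K y)"
    using K finite_radonD(3)[OF \<beta>] by (intro integrable_mult_right integrable_real_indicator) (auto simp: emeasure_eq_measure)
   show "measure \<beta> K ^ n * indicator K y <= u (s + y)" for y
    using u(2)[of "s + y"] u(5)[OF W(2)[OF s, of y]] by (auto split: split_indicator)
  qed
  finally show ?thesis .
 qed
 moreover have "(avg \<beta> ^^ Suc n) (%x. complex_of_real (indicator (W (Suc n + j)) x)) = (%x. complex_of_real (v x))"
  using u(4) eq by simp
 ultimately show ?case using vm by blast
qed

text \<open>The set V + K + ... + K with n summands K, written as a union of translates; it is open
  as soon as V is.\<close>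

primrec sumset_iter :: "'a set => 'a set => nat => 'a set" where
 "sumset_iter V K 0 = V"
| "sumset_iter V K (Suc n) = (\<Union>y\<in>K. {x. x - y : sumset_iter V K n})"

lemma open_sumset_iter: "open V ==> open (sumset_iter V K n)"
proof (induction n)
 case (Suc n)
 have "open {x. x - y : sumset_iter V K n}" for y
  using open_vimage[OF Suc.IH[OF Suc.prems], of "%x. x - y"] by (simp add: vimage_def continuous_on_diff continuous_on_id continuous_on_const)
 thus ?case by auto
qed simp

text \<open>
  If finitely many translates \<open>a + V\<close> cover \<open>V + K\<close>, then the translates by the
  \<open>n\<close>-fold sums of the \<open>a\<close> cover \<open>V + nK\<close>; in an Abelian group there are
  only polynomially many such sums.
\<close>

lemma sumset_iter_growth:
 assumes V: "open V" "emeasure m V < top" and F: "finite F" and cover: "sumset_iter V K 1 \<subseteq> (\<Union>a\<in>F. {x. x - a : V})"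
 shows "emeasure m (sumset_iter V K n) <= of_nat ((n + 1) ^ card F) * emeasure m V"
proof -
 define mult where "mult k a = (\<Sum>i<k. a)" for k :: nat and a :: 'a
 define s where "s k = (\<Sum>a\<in>F. mult (k a) a)" for k
 define I where "I n = Pi\<^sub>E F (%_. {..n})" for n :: nat
 have cov: "EX k:I n. x - s k : V" if "x : sumset_iter V K n" for x n
  using that
 proof (induction n arbitrary: x)
  case 0
  have "s (\<lambda>a\<in>F. 0) = 0" unfolding s_def mult_def by (rule sum.neutral) simp
  thus ?case using 0 by (intro bexI[of _ "\<lambda>a\<in>F. 0"]) (simp_all add: I_def restrict_PiE_iff del: restrict_apply)
 next
  case (Suc n)
  then obtain y where y: "y : K" "x - y : sumset_iter V K n" by auto
  then obtain k where k: "k : I n" "x - y - s k : V" using Suc.IH by blast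
  \<comment> \<open>Commutativity of the group: the last summand y is moved past the sum collected
    so far.\<close>
  have "x - s k - y : V" using k(2) by (simp add: algebra_simps)
  hence "x - s k : sumset_iter V K 1" using y(1) by auto
  then obtain a where a: "a : F" "x - s k - a : V" using cover by auto
  define k' where "k' = k(a := Suc (k a))"
  have "s k' = s k + a"
  proof -
   have "s k' = mult (k' a) a + (\<Sum>b\<in>F - {a}. mult (k' b) b)" unfolding s_def by (rule sum.remove[OF F a(1)])
   also have "mult (k' a) a = mult (k a) a + a" by (simp add: k'_def mult_def)
   also have "(\<Sum>b\<in>F - {a}. mult (k' b) b) = (\<Sum>b\<in>F - {a}. mult (k b) b)" by (rule sum.cong) (auto simp: k'_def)
   also have "mult (k a) a + a + (\<Sum>b\<in>F - {a}. mult (k b) b) = s k + a"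
    unfolding s_def sum.remove[OF F a(1)] by (simp add: algebra_simps)
   finally show ?thesis .
  qed
  moreover have "k' : I (Suc n)" using k(1) a(1) by (auto simp: I_def k'_def PiE_iff extensional_def le_SucI)
  ultimately show ?case using a(2) by (intro bexI[of _ k']) (simp_all add: algebra_simps)
 qed
 have fI: "finite (I n)" unfolding I_def using F by (intro finite_PiE) auto
 have op: "open {x. x - t : V}" for t
  using open_vimage[OF V(1), of "%x. x - t"] by (simp add: vimage_def continuous_on_diff continuous_on_id continuous_on_const)
 have "emeasure m (sumset_iter V K n) <= emeasure m (\<Union>k\<in>I n. {x. x - s k : V})"
 proof (rule emeasure_mono)
  show "sumset_iter V K n \<subseteq> (\<Union>k\<in>I n. {x. x - s k : V})" using cov by auto
  have "open (\<Union>k\<in>I n. {x. x - s k : V})" using op by blast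
  thus "(\<Union>k\<in>I n. {x. x - s k : V}) : sets m" by simp
 qed
 also have "... <= (\<Sum>k\<in>I n. emeasure m {x. x - s k : V})"
  by (rule emeasure_subadditive_finite[OF fI]) (use op in auto)
 also have "... = (\<Sum>k\<in>I n. emeasure m V)"
  using emeasure_shift[of V "- s _"] V(1) by (intro sum.cong) auto
 also have "... = of_nat (card (I n)) * emeasure m V" by simp
 also have "card (I n) = (n + 1) ^ card F" unfolding I_def using F by (simp add: card_PiE)
 finally show ?thesis .
qed

text \<open>V lies in a compact set C, and C + K is compact, so finitely many translates of V cover
  it.\<close>

lemma exists_sumset_cover:
 assumes K: "compact (K :: 'a set)"
 shows "EX V F. open V & V ~= {} & emeasure m V < top & finite F & sumset_iter V K 1 \<subseteq> (\<Union>a\<in>F. {x. x - a : V})"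
proof -
 obtain V C where V: "open V" "compact C" "(0::'a) : V" "V \<subseteq> C" using compact_nbhd[of 0] by metis
 have "compact ((%z. fst z + snd z) ` (C \<times> K))"
  by (intro compact_continuous_image[OF continuous_on_add[OF continuous_on_fst[OF continuous_on_id] continuous_on_snd[OF continuous_on_id]]] compact_Times V(2) K)
 moreover have "V ~= {}" using V(3) by auto
 ultimately obtain F where F: "finite F" "(%z. fst z + snd z) ` (C \<times> K) \<subseteq> (\<Union>a\<in>F. {x. x + a : V})"
  using compact_translates_cover[OF _ V(1)] by meson
 have F': "(\<Union>a\<in>F. {x. x + a : V}) = (\<Union>a\<in>uminus ` F. {x. x - a : V})" by simp
 have "sumset_iter V K 1 \<subseteq> (%z. fst z + snd z) ` (C \<times> K)"
 proof
  fix x assume "x : sumset_iter V K 1"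
  then obtain y where "y : K" "x - y : V" by auto
  thus "x : (%z. fst z + snd z) ` (C \<times> K)" using V(4) by (intro image_eqI[of _ _ "(x - y, y)"]) auto
 qed
 moreover have "emeasure m V < top"
  using emeasure_mono[OF V(4), of m] finite_compact[OF V(2)] V(2) by (auto simp: borel_compact intro: le_less_trans)
 moreover have "finite (uminus ` F)" using F(1) by simp
 ultimately show ?thesis
  using V(1) \<open>V ~= {}\<close> F(2) unfolding F' by (meson order_trans)
qed

end

text \<open>The right side has the shape met below: linear growth of the powers times the bound for
  the norm of an indicator whose set has polynomially growing measure.\<close>

lemma exponential_beats_polynomial:
 fixes c a b C :: real
 assumes "1 < c" "0 < a" "!!n::nat. n >= M ==> c ^ n * a <= C * real n * (1 + (1 + real n) ^ d * b)"
 shows False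
proof -
 have "(%n. C * real n * (1 + (1 + real n) ^ d * b) / c ^ n) \<longlonglongrightarrow> 0"
  using assms(1) by real_asymp
 moreover have "EX N. ALL n>=N. a <= C * real n * (1 + (1 + real n) ^ d * b) / c ^ n"
  using assms(1) assms(3) by (intro exI[of _ M]) (simp add: pos_le_divide_eq mult.commute)
 ultimately have "a <= 0" by (rule LIMSEQ_le_const)
 thus False using assms(2) by simp
qed

lemma (in haar_Lp) ume_contraction_positive:
 assumes b: "finite_radon b" and T: "!!f. f : borel_measurable borel ==> T f = avg b f" and u: "uniformly_mean_ergodic p m T"
 shows "measure b UNIV <= 1"
proof (rule ccontr)
 assume "\<not> measure b UNIV <= 1"
 interpret b: finite_measure b by (rule finite_radonD(5)[OF b])
 note [simp] = finite_radonD(3,4)[OF b]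
 have "1 < emeasure b UNIV" using \<open>\<not> measure b UNIV <= 1\<close> by (simp add: b.emeasure_eq_measure)
 also have "... = (SUP K\<in>{K. compact K & K \<subseteq> UNIV}. emeasure b K)" by (rule radonD(4)[OF finite_radonD(1)[OF b]]) simp
 \<comment> \<open>By inner regularity a compact part already has mass above 1.\<close>
 finally obtain K where K: "compact K" "1 < emeasure b K" by (auto simp: less_SUP_iff)
 hence c: "1 < measure b K" by (simp add: b.emeasure_eq_measure)
 obtain V F where V: "open V" "V ~= {}" "emeasure m V < top" "finite F" "sumset_iter V K 1 \<subseteq> (\<Union>a\<in>F. {x. x - a : V})"
  using exists_sumset_cover[OF K(1)] by blast
 define W where "W = sumset_iter V K"
 have Wo: "open (W n)" for n unfolding W_def by (rule open_sumset_iter[OF V(1)])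
 have Wstep: "s + y : W (Suc n)" if "s : W n" "y : K" for n s y using that by (auto simp: W_def intro!: bexI[of _ y])
 have Wm: "emeasure m (W n) <= of_nat ((n + 1) ^ card F) * emeasure m V" for n
  unfolding W_def by (rule sumset_iter_growth[OF V(1,3,4,5)])
 have Wfin: "emeasure m (W n) < top" for n
  by (rule le_less_trans[OF Wm]) (use V(3) in \<open>simp add: ennreal_mult_less_top of_nat_less_top del: of_nat_power\<close>)
 have Wmeas: "measure m (W n) <= (1 + real n) ^ card F * measure m V" for n
 proof -
  have "ennreal (measure m (W n)) <= ennreal ((1 + real n) ^ card F * measure m V)"
   using Wm[of n] Wfin[of n] V(3) by (simp add: emeasure_eq_ennreal_measure less_top[symmetric] ennreal_mult ennreal_of_nat_eq_real_of_nat)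
  thus ?thesis by simp
 qed
 define f where "f A = (%x::'a. complex_of_real (indicator A x))" for A
 have r: "represents T (A b)"
  using represents_A[OF b] T Lp_measurable unfolding represents_def by fastforce
 obtain P where P: "bop P" "converges_to (ces (A b)) P" using u uniformly_mean_ergodic_iff[OF r bop_A[OF b]] by blast
 obtain C where C: "!!n x. n >= 1 ==> x : X ==> Lp_norm p m ((A b ^^ n) x) <= C * n * Lp_norm p m x"
  using ume_power_growth[OF bop_A[OF b] P] by blast
 have fV: "f (W n) : Lp_space p m" "Lp_norm p m (f (W n)) <= 1 + measure m (W n)" for n
  unfolding f_def using Lp_norm_indicator[OF p, of "W n" m] Wo Wfin by auto
 have a: "0 < Lp_norm p m (f V)"
  unfolding f_def using Lp_norm_indicator(3)[OF p, of V m] V open_positive[OF V(1,2)] by auto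
 have main: "measure b K ^ n * Lp_norm p m (f V) <= \<bar>C\<bar> * real n * (1 + (1 + real n) ^ card F * measure m V)" if n: "n >= 1" for n :: nat
 proof -
  \<comment> \<open>The iterates are computed on functions instead of representatives, so that the
    lower bound on V holds pointwise.\<close>
  obtain u where um: "u : borel_measurable borel" "!!x. 0 <= u x"
   and eq: "(avg b ^^ n) (f (W n)) = (%x. complex_of_real (u x))" and ge: "!!s. s : V ==> measure b K ^ n <= u s"
   using funpow_avg_indicator[where W = W and n = n and j = 0, OF b borel_compact[OF K(1)] borel_open[OF Wo] Wstep]
   by (auto simp: f_def W_def)
  note ra = represents_Lp[OF represents_funpow[OF represents_A[OF b] bop_A[OF b]] bop_funpow[OF bop_A[OF b]] fV(1), of n n]
  have "measure b K ^ n * Lp_norm p m (f V) = Lp_norm p m (%x. of_real (measure b K ^ n) * f V x)"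
   using Lp_scale(2)[OF p, of "f V" m] fV(1)[of 0] by (simp add: W_def norm_power)
  also have "... <= Lp_norm p m ((avg b ^^ n) (f (W n)))"
  proof (rule Lp_norm_mono[OF p ra(1)])
   show "(%x. of_real (measure b K ^ n) * f V x) : borel_measurable m" using V(1) by (simp add: f_def)
   show "norm (of_real (measure b K ^ n) * f V x) <= norm ((avg b ^^ n) (f (W n)) x)" for x
    unfolding eq using ge[of x] um(2)[of x] by (auto simp: f_def norm_mult norm_power split: split_indicator)
  qed
  also have "... = Lp_norm p m ((A b ^^ n) (\<pi> (f (W n))))" by (rule ra(3))
  also have "... <= C * n * Lp_norm p m (\<pi> (f (W n)))" by (rule C[OF n \<pi>_X[OF fV(1)]])
  also have "... <= \<bar>C\<bar> * real n * (1 + (1 + real n) ^ card F * measure m V)"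
   unfolding \<pi>_Lp(2)[OF fV(1)] using fV(2)[of n] Wmeas[of n] Lp_norm_nonneg by (intro mult_mono) auto
  finally show ?thesis .
 qed
 show False by (rule exponential_beats_polynomial[OF c a, of 1 "\<bar>C\<bar>" "card F" "measure m V"]) (rule main)
qed

section \<open>Restriction, convolution powers and densities\<close>

text \<open>The excess of |l| over C is dominated by |f n - l|, so its integral is 0. Thus balls of
  L^\<infinity> are closed under limits in L^1.\<close>

lemma L1_limit_bound:
 assumes f: "!!n. f n : Lp_space 1 M" and l: "l : Lp_space 1 M" and lim: "(%n. Lp_norm 1 M (%x. f n x - l x)) \<longlonglongrightarrow> 0"
  and C: "0 <= C" "!!n. AE x in M. norm (f n x) <= C"
 shows "AE x in M. norm (l x) <= C"
proof -
 define u where "u x = max (norm (l x) - C) 0" for x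
 have lm: "l : borel_measurable M" "integrable M (%x. norm (l x))" using l by (auto simp: Lp_space_one)
 have i: "integrable M u"
  by (rule Bochner_Integration.integrable_bound[OF lm(2)]) (use lm C in \<open>auto simp: u_def[abs_def]\<close>)
 have "integral\<^sup>L M u <= Lp_norm 1 M (%x. f n x - l x)" for n
  unfolding Lp_norm_one
 proof (rule integral_mono_AE[OF i])
  show "integrable M (%x. norm (f n x - l x))" using Lp_diff[OF _ f l, of n] by (simp add: Lp_space_one)
  show "AE x in M. u x <= norm (f n x - l x)"
   using C(2)[of n]
  proof eventually_elim
   case (elim x)
   thus ?case using norm_triangle_sub[of "l x" "f n x"] by (simp add: u_def norm_minus_commute)
  qed
 qed
 hence "integral\<^sup>L M u <= 0" by (intro LIMSEQ_le_const[OF lim]) auto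
 moreover have "integral\<^sup>L M u >= 0" by (simp add: u_def)
 ultimately have "AE x in M. u x = 0" using integral_nonneg_eq_0_iff_AE[OF i] by (auto simp: u_def)
 thus ?thesis by eventually_elim (simp add: u_def split: if_splits add: max_def)
qed

text \<open>A compact K that nearly exhausts an open U for b also does so for the part of b on
  E.\<close>

lemma finite_radon_restrict:
 fixes b :: "'a::t2_space measure"
 assumes b: "finite_radon b" and E: "E : sets borel"
 shows "finite_radon (density b (%x. ennreal (indicator E x)))"
  and "A : sets borel ==> emeasure (density b (%x. ennreal (indicator E x))) A = emeasure b (E \<inter> A)"
proof -
 note R [simp] = finite_radonD(3,4)[OF b]
 interpret finite_measure b by (rule finite_radonD(5)[OF b])
 define a where "a = density b (%x. ennreal (indicator E x))"
 have a: "emeasure a A = emeasure b (E \<inter> A)" if "A : sets borel" for A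
  using that E emeasure_density_indicator[of E b A] unfolding a_def by (simp add: ennreal_indicator)
 thus "A : sets borel ==> emeasure (density b (%x. ennreal (indicator E x))) A = emeasure b (E \<inter> A)"
  by (simp add: a_def)
 have fin: "emeasure a UNIV < top" using a[of UNIV] by (simp add: emeasure_eq_measure)
 show "finite_radon (density b (%x. ennreal (indicator E x)))"
  unfolding a_def[symmetric]
 proof (rule finite_radonI[OF _ fin])
  fix U :: "'a set" and e :: real assume U: "open U" and e: "0 < e"
  obtain K where K: "compact K" "K \<subseteq> U" "emeasure b U <= emeasure b K + ennreal e" by (rule finite_radonE[OF b U e])
  have Ks: "K : sets borel" by (rule borel_compact[OF K(1)])
  have "measure b (U - K) <= e"
   using K Ks U e finite_measure_Diff[of U K] by (simp add: emeasure_eq_measure flip: ennreal_plus)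
  moreover have "measure b (E \<inter> U) <= measure b ((E \<inter> K) \<union> (U - K))"
   using E U Ks by (intro finite_measure_mono) auto
  moreover have "... <= measure b (E \<inter> K) + measure b (U - K)" using E U Ks by (intro measure_Un_le) auto
  ultimately have "emeasure a U <= emeasure a K + ennreal e"
   using a[of U] a[OF Ks] U e by (simp add: emeasure_eq_measure flip: ennreal_plus)
  thus "EX K. compact K & K \<subseteq> U & emeasure a U <= emeasure a K + ennreal e" using K by blast
 qed (simp add: a_def)
qed

lemma avg_restrict:
 fixes f :: "'a::{topological_ab_group_add, t2_space} => complex"
 assumes b: "finite_radon b" and E: "E : sets borel" and i: "integrable b (%y. f (s + y))"
 shows "avg b f s = avg (density b (%x. ennreal (indicator E x))) f s + avg (density b (%x. ennreal (indicator (- E) x))) f s"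
proof -
 note [simp] = finite_radonD(3,4)[OF b]
 have d: "avg (density b (%x. ennreal (indicator E x))) f s = (LINT y|b. indicator E y *\<^sub>R f (s + y))" if "E : sets borel" for E
  unfolding avg_def by (rule integral_density) (use i that in \<open>auto intro!: borel_measurable_indicator\<close>)
 have j: "integrable b (%y. indicator E y *\<^sub>R f (s + y))" if "E : sets borel" for E
  by (rule integrable_mult_indicator[OF _ i]) (use that in simp)
 have "(LINT y|b. indicator E y *\<^sub>R f (s + y)) + (LINT y|b. indicator (- E) y *\<^sub>R f (s + y)) = (LINT y|b. f (s + y))"
  using E by (subst Bochner_Integration.integral_add[symmetric]) (auto intro!: j Bochner_Integration.integral_cong split: split_indicator)
 thus ?thesis using E by (simp add: d) (simp add: avg_def)
qed

text \<open>\<open>conv_pow b k\<close> is the convolution power of order k + 1; starting at b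
  avoids the point mass at 0.\<close>

primrec conv_pow :: "'a::{topological_ab_group_add, t2_space} measure => nat => 'a measure" where
 "conv_pow b 0 = b"
| "conv_pow b (Suc k) = radon_conv b (conv_pow b k)"

lemma (in haar) conv_pow_radon:
 fixes b :: "'a measure"
 assumes b: "finite_radon b"
 shows "finite_radon (conv_pow b k)" "emeasure (conv_pow b k) UNIV = emeasure b UNIV ^ Suc k"
proof (induction k)
 case (Suc k)
 show "finite_radon (conv_pow b (Suc k))" "emeasure (conv_pow b (Suc k)) UNIV = emeasure b UNIV ^ Suc (Suc k)"
  using finite_radon_conv[OF b Suc(1)] Suc(2) by simp_all
qed (use b in simp_all)

lemma (in haar_Lp) A_funpow: "finite_radon b ==> f : X ==> (A b ^^ Suc k) f = A (conv_pow b k) f"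
 by (induction k) (simp_all add: A_A conv_pow_radon)

text \<open>The Radon-Nikodym density, made finite-valued. The formula holds at every s, which later
  gives bounds uniform in s.\<close>

lemma (in haar) avg_density_integral:
 fixes a :: "'a measure" and u :: "'a => complex"
 assumes fin: "emeasure m UNIV < top" and a: "finite_radon a" and ac: "absolutely_continuous m a"
 shows "EX h:Lp_space 1 m. ALL u:borel_measurable borel. ALL s. avg a u s = (LINT y|m. h y * u (s + y))"
proof -
 interpret finite_measure m by (rule finite_measureI) (use fin in simp)
 interpret a: finite_measure a by (rule finite_radonD(5)[OF a])
 have "sets a = sets m" using finite_radonD(3)[OF a] by simp
 from Radon_Nikodym[OF ac this] obtain g where g: "g : borel_measurable m" "density m g = a" by blast
 note [measurable] = g(1)[simplified]
 have "(\<integral>\<^sup>+x. g x \<partial>m) = emeasure a UNIV" using g by (auto simp: emeasure_density)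
 hence gi: "(\<integral>\<^sup>+x. g x \<partial>m) ~= top" by (simp add: a.emeasure_eq_measure)
 hence ga: "AE x in m. ennreal (enn2real (g x)) = g x"
  using nn_integral_PInf_AE[OF g(1)] by (auto elim!: eventually_mono simp: less_top)
 define h where "h x = complex_of_real (enn2real (g x))" for x
 have "(\<integral>\<^sup>+x. ennreal (enn2real (g x)) \<partial>m) = (\<integral>\<^sup>+x. g x \<partial>m)" by (rule nn_integral_cong_AE[OF ga])
 hence "integrable m (%x. enn2real (g x))"
  using gi by (intro integrableI_nonneg) (auto simp: less_top)
 hence "h : Lp_space 1 m" by (simp add: Lp_space_one h_def[abs_def])
 moreover have "avg a u s = (LINT y|m. h y * u (s + y))" if u: "u : borel_measurable borel" for u s
 proof -
  have "a = density m (%x. ennreal (enn2real (g x)))"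
   unfolding g(2)[symmetric] by (rule density_cong) (use ga in \<open>auto elim!: eventually_mono\<close>)
  hence "avg a u s = (LINT y|m. enn2real (g y) *\<^sub>R u (s + y))"
   unfolding avg_def using avg_integrand_measurable[OF u, of s] by (subst integral_density[symmetric]) auto
  thus ?thesis by (simp add: h_def scaleR_conv_of_real)
 qed
 ultimately show ?thesis by blast
qed

section \<open>Mean ergodicity on a compact group\<close>

text \<open>One lifting serves L^1 and L^\<infinity>. Representatives of bounded functions then
  agree in both spaces, and the carrier for L^\<infinity> is a subset of that for L^1.\<close>

locale compact_haar = haar m for m :: "'a::{topological_ab_group_add, t2_space} measure" +
 fixes \<pi> :: "('a => complex) => 'a => complex"
 assumes compact: "compact (UNIV :: 'a set)" and lifting: "Lp_lifting m 1 \<pi>"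
begin

lemma finite_m: "emeasure m UNIV < top"
 using finite_compact[OF compact] by simp

sublocale L1: haar_pairing m 1 \<pi> top
 using lifting finite_m by (intro haar_pairing.intro haar_Lp.intro haar_axioms haar_pairing_axioms.intro) (auto simp: conjugate_exponents_def)

sublocale Li: haar_pairing m top \<pi> 1
 using lifting finite_m
 by (intro haar_pairing.intro haar_Lp.intro haar_axioms haar_pairing_axioms.intro) (auto simp: conjugate_exponents_def Lp_lifting_def)

lemma Li_X_bounded: "f : Li.X ==> f : bounded_integrable m"
 using bounded_integrable_finite_measure[OF Li.X_Lp] finite_m by simp

lemma Li_X_L1: "f : Li.X ==> f : L1.X"
 using Li_X_bounded Li.\<pi>_id by (auto simp: L1.X_def bounded_integrable_def)

lemma D_eq: "L1.D = Li.X" "Li.D = Li.X"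
 using Li_X_bounded Li_X_L1 by (auto simp: L1.D_def Li.D_def bounded_integrable_def L1.X_def Li.X_def)

lemma L1_norm_le:
 assumes "f : Li.X" shows "Lp_norm 1 m f <= measure m UNIV * Lp_norm top m f"
proof -
 interpret finite_measure m by (rule finite_measureI) (use finite_m in simp)
 have "integrable m (%x. norm (f x))" using L1.X_Lp[OF Li_X_L1[OF assms]] by (simp add: Lp_space_one)
 hence "Lp_norm 1 m f <= (LINT x|m. Lp_norm top m f)"
  unfolding Lp_norm_one using Lp_norm_inf_AE[OF Li.X_Lp[OF assms]] by (intro integral_mono_AE) auto
 thus ?thesis by simp
qed

text \<open>On the common domain D, which is all of L^\<infinity>, symmetry carries an operator
  bound from either exponent to the other; density of D then extends it to L^1.\<close>

lemma symmetric_bound_iff: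
 assumes "L1.symmetric_op W" "Li.symmetric_op W" "0 <= e"
 shows "(ALL x:L1.X. Lp_norm 1 m (W x) <= e * Lp_norm 1 m x) \<longleftrightarrow> (ALL x:Li.X. Lp_norm top m (W x) <= e * Lp_norm top m x)"
proof
 have b: "L1.bop W" "Li.bop W" using assms by (simp_all add: L1.symmetric_op_def Li.symmetric_op_def)
 show "ALL x:Li.X. Lp_norm top m (W x) <= e * Lp_norm top m x" if "ALL x:L1.X. Lp_norm 1 m (W x) <= e * Lp_norm 1 m x"
  using L1.symmetric_op_E(2)[OF assms(1), of e] L1.bop_lin[OF b(1)] assms(3) that by (simp add: L1.bounded_by_def D_eq)
 assume "ALL x:Li.X. Lp_norm top m (W x) <= e * Lp_norm top m x"
 hence "Lp_norm 1 m (W x) <= e * Lp_norm 1 m x" if "x : Li.X" for x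
  using Li.symmetric_op_E(2)[OF assms(2), of e] Li.bop_lin[OF b(2)] assms(3) that by (simp add: Li.bounded_by_def D_eq)
 thus "ALL x:L1.X. Lp_norm 1 m (W x) <= e * Lp_norm 1 m x"
  using L1.bounded_on_dense[OF b(1) assms(3)] by (simp add: D_eq)
qed

text \<open>Elements of L^\<infinity> have means that converge even in the stronger norm; they are
  dense in L^1, where the means are contractions.\<close>

lemma ces_cauchy_L1:
 assumes b: "finite_radon b" and T: "measure b UNIV <= 1"
  and me: "!!x. x : Li.X ==> EX l. Li.tends (%n. Li.ces (Li.A b) n x) l"
  and h: "h : L1.X" and e: "0 < e"
 shows "EX M. ALL i>=M. ALL j>=M. Lp_norm 1 m (L1.ces (L1.A b) i h - L1.ces (L1.A b) j h) <= e"
proof -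
 let ?c = "L1.ces (L1.A b)"
 have bT: "L1.bounded_by (L1.A b) 1" by (rule L1.bounded_by_mono[OF L1.bounded_by_A[OF b] T])
 note bop = L1.bounded_by_bop[OF bT]
 have cX: "?c n x : L1.X" if "x : L1.X" for n x by (rule L1.bopX[OF L1.bop_ces[OF bop] that])
 have cX': "?c n x : Li.X" if "x : Li.X" for n x by (rule Li.bopX[OF Li.bop_ces[OF Li.bop_A[OF b]] that])
 obtain v where v: "v : Li.X" "Lp_norm 1 m (h - v) < e / 3" using L1.D_dense[OF h, of "e / 3"] e by (auto simp: D_eq)
 note v1 = Li_X_L1[OF v(1)]
 obtain l where l: "Li.tends (%n. ?c n v) l" using me[OF v(1)] by blast
 \<comment> \<open>Two errors d, multiplied by the total mass, stay below e/3.\<close>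
 define d where "d = e / (6 * (measure m UNIV + 1))"
 have d: "d > 0" using e by (simp add: d_def add_nonneg_pos)
 have lim: "(%n. Lp_norm top m (?c n v - l)) \<longlonglongrightarrow> 0" using l by (simp add: Li.tends_def)
 obtain M where M: "!!n. n >= M ==> Lp_norm top m (?c n v - l) < d"
  using order_tendstoD(2)[OF lim d] unfolding eventually_sequentially by blast
 have "Lp_norm 1 m (?c i h - ?c j h) <= e" if "i >= M" "j >= M" for i j
 proof -
  have lX: "l : Li.X" using l by (rule Li.tends_X)
  have hX: "h - v : L1.X" using h v1 by (rule L1.X_closed)
  have "Lp_norm top m (?c i v - ?c j v) <= 2 * d"
   using Li.N_diff_triangle[OF cX'[OF v(1), of i] lX cX'[OF v(1), of j]] M[OF that(1)] M[OF that(2)]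
    Li.N_diff_commute[OF lX cX'[OF v(1), of j]] by linarith
  hence "Lp_norm 1 m (?c i v - ?c j v) <= measure m UNIV * (2 * d)"
   using L1_norm_le[OF Li.X_closed(3)[OF cX'[OF v(1)] cX'[OF v(1)]], of i j] by (meson measure_nonneg mult_left_mono order_trans)
  also have "... <= (measure m UNIV + 1) * (2 * d)" using d by simp
  also have "... = e / 3" using add_nonneg_pos[OF measure_nonneg[of m UNIV] zero_less_one] by (simp add: d_def divide_simps)
  finally have 1: "Lp_norm 1 m (?c i v - ?c j v) <= e / 3" .
  have 2: "Lp_norm 1 m (?c n (h - v)) <= e / 3" for n
   using L1.ces_le[OF bT hX, of n] v(2) by simp
  have eq: "?c i h - ?c j h = (?c i v - ?c j v) + (?c i (h - v) - ?c j (h - v))"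
   using L1.lin_diff[OF L1.bop_lin[OF L1.bop_ces[OF bop]] h v1] by simp
  show ?thesis
   unfolding eq using L1.N_triangle[OF L1.X_closed(3)[OF cX[OF v1] cX[OF v1]] L1.X_closed(3)[OF cX[OF hX] cX[OF hX]], of i j i j]
    L1.N_diff_le[OF cX[OF hX] cX[OF hX], of i j] 1 2[of i] 2[of j] by linarith
 qed
 thus ?thesis by blast
qed

text \<open>Averages commute with translations. The lifting appears because a translate of a
  representative need not be a representative.\<close>

lemma ces_translate:
 assumes b: "finite_radon b" and x: "x : Li.X"
 shows "AE y in m. Li.ces (Li.A b) n x (y + s) = Li.ces (Li.A b) n (\<pi> (%y. x (y + s))) y"
proof -
 have pow: "(avg b ^^ k) (%y. f (y + s)) y = (avg b ^^ k) f (y + s)" for k f y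
 proof (induction k arbitrary: y)
  case (Suc k)
  thus ?case by (simp add: avg_def algebra_simps)
 qed simp
 note rep = Li.represents_cesaro[OF Li.represents_A[OF b] Li.bop_A[OF b], of n]
 have r: "cesaro_mean (avg b) n f : borel_measurable borel" "AE y in m. cesaro_mean (avg b) n f y = Li.ces (Li.A b) n (\<pi> f) y"
  if "f : Lp_space top m" for f
  using rep that by (auto simp: Li.represents_def)
 note xL = Li.X_Lp[OF x] and xs = Lp_shift(1)[OF Li.p Li.X_Lp[OF x], of s]
 have m: "Li.ces (Li.A b) n x : borel_measurable borel"
  by (rule Li.X_measurable[OF Li.bopX[OF Li.bop_ces[OF Li.bop_A[OF b]] x]])
 have "AE y in m. cesaro_mean (avg b) n x (y + s) = Li.ces (Li.A b) n x (y + s)"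
  by (rule AE_shift) (use r[OF xL] m Li.\<pi>_id[OF x] in \<open>simp_all, measurable\<close>)
 moreover have "cesaro_mean (avg b) n (%y. x (y + s)) y = cesaro_mean (avg b) n x (y + s)" for y
  by (simp add: cesaro_mean_def pow)
 ultimately show ?thesis using r(2)[OF xs] by (auto elim!: eventually_elim2)
qed
text \<open>Symmetry moves the difference of means from x to the density h, and commutation with
  translations removes s. Hence convergence at the single element \<open>\<pi> (%y. h (- y))\<close>
  of L^1 controls all x and all s at once.\<close>

lemma avg_ces_bound:
 assumes b: "finite_radon b" and h: "h : Lp_space 1 m" and x: "x : Li.X"
 shows "norm (LINT y|m. h y * (Li.ces (Li.A b) i x - Li.ces (Li.A b) j x) (s + y))
  <= Lp_norm 1 m (L1.ces (L1.A b) i (\<pi> (%y. h (- y))) - L1.ces (L1.A b) j (\<pi> (%y. h (- y)))) * Lp_norm top m x"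
proof -
 define W where "W x = L1.ces (L1.A b) i x - L1.ces (L1.A b) j x" for x
 define g where "g = \<pi> (%y. x (y + s))"
 define h' where "h' = \<pi> (%y. h (- y))"
 have W: "L1.symmetric_op W" unfolding W_def[abs_def] by (rule L1.symmetric_op_ces_diff[OF L1.symmetric_A[OF b]])
 hence bW: "L1.bop W" by (simp add: L1.symmetric_op_def)
 have WX: "W u : Li.X" if "u : Li.X" for u
  unfolding W_def by (intro Li.X_closed(3) Li.bopX[OF Li.bop_ces[OF Li.bop_A[OF b]]] that)
 note xs = Lp_shift[OF Li.p Li.X_Lp[OF x], of s]
 have g: "g : Li.X" "Lp_norm top m g <= Lp_norm top m x"
  unfolding g_def using Li.\<pi>_X[OF xs(1)] Li.\<pi>_Lp(2)[OF xs(1)] xs(2) by auto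
 have hu: "(%y. h (- y)) : Lp_space 1 m" by (rule Lp_uminus(1)[OF _ h]) simp
 have h': "h' : L1.X" unfolding h'_def by (rule L1.\<pi>_X[OF hu])
 have m: "h : borel_measurable borel" "(%y. h (- y)) : borel_measurable borel" "W g : borel_measurable borel" "W x : borel_measurable borel"
  using Lp_measurable[OF h] Lp_measurable[OF hu] Li.X_measurable[OF WX[OF g(1)]] Li.X_measurable[OF WX[OF x]] by auto
 have "AE y in m. W x (y + s) = W g y"
  using ces_translate[OF b x, of i s] ces_translate[OF b x, of j s]
  unfolding W_def g_def by eventually_elim simp
 hence "(LINT y|m. h y * W x (s + y)) = (LINT y|m. h y * W g y)"
  using m measurable_compose[OF shift_measurable(2) m(4), of s]
  by (intro integral_cong_AE) (auto elim!: eventually_mono simp: add.commute)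
 also have "... = L1.B (%y. h (- y)) (W g)"
 proof -
  have "(%y. h y * W g y) : borel_measurable borel" using m by (intro borel_measurable_times)
  from integral_uminus[OF this] show ?thesis by (simp add: L1.B_def)
 qed
 also have "... = L1.B h' (W g)" unfolding h'_def by (rule L1.B_\<pi>(2)[OF m(2,3), symmetric])
 also have "... = L1.B (W h') g"
  using L1.symmetric_op_extend[OF W h', of g] g(1) by (simp add: D_eq)
 finally have "norm (LINT y|m. h y * W x (s + y)) <= Lp_norm 1 m (W h') * Lp_norm top m g"
  using L1.B_le[OF L1.bopX[OF bW h'] L1.D_E, of g] g(1) by (simp add: D_eq)
 also have "... <= Lp_norm 1 m (W h') * Lp_norm top m x" using g(2) Lp_norm_nonneg by (rule mult_left_mono)
 finally show ?thesis by (simp add: W_def h'_def)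
qed

text \<open>Lebesgue decomposition of a convolution power: the singular part has mass below 1, and
  \<open>avg_ces_bound\<close> controls the part with a density. These are the two terms that
  \<open>ces_cauchy_of_split\<close> asks for.\<close>

lemma ces_cauchy_nonsingular:
 assumes b: "finite_radon b" and T: "measure b UNIV <= 1"
  and me: "!!x. x : Li.X ==> EX l. Li.tends (%n. Li.ces (Li.A b) n x) l"
  and sing: "!!N. N : sets borel ==> emeasure m N = 0 ==> measure (conv_pow b k) N < 1" and e: "0 < e"
 shows "EX M. ALL i>=M. ALL j>=M. ALL x:Li.X. Lp_norm top m (Li.ces (Li.A b) i x - Li.ces (Li.A b) j x) <= e * Lp_norm top m x"
proof -
 define c where "c = conv_pow b k"
 have c: "finite_radon c" unfolding c_def by (rule conv_pow_radon(1)[OF b])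
 interpret c: finite_measure c by (rule finite_radonD(5)[OF c])
 note [simp] = finite_radonD(3,4)[OF c]
 define Z where "Z = {N : sets borel. emeasure m N = 0}"
 have bdd: "bdd_above (measure c ` Z)" by (intro bdd_aboveI[of _ "measure c UNIV"]) (use c.finite_measure_mono in auto)
 have "Z ~= {}" by (auto simp: Z_def)
 have "EX N:Z. (SUP N\<in>Z. measure c N) - 1 / Suc n < measure c N" for n
  using less_cSUP_iff[OF \<open>Z ~= {}\<close> bdd, of "(SUP N\<in>Z. measure c N) - 1 / Suc n"] by simp
 then obtain Ns where Ns: "!!n. Ns n : Z" "!!n. (SUP N\<in>Z. measure c N) - 1 / Suc n < measure c (Ns n)" by metis
 \<comment> \<open>A countable union of null sets is null, so the supremum of their masses is
   attained here.\<close>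
 define N where "N = (\<Union>n. Ns n)"
 have N: "N : Z" using Ns(1) unfolding N_def Z_def by (auto intro!: emeasure_UN_eq_0)
 hence Ns': "N : sets borel" by (simp add: Z_def)
 have max: "measure c N' <= measure c N" if "N' : Z" for N'
 proof (rule field_le_epsilon)
  fix d :: real assume "d > 0"
  then obtain n where n: "1 / Suc n < d" using reals_Archimedean[of d] by (auto simp: inverse_eq_divide)
  have "measure c N' <= (SUP N\<in>Z. measure c N)" by (rule cSUP_upper[OF that bdd])
  also have "... <= measure c (Ns n) + d" using Ns(2)[of n] n by simp
  also have "measure c (Ns n) <= measure c N" using Ns' by (intro c.finite_measure_mono) (auto simp: N_def)
  finally show "measure c N' <= measure c N + d" by simp
 qed
 define a where "a = density c (%x. ennreal (indicator (- N) x))"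
 define \<sigma> where "\<sigma> = density c (%x. ennreal (indicator N x))"
 have a: "finite_radon a" and \<sigma>: "finite_radon \<sigma>"
  unfolding a_def \<sigma>_def using Ns' by (auto intro!: finite_radon_restrict(1)[OF c])
 \<comment> \<open>A null set charged by a could be added to N, against maximality.\<close>
 have "emeasure a N' = 0" if "N' : null_sets m" for N'
 proof -
  have "N \<union> N' : Z" using null_sets.Un[of N m N'] that N by (simp add: Z_def null_sets_def)
  hence "measure c (N \<union> N') <= measure c N" by (rule max)
  moreover have "measure c (N \<union> N') = measure c N + measure c (N' - N)"
   using that Ns' c.finite_measure_Union[of N "N' - N"] by (auto simp: null_sets_def)
  ultimately have "measure c (- N \<inter> N') = 0" using measure_nonneg[of c "N' - N"] by (simp add: Diff_eq Int_commute antisym)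
  thus ?thesis
   using finite_radon_restrict(2)[OF c, of "- N" N'] Ns' that by (simp add: a_def c.emeasure_eq_measure null_sets_def)
 qed
 hence "absolutely_continuous m a"
  using finite_radonD(3)[OF a] by (auto simp: absolutely_continuous_def null_sets_def)
 then obtain h where h: "h : Lp_space 1 m" "!!u s. u : borel_measurable borel ==> avg a u s = (LINT y|m. h y * u (s + y))"
  using avg_density_integral[OF finite_m a] by blast
 define h' where "h' = \<pi> (%y. h (- y))"
 have h': "h' : L1.X" unfolding h'_def by (intro L1.\<pi>_X Lp_uminus(1)[OF _ h(1)]) simp
 have bT: "Li.bounded_by (Li.A b) 1" by (rule Li.bounded_by_mono[OF Li.bounded_by_A[OF b] T])
 have "measure \<sigma> UNIV = measure c N"
  using finite_radon_restrict(2)[OF c, of N UNIV] Ns' by (simp add: \<sigma>_def measure_def)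
 hence q: "measure \<sigma> UNIV < 1" using sing N by (simp add: Z_def c_def)
 have split: "(Li.A b ^^ Suc k) x = Li.A a x + Li.A \<sigma> x" if x: "x : Li.X" for x
 proof -
  note xm = Li.X_measurable[OF x]
  have "AE s in m. avg c x s = avg a x s + avg \<sigma> x s"
   using avg_integrable_AE[OF c Li.p finite_m Li.X_Lp[OF x]]
  proof eventually_elim
   case (elim s)
   from avg_restrict[OF c Ns' elim] show ?case by (simp add: a_def \<sigma>_def)
  qed
  hence "\<pi> (avg c x) = \<pi> (%s. avg a x s + avg \<sigma> x s)"
   using avg_measurable[OF c xm] avg_measurable[OF a xm] avg_measurable[OF \<sigma> xm]
   by (intro Li.\<pi>_eqI) (auto intro: borel_measurable_add)
  thus ?thesis unfolding Li.A_funpow[OF b x] c_def[symmetric] by (simp add: Li.A_def Li.\<pi>_add plus_fun_def)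
 qed
 show ?thesis
 proof (rule Li.ces_cauchy_of_split[OF bT Li.bounded_by_A[OF \<sigma>] q split Li.A_X[OF a] _ e])
  fix d :: real assume d: "0 < d"
  obtain M where M: "ALL i>=M. ALL j>=M. Lp_norm 1 m (L1.ces (L1.A b) i h' - L1.ces (L1.A b) j h') <= d"
   using ces_cauchy_L1[OF b T me h' d] by blast
  have "Lp_norm top m (Li.A a (Li.ces (Li.A b) i x - Li.ces (Li.A b) j x)) <= d * Lp_norm top m x"
   if ij: "i >= M" "j >= M" and x: "x : Li.X" for i j x
  proof -
   define u where "u = Li.ces (Li.A b) i x - Li.ces (Li.A b) j x"
   have u: "u : Li.X" unfolding u_def by (intro Li.X_closed(3) Li.bopX[OF Li.bop_ces[OF Li.bop_A[OF b]]] x)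
   note um = Li.X_measurable[OF u]
   \<comment> \<open>Because a has a density this holds at every s, with the same constant.\<close>
   have "norm (avg a u s) <= Lp_norm 1 m (L1.ces (L1.A b) i h' - L1.ces (L1.A b) j h') * Lp_norm top m x" for s
    unfolding h(2)[OF um] unfolding u_def h'_def by (rule avg_ces_bound[OF b h(1) x])
   also have "... <= d * Lp_norm top m x" using M ij by (intro mult_right_mono Lp_norm_nonneg) auto
   finally have "Lp_norm top m (avg a u) <= d * Lp_norm top m x"
    using avg_measurable[OF a um] d Lp_norm_nonneg[of top m x] by (intro Lp_norm_inf_le) auto
   thus ?thesis
    using Li.\<pi>_Lp(2)[OF avg_Lp(1)[OF a Li.p Li.finp Li.X_Lp[OF u]]] by (simp add: Li.A_def u_def)
  qed
  thus "EX M. ALL i>=M. ALL j>=M. ALL x:Li.X. Lp_norm top m (Li.A a (Li.ces (Li.A b) i x - Li.ces (Li.A b) j x)) <= d * Lp_norm top m x"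
   by blast
 qed
qed

lemma tends_AE_bound:
 assumes t: "L1.tends s l" and C: "0 <= C" "!!n. AE x in m. norm (s n x) <= C" shows "AE x in m. norm (l x) <= C"
 using L1_limit_bound[of s m l, OF L1.X_Lp L1.X_Lp _ C] t by (simp add: L1.tends_def fun_diff_def)

lemma unit_ball_Li: "f : L1.X ==> AE x in m. norm (f x) <= 1 ==> f : Li.X"
 using L1.X_measurable[of f] L1.\<pi>_id[of f] by (auto simp: Li.X_def Lp_space_inf intro!: exI[of _ 1])

text \<open>
  By Baire's theorem in the unit ball of \<open>L\<^sup>\<infinity>\<close> with the metric of \<open>L\<^sup>1\<close>, the means are uniformly
  Cauchy on functions supported in a set of small measure.
\<close>

lemma ces_small_support:
 assumes b: "finite_radon b"
  and me: "!!x. x : Li.X ==> EX l. Li.tends (%n. Li.ces (Li.A b) n x) l" and d: "0 < d"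
 shows "EX n r. 0 < r & (ALL U:sets borel. measure m U < r --> (ALL k>=n. ALL l>=n. ALL g:Li.X. (AE x in m. norm (g x) <= 1) -->
  (AE x in m. norm ((Li.ces (Li.A b) k (\<pi> (%x. indicator U x * g x)) - Li.ces (Li.A b) l (\<pi> (%x. indicator U x * g x))) x) <= 2 * d)))"
proof -
 let ?c = "L1.ces (L1.A b)"
 note bc = L1.bop_ces[OF L1.bop_A[OF b]]
 define Y where "Y = {f : L1.X. AE x in m. norm (f x) <= 1}"
 \<comment> \<open>These sets are closed in L^1 because bounds survive L^1 limits, and they cover Y
   by mean ergodicity on L^\<infinity>.\<close>
 define F where "F n = {f : Y. ALL k>=n. ALL l>=n. AE x in m. norm ((?c k f - ?c l f) x) <= d}" for n
 have Yc: "l : Y" if "!!n. s n : Y" "L1.tends s l" for s l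
  using tends_AE_bound[OF that(2), of 1] that(1) L1.tends_X(2)[OF that(2)] by (auto simp: Y_def)
 have Fc: "l : F n" if s: "!!i. s i : F n" "L1.tends s l" for n s l
 proof -
  have "l : Y" by (rule Yc[OF _ s(2)]) (use s(1) in \<open>simp add: F_def\<close>)
  moreover have "AE x in m. norm ((?c k l - ?c j l) x) <= d" if "k >= n" "j >= n" for k j
   by (rule tends_AE_bound[OF L1.tends_diff[OF L1.tends_bop[OF bc s(2)] L1.tends_bop[OF bc s(2)]]])
     (use s(1) that d in \<open>auto simp: F_def\<close>)
  ultimately show ?thesis by (simp add: F_def)
 qed
 have cover: "Y \<subseteq> (\<Union>n. F n)"
 proof
  fix f assume f: "f : Y"
  hence fX: "f : Li.X" using unit_ball_Li by (simp add: Y_def)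
  then obtain l where l: "Li.tends (%n. ?c n f) l" using me by blast
  hence lim: "(%n. Lp_norm top m (?c n f - l)) \<longlonglongrightarrow> 0" by (simp add: Li.tends_def)
  have "d / 2 > 0" using d by simp
  then obtain M where M: "!!n. n >= M ==> Lp_norm top m (?c n f - l) < d / 2"
   using order_tendstoD(2)[OF lim] unfolding eventually_sequentially by blast
  have cX: "?c n f : Li.X" "l : Li.X" for n using Li.tends_X[OF l] by auto
  have "AE x in m. norm ((?c k f - ?c j f) x) <= d" if "k >= M" "j >= M" for k j
  proof -
   have "Lp_norm top m (?c k f - ?c j f) <= d"
    using Li.N_diff_triangle[OF cX(1,2) cX(1), of k j] M[OF that(1)] M[OF that(2)] Li.N_diff_commute[OF cX(2,1), of j] by linarith
   thus ?thesis
    using Lp_norm_inf_AE[OF Li.X_Lp[OF Li.X_closed(3)[OF cX(1) cX(1)]], of k j] by (auto elim!: eventually_mono)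
  qed
  thus "f : (\<Union>n. F n)" using f by (auto simp: F_def)
 qed
 have Y: "Y \<subseteq> L1.X" "F n \<subseteq> Y" "0 : Y" for n by (auto simp: Y_def F_def)
 hence "Y ~= {}" by blast
 from L1.Baire_ball[OF Y(1) this Yc Y(2) Fc cover]
 have "EX n f r. 0 < r & f : F n & (ALL g:Y. Lp_norm 1 m (g - f) < r --> g : F n)" .
 then obtain n f r where r: "0 < r" "f : F n" "!!g. g : Y ==> Lp_norm 1 m (g - f) < r ==> g : F n" by blast
 have f: "f : L1.X" "AE x in m. norm (f x) <= 1" using r(2) by (auto simp: F_def Y_def)
 note fm [measurable] = L1.X_measurable[OF f(1)]
 interpret finite_measure m by (rule finite_measureI) (use finite_m in simp)
 have "AE x in m. norm ((?c k (\<pi> (%x. indicator U x * g x)) - ?c l (\<pi> (%x. indicator U x * g x))) x) <= 2 * d"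
  if U: "U : sets borel" "measure m U < r / 2" and kl: "k >= n" "l >= n" and g: "g : Li.X" "AE x in m. norm (g x) <= 1" for U k l g
 proof -
  \<comment> \<open>v on U and f elsewhere stays in the L^1 ball around f when U is small. The
    indicator of U times g is the difference of the choices v = g and v = 0, hence the factor 2 in
    the final bound.\<close>
  define q where "q v = (%x. if x : U then v x else f x)" for v
  have q: "q v : Lp_space 1 m" "\<pi> (q v) : F n" if v: "v : borel_measurable borel" "AE x in m. norm (v x) <= 1" for v
  proof -
   note [measurable] = v(1) U(1)
   have qm: "q v : borel_measurable borel" unfolding q_def by measurable
   have q1: "AE x in m. norm (q v x) <= 1" using v(2) f(2) by eventually_elim (simp add: q_def)
   have "q v : Lp_space top m" using qm q1 by (auto simp: Lp_space_inf intro!: exI[of _ 1])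
   thus ql: "q v : Lp_space 1 m"
    using bounded_integrable_finite_measure[of "q v" m] finite_m by (simp add: bounded_integrable_def)
   have "AE x in m. norm (\<pi> (q v) x) <= 1" using L1.\<pi>_AE[of "q v"] q1 by eventually_elim simp
   hence "\<pi> (q v) : Y" using L1.\<pi>_X[OF ql] by (simp add: Y_def)
   moreover have "Lp_norm 1 m (\<pi> (q v) - f) < r"
   proof -
    have "\<pi> (q v) - f = \<pi> (%x. q v x - f x)" unfolding L1.\<pi>_minus L1.\<pi>_id[OF f(1)] by (simp add: fun_diff_def)
    hence "Lp_norm 1 m (\<pi> (q v) - f) = (LINT x|m. norm (q v x - f x))"
     using L1.\<pi>_Lp(2)[OF Lp_diff[OF L1.p ql L1.X_Lp[OF f(1)]]] by (simp add: Lp_norm_one)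
    also have "... <= (LINT x|m. 2 * indicator U x)"
    proof (rule integral_mono_AE)
     show "integrable m (%x. norm (q v x - f x))" using Lp_diff[OF L1.p ql L1.X_Lp[OF f(1)]] by (simp add: Lp_space_one)
     show "integrable m (%x. 2 * indicator U x :: real)" using U by (intro integrable_mult_right integrable_real_indicator) (auto simp: emeasure_eq_measure)
     show "AE x in m. norm (q v x - f x) <= 2 * indicator U x"
      using v(2) f(2)
     proof eventually_elim
      case (elim x)
      thus ?case using norm_triangle_ineq4[of "v x" "f x"] by (simp add: q_def)
     qed
    qed
    also have "... = 2 * measure m U" using U by simp
    finally show ?thesis using U(2) by simp
   qed
   ultimately show "\<pi> (q v) : F n" by (rule r(3))
  qed
  note gm = Li.X_measurable[OF g(1)]
  have q0: "q (%x. 0) : Lp_space 1 m" "\<pi> (q (%x. 0)) : F n" using q[of "%x. 0"] by auto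
  have "(%x. indicator U x * g x) = (%x. q g x - q (%x. 0) x)" by (auto simp: q_def split: split_indicator)
  hence eq: "\<pi> (%x. indicator U x * g x) = \<pi> (q g) - \<pi> (q (%x. 0))" by (simp add: L1.\<pi>_minus fun_diff_def)
  have ceq: "?c k (\<pi> (%x. indicator U x * g x)) = ?c k (\<pi> (q g)) - ?c k (\<pi> (q (%x. 0)))" for k
   unfolding eq by (rule L1.lin_diff[OF L1.bop_lin[OF bc] L1.\<pi>_X[OF q(1)[OF gm g(2)]] L1.\<pi>_X[OF q0(1)]])
  have "AE x in m. norm ((?c k (\<pi> (q g)) - ?c l (\<pi> (q g))) x) <= d" "AE x in m. norm ((?c k (\<pi> (q (%x. 0))) - ?c l (\<pi> (q (%x. 0)))) x) <= d"
   using q(2)[OF gm g(2)] q0(2) kl by (simp_all add: F_def)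
  thus ?thesis
   unfolding ceq
  proof eventually_elim
   case (elim x)
   thus ?case
    using norm_triangle_ineq4[of "(?c k (\<pi> (q g)) - ?c l (\<pi> (q g))) x" "(?c k (\<pi> (q (%x. 0))) - ?c l (\<pi> (q (%x. 0)))) x"]
    by (simp add: algebra_simps)
  qed
 qed
 thus ?thesis using r(1) by (intro exI[of _ n] exI[of _ "r / 2"]) auto
qed

text \<open>At s = 0 the averages do not see a function that vanishes on U, since each convolution
  power has mass at least 1 on U and at most 1 in all. Lower semicontinuity of the mass of
  translates of U extends this, up to d, to a neighbourhood of 0 for finitely many powers.\<close>

lemma ces_near_0:
 assumes b: "finite_radon b" and T: "measure b UNIV <= 1" and U: "open U" "!!k. 1 <= measure (conv_pow b k) U" and d: "0 < d" "d < 1"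
 shows "EX W. open W & 0 : W & (ALL n<=K. ALL g:Li.X. (AE x in m. norm (g x) <= 1) -->
  (AE s in m. s : W --> norm (Li.ces (Li.A b) n (\<pi> (%x. indicator (- U) x * g x)) s) <= d))"
proof -
 define c where "c = conv_pow b"
 have c: "finite_radon (c k)" for k unfolding c_def by (rule conv_pow_radon(1)[OF b])
 have fin: "finite_measure (c k)" for k by (rule finite_radonD(5)[OF c])
 note [simp] = finite_radonD(3,4)[OF c]
 have mass: "measure (c k) UNIV <= 1" for k
 proof -
  have "emeasure (c k) UNIV = ennreal (measure b UNIV ^ Suc k)"
   using conv_pow_radon(2)[OF b, of k] finite_radonD(5)[OF b] by (simp add: c_def finite_measure.emeasure_eq_measure ennreal_power ennreal_mult)
  thus ?thesis using T by (simp add: measure_def power_le_one mult_le_one)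
 qed
 define W where "W = (\<Inter>k<K. {s. ennreal (1 - d) < emeasure (c k) {y. s + y : U}})"
 have "open {s. ennreal (1 - d) < emeasure (c k) {y. s + y : U}}" for k
  using emeasure_slice_lsc[OF finite_radonD(1)[OF c], of "{(s, y). s + y : U}" "ennreal (1 - d)" k]
   open_vimage[OF U(1), of "%z. fst z + snd z"]
  by (simp add: vimage_def case_prod_beta' continuous_on_add continuous_on_fst continuous_on_snd continuous_on_id)
 hence Wo: "open W" unfolding W_def by (intro open_INT) auto
 have W0: "0 : W"
  using U(2) d by (auto simp: W_def c_def[symmetric] finite_measure.emeasure_eq_measure[OF fin] ennreal_less_iff intro: less_le_trans[of _ 1])
 have Us: "{y. s + y : U} : sets borel" for s
  using measurable_sets[OF shift_measurable(2), of U s] U(1) by (simp add: vimage_def)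
 have far: "measure (c k) {y. s + y \<notin> U} <= d" if "s : W" "k < K" for s k
 proof -
  have "ennreal (1 - d) < emeasure (c k) {y. s + y : U}" using that by (auto simp: W_def)
  hence "1 - d < measure (c k) {y. s + y : U}"
   using d by (simp add: finite_measure.emeasure_eq_measure[OF fin] ennreal_less_iff)
  moreover have "measure (c k) {y. s + y \<notin> U} = measure (c k) UNIV - measure (c k) {y. s + y : U}"
   using finite_measure.finite_measure_compl[OF fin, of "{y. s + y : U}" k] Us by (simp add: Compl_eq_Diff_UNIV[symmetric] Collect_neg_eq)
  ultimately show ?thesis using mass[of k] by linarith
 qed
 have "AE s in m. s : W --> norm (Li.ces (Li.A b) n (\<pi> (%x. indicator (- U) x * g x)) s) <= d"
  if n: "n <= K" and g: "g : Li.X" "AE x in m. norm (g x) <= 1" for n g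
 proof -
  note gm [measurable] = Li.X_measurable[OF g(1)]
  have [measurable]: "U : sets borel" using U(1) by simp
  \<comment> \<open>Averages over a singular measure see null sets, so the bound by the indicator of
    the complement is made to hold everywhere before averaging.\<close>
  define v where "v x = (if x : U \<or> norm (g x) > 1 then 0 else g x)" for x
  have vm [measurable]: "v : borel_measurable borel" unfolding v_def[abs_def] by measurable
  have v: "norm (v x) <= indicator (- U) x" for x by (auto simp: v_def split: split_indicator)
  have vL: "v : Lp_space top m" using v order_trans[OF v, of _ 1] by (auto simp: Lp_space_inf intro!: exI[of _ 1] split: split_indicator)
  have "AE x in m. indicator (- U) x * g x = v x" using g(2) by eventually_elim (auto simp: v_def split: split_indicator)
  hence eq: "\<pi> (%x. indicator (- U) x * g x) = \<pi> v" by (intro Li.\<pi>_eqI) (use U(1) in simp_all)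
  have le: "norm (avg (c k) v s) <= d" if "s : W" "k < K" for s k
  proof -
   have i: "integrable (c k) (%y. indicator {y. s + y \<notin> U} y :: real)"
    using Us[of s] finite_measure.emeasure_finite[OF fin] by (intro integrable_real_indicator) (auto simp: less_top Collect_neg_eq)
   have "norm (avg (c k) v s) <= (LINT y|c k. indicator {y. s + y \<notin> U} y)"
    unfolding avg_def
    by (rule order_trans[OF integral_norm_bound integral_mono'[OF i]]) (use v in \<open>auto split: split_indicator simp: indicator_def\<close>)
   also have "... <= d" using far[OF that] by simp
   finally show ?thesis .
  qed
  have "AE s in m. ALL k<K. (Li.A b ^^ Suc k) (\<pi> v) s = avg (c k) v s"
  proof (subst AE_all_countable, intro allI)
   fix k
   have "(Li.A b ^^ Suc k) (\<pi> v) = \<pi> (avg (c k) v)"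
    using Li.A_funpow[OF b Li.\<pi>_X[OF vL], of k] Li.represents_Lp(2)[OF Li.represents_A[OF c] Li.bop_A[OF c] vL, of k] by (simp add: c_def)
   thus "AE s in m. k < K --> (Li.A b ^^ Suc k) (\<pi> v) s = avg (c k) v s"
    using Li.\<pi>_AE[of "avg (c k) v"] by (auto elim!: eventually_mono)
  qed
  thus ?thesis
   unfolding eq
  proof eventually_elim
   case (elim s)
   show ?case
   proof
   assume s: "s : W"
   \<comment> \<open>The k-th power of the operator belongs to \<open>conv_pow b (k - 1)\<close>,
     hence the shifted index.\<close>
   have "norm ((Li.A b ^^ k) (\<pi> v) s) <= d" if "k : {1..n}" for k
    using elim(1)[rule_format, of "k - 1"] le[OF s, of "k - 1"] that n by (cases k) auto
   hence "norm (\<Sum>k=1..n. (Li.A b ^^ k) (\<pi> v) s) <= (\<Sum>k=1..n. d)" by (intro order_trans[OF norm_sum sum_mono])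
   hence "norm (\<Sum>k=1..n. (Li.A b ^^ k) (\<pi> v) s) / n <= d" using d by (cases "n = 0") (auto simp: divide_le_eq mult.commute)
   moreover have "(\<Sum>k\<in>I. (Li.A b ^^ k) (\<pi> v)) s = (\<Sum>k\<in>I. (Li.A b ^^ k) (\<pi> v) s)" for I
    by (induction I rule: infinite_finite_induct) simp_all
   ultimately show "norm (Li.ces (Li.A b) n (\<pi> v) s) <= d" by (simp add: Li.ces_def norm_mult norm_divide)
   qed
  qed
 qed
 thus ?thesis using Wo W0 by blast
qed

text \<open>g is split along a small open U around the null set. The part on U is uniformly
  controlled by \<open>ces_small_support\<close>, and the part off U is almost invisible near 0.
  Translations commute with the means and move the estimate near 0 around the compact group.\<close>

lemma ces_cauchy_singular:
 assumes b: "finite_radon b" and T: "measure b UNIV <= 1"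
  and me: "!!x. x : Li.X ==> EX l. Li.tends (%n. Li.ces (Li.A b) n x) l"
  and N: "N : sets borel" "emeasure m N = 0" "!!k. 1 <= measure (conv_pow b k) N" and e: "0 < e"
 shows "EX M. ALL i>=M. ALL j>=M. ALL x:Li.X. Lp_norm top m (Li.ces (Li.A b) i x - Li.ces (Li.A b) j x) <= e * Lp_norm top m x"
proof -
 let ?c = "Li.ces (Li.A b)"
 \<comment> \<open>The part on U contributes 2 d and each of the two means of the other part
   contributes d; the bound 1/2 ensures d < 1.\<close>
 define d where "d = min (e / 4) (1 / 2)"
 have d: "0 < d" "d < 1" "4 * d <= e" using e by (auto simp: d_def)
 note bc = Li.bop_ces[OF Li.bop_A[OF b]]
 obtain n r where r: "0 < r" "!!U k l g. U : sets borel ==> measure m U < r ==> k >= n ==> l >= n ==> g : Li.X ==> AE x in m. norm (g x) <= 1 ==>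
   AE x in m. norm ((?c k (\<pi> (%x. indicator U x * g x)) - ?c l (\<pi> (%x. indicator U x * g x))) x) <= 2 * d"
  using ces_small_support[OF b me d(1)] by blast
 obtain U where U: "open U" "N \<subseteq> U" "emeasure m U < ennreal r" using open_outer[OF N(1), of "ennreal r"] N(2) r(1) by auto
 have Us [measurable]: "U : sets borel" using U(1) by simp
 have Ur: "measure m U < r" using U(3) less_trans[OF U(3) ennreal_less_top] by (simp add: emeasure_eq_ennreal_measure ennreal_less_iff)
 have UN: "1 <= measure (conv_pow b k) U" for k
 proof -
  note R = finite_radonD[OF conv_pow_radon(1)[OF b], of k]
  show ?thesis using N(3)[of k] finite_measure.finite_measure_mono[OF R(5) U(2)] Us R(3) by (auto intro: order_trans)
 qed
 have "Lp_norm top m (?c k g - ?c l g) <= e * Lp_norm top m g" if kl: "k >= n" "l >= n" and g: "g : Li.X" for k l g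
 proof (rule Li.bounded_on_unit_ball[OF Li.bop_lin[OF Li.bop_diff[OF bc bc]] _ g])
  \<comment> \<open>W may depend on k and l, as only the powers in these two means occur; the
    threshold n was fixed before.\<close>
  obtain W where W: "open W" "0 : W" "!!i g. i <= max k l ==> g : Li.X ==> AE x in m. norm (g x) <= 1 ==>
    AE s in m. s : W --> norm (?c i (\<pi> (%x. indicator (- U) x * g x)) s) <= d"
   using ces_near_0[OF b T U(1) UN d(1,2), of "max k l"] by blast
  have near: "AE s in m. s : W --> norm ((?c k g - ?c l g) s) <= 4 * d" if g: "g : Li.X" "AE x in m. norm (g x) <= 1" for g
  proof -
   note [measurable] = Li.X_measurable[OF g(1)]
   have L: "(%x. indicator V x * g x) : Lp_space top m" if [measurable]: "V : sets borel" for V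
    using g(2) by (auto simp: Lp_space_inf norm_mult intro!: exI[of _ 1] elim!: eventually_mono split: split_indicator)
   define u where "u = \<pi> (%x. indicator U x * g x)"
   define w where "w = \<pi> (%x. indicator (- U) x * g x)"
   have uw: "u : Li.X" "w : Li.X" unfolding u_def w_def by (intro Li.\<pi>_X L; measurable)+
   have "g = \<pi> (%x. indicator U x * g x + indicator (- U) x * g x)"
    using Li.\<pi>_id[OF g(1)] by (simp flip: distrib_right indicator_add add: indicator_compl)
   hence "g = u + w" unfolding Li.\<pi>_add u_def w_def by (simp add: plus_fun_def)
   hence c: "?c i g = ?c i u + ?c i w" for i using Li.linD(2)[OF Li.bop_lin[OF bc] uw] by simp
   have "AE s in m. norm ((?c k u - ?c l u) s) <= 2 * d" unfolding u_def by (rule r(2)[OF Us Ur kl g])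
   moreover have "AE s in m. s : W --> norm (?c k w s) <= d" "AE s in m. s : W --> norm (?c l w s) <= d"
    unfolding w_def by (intro W(3) g; simp)+
   ultimately show ?thesis
    unfolding c
   proof eventually_elim
    case (elim s)
    have "norm ((?c k u + ?c k w - (?c l u + ?c l w)) s) <= norm ((?c k u - ?c l u) s) + norm (?c k w s) + norm (?c l w s)"
     using norm_triangle_ineq[of "(?c k u - ?c l u) s" "?c k w s - ?c l w s"] norm_triangle_ineq4[of "?c k w s" "?c l w s"]
     by (simp add: algebra_simps)
    thus ?case using elim by auto
   qed
  qed
  fix g assume g: "g : Li.X" "Lp_norm top m g <= 1"
  have g1: "AE x in m. norm (g x) <= 1" using Lp_norm_inf_AE[OF Li.X_Lp[OF g(1)]] g(2) by (auto elim!: eventually_mono)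
  have DX: "?c k g - ?c l g : Li.X" by (intro Li.X_closed(3) Li.bopX[OF bc] g)
  note [measurable] = Li.X_measurable[OF g(1)] Li.X_measurable[OF DX]
  have pred: "Measurable.pred borel (%y. y : W --> norm ((?c k g - ?c l g) (y - t)) <= 4 * d)" for t
  proof -
   note [measurable] = measurable_compose[OF shift_measurable(3) Li.X_measurable[OF DX], of t]
   have [measurable]: "W : sets borel" using W(1) by simp
   show ?thesis by measurable
  qed
  \<comment> \<open>The estimate on W for a translated function is an estimate for g on a translate
    of W.\<close>
  have tr: "AE y in m. y + t : W --> norm ((?c k g - ?c l g) y) <= 4 * d" for t
  proof -
   have "(%y. g (y - t)) : Lp_space top m" using Lp_shift(1)[OF Li.p Li.X_Lp[OF g(1)], of "- t"] by simp
   hence gt: "\<pi> (%y. g (y - t)) : Li.X" by (rule Li.\<pi>_X)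
   have "AE y in m. norm (g (y - t)) <= 1" using AE_shift[of "%x. norm (g x) <= 1" "- t"] g1 by simp
   hence "AE y in m. norm (\<pi> (%y. g (y - t)) y) <= 1" using Li.\<pi>_AE[of "%y. g (y - t)"] by eventually_elim simp
   from near[OF gt this] have "AE y in m. y : W --> norm ((?c k g - ?c l g) (y - t)) <= 4 * d"
    using ces_translate[OF b g(1), of k "- t"] ces_translate[OF b g(1), of l "- t"] by eventually_elim simp
   hence "AE y in m. y + t : W --> norm ((?c k g - ?c l g) (y + t - t)) <= 4 * d"
    using pred[of t] by (intro AE_shift) simp_all
   thus ?thesis by simp
  qed
  obtain C where C: "finite C" "UNIV \<subseteq> (\<Union>t\<in>C. {x. x + t : W})" using compact_translates_cover[OF compact W(1)] W(2) by blast
  have "AE y in m. ALL t:C. y + t : W --> norm ((?c k g - ?c l g) y) <= 4 * d" by (rule AE_finite_allI[OF C(1) tr])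
  hence "AE y in m. norm ((?c k g - ?c l g) y) <= 4 * d"
   by eventually_elim (use C(2) in blast)
  hence "AE y in m. norm ((?c k g - ?c l g) y) <= e" using d(3) by (auto elim!: eventually_mono)
  thus "Lp_norm top m (?c k g - ?c l g) <= e" using e by (intro Lp_norm_inf_le) auto
 qed
 thus ?thesis by blast
qed

end

lemma (in Lp_lifting) mean_ergodic_tends:
 assumes r: "represents T S" and S: "bop S" and me: "mean_ergodic p M T" and x: "x : X"
 shows "EX l. tends (%n. ces S n x) l"
proof -
 obtain P where P: "bounded_Lp_operator p M P"
  and lim: "!!f. f : Lp_space p M ==> (%n. Lp_norm p M (%x. cesaro_mean T n f x - P f x)) \<longlonglongrightarrow> 0"
  using me by (auto simp: mean_ergodic_def)
 note rP = bounded_represents[OF P]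
 note rd = represents_Lp(3)[OF represents_diff[OF represents_cesaro[OF r S] rP(1)] bop_diff[OF bop_ces[OF S] rP(2)] X_Lp[OF x]]
 show ?thesis
  using lim[OF X_Lp[OF x]] bopX[OF bop_ces[OF S] x] bopX[OF rP(2) x]
  by (intro exI[of _ "\<pi> (P x)"]) (simp add: tends_def rd \<pi>_id[OF x])
qed

lemma (in haar_Lp) represents_eq_avg:
 assumes "finite_radon b" "!!f. f : borel_measurable borel ==> T f = avg b f" shows "represents T (A b)"
 using represents_A[OF assms(1)] assms(2) Lp_measurable unfolding represents_def by fastforce

context compact_haar
begin

text \<open>The constant function is an eigenvector whose eigenvalue is the mass of b; if this
  exceeded 1, its means would grow exponentially.\<close>

lemma mean_ergodic_mass:
 assumes b: "finite_radon b" and me: "!!x. x : Li.X ==> EX l. Li.tends (%n. Li.ces (Li.A b) n x) l"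
 shows "measure b UNIV <= 1"
proof (rule ccontr)
 define c where "c = measure b UNIV"
 assume "\<not> measure b UNIV <= 1"
 hence c: "1 < c" by (simp add: c_def)
 define x where "x = \<pi> (%_. 1)"
 have 1: "(%_. 1) : Lp_space top m" "0 < Lp_norm top m (%_. 1 :: complex)"
  using Lp_norm_indicator[OF Li.p, of UNIV m] finite_m open_positive[of UNIV] by auto
 have x: "x : Li.X" "0 < Lp_norm top m x" unfolding x_def using Li.\<pi>_X[OF 1(1)] Li.\<pi>_Lp(2)[OF 1(1)] 1(2) by auto
 have Ax: "Li.A b x = (%s. c * x s)"
  unfolding x_def Li.represents_Lp(2)[OF Li.represents_A[OF b] Li.bop_A[OF b] 1(1), symmetric] Li.\<pi>_scale[symmetric]
  using finite_radonD(4)[OF b] by (simp add: avg_def[abs_def] c_def scaleR_conv_of_real)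
 have Ak: "(Li.A b ^^ k) x = (%s. of_real (c ^ k) * x s)" for k
 proof (induction k)
  case (Suc k)
  thus ?case using Li.linD(3)[OF Li.bop_lin[OF Li.bop_A[OF b]] x(1), of "of_real (c ^ k)"] Ax by (simp add: mult_ac)
 qed simp
 have ces: "Li.ces (Li.A b) n x = (%s. of_real ((\<Sum>k=1..n. c ^ k) / n) * x s)" for n
 proof -
  have "(\<Sum>k\<in>I. (Li.A b ^^ k) x) = (%s. of_real (\<Sum>k\<in>I. c ^ k) * x s)" for I
   unfolding Ak by (induction I rule: infinite_finite_induct) (auto simp: fun_eq_iff distrib_right)
  thus ?thesis by (simp add: Li.ces_def fun_eq_iff)
 qed
 obtain l where l: "Li.tends (%n. Li.ces (Li.A b) n x) l" using me[OF x(1)] by blast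
 hence lim: "(%n. Lp_norm top m (Li.ces (Li.A b) n x - l)) \<longlonglongrightarrow> 0" by (simp add: Li.tends_def)
 obtain M where M: "!!n. n >= M ==> Lp_norm top m (Li.ces (Li.A b) n x - l) < 1"
  using order_tendstoD(2)[OF lim zero_less_one] unfolding eventually_sequentially by blast
 \<comment> \<open>The odd last factor, equal to 1, only matches the shape of
   \<open>exponential_beats_polynomial\<close>.\<close>
 have "c ^ n * Lp_norm top m x <= (Lp_norm top m l + 1) * real n * (1 + (1 + real n) ^ 0 * 0)" if n: "n >= max M 1" for n
 proof -
  have "c ^ n <= (\<Sum>k=1..n. c ^ k)" using n c by (intro member_le_sum) auto
  hence "c ^ n * Lp_norm top m x <= (\<Sum>k=1..n. c ^ k) * Lp_norm top m x" by (rule mult_right_mono) (rule Lp_norm_nonneg)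
  also have "... = real n * Lp_norm top m (Li.ces (Li.A b) n x)"
   unfolding ces Li.N_scale[OF x(1)] norm_of_real using n c by (simp add: sum_nonneg)
  also have "... <= real n * (1 + Lp_norm top m l)"
   using Li.N_le_add[OF Li.tends_X[OF l], of n] M[of n] n by (intro mult_left_mono) auto
  finally show ?thesis by (simp add: algebra_simps)
 qed
 thus False by (rule exponential_beats_polynomial[OF c x(2)])
qed

text \<open>Either some convolution power has mass below 1 on every null set, or each power has mass
  at least 1 on some null set. In the second case the union of these countably many sets is one null
  set that serves all powers.\<close>

theorem uniformly_mean_ergodic_iff_mean_ergodic:
 assumes b: "finite_radon b" and T: "!!f. f : borel_measurable borel ==> T f = avg b f"
 shows "uniformly_mean_ergodic 1 m T \<longleftrightarrow> mean_ergodic top m T" "uniformly_mean_ergodic top m T \<longleftrightarrow> mean_ergodic top m T"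
proof -
 have r1: "L1.represents T (L1.A b)" and ri: "Li.represents T (Li.A b)"
  by (rule L1.represents_eq_avg[OF b], erule T, rule Li.represents_eq_avg[OF b], erule T)
 note b1 = L1.bop_A[OF b] and bi = Li.bop_A[OF b]
 define C1 where "C1 \<longleftrightarrow> (ALL e>0. EX M. ALL i>=M. ALL j>=M. ALL x:L1.X. Lp_norm 1 m (L1.ces (L1.A b) i x - L1.ces (L1.A b) j x) <= e * Lp_norm 1 m x)"
 define Ci where "Ci \<longleftrightarrow> (ALL e>0. EX M. ALL i>=M. ALL j>=M. ALL x:Li.X. Lp_norm top m (Li.ces (Li.A b) i x - Li.ces (Li.A b) j x) <= e * Lp_norm top m x)"
 have eq: "C1 \<longleftrightarrow> Ci"
  unfolding C1_def Ci_def
  using symmetric_bound_iff[OF L1.symmetric_op_ces_diff[OF L1.symmetric_A[OF b]] Li.symmetric_op_ces_diff[OF Li.symmetric_A[OF b]]]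
  by (intro all_cong) simp
 have u1: "uniformly_mean_ergodic 1 m T \<longleftrightarrow> C1"
  unfolding L1.uniformly_mean_ergodic_iff[OF r1 b1] C1_def by (rule L1.converges_iff_Cauchy) (rule L1.bop_ces[OF b1])
 have ui: "uniformly_mean_ergodic top m T \<longleftrightarrow> Ci"
  unfolding Li.uniformly_mean_ergodic_iff[OF ri bi] Ci_def by (rule Li.converges_iff_Cauchy) (rule Li.bop_ces[OF bi])
 have "Ci" if m: "mean_ergodic top m T"
 proof -
  have me: "EX l. Li.tends (%n. Li.ces (Li.A b) n x) l" if "x : Li.X" for x
   by (rule Li.mean_ergodic_tends[OF ri bi m that])
  have mass: "measure b UNIV <= 1" by (rule mean_ergodic_mass[OF b]) (rule me)
  show ?thesis
  proof (cases "EX k. ALL N:sets borel. emeasure m N = 0 --> measure (conv_pow b k) N < 1")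
   case True
   then obtain k where k: "!!N. N : sets borel ==> emeasure m N = 0 ==> measure (conv_pow b k) N < 1" by blast
   show ?thesis unfolding Ci_def by (intro allI impI, rule ces_cauchy_nonsingular[where k = k, OF b mass]) (simp_all add: me k)
  next
   case False
   hence "ALL k. EX N. N : sets borel & emeasure m N = 0 & 1 <= measure (conv_pow b k) N" by (force simp: not_less)
   then obtain N where N: "!!k. N k : sets borel" "!!k. emeasure m (N k) = 0" "!!k. 1 <= measure (conv_pow b k) (N k)"
    by metis
   have Ns: "(\<Union>k. N k) : sets borel" "emeasure m (\<Union>k. N k) = 0" using N by (auto intro!: emeasure_UN_eq_0)
   have N1: "1 <= measure (conv_pow b k) (\<Union>k. N k)" for k
    using N(3)[of k] finite_measure.finite_measure_mono[OF finite_radonD(5)[OF conv_pow_radon(1)[OF b]], of "N k" "\<Union>k. N k" k]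
     Ns(1) finite_radonD(3)[OF conv_pow_radon(1)[OF b], of k] by fastforce
   show ?thesis unfolding Ci_def by (intro allI impI, rule ces_cauchy_singular[OF b mass _ Ns]) (simp_all add: me N1)
  qed
 qed
 thus "uniformly_mean_ergodic 1 m T \<longleftrightarrow> mean_ergodic top m T" "uniformly_mean_ergodic top m T \<longleftrightarrow> mean_ergodic top m T"
  using u1 ui eq Li.ume_imp_mean_ergodic[OF ri bi] by blast+
qed

end

section \<open>The equivalences for a given exponent\<close>

context haar
begin

lemma lifting_exists:
 assumes "!!p. p : I ==> 1 <= p" "top : I ==> emeasure m UNIV < top"
 shows "EX \<pi>. ALL p:I. Lp_lifting m p \<pi>"
proof -
 obtain \<pi> where "(ALL f g. \<pi> (%x. f x + g x) = (%x. \<pi> f x + \<pi> g x)) & (ALL c f. \<pi> (%x. c * f x) = (%x. c * \<pi> f x)) &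
   (ALL f. (%x. f x - \<pi> f x) : null_functions m) & (ALL f:null_functions m. \<pi> f = (%x. 0))"
  using exists_lifting[of m] by blast
 thus ?thesis using assms by (intro exI[of _ \<pi>]) (auto simp: Lp_lifting_def)
qed

theorem uniformly_mean_ergodic_L2:
 fixes c :: "nat => complex"
 assumes b: "!!i. finite_radon (b i)" and T: "!!f. f : borel_measurable borel ==> T f = (%s. \<Sum>i<n. c i * avg (b i) f s)"
 shows "uniformly_mean_ergodic 2 m T \<longleftrightarrow> Lp_operator_norm 2 m T <= 1 & \<not> (1 islimpt Lp_spectrum 2 m T)"
proof -
 obtain \<pi> where \<pi>: "Lp_lifting m 2 \<pi>" using lifting_exists[of "{2}"] by auto
 have "conjugate_exponents 2 2" unfolding conjugate_exponents_def by (intro disjI2 exI[of _ 2]) simp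
 then interpret avg_combination m 2 \<pi> 2 c b n
  by (intro avg_combination.intro haar_pairing.intro haar_Lp.intro haar_axioms \<pi> haar_pairing_axioms.intro avg_combination_axioms.intro b) simp_all
 note r = represents_T[OF T]
 show ?thesis
  using ume_contraction_L2[OF refl r] ume_imp_isolated[OF r bop_S] isolated_imp_ume[OF T] by blast
qed

text \<open>For p = 1 the conjugate exponent is \<infinity>, whose duality is set up for finite Haar
  measure; hence the condition at both endpoints.\<close>

theorem uniformly_mean_ergodic_positive:
 assumes b: "finite_radon b" and T: "!!f. f : borel_measurable borel ==> T f = avg b f"
  and p: "1 <= p" and fin: "p = 1 \<or> p = top ==> emeasure m UNIV < top"
 shows "uniformly_mean_ergodic p m T \<longleftrightarrow> Lp_operator_norm p m T <= 1 & \<not> (1 islimpt Lp_spectrum p m T)"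
proof -
 obtain \<pi> where \<pi>: "Lp_lifting m p \<pi>" using lifting_exists[of "{p}"] p fin by auto
 obtain q where pq: "conjugate_exponents p q" using conjugate_exponent_exists[OF p] by blast
 have finq: "q = top ==> emeasure m UNIV < top" using pq fin by (auto simp: conjugate_exponents_def)
 interpret avg_combination m p \<pi> q "%_. 1" "%_. b" 1
  by (intro avg_combination.intro haar_pairing.intro haar_Lp.intro haar_axioms \<pi> haar_pairing_axioms.intro avg_combination_axioms.intro b pq) (rule finq)
 have T': "T f = (%s. \<Sum>i<(1::nat). 1 * avg b f s)" if "f : borel_measurable borel" for f using T[OF that] by simp
 have r: "represents T (A b)" by (rule represents_eq_avg[OF b], erule T)
 have "Lp_operator_norm p m T <= 1" if "uniformly_mean_ergodic p m T"
  by (rule Lp_operator_norm_le[OF r bounded_by_mono[OF bounded_by_A[OF b]]]) (rule ume_contraction_positive[OF b _ that], erule T)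
 thus ?thesis using ume_imp_isolated[OF r bop_A[OF b]] isolated_imp_ume[OF T'] by blast
qed

end

theorem theoremB:
  fixes m :: "'a::{topological_ab_group_add, t2_space} measure"
    and \<mu> :: "'a set \<Rightarrow> complex"
    and p :: ennreal
  assumes "locally_compact_space (euclidean :: 'a topology)"
    and "haar_measure m"
    and "\<mu> \<in> bounded_regular_measures"
    and "1 \<le> p" and "p \<le> \<infinity>"
  shows "(p = 2 \<or>
          (positive_measure \<mu> \<and> 1 < p \<and> p < \<infinity>) \<or>
          (compact (UNIV :: 'a set) \<and> positive_measure \<mu> \<and> (p = 1 \<or> p = \<infinity>)) \<longrightarrow>
            (uniformly_mean_ergodic p m (convolution \<mu>) \<longleftrightarrow>
              Lp_operator_norm p m (convolution \<mu>) \<le> 1 \<and>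
              \<not> (1 islimpt Lp_spectrum p m (convolution \<mu>)))) \<and>
         (compact (UNIV :: 'a set) \<and> positive_measure \<mu> \<and> (p = 1 \<or> p = \<infinity>) \<longrightarrow>
            (uniformly_mean_ergodic p m (convolution \<mu>) \<longleftrightarrow>
              mean_ergodic \<infinity> m (convolution \<mu>)))"
proof -
 interpret haar m by unfold_locales fact+
 have two: "uniformly_mean_ergodic 2 m (convolution \<mu>) \<longleftrightarrow>
   Lp_operator_norm 2 m (convolution \<mu>) <= 1 & \<not> (1 islimpt Lp_spectrum 2 m (convolution \<mu>))"
 proof -
  obtain c and b :: "nat => 'a measure" where "!!i. finite_radon (b i)"
   "!!f. f : borel_measurable borel ==> convolution \<mu> f = (%s. \<Sum>i<4. c i * avg (b i) f s)"
   using convolution_avg(1)[OF assms(3)] by metis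
  thus ?thesis by (rule uniformly_mean_ergodic_L2)
 qed
 have pos: "uniformly_mean_ergodic p m (convolution \<mu>) \<longleftrightarrow>
   Lp_operator_norm p m (convolution \<mu>) <= 1 & \<not> (1 islimpt Lp_spectrum p m (convolution \<mu>))"
  if pm: "positive_measure \<mu>" and c: "p = 1 \<or> p = top --> compact (UNIV :: 'a set)"
 proof -
  obtain b :: "'a measure" where "finite_radon b" "!!f. f : borel_measurable borel ==> convolution \<mu> f = avg b f"
   using convolution_avg(2)[OF assms(3) pm] by metis
  thus ?thesis using finite_compact[of UNIV] c assms(4) by (intro uniformly_mean_ergodic_positive) auto
 qed
 have "uniformly_mean_ergodic p m (convolution \<mu>) \<longleftrightarrow> mean_ergodic \<infinity> m (convolution \<mu>)"
  if c: "compact (UNIV :: 'a set)" and pm: "positive_measure \<mu>" and p: "p = 1 \<or> p = top"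
 proof -
  obtain \<pi> where "Lp_lifting m 1 \<pi>" using lifting_exists[of "{1}"] by auto
  then interpret compact_haar m \<pi> using c by (intro compact_haar.intro haar_axioms compact_haar_axioms.intro)
  obtain b :: "'a measure" where b: "finite_radon b" "!!f. f : borel_measurable borel ==> convolution \<mu> f = avg b f"
   using convolution_avg(2)[OF assms(3) pm] by metis
  show ?thesis using uniformly_mean_ergodic_iff_mean_ergodic[OF b] p by auto
 qed
 thus ?thesis using two pos by (auto simp: infinity_ennreal_def)
qed

end
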